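(* Let $M_H\subset\mathbb C^{n+d}$ be a generic homogeneous model submanifold $$M_H=\{(z,w)\in\mathbb C^n\times\mathbb C^d:\ v_{m_j}=P_{m_j}(z,\bar z,u_{m_1},\dots,u_{m_{j-1}}),\ j=1,\dots,q\}$$ as described in the context, and assume that $M_H$ is holomorphically nondegenerate at $0$. Then: (1) There exists $k$ such that $hol(M_H,0)$ admits the weighted grading $$hol(M_H,0)=\bigoplus_{\mu\le k}G_\mu,\qquad G_k\neq\{0\}.$$ (2) There exist an integer $r$ and a constant $k_0\ge 1$, depending only on $M_H$, such that for every $C^r$-smooth perturbation $M$ of $M_H$ of the form $$M=\{v_{m_j}=P_{m_j}(z,\bar z,u_{m_1},\dots,u_{m_{j-1}})+R_{m_j}(z,\bar z,u),\ j=1,\dots,q\},$$ where the $R_{m_j}$ are $C^r$-smooth and all their derivatives at $0$ of weighted order at most $\frac{m_j}{m_1}$ vanish, any $h\in Aut(M,0)$ is uniquely determined by its weighted jet of order $k+k_0$ at $0$.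
   Context: Model. Coordinates in $\mathbb C^{n+d}$ are $(z,w)$, $w=u+iv$, $w=(w_{m_1},\dots,w_{m_q})$ with $w_{m_j}\in\mathbb C^{l_j}$, $\sum_j l_j=d$, where $m_1<\dots<m_q$ are the Hörmander numbers. $M_H$ is a generic submanifold of codimension $d$, of finite type at $0$ in the sense of Kohn and Bloom–Graham, with Hörmander numbers $m_1<\dots<m_q$ (with multiplicities $l_j$). Each $P_{m_j}$ is an $\mathbb R^{l_j}$-valued polynomial in $(z,\bar z,u_{m_1},\dots,u_{m_{j-1}})$ with non-zero components, satisfying: $P_{m_j}(tz,t\bar z,t^{m_1}u_{m_1},\dots,t^{m_{j-1}}u_{m_{j-1}})\equiv t^{m_j}P_{m_j}(z,\bar z,u_{m_1},\dots,u_{m_{j-1}})$; $P_{m_j}(z,0,u_{m_1},\dots,u_{m_{j-1}})\equiv0$ (here $z$ and $\bar z$ are treated as independent variables); and, for $i<j$, there are no terms of the form $u_{m_i}^{\alpha_i}\cdots u_{m_{j-1}}^{\alpha_{j-1}}P_{m_i}$ in $P_{m_j}$ (Bloom–Graham normalization). Weights. $z_1,\dots,z_n$ (and their conjugates) have weight $\frac1{m_1}$; the components of $w_{m_j}$ and $u_{m_j}$ have weight $\frac{m_j}{m_1}$. Weighted degree of monomials, weighted order of derivatives and weighted homogeneous polynomials are defined accordingly. A holomorphic vector field $\sum_j F_j\frac{\partial}{\partial z_j}+\sum_j G_{m_j}\cdot\frac{\partial}{\partial w_{m_j}}$ is weighted homogeneous of weight $\mu$ if each $F_j$ is a weighted homogeneous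 polynomial of weighted degree $\mu+\frac1{m_1}$ and each component of $G_{m_j}$ is one of weighted degree $\mu+\frac{m_j}{m_1}$. $hol(M_H,0)$ is the Lie algebra of germs at $0$ of real-analytic infinitesimal CR automorphisms of $M_H$, identified with the germs at $0$ of holomorphic vector fields $Z$ in $\mathbb C^{n+d}$ such that $\mathrm{Re}\,Z$ is tangent to $M_H$. $G_\mu\subset hol(M_H,0)$ is the subspace of elements that are weighted homogeneous of weight $\mu$ (non-trivial only if $\mu\ge-\frac{m_q}{m_1}$). $M_H$ is holomorphically nondegenerate at $0$ if there is no nonzero germ at $0$ of a holomorphic vector field $X$ that is itself (not just its real part) tangent to $M_H$. $Aut(M,0)$ is the set of germs at $0$ of biholomorphisms fixing $0$ and mapping $M$ into itself. The weighted jet of order $s$ of $h$ at $0$ is the collection of all weighted homogeneous parts of weighted degree at most $s$ in the Taylor expansions at $0$ of the components of $h$; "uniquely determined" means that two elements of $Aut(M,0)$ with the same weighted jet of that order coincide. *)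

theory Defs
  imports "HOL-Analysis.Analysis" "HOL-Library.Poly_Mapping"
begin

text \<open>
  The space of the \<open>(z, w)\<close> is \<^typ>\<open>complex ^ ('n + 'd)\<close> for finite index types: component
  \<^term>\<open>Inl i\<close> is \<open>z\<^sub>i\<close>, component \<^term>\<open>Inr l\<close> is \<open>w\<^sub>l\<close>.
  The Hoermander numbers are given with their multiplicities by a function \<open>m\<close> on \<open>'d\<close>:
  the numbers \<open>m\<^sub>1 < \<dots> < m\<^sub>q\<close> are the values of \<open>m\<close>, the block \<open>w\<^bsub>m\<^sub>j\<^esub>\<close> consists of the
  components \<open>w\<^sub>l\<close> with \<open>m l = m\<^sub>j\<close>, and \<open>l\<^sub>j\<close> is the number of such \<open>l\<close>.
\<close>

type_synonym 'v cpoly = "('v \<Rightarrow>\<^sub>0 nat) \<Rightarrow>\<^sub>0 complex"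

definition poly_eval :: "('v \<Rightarrow> complex) \<Rightarrow> 'v cpoly \<Rightarrow> complex" where
  "poly_eval x p =
     (\<Sum>M\<in>Poly_Mapping.keys p. Poly_Mapping.lookup p M *
        (\<Prod>v\<in>Poly_Mapping.keys M. x v ^ Poly_Mapping.lookup M v))"

definition monomial_weight :: "('v \<Rightarrow> real) \<Rightarrow> ('v \<Rightarrow>\<^sub>0 nat) \<Rightarrow> real" where
  "monomial_weight wt M =
     (\<Sum>v\<in>Poly_Mapping.keys M. wt v * real (Poly_Mapping.lookup M v))"

definition weighted_homogeneous :: "('v \<Rightarrow> real) \<Rightarrow> real \<Rightarrow> 'v cpoly \<Rightarrow> bool" where
  "weighted_homogeneous wt \<sigma> p \<longleftrightarrow> (\<forall>M\<in>Poly_Mapping.keys p. monomial_weight wt M = \<sigma>)"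

definition first_hoermander :: "('d::finite \<Rightarrow> nat) \<Rightarrow> nat" where
  "first_hoermander m = Min (range m)"

text \<open>All weights are normalized by the first Hoermander number, so that \<open>z\<close> has weight \<open>1/m\<^sub>1\<close>.\<close>

fun coord_weight :: "('d::finite \<Rightarrow> nat) \<Rightarrow> 'n + 'd \<Rightarrow> real" where
  "coord_weight m (Inl i) = 1 / real (first_hoermander m)"
| "coord_weight m (Inr l) = real (m l) / real (first_hoermander m)"

datatype ('n, 'd) crvar = Z 'n | Zbar 'n | U 'd

fun crvar_weight :: "('d::finite \<Rightarrow> nat) \<Rightarrow> ('n, 'd) crvar \<Rightarrow> real" where
  "crvar_weight m (Z i) = 1 / real (first_hoermander m)"
| "crvar_weight m (Zbar i) = 1 / real (first_hoermander m)"
| "crvar_weight m (U l) = real (m l) / real (first_hoermander m)"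

text \<open>The value of a polynomial at independent \<open>z\<close>, \<open>\<zeta>\<close> (in place of the conjugate of \<open>z\<close>)
  and real \<open>u\<close>.\<close>

definition cr_eval ::
  "('n, 'd) crvar cpoly \<Rightarrow> complex ^ 'n \<Rightarrow> complex ^ 'n \<Rightarrow> real ^ 'd \<Rightarrow> complex" where
  "cr_eval p z \<zeta> u =
     poly_eval (\<lambda>v. case v of Z i \<Rightarrow> z $ i | Zbar i \<Rightarrow> \<zeta> $ i | U l \<Rightarrow> of_real (u $ l)) p"

definition vcnj :: "complex ^ 'n \<Rightarrow> complex ^ 'n" where
  "vcnj z = (\<chi> i. cnj (z $ i))"

text \<open>
  \<open>P s\<close> with \<open>m s < m l\<close> contributes a term \<open>u\<^sup>\<alpha> P\<^sub>s\<close> to \<open>P\<^sub>l\<close> if for some \<open>c \<noteq> 0\<close> the coefficients of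
  \<open>P\<^sub>l\<close> and of \<open>c u\<^sup>\<alpha> P\<^sub>s\<close> agree at all monomials of \<open>u\<^sup>\<alpha> P\<^sub>s\<close>. This is a
  literal reading of ``\<open>P\<^sub>l\<close> has a term of the form \<open>u\<^sup>\<alpha> P\<^sub>s\<close>'' for the Bloom-Graham normalization; \<open>\<alpha>\<close>
  involves only the blocks of \<open>u\<close> from that of \<open>s\<close> up to the one before that of \<open>l\<close>.
\<close>

definition contains_term ::
  "('d::finite \<Rightarrow> nat) \<Rightarrow> ('d \<Rightarrow> ('n, 'd) crvar cpoly) \<Rightarrow> 'd \<Rightarrow> 'd \<Rightarrow> bool" where
  "contains_term m P l s \<longleftrightarrow>
     (\<exists>\<alpha> c. Poly_Mapping.keys \<alpha> \<subseteq> U ` {t. m s \<le> m t \<and> m t < m l} \<and> c \<noteq> 0 \<and>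
        (\<forall>M\<in>Poly_Mapping.keys (Poly_Mapping.single \<alpha> 1 * P s).
           Poly_Mapping.lookup (P l) M = c * Poly_Mapping.lookup (Poly_Mapping.single \<alpha> 1 * P s) M))"

definition model_polynomials ::
  "('d::finite \<Rightarrow> nat) \<Rightarrow> ('d \<Rightarrow> ('n::finite, 'd) crvar cpoly) \<Rightarrow> bool" where
  "model_polynomials m P \<longleftrightarrow>
     (\<forall>l. P l \<noteq> 0) \<and>
     (\<forall>l. \<forall>M\<in>Poly_Mapping.keys (P l). \<forall>k. U k \<in> Poly_Mapping.keys M \<longrightarrow> m k < m l) \<and>
     (\<forall>l z u. cr_eval (P l) z (vcnj z) u \<in> \<real>) \<and>
     (\<forall>l z \<zeta> u. \<forall>t::real.
        cr_eval (P l) (t *\<^sub>R z) (t *\<^sub>R \<zeta>) (\<chi> k. t ^ m k * u $ k)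
          = of_real (t ^ m l) * cr_eval (P l) z \<zeta> u) \<and>
     (\<forall>l z u. cr_eval (P l) z 0 u = 0) \<and>
     (\<forall>l s. m s < m l \<longrightarrow> \<not> contains_term m P l s)"

definition zpart :: "complex ^ ('n::finite + 'd::finite) \<Rightarrow> complex ^ 'n" where
  "zpart p = (\<chi> i. p $ Inl i)"

definition upart :: "complex ^ ('n::finite + 'd::finite) \<Rightarrow> real ^ 'd" where
  "upart p = (\<chi> l. Re (p $ Inr l))"

definition perturbed_model ::
  "('d::finite \<Rightarrow> ('n::finite, 'd) crvar cpoly) \<Rightarrow> ((complex ^ 'n) \<times> (real ^ 'd)) set \<Rightarrow>
   ((complex ^ 'n) \<times> (real ^ 'd) \<Rightarrow> real ^ 'd) \<Rightarrow> (complex ^ ('n + 'd)) set" where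
  "perturbed_model P W R =
     {p. (zpart p, upart p) \<in> W \<and>
         (\<forall>l. of_real (Im (p $ Inr l)) =
                cr_eval (P l) (zpart p) (vcnj (zpart p)) (upart p)
                + of_real (R (zpart p, upart p) $ l))}"

definition model ::
  "('d::finite \<Rightarrow> ('n::finite, 'd) crvar cpoly) \<Rightarrow> (complex ^ ('n + 'd)) set" where
  "model P =
     {p. \<forall>l. of_real (Im (p $ Inr l)) = cr_eval (P l) (zpart p) (vcnj (zpart p)) (upart p)}"

primrec Ck_on ::
  "nat \<Rightarrow> ('a::real_normed_vector \<Rightarrow> 'b::real_normed_vector) \<Rightarrow> 'a set \<Rightarrow> bool" where
  "Ck_on 0 f S \<longleftrightarrow> continuous_on S f"
| "Ck_on (Suc k) f S \<longleftrightarrow>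
     (\<forall>x\<in>S. f differentiable (at x)) \<and> (\<forall>v. Ck_on k (\<lambda>x. frechet_derivative f (at x) v) S)"

definition holomorphic_map_on :: "(complex ^ 'a \<Rightarrow> complex ^ 'b) \<Rightarrow> (complex ^ 'a) set \<Rightarrow> bool" where
  "holomorphic_map_on f S \<longleftrightarrow>
     (\<forall>p\<in>S. \<exists>L. (f has_derivative L) (at p) \<and> (\<forall>c v. L (c *s v) = c *s L v))"

definition biholomorphic_between ::
  "(complex ^ 'a) set \<Rightarrow> (complex ^ 'a) set \<Rightarrow> (complex ^ 'a \<Rightarrow> complex ^ 'a) \<Rightarrow> bool" where
  "biholomorphic_between S T h \<longleftrightarrow>
     open S \<and> open T \<and> bij_betw h S T \<and> holomorphic_map_on h S \<and>
     holomorphic_map_on (inv_into S h) T"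

fun cr_derivative ::
  "('n::finite, 'd::finite) crvar \<Rightarrow> ((complex ^ 'n) \<times> (real ^ 'd) \<Rightarrow> complex) \<Rightarrow>
   (complex ^ 'n) \<times> (real ^ 'd) \<Rightarrow> complex" where
  "cr_derivative (Z i) f x =
     (frechet_derivative f (at x) (axis i 1, 0) - \<i> * frechet_derivative f (at x) (axis i \<i>, 0)) / 2"
| "cr_derivative (Zbar i) f x =
     (frechet_derivative f (at x) (axis i 1, 0) + \<i> * frechet_derivative f (at x) (axis i \<i>, 0)) / 2"
| "cr_derivative (U l) f x = frechet_derivative f (at x) (0, axis l 1)"

definition vanishing_derivatives ::
  "('d::finite \<Rightarrow> nat) \<Rightarrow> ((complex ^ 'n::finite) \<times> (real ^ 'd) \<Rightarrow> real ^ 'd) \<Rightarrow> bool" where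
  "vanishing_derivatives m R \<longleftrightarrow>
     (\<forall>l vs. sum_list (map (crvar_weight m) vs) \<le> real (m l) / real (first_hoermander m) \<longrightarrow>
        foldr cr_derivative vs (\<lambda>x. of_real (R x $ l)) 0 = 0)"

definition germ_eq :: "('a::real_normed_vector \<Rightarrow> 'b) \<Rightarrow> ('a \<Rightarrow> 'b) \<Rightarrow> bool" where
  "germ_eq f g \<longleftrightarrow> (\<forall>\<^sub>F x in nhds 0. f x = g x)"

lemma equivp_germ_eq: "equivp germ_eq"
proof (rule equivpI)
  show "reflp germ_eq"
    by (simp add: reflp_def germ_eq_def)
  show "symp germ_eq"
    by (simp add: symp_def germ_eq_def eq_commute)
  show "transp germ_eq"
    unfolding transp_def germ_eq_def by (auto elim: eventually_elim2)
qed

quotient_type (overloaded) ('a, 'b) germ = "'a::real_normed_vector \<Rightarrow> 'b" / germ_eq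
  morphisms rep_germ germ
  by (rule equivp_germ_eq)

instantiation germ :: (real_normed_vector, real_vector) real_vector
begin

lift_definition zero_germ :: "('a, 'b) germ" is "\<lambda>_. 0" .

lift_definition plus_germ :: "('a, 'b) germ \<Rightarrow> ('a, 'b) germ \<Rightarrow> ('a, 'b) germ"
  is "\<lambda>f g x. f x + g x"
  unfolding germ_eq_def by (auto elim: eventually_elim2)

lift_definition minus_germ :: "('a, 'b) germ \<Rightarrow> ('a, 'b) germ \<Rightarrow> ('a, 'b) germ"
  is "\<lambda>f g x. f x - g x"
  unfolding germ_eq_def by (auto elim: eventually_elim2)

lift_definition uminus_germ :: "('a, 'b) germ \<Rightarrow> ('a, 'b) germ"
  is "\<lambda>f x. - f x"
  unfolding germ_eq_def by (auto elim: eventually_mono)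

lift_definition scaleR_germ :: "real \<Rightarrow> ('a, 'b) germ \<Rightarrow> ('a, 'b) germ"
  is "\<lambda>c f x. c *\<^sub>R f x"
  unfolding germ_eq_def by (auto elim: eventually_mono)

instance
  by standard (transfer; simp add: germ_eq_def algebra_simps)+

end

lemma germ_eq_frechet_derivative:
  assumes "germ_eq f g"
  shows "\<forall>\<^sub>F x in nhds 0. frechet_derivative f (at x) = frechet_derivative g (at x)"
proof -
  obtain S where S: "open S" "0 \<in> S" "\<And>x. x \<in> S \<Longrightarrow> f x = g x"
    using assms unfolding germ_eq_def eventually_nhds by auto
  have "frechet_derivative f (at x) = frechet_derivative g (at x)" if "x \<in> S" for x
  proof -
    have "(f has_derivative L) (at x) \<longleftrightarrow> (g has_derivative L) (at x)" for L
      using S(1,3) that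
      by (metis has_derivative_transform_within_open)
    then show ?thesis
      by (simp add: frechet_derivative_def)
  qed
  then show ?thesis
    using S(1,2) unfolding eventually_nhds by blast
qed

text \<open>
  A vector field is a map \<open>X\<close> from the space to itself. A holomorphic field
  \<open>\<Sum>\<^sub>j F\<^sub>j \<partial>/\<partial>z\<^sub>j + \<Sum>\<^sub>l G\<^sub>l \<partial>/\<partial>w\<^sub>l\<close> is represented by \<open>X = (F, G)\<close>; its real part is, up to the factor
  \<open>1/2\<close>, the real vector field \<open>X\<close>, and the bracket below is the bracket both of holomorphic
  and of real vector fields.
\<close>

definition lie_bracket ::
  "('a::real_normed_vector \<Rightarrow> 'a) \<Rightarrow> ('a \<Rightarrow> 'a) \<Rightarrow> 'a \<Rightarrow> 'a" where
  "lie_bracket X Y p =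
     frechet_derivative Y (at p) (X p) - frechet_derivative X (at p) (Y p)"

lift_definition germ_bracket :: "('a::real_normed_vector, 'a) germ \<Rightarrow> ('a, 'a) germ \<Rightarrow> ('a, 'a) germ"
  is lie_bracket
proof -
  fix X X' Y Y' :: "'a \<Rightarrow> 'a"
  assume *: "germ_eq X X'" "germ_eq Y Y'"
  show "germ_eq (lie_bracket X Y) (lie_bracket X' Y')"
    using germ_eq_frechet_derivative[OF *(1)] germ_eq_frechet_derivative[OF *(2)] *
    unfolding germ_eq_def lie_bracket_def
    by eventually_elim simp
qed

text \<open>For the submanifolds considered here, the velocities of all differentiable curves in \<open>M\<close>
  form the usual tangent space.\<close>

definition tangent_space :: "'a::real_normed_vector set \<Rightarrow> 'a \<Rightarrow> 'a set" where
  "tangent_space M p =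
     {v. \<exists>\<gamma>. \<gamma> 0 = p \<and> (\<gamma> has_vector_derivative v) (at 0) \<and> (\<forall>\<^sub>F t in nhds (0::real). \<gamma> t \<in> M)}"

definition complex_tangent_space :: "(complex ^ 'a) set \<Rightarrow> complex ^ 'a \<Rightarrow> (complex ^ 'a) set" where
  "complex_tangent_space M p = {v \<in> tangent_space M p. \<i> *s v \<in> tangent_space M p}"

text \<open>Sections near \<open>0\<close> of the complex tangent bundle of \<open>M\<close>, extended smoothly to a
  neighbourhood of \<open>0\<close> in the ambient space; along \<open>M\<close> the bracket of fields tangent to \<open>M\<close> does not
  depend on the extension.\<close>

definition complex_tangent_sections :: "(complex ^ 'a) set \<Rightarrow> (complex ^ 'a \<Rightarrow> complex ^ 'a) set" where
  "complex_tangent_sections M =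
     {X. \<exists>S. open S \<and> 0 \<in> S \<and> (\<forall>k. Ck_on k X S) \<and> (\<forall>p\<in>S \<inter> M. X p \<in> complex_tangent_space M p)}"

inductive commutator :: "(complex ^ 'a) set \<Rightarrow> nat \<Rightarrow> (complex ^ 'a \<Rightarrow> complex ^ 'a) \<Rightarrow> bool"
  for M where
  "X \<in> complex_tangent_sections M \<Longrightarrow> commutator M 1 X"
| "X \<in> complex_tangent_sections M \<Longrightarrow> commutator M k Y \<Longrightarrow> commutator M (Suc k) (lie_bracket X Y)"

definition commutator_space :: "(complex ^ 'a) set \<Rightarrow> nat \<Rightarrow> (complex ^ 'a) set" where
  "commutator_space M k = span {X 0 | X j. j \<le> k \<and> commutator M j X}"

definition finite_type_at_0 :: "(complex ^ 'a) set \<Rightarrow> bool" where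
  "finite_type_at_0 M \<longleftrightarrow> (\<exists>k. commutator_space M k = tangent_space M 0)"

text \<open>The Hoermander numbers are the lengths \<open>k \<ge> 2\<close> at which the dimension of
  \<open>commutator_space M k\<close> jumps; the multiplicity is the size of the jump.\<close>

definition hoermander_numbers :: "(complex ^ 'a) set \<Rightarrow> ('d::finite \<Rightarrow> nat) \<Rightarrow> bool" where
  "hoermander_numbers M m \<longleftrightarrow>
     (\<forall>l. m l \<ge> 2) \<and>
     (\<forall>k\<ge>2. dim (commutator_space M k) = dim (commutator_space M (k - 1)) + card {l. m l = k})"

definition hol :: "(complex ^ 'a) set \<Rightarrow> (complex ^ 'a, complex ^ 'a) germ set" where
  "hol M = {germ X | X. \<exists>S. open S \<and> 0 \<in> S \<and> holomorphic_map_on X S \<and>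
                          (\<forall>p\<in>S \<inter> M. X p \<in> tangent_space M p)}"

text \<open>A holomorphic field is itself tangent to \<open>M\<close> if its real and imaginary parts are, that is,
  if both \<open>X\<close> and \<open>\<i> X\<close> are tangent as real fields.\<close>

definition holomorphically_nondegenerate_at_0 :: "(complex ^ 'a) set \<Rightarrow> bool" where
  "holomorphically_nondegenerate_at_0 M \<longleftrightarrow>
     \<not> (\<exists>X S. open S \<and> 0 \<in> S \<and> holomorphic_map_on X S \<and>
             (\<forall>p\<in>S \<inter> M. X p \<in> complex_tangent_space M p) \<and> germ X \<noteq> 0)"

definition homogeneous_field ::
  "('a \<Rightarrow> real) \<Rightarrow> real \<Rightarrow> (complex ^ 'a \<Rightarrow> complex ^ 'a) \<Rightarrow> bool" where
  "homogeneous_field wt \<mu> X \<longleftrightarrow>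
     (\<forall>a. \<exists>F. weighted_homogeneous wt (\<mu> + wt a) F \<and> (\<forall>p. X p $ a = poly_eval (($) p) F))"

definition G ::
  "('a \<Rightarrow> real) \<Rightarrow> (complex ^ 'a) set \<Rightarrow> real \<Rightarrow> (complex ^ 'a, complex ^ 'a) germ set" where
  "G wt M \<mu> = hol M \<inter> {germ X | X. homogeneous_field wt \<mu> X}"

definition internal_direct_sum :: "'v::real_vector set \<Rightarrow> 'i set \<Rightarrow> ('i \<Rightarrow> 'v set) \<Rightarrow> bool" where
  "internal_direct_sum V I W \<longleftrightarrow>
     subspace V \<and> (\<forall>i\<in>I. subspace (W i) \<and> W i \<subseteq> V) \<and>
     (\<forall>x\<in>V. \<exists>!y. (\<forall>i\<in>I. y i \<in> W i) \<and> (\<forall>i. i \<notin> I \<longrightarrow> y i = 0) \<and>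
               finite {i. y i \<noteq> 0} \<and> x = (\<Sum>i | y i \<noteq> 0. y i))"

definition weighted_grading ::
  "(complex ^ 'a, complex ^ 'a) germ set \<Rightarrow> real \<Rightarrow>
   (real \<Rightarrow> (complex ^ 'a, complex ^ 'a) germ set) \<Rightarrow> bool" where
  "weighted_grading L k W \<longleftrightarrow>
     internal_direct_sum L {..k} W \<and>
     (\<forall>\<mu> \<nu>. \<forall>X\<in>W \<mu>. \<forall>Y\<in>W \<nu>. germ_bracket X Y \<in> W (\<mu> + \<nu>))"

definition Aut :: "(complex ^ 'a) set \<Rightarrow> (complex ^ 'a, complex ^ 'a) germ set" where
  "Aut M = {germ h | h. \<exists>S T. 0 \<in> S \<and> biholomorphic_between S T h \<and> h 0 = 0 \<and> h ` (S \<inter> M) \<subseteq> M}"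

definition coord_derivative :: "'a::finite \<Rightarrow> (complex ^ 'a \<Rightarrow> complex) \<Rightarrow> complex ^ 'a \<Rightarrow> complex" where
  "coord_derivative a f p = frechet_derivative f (at p) (axis a 1)"

text \<open>The part of weighted degree \<open>\<sigma>\<close> of the Taylor expansion
  \<open>f(p) = \<Sum>\<^sub>N 1/N! \<Sum>\<^bsub>a\<^sub>1,\<dots>,a\<^sub>N\<^esub> (\<partial>\<^bsub>a\<^sub>1\<^esub> \<cdots> \<partial>\<^bsub>a\<^sub>N\<^esub> f)(0) p\<^bsub>a\<^sub>1\<^esub> \<cdots> p\<^bsub>a\<^sub>N\<^esub>\<close> at \<open>0\<close>. For positive weights the sum is finite.\<close>

definition homogeneous_part ::
  "('a::finite \<Rightarrow> real) \<Rightarrow> real \<Rightarrow> (complex ^ 'a \<Rightarrow> complex) \<Rightarrow> complex ^ 'a \<Rightarrow> complex" where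
  "homogeneous_part wt \<sigma> f p =
     (\<Sum>as | sum_list (map wt as) = \<sigma>.
        foldr coord_derivative as f 0 / fact (length as) * prod_list (map (($) p) as))"

definition jet ::
  "('a::finite \<Rightarrow> real) \<Rightarrow> real \<Rightarrow> (complex ^ 'a \<Rightarrow> complex ^ 'a) \<Rightarrow>
   real \<Rightarrow> 'a \<Rightarrow> complex ^ 'a \<Rightarrow> complex" where
  "jet wt s h = (\<lambda>\<sigma> a. if \<sigma> \<le> s then homogeneous_part wt \<sigma> (\<lambda>p. h p $ a) else (\<lambda>_. 0))"

lemma germ_eq_foldr_coord_derivative:
  assumes "germ_eq f g"
  shows "germ_eq (foldr coord_derivative as f) (foldr coord_derivative as g)"
proof (induction as)
  case Nil
  then show ?case using assms by simp
next
  case (Cons a as)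
  show ?case
    using germ_eq_frechet_derivative[OF Cons.IH]
    by (simp add: germ_eq_def coord_derivative_def [abs_def]) (erule eventually_mono, simp)
qed

lift_definition weighted_jet ::
  "('a::finite \<Rightarrow> real) \<Rightarrow> real \<Rightarrow> (complex ^ 'a, complex ^ 'a) germ \<Rightarrow> real \<Rightarrow> 'a \<Rightarrow> complex ^ 'a \<Rightarrow> complex"
  is jet
proof -
  fix wt :: "'a \<Rightarrow> real" and s :: real and f g :: "complex ^ 'a \<Rightarrow> complex ^ 'a"
  assume *: "germ_eq f g"
  have "foldr coord_derivative as (\<lambda>p. f p $ a) 0 = foldr coord_derivative as (\<lambda>p. g p $ a) 0" for as a
  proof -
    have "germ_eq (\<lambda>p. f p $ a) (\<lambda>p. g p $ a)"
      using * unfolding germ_eq_def by (auto elim: eventually_mono)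
    from germ_eq_foldr_coord_derivative[OF this, of as] show ?thesis
      unfolding germ_eq_def by (rule eventually_nhds_x_imp_x)
  qed
  then show "jet wt s f = jet wt s g"
    by (simp add: jet_def homogeneous_part_def fun_eq_iff)
qed

end

theory Submission
  imports Defs "HOL-Complex_Analysis.Cauchy_Integral_Formula" "HOL-Library.Function_Algebras"
begin

text \<open>
  Treat the conjugates of \<open>z\<close> and \<open>w\<close> on the model as independent coordinates \<open>\<zeta>\<close> and
  \<open>\<tau> = w - 2 i P(z, \<zeta>, u)\<close>, where \<open>u\<close> solves \<open>u + i P(z, \<zeta>, u) = w\<close>. The fields
  \<open>L\<^sub>j = \<partial>/\<partial>z\<^sub>j + \<Sum>\<^sub>l R\<^sub>l\<^sub>j \<partial>/\<partial>w\<^sub>l\<close> that annihilate \<open>\<zeta>\<close> and \<open>\<tau>\<close> are locally nilpotent and generate a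
  nilpotent Lie algebra. Tangency of a polynomial field \<open>X\<close> is a linear relation between the components of
  \<open>X\<close> and those of its conjugate; differentiating it in \<open>\<zeta>\<close> and eliminating, which holomorphic
  nondegeneracy permits, shows that the components of \<open>X\<close> are annihilated by a power of each \<open>L\<^sub>j\<close> that does
  not depend on \<open>X\<close>. By nilpotency, words in the \<open>L\<^sub>j\<close> then act on all these components like combinations of words
  of bounded length. By finite type a polynomial in \<open>(z, w)\<close> annihilated by all \<open>L\<^sub>j\<close> is constant, so a
  nonzero component of weighted degree \<open>\<sigma>\<close> is not annihilated by some word of length \<open>\<sigma>\<close>, and \<open>\<sigma>\<close> is bounded.
  Hence only finitely many \<open>G\<^sub>\<mu>\<close> are nonzero. The weighted Taylor parts of a holomorphic tangent field are
  tangent by scaling, which gives the grading; the Euler field shows \<open>k \<ge> 0\<close>.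

  If \<open>h\<close> and \<open>g\<close> are automorphisms of a perturbation with the same weighted jet and \<open>g\<^sup>-\<^sup>1 h\<close> is not the
  identity, then the leading weighted part of \<open>g\<^sup>-\<^sup>1 h - id\<close> is, again by scaling, a field tangent to the model of
  weight larger than \<open>k\<close>, hence zero, a contradiction.
\<close>

section \<open>Words in nilpotent operators\<close>

text \<open>Elimination yields an exponent for each \<open>LL j\<close> that serves all tangent
  fields, but says nothing about brackets, and a bracket of locally nilpotent operators is not
  locally nilpotent for formal reasons. Nilpotency of the Lie algebra helps: conjugating one locally
  nilpotent element by the exponential of another keeps it locally nilpotent, and the conjugate is a
  polynomial in the time whose linear coefficient is the bracket. So finitely many locally nilpotent
  elements span, and nonzero ordered words in them are bounded. Uniformity in the field comes from
  letting the operators act on one function that lists all components: a single cyclic vector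
  carries every field, and the coefficients of the bounded words are common to all. The derivatives
  in \<zeta> join the generators because words in the \<open>LL j\<close> introduce \<zeta>, while
  finite type speaks only of polynomials in (z, w). For the second claim, \<open>r\<close> is the
  sum of the \<open>m l\<close>, and \<open>k\<^sub>0\<close> is the sum of the integral weights of
  all coordinates divided by the first Hoermander number; it covers the gap between the weight of a
  field and the degrees of its components.\<close>

instantiation "fun" :: (type, real_vector) real_vector
begin

definition scaleR_fun_def: "r *\<^sub>R f = (\<lambda>x. r *\<^sub>R f x)"

instance
  by standard (auto simp: scaleR_fun_def fun_eq_iff scaleR_add_right scaleR_add_left)

end

lemma scaleR_fun_apply [simp]: "(r *\<^sub>R f) x = r *\<^sub>R f x"
  by (simp add: scaleR_fun_def)

lemma sum_fun_apply: "(sum f A) x = (\<Sum>i\<in>A. f i x)"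
  by (induction A rule: infinite_finite_induct) auto

section \<open>Brackets of linear operators and local nilpotency\<close>

definition comm :: "('v::real_vector \<Rightarrow> 'v) \<Rightarrow> ('v \<Rightarrow> 'v) \<Rightarrow> 'v \<Rightarrow> 'v" where
  "comm x T = (\<lambda>v. x (T v) - T (x v))"

definition act :: "('v \<Rightarrow> 'v) list \<Rightarrow> 'v \<Rightarrow> 'v" where
  "act ws v = foldr (\<lambda>x. x) ws v"

lemma act_Nil [simp]: "act [] v = v"
  and act_Cons [simp]: "act (x # ws) v = x (act ws v)"
  by (simp_all add: act_def)

text \<open>Only brackets with a generator on the left are listed; by the Jacobi identity
  (\<open>comm_liec_N\<close>) their spans contain all other brackets, and the index still counts
  the letters.\<close>

inductive liec :: "('v::real_vector \<Rightarrow> 'v) set \<Rightarrow> nat \<Rightarrow> ('v \<Rightarrow> 'v) \<Rightarrow> bool" for X where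
  gen: "x \<in> X \<Longrightarrow> liec X 1 x"
| brk: "x \<in> X \<Longrightarrow> liec X k T \<Longrightarrow> liec X (Suc k) (comm x T)"

lemma subspace_linear: "subspace {T :: 'v::real_vector \<Rightarrow> 'v. linear T}"
  by (auto simp: subspace_def linear_iff algebra_simps)

lemma linear_comm: "linear x \<Longrightarrow> linear T \<Longrightarrow> linear (comm x T)"
  by (auto simp: comm_def linear_iff algebra_simps)

lemma comm_linear_right: "linear x \<Longrightarrow> linear (comm x)"
  by (rule linearI) (auto simp: comm_def fun_eq_iff linear_add linear_scale algebra_simps)

lemma comm_left: "linear T \<Longrightarrow> linear (\<lambda>x. comm x T)"
  by (rule linearI) (auto simp: comm_def fun_eq_iff linear_add linear_scale algebra_simps)

lemma span_linear_image:
  assumes "linear h" "x \<in> span S" "\<And>y. y \<in> S \<Longrightarrow> h y \<in> T" "subspace T"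
  shows "h x \<in> T"
  using assms(2)
proof (induction rule: span_induct_alt)
  case base
  then show ?case using assms(1,4) by (simp add: linear_0 subspace_0)
next
  case (step c x y)
  then show ?case
    using assms by (simp add: linear_add linear_scale subspace_add subspace_scale)
qed

lemma linear_eval: "linear (\<lambda>T :: 'a \<Rightarrow> 'v::real_vector. T g)"
  by (rule linearI) auto

lemma linear_funpow: "linear (y :: 'v::real_vector \<Rightarrow> 'v) \<Longrightarrow> linear (y ^^ n)"
  by (induction n) (auto simp: linear_id linear_compose simp flip: id_def)

lemma funpow_zero_mono:
  assumes "linear (y :: 'v::real_vector \<Rightarrow> 'v)" "(y ^^ K) g = 0" "K \<le> N"
  shows "(y ^^ N) g = 0"
proof -
  have "(y ^^ N) g = (y ^^ (N - K)) ((y ^^ K) g)"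
    using assms(3) by (metis comp_apply funpow_add le_add_diff_inverse2)
  then show ?thesis using assms(1,2) linear_0 linear_funpow by auto
qed

lemma nil_subspace:
  assumes "linear (y :: 'v::real_vector \<Rightarrow> 'v)"
  shows "subspace {g. \<exists>K. (y ^^ K) g = 0}"
proof (rule subspaceI)
  show "0 \<in> {g. \<exists>K. (y ^^ K) g = 0}" by (auto intro: exI[of _ 0])
next
  fix a b assume "a \<in> {g. \<exists>K. (y ^^ K) g = 0}" "b \<in> {g. \<exists>K. (y ^^ K) g = 0}"
  then obtain K L where "(y ^^ K) a = 0" "(y ^^ L) b = 0" by auto
  then have "(y ^^ (K + L)) (a + b) = 0"
    using funpow_zero_mono[OF assms, of K a "K + L"] funpow_zero_mono[OF assms, of L b "K + L"]
    by (simp add: linear_add[OF linear_funpow[OF assms]])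
  then show "a + b \<in> {g. \<exists>K. (y ^^ K) g = 0}" by blast
next
  fix c :: real and a assume "a \<in> {g. \<exists>K. (y ^^ K) g = 0}"
  then show "c *\<^sub>R a \<in> {g. \<exists>K. (y ^^ K) g = 0}"
    using linear_scale[OF linear_funpow[OF assms]] by auto
qed

lemma nil_step:
  assumes "linear (y :: 'v::real_vector \<Rightarrow> 'v)" "(y ^^ K) (y g) = 0"
  shows "\<exists>K. (y ^^ K) g = 0"
  using assms(2) by (intro exI[of _ "Suc K"]) (simp add: funpow_swap1)

text \<open>From \<open>y (T g) = T (y g) + comm y T g\<close>: the outer induction shortens the
  chain of brackets with \<open>y\<close>, the inner one the power of \<open>y\<close> that kills
  \<open>g\<close>.\<close>

lemma nil_apply:
  assumes y: "linear (y :: 'v::real_vector \<Rightarrow> 'v)"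
  shows "linear T \<Longrightarrow> (comm y ^^ r) T = 0 \<Longrightarrow> (y ^^ K) g = 0 \<Longrightarrow> \<exists>K. (y ^^ K) (T g) = 0"
proof (induction r arbitrary: T K g)
  case 0
  then show ?case by (auto intro: exI[of _ 0])
next
  case (Suc r)
  have T': "(comm y ^^ r) (comm y T) = 0"
    using Suc.prems(2) unfolding funpow_Suc_right comp_def .
  show ?case using Suc.prems(3)
  proof (induction K arbitrary: g)
    case 0
    then show ?case using Suc.prems(1) by (auto intro: exI[of _ 0] simp: linear_0)
  next
    case (Suc K)
    have *: "(y ^^ K) (y g) = 0" using Suc.prems by (simp add: funpow_swap1)
    have "\<exists>L. (y ^^ L) (T (y g)) = 0" using Suc.IH[OF *] .
    moreover have "\<exists>L. (y ^^ L) (comm y T g) = 0"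
      using \<open>\<And>T K g. linear T \<Longrightarrow> (comm y ^^ r) T = 0 \<Longrightarrow> (y ^^ K) g = 0 \<Longrightarrow> \<exists>K. (y ^^ K) (T g) = 0\<close>
        [OF linear_comm[OF y \<open>linear T\<close>] T' Suc.prems] .
    ultimately have "\<exists>L. (y ^^ L) (T (y g) + comm y T g) = 0"
      using subspace_add[OF nil_subspace[OF y]] by blast
    then have "\<exists>L. (y ^^ L) (y (T g)) = 0" by (simp add: comm_def)
    then show ?case using nil_step[OF y] by blast
  qed
qed

text \<open>The exponential of \<open>t\<close> times \<open>y\<close> on vectors that some power of
  \<open>y\<close> kills. Summing over the nonzero terms avoids choosing that power; for linear
  \<open>y\<close> and any other vector the index set is infinite and the value is 0.\<close>

definition expo :: "('v::real_vector \<Rightarrow> 'v) \<Rightarrow> real \<Rightarrow> 'v \<Rightarrow> 'v" where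
  "expo y t g = (\<Sum>i | (y ^^ i) g \<noteq> 0. (t ^ i / fact i) *\<^sub>R (y ^^ i) g)"

lemma expo_eq:
  assumes "linear y" "(y ^^ K) g = 0"
  shows "expo y t g = (\<Sum>i<K. (t ^ i / fact i) *\<^sub>R (y ^^ i) g)"
  unfolding expo_def
proof (rule sum.mono_neutral_left)
  show "{i. (y ^^ i) g \<noteq> 0} \<subseteq> {..<K}"
    by (metis (mono_tags, lifting) assms funpow_zero_mono lessThan_iff linorder_not_le mem_Collect_eq subsetI)
qed auto

text \<open>Both sides run over the support of \<open>b\<close>, a finite rectangle; its diagonals
  are exhausted once \<open>N\<close> reaches \<open>p + q\<close>.\<close>

lemma double_sum_antidiagonal:
  fixes b :: "nat \<Rightarrow> nat \<Rightarrow> 'v::real_vector"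
  assumes "\<And>i j. i \<ge> p \<or> j \<ge> q \<Longrightarrow> b i j = 0" "p + q \<le> N"
  shows "(\<Sum>n<N. \<Sum>i\<le>n. b i (n - i)) = (\<Sum>i<p. \<Sum>j<q. b i j)"
proof -
  have "(\<Sum>n<N. \<Sum>i\<le>n. b i (n - i)) = (\<Sum>(i,j)\<in>{(i,j). i + j < N}. b i j)"
    unfolding sum.nested_swap' sum.triangle_reindex_eq
    by (rule sum.triangle_reindex[symmetric])
  also have "\<dots> = (\<Sum>(i,j)\<in>{..<p} \<times> {..<q}. b i j)"
  proof (rule sum.mono_neutral_right)
    have "{(i,j). i + j < N} \<subseteq> {..<N} \<times> {..<N}" by auto
    then show "finite {(i,j). i + j < N}" by (rule finite_subset) auto
    show "\<forall>i\<in>{(i, j). i + j < N} - {..<p} \<times> {..<q}. (case i of (i, j) \<Rightarrow> b i j) = 0"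
      using assms(1) by (clarsimp simp: not_less) (metis not_less)
  qed (use assms(2) in auto)
  also have "\<dots> = (\<Sum>i<p. \<Sum>j<q. b i j)"
    by (simp add: sum.cartesian_product)
  finally show ?thesis .
qed

text \<open>Collected by total degree, the product of the two series has the binomial expansion of
  \<open>(t + -t) ^ n\<close> as its coefficient of order \<open>n\<close>.\<close>

lemma expo_inverse:
  assumes "linear y" "(y ^^ K) g = 0"
  shows "expo y t (expo y (-t) g) = g"
proof (cases "K = 0")
  case True
  then have "g = 0" using assms by simp
  then show ?thesis using expo_eq[OF assms(1), of 0] by simp
next
  case False
  have e: "expo y (-t) g = (\<Sum>j<K. ((-t) ^ j / fact j) *\<^sub>R (y ^^ j) g)"
    by (rule expo_eq[OF assms])
  have pw: "(y ^^ i) (expo y (-t) g) = (\<Sum>j<K. ((-t) ^ j / fact j) *\<^sub>R (y ^^ (i + j)) g)" for i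
    unfolding e by (simp add: linear_sum[OF linear_funpow[OF assms(1)]] funpow_add
        linear_scale[OF linear_funpow[OF assms(1)]])
  have z: "(y ^^ n) g = 0" if "n \<ge> K" for n
    using funpow_zero_mono[OF assms that] .
  have "(y ^^ K) (expo y (-t) g) = 0" unfolding pw by (simp add: z)
  then have "expo y t (expo y (-t) g)
      = (\<Sum>i<K. \<Sum>j<K. (t ^ i / fact i * ((-t) ^ j / fact j)) *\<^sub>R (y ^^ (i + j)) g)"
    by (simp add: expo_eq[OF assms(1)] pw scaleR_sum_right)
  \<comment> \<open>The truncation is written into the summand so that it vanishes outside the
    square, as the regrouping by diagonals requires.\<close>
  also have "\<dots> = (\<Sum>i<K. \<Sum>j<K. if i < K \<and> j < K then (t ^ i / fact i * ((-t) ^ j / fact j)) *\<^sub>R (y ^^ (i + j)) g else 0)"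
    by simp
  also have "\<dots> = (\<Sum>n<K + K. \<Sum>i\<le>n. if i < K \<and> n - i < K then (t ^ i / fact i * ((-t) ^ (n - i) / fact (n - i))) *\<^sub>R (y ^^ (i + (n - i))) g else 0)"
    by (rule double_sum_antidiagonal[symmetric]) auto
  also have "\<dots> = (\<Sum>n<K + K. if n = 0 then g else 0)"
  proof (rule sum.cong[OF refl])
    fix n assume "n \<in> {..<K + K}"
    show "(\<Sum>i\<le>n. if i < K \<and> n - i < K then (t ^ i / fact i * ((-t) ^ (n - i) / fact (n - i))) *\<^sub>R (y ^^ (i + (n - i))) g else 0)
        = (if n = 0 then g else 0)"
    proof (cases "n < K")
      case True
      have "(\<Sum>i\<le>n. if i < K \<and> n - i < K then (t ^ i / fact i * ((-t) ^ (n - i) / fact (n - i))) *\<^sub>R (y ^^ (i + (n - i))) g else 0)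
         = (\<Sum>i\<le>n. (of_nat (n choose i) * t ^ i * (-t) ^ (n - i)) / fact n) *\<^sub>R (y ^^ n) g"
        unfolding scaleR_sum_left
        by (rule sum.cong) (use True in \<open>auto simp: binomial_fact field_simps\<close>)
      also have "(\<Sum>i\<le>n. (of_nat (n choose i) * t ^ i * (-t) ^ (n - i)) / fact n) = (t + -t) ^ n / fact n"
        unfolding binomial_ring sum_divide_distrib by simp
      finally show ?thesis by (auto simp: power_0_left)
    next
      case f: False
      then show ?thesis using z False by (auto intro!: sum.neutral)
    qed
  qed
  also have "\<dots> = g" using False by simp
  finally show ?thesis .
qed

lemma Leibniz_comm:
  assumes "linear y"
  shows "linear T \<Longrightarrow> (y ^^ n) (T g) = (\<Sum>i\<le>n. of_nat (n choose i) *\<^sub>R (comm y ^^ i) T ((y ^^ (n - i)) g))"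
proof (induction n arbitrary: T g)
  case 0
  then show ?case by simp
next
  case (Suc n)
  have l: "linear (comm y T)" by (rule linear_comm[OF assms Suc.prems])
  have "(y ^^ Suc n) (T g) = (y ^^ n) (T (y g)) + (y ^^ n) (comm y T g)"
    by (simp add: funpow_swap1 comm_def linear_diff[OF linear_funpow[OF assms]])
  also have "(y ^^ n) (T (y g)) = (\<Sum>i\<le>n. of_nat (n choose i) *\<^sub>R (comm y ^^ i) T ((y ^^ (Suc n - i)) g))"
    unfolding Suc.IH[OF Suc.prems] by (rule sum.cong) (auto simp: funpow_swap1 Suc_diff_le)
  also have "\<dots> = (\<Sum>i\<le>Suc n. of_nat (n choose i) *\<^sub>R (comm y ^^ i) T ((y ^^ (Suc n - i)) g))"
    by simp
  also have "\<dots> = T ((y ^^ Suc n) g) + (\<Sum>i\<le>n. of_nat (n choose Suc i) *\<^sub>R (comm y ^^ Suc i) T ((y ^^ (n - i)) g))"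
    by (subst sum.atMost_Suc_shift) simp
  also have "(y ^^ n) (comm y T g) = (\<Sum>i\<le>n. of_nat (n choose i) *\<^sub>R (comm y ^^ Suc i) T ((y ^^ (n - i)) g))"
    unfolding Suc.IH[OF l] by (simp add: funpow_swap1)
  finally have "(y ^^ Suc n) (T g) = T ((y ^^ Suc n) g) + (\<Sum>i\<le>n. of_nat (Suc n choose Suc i) *\<^sub>R (comm y ^^ Suc i) T ((y ^^ (n - i)) g))"
    by (simp add: sum.distrib scaleR_add_left algebra_simps)
  then show ?case
    by (subst sum.atMost_Suc_shift) simp
qed

text \<open>Conjugation by exp(t y) is the exponential of t times the bracket with \<open>y\<close>.
  It is stated as an intertwining relation, so that no inverse of the exponential occurs.\<close>

lemma expo_intertwine:
  assumes y: "linear y" and T: "linear T" and K: "(y ^^ K) g = 0" and ad: "\<And>i. i \<ge> s \<Longrightarrow> (comm y ^^ i) T = 0"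
    and K': "(y ^^ K') (T g) = 0"
  shows "(\<Sum>k<s. (t ^ k / fact k) *\<^sub>R (comm y ^^ k) T) (expo y t g) = expo y t (T g)"
proof -
  let ?N = "K' + s + K"
  have lin: "linear ((comm y ^^ k) T)" for k
    by (induction k) (auto simp: T linear_comm y)
  have "(y ^^ ?N) (T g) = 0" by (rule funpow_zero_mono[OF y K']) simp
  then have "expo y t (T g) = (\<Sum>n<?N. (t ^ n / fact n) *\<^sub>R (y ^^ n) (T g))"
    by (rule expo_eq[OF y])
  also have "\<dots> = (\<Sum>n<?N. \<Sum>i\<le>n. (t ^ i / fact i * (t ^ (n - i) / fact (n - i))) *\<^sub>R (comm y ^^ i) T ((y ^^ (n - i)) g))"
    unfolding Leibniz_comm[OF y T] scaleR_sum_right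
    by (intro sum.cong refl) (auto simp: binomial_fact field_simps simp flip: power_add)
  also have "\<dots> = (\<Sum>i<s. \<Sum>j<K. (t ^ i / fact i * (t ^ j / fact j)) *\<^sub>R (comm y ^^ i) T ((y ^^ j) g))"
  proof (rule double_sum_antidiagonal)
    fix i j assume "s \<le> i \<or> K \<le> j"
    then have "(comm y ^^ i) T ((y ^^ j) g) = 0"
      using ad[of i] funpow_zero_mono[OF y K, of j] linear_0[OF lin] by auto
    then show "(t ^ i / fact i * (t ^ j / fact j)) *\<^sub>R (comm y ^^ i) T ((y ^^ j) g) = 0" by simp
  qed simp
  also have "\<dots> = (\<Sum>k<s. (t ^ k / fact k) *\<^sub>R (comm y ^^ k) T (expo y t g))"
    unfolding expo_eq[OF y K] by (simp add: linear_sum[OF lin] linear_scale[OF lin] scaleR_sum_right)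
  finally show ?thesis by (simp add: sum_fun_apply)
qed

text \<open>Comparing the values at \<open>2 * t\<close> and at \<open>t\<close> removes the top
  coefficient and multiplies the others by the nonzero factors \<open>2 ^ k - 2 ^ n\<close>.\<close>

lemma polynomial_coeffs_in_subspace:
  fixes v :: "nat \<Rightarrow> 'v::real_vector"
  assumes "subspace S"
  shows "(\<And>t::real. (\<Sum>k<n. t ^ k *\<^sub>R v k) \<in> S) \<Longrightarrow> k < n \<Longrightarrow> v k \<in> S"
proof (induction n arbitrary: v k)
  case 0
  then show ?case by simp
next
  case (Suc n)
  have "(\<Sum>k<n. t ^ k *\<^sub>R ((2 ^ k - 2 ^ n) *\<^sub>R v k)) \<in> S" for t :: real
  proof -
    have "(\<Sum>k<Suc n. (2 * t) ^ k *\<^sub>R v k) - 2 ^ n *\<^sub>R (\<Sum>k<Suc n. t ^ k *\<^sub>R v k) \<in> S"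
      using Suc.prems(1) assms by (intro subspace_diff subspace_scale)
    also have "(\<Sum>k<Suc n. (2 * t) ^ k *\<^sub>R v k) - 2 ^ n *\<^sub>R (\<Sum>k<Suc n. t ^ k *\<^sub>R v k)
        = (\<Sum>k<n. t ^ k *\<^sub>R ((2 ^ k - 2 ^ n) *\<^sub>R v k))"
      by (simp add: scaleR_sum_right sum_subtractf[symmetric] power_mult_distrib algebra_simps
          scaleR_diff_left scaleR_add_right)
    finally show ?thesis .
  qed
  from Suc.IH[OF this] have "(2 ^ k - 2 ^ n :: real) *\<^sub>R v k \<in> S" if "k < n" for k
    using that .
  then have *: "v k \<in> S" if "k < n" for k
  proof -
    have "(2 ^ k - 2 ^ n :: real) \<noteq> 0" using that by simp
    moreover have "(2 ^ k - 2 ^ n :: real) *\<^sub>R v k \<in> S"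
      using \<open>\<And>k. k < n \<Longrightarrow> (2 ^ k - 2 ^ n) *\<^sub>R v k \<in> S\<close> that .
    ultimately show ?thesis using subspace_scale[OF assms, of "(2 ^ k - 2 ^ n) *\<^sub>R v k" "inverse (2 ^ k - 2 ^ n)"]
      by simp
  qed
  have "(\<Sum>k<Suc n. 1 ^ k *\<^sub>R v k) - (\<Sum>k<n. v k) \<in> S"
    by (rule subspace_diff[OF assms Suc.prems(1) subspace_sum[OF assms]]) (use * in auto)
  then have "v n \<in> S" by simp
  then show ?case using * Suc.prems(2) by (auto simp: less_Suc_eq)
qed

lemma finite_liec: "finite X \<Longrightarrow> finite {T. liec X k T}"
proof (induction k)
  case 0
  have "\<not> liec X 0 T" for T
  proof
    assume "liec X 0 T"
    then show False by cases auto
  qed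
  then have "{T. liec X 0 T} = {}" by blast
  then show ?case by simp
next
  case (Suc k)
  have "{T. liec X (Suc k) T} \<subseteq> X \<union> (\<lambda>(x, T). comm x T) ` (X \<times> {T. liec X k T})"
  proof
    fix T assume "T \<in> {T. liec X (Suc k) T}"
    then have "liec X (Suc k) T" by simp
    then show "T \<in> X \<union> (\<lambda>(x, T). comm x T) ` (X \<times> {T. liec X k T})"
      by cases auto
  qed
  then show ?case by (rule finite_subset) (use Suc in auto)
qed

text \<open>The aim is the finite dimensionality of the module generated by \<open>f\<close>: a
  finitely generated nilpotent Lie algebra acts, and each generator, though not each bracket, is
  known to be nilpotent on the cyclic vector.\<close>

locale nilpotent_operators =
  fixes X :: "('v::real_vector \<Rightarrow> 'v) set" and s :: nat and f :: 'v
  assumes finite_gens: "finite X"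
    and linear_gens: "x \<in> X \<Longrightarrow> linear x"
    and liec_zero: "liec X k T \<Longrightarrow> k > s \<Longrightarrow> T = 0"
    and gens_nil: "x \<in> X \<Longrightarrow> \<exists>K. (x ^^ K) f = 0"
begin

text \<open>For positive \<open>k\<close>, the \<open>k\<close>-th term of the lower central series;
  \<open>N 1\<close> is the whole Lie algebra.\<close>

definition N :: "nat \<Rightarrow> ('v \<Rightarrow> 'v) set" where
  "N k = span {T. \<exists>j\<ge>k. liec X j T}"

definition cyc :: "'v set" where
  "cyc = span {act ws f | ws. set ws \<subseteq> X}"

lemma linear_liec: "liec X k T \<Longrightarrow> linear T"
  by (induction rule: liec.induct) (auto intro: linear_comm linear_gens)

lemma linear_N: "T \<in> N k \<Longrightarrow> linear T"
proof -
  assume T: "T \<in> N k"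
  have "{T. \<exists>j\<ge>k. liec X j T} \<subseteq> {T. linear T}"
    by (intro subsetI) (elim CollectE exE conjE, intro CollectI, rule linear_liec)
  from subsetD[OF span_minimal[OF this subspace_linear] T[unfolded N_def]] show ?thesis by simp
qed

lemma N_mono: "j \<le> k \<Longrightarrow> N k \<subseteq> N j"
  unfolding N_def by (intro span_mono subsetI) (elim CollectE exE conjE, intro CollectI exI conjI, rule order_trans)

lemma N_zero: "k > s \<Longrightarrow> T \<in> N k \<Longrightarrow> T = 0"
proof -
  assume "k > s" "T \<in> N k"
  have "{T. \<exists>j\<ge>k. liec X j T} \<subseteq> {0}"
  proof
    fix S assume "S \<in> {T. \<exists>j\<ge>k. liec X j T}"
    then obtain j where "j \<ge> k" "liec X j S" by auto
    then show "S \<in> {0}" using liec_zero[of j S] \<open>k > s\<close> by simp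
  qed
  then have "N k \<subseteq> span {0}" unfolding N_def by (rule span_mono)
  then show ?thesis using \<open>T \<in> N k\<close> by auto
qed

lemma subspace_N: "subspace (N k)" by (simp add: N_def)

lemma comm_gen_N:
  assumes x: "x \<in> X" and T: "T \<in> N b" shows "comm x T \<in> N (Suc b)"
proof (rule span_linear_image[OF comm_linear_right[OF linear_gens[OF x]] T[unfolded N_def] _ subspace_N])
  fix y assume "y \<in> {T. \<exists>j\<ge>b. liec X j T}"
  then obtain j where "j \<ge> b" "liec X j y" by auto
  then have "liec X (Suc j) (comm x y)" using x liec.brk by blast
  then show "comm x y \<in> N (Suc b)" unfolding N_def using \<open>j \<ge> b\<close>
    by (intro span_base) auto
qed

text \<open>Induction on the left bracket; the Jacobi identity moves its outermost generator
  outside, where \<open>comm_gen_N\<close> applies.\<close>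

lemma comm_liec_N: "liec X a S \<Longrightarrow> T \<in> N b \<Longrightarrow> comm S T \<in> N (a + b)"
proof (induction arbitrary: T b rule: liec.induct)
  case (gen x)
  then show ?case using comm_gen_N by simp
next
  case (brk x k S)
  have "comm x (comm S T) \<in> N (Suc (k + b))"
    using comm_gen_N[OF brk(1) brk.IH[OF brk.prems]] .
  moreover have "comm S (comm x T) \<in> N (k + Suc b)"
    using brk.IH[OF comm_gen_N[OF brk(1) brk.prems]] .
  moreover have "comm (comm x S) T = comm x (comm S T) - comm S (comm x T)"
    using linear_N[OF brk.prems] linear_liec[OF brk(2)] linear_gens[OF brk(1)]
    by (simp add: comm_def fun_eq_iff linear_diff)
  ultimately show ?case
    using subspace_diff[OF subspace_N] by (metis add_Suc add_Suc_right)
qed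

lemma comm_N: "S \<in> N a \<Longrightarrow> T \<in> N b \<Longrightarrow> comm S T \<in> N (a + b)"
proof -
  assume S: "S \<in> N a" and T: "T \<in> N b"
  show ?thesis
  proof (rule span_linear_image[OF comm_left[OF linear_N[OF T]] S[unfolded N_def] _ subspace_N])
    fix y assume "y \<in> {T. \<exists>j\<ge>a. liec X j T}"
    then obtain j where "j \<ge> a" "liec X j y" by auto
    then show "comm y T \<in> N (a + b)" using comm_liec_N[OF _ T, of j y] N_mono[of "a + b" "j + b"] by auto
  qed
qed

lemma comm_N1: "S \<in> N 1 \<Longrightarrow> T \<in> N 1 \<Longrightarrow> comm S T \<in> N 1"
  using subsetD[OF N_mono comm_N, of 1 1 1] by simp

lemma ad_N: "S \<in> N 1 \<Longrightarrow> T \<in> N 1 \<Longrightarrow> (comm S ^^ i) T \<in> N (Suc i)"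
proof (induction i)
  case (Suc i)
  then show ?case using comm_N[of S 1 "(comm S ^^ i) T" "Suc i"] by simp
qed simp

lemma ad_zero: "S \<in> N 1 \<Longrightarrow> T \<in> N 1 \<Longrightarrow> i \<ge> s \<Longrightarrow> (comm S ^^ i) T = 0"
  by (rule N_zero[OF _ ad_N]) simp_all

lemma gens_N: "x \<in> X \<Longrightarrow> x \<in> N 1"
  unfolding N_def by (intro span_base) (use gen in blast)

lemma subspace_cyc: "subspace cyc" by (simp add: cyc_def)

lemma gens_cyc: assumes x: "x \<in> X" and g: "g \<in> cyc" shows "x g \<in> cyc"
  unfolding cyc_def
proof (rule span_linear_image[OF linear_gens[OF x] g[unfolded cyc_def]])
  fix y assume "y \<in> {act ws f |ws. set ws \<subseteq> X}"
  then obtain ws where "y = act ws f" "set ws \<subseteq> X" by auto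
  then show "x y \<in> span {act ws f |ws. set ws \<subseteq> X}"
    using x by (intro span_base CollectI exI[of _ "x # ws"]) auto
qed auto

lemma N_cyc: assumes T: "T \<in> N k" and g: "g \<in> cyc" shows "T g \<in> cyc"
proof -
  have *: "liec X j T \<Longrightarrow> g \<in> cyc \<Longrightarrow> T g \<in> cyc" for j T g
  proof (induction arbitrary: g rule: liec.induct)
    case (gen x)
    then show ?case by (rule gens_cyc)
  next
    case (brk x k T)
    have "x (T g) \<in> cyc" "T (x g) \<in> cyc"
      by (rule gens_cyc[OF brk(1) brk.IH[OF brk.prems]], rule brk.IH[OF gens_cyc[OF brk(1) brk.prems]])
    then show ?case unfolding comm_def by (rule subspace_diff[OF subspace_cyc])
  qed
  show "T g \<in> cyc"
  proof (rule span_linear_image[OF linear_eval T[unfolded N_def] _ subspace_cyc])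
    fix S assume "S \<in> {T. \<exists>j\<ge>k. liec X j T}"
    then obtain j where "liec X j S" by auto
    then show "S g \<in> cyc" using g by (rule *)
  qed
qed

text \<open>Local nilpotency spreads from the cyclic vector to the module one letter at a time,
  because iterated brackets with \<open>y\<close> end in 0.\<close>

lemma nil_everywhere:
  assumes y: "y \<in> N 1" and f: "\<exists>K. (y ^^ K) f = 0" and g: "g \<in> cyc"
  shows "\<exists>K. (y ^^ K) g = 0"
proof -
  have l: "linear y" using linear_N y by blast
  have "\<exists>K. (y ^^ K) (act ws f) = 0" if "set ws \<subseteq> X" for ws
    using that
  proof (induction ws)
    case (Cons x ws)
    then obtain K where "(y ^^ K) (act ws f) = 0" by auto
    from nil_apply[OF l linear_gens ad_zero[OF y gens_N] this] Cons.prems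
    show ?case by auto
  qed (use f in simp)
  then have "cyc \<subseteq> {g. \<exists>K. (y ^^ K) g = 0}"
    unfolding cyc_def by (intro span_minimal nil_subspace l subsetI) (auto simp only: mem_Collect_eq)
  from subsetD[OF this g] show ?thesis by simp
qed

text \<open>The elements of the Lie algebra that are locally nilpotent on the module.
  \<open>NN\<close> is not claimed to be a subspace; the point of the following lemmas is that it
  spans \<open>N 1\<close>.\<close>

definition NN :: "('v \<Rightarrow> 'v) set" where
  "NN = {y \<in> N 1. \<forall>g\<in>cyc. \<exists>K. (y ^^ K) g = 0}"

lemma NN_D1: "y \<in> NN \<Longrightarrow> y \<in> N 1"
  unfolding NN_def by (elim CollectE conjE)

lemma NN_D2: "y \<in> NN \<Longrightarrow> g \<in> cyc \<Longrightarrow> \<exists>K. (y ^^ K) g = 0"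
  unfolding NN_def by (elim CollectE conjE bspec)

lemma gens_NN: "x \<in> X \<Longrightarrow> x \<in> NN"
  unfolding NN_def by (intro CollectI conjI ballI gens_N nil_everywhere[OF gens_N gens_nil])

text \<open>The sum is the conjugate of \<open>T\<close> by exp(t y). Its powers on
  \<open>expo y t h\<close> are the images of the powers of \<open>T\<close> on \<open>h\<close>,
  and every vector of the module has the form \<open>expo y t h\<close>.\<close>

lemma conj_NN:
  assumes y: "y \<in> NN" and T: "T \<in> NN"
  shows "(\<Sum>k<s. (t ^ k / fact k) *\<^sub>R (comm y ^^ k) T) \<in> NN"
proof -
  let ?Y = "\<Sum>k<s. (t ^ k / fact k) *\<^sub>R (comm y ^^ k) T"
  have y1: "y \<in> N 1" and T1: "T \<in> N 1" using y T NN_D1 by blast+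
  have ly: "linear y" and lT: "linear T" using linear_N[OF y1] linear_N[OF T1] .
  have Y1: "?Y \<in> N 1"
  proof (intro subspace_sum subspace_scale subspace_N)
    fix i show "(comm y ^^ i) T \<in> N 1"
      using ad_N[OF y1 T1, of i] N_mono[of 1 "Suc i"] by auto
  qed
  have inter: "?Y (expo y t g) = expo y t (T g)" if g: "g \<in> cyc" for g
  proof -
    obtain K where K: "(y ^^ K) g = 0" using NN_D2[OF y g] by (elim exE)
    have "T g \<in> cyc" using N_cyc[OF T1 g] .
    then obtain K' where K': "(y ^^ K') (T g) = 0" using NN_D2[OF y \<open>T g \<in> cyc\<close>] by (elim exE)
    show ?thesis by (rule expo_intertwine[OF ly lT K _ K']) (rule ad_zero[OF y1 T1])
  qed
  have Tp: "(T ^^ n) g \<in> cyc" if "g \<in> cyc" for n g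
    using that by (induction n) (auto intro: N_cyc[OF T1])
  have pw: "(?Y ^^ n) (expo y t g) = expo y t ((T ^^ n) g)" if "g \<in> cyc" for g n
  proof (induction n)
    case (Suc n)
    have "(?Y ^^ Suc n) (expo y t g) = ?Y ((?Y ^^ n) (expo y t g))" by (simp only: funpow.simps comp_apply)
    also have "\<dots> = ?Y (expo y t ((T ^^ n) g))" by (simp only: Suc)
    also have "\<dots> = expo y t (T ((T ^^ n) g))" by (rule inter[OF Tp[OF that]])
    finally show ?case by (simp only: funpow.simps comp_apply)
  qed simp
  have "\<exists>K. (?Y ^^ K) g = 0" if g: "g \<in> cyc" for g
  proof -
    obtain K where K: "(y ^^ K) g = 0" using NN_D2[OF y g] by (elim exE)
    let ?h = "expo y (-t) g"
    have yp: "(y ^^ n) g \<in> cyc" for n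
      by (induction n) (auto intro: g N_cyc[OF y1])
    have h: "?h \<in> cyc" unfolding expo_eq[OF ly K]
      by (intro subspace_sum subspace_scale subspace_cyc yp)
    then obtain L where L: "(T ^^ L) ?h = 0" using NN_D2[OF T h] by (elim exE)
    have "(?Y ^^ L) g = (?Y ^^ L) (expo y t ?h)" using expo_inverse[OF ly K] by simp
    also have "\<dots> = expo y t 0" using pw[OF h, of L] L by simp
    also have "\<dots> = 0" using expo_eq[OF ly, of 0 0 t] by simp
    finally show ?thesis by (rule exI)
  qed
  then show ?thesis unfolding NN_def by (intro CollectI conjI Y1 ballI)
qed

text \<open>The bracket is the coefficient of \<open>t\<close> in the conjugate, a polynomial in
  \<open>t\<close> with values in the span of \<open>NN\<close>. The case distinction ensures that
  the term of index 1 occurs in the truncated sum; otherwise the bracket is 0.\<close>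

lemma comm_NN:
  assumes "y \<in> NN" "T \<in> NN" shows "comm y T \<in> span NN"
proof (cases "s \<ge> 2")
  case True
  have "(\<Sum>k<s. t ^ k *\<^sub>R ((1 / fact k) *\<^sub>R (comm y ^^ k) T)) \<in> span NN" for t
    using span_base[OF conj_NN[OF assms, of t]] by simp
  from polynomial_coeffs_in_subspace[OF subspace_span this, of 1] True show ?thesis by simp
next
  case False
  have "comm y T \<in> N 2" using comm_N[OF NN_D1[OF assms(1)] NN_D1[OF assms(2)]] by (simp add: numeral_2_eq_2)
  then have "comm y T = 0" using N_zero[of 2] False by auto
  then show ?thesis using span_zero by simp
qed

lemma liec_span_NN: "liec X k T \<Longrightarrow> T \<in> span NN"
proof (induction rule: liec.induct)
  case (gen x)
  then show ?case by (intro span_base gens_NN)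
next
  case (brk x k T)
  show ?case
    by (rule span_linear_image[OF comm_linear_right[OF linear_gens[OF brk(1)]] brk.IH])
      (rule comm_NN[OF gens_NN[OF brk(1)]], assumption, rule subspace_span)
qed

lemma N_span_finite: "N 1 = span {T. \<exists>k\<le>s. liec X k T}"
proof (rule antisym)
  show "N 1 \<subseteq> span {T. \<exists>k\<le>s. liec X k T}"
    unfolding N_def
  proof (rule span_minimal)
    show "{T. \<exists>j\<ge>1. liec X j T} \<subseteq> span {T. \<exists>k\<le>s. liec X k T}"
    proof safe
      fix T j assume "liec X j T"
      then show "T \<in> span {T. \<exists>k\<le>s. liec X k T}"
        using liec_zero[of j T] by (cases "j \<le> s") (auto intro: span_base span_zero)
    qed
  qed simp
  have "liec X k T \<Longrightarrow> k \<ge> 1" for k T by (induction rule: liec.induct) auto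
  then show "span {T. \<exists>k\<le>s. liec X k T} \<subseteq> N 1"
    unfolding N_def by (intro span_mono) auto
qed

text \<open>Finitely many brackets span the Lie algebra, and each of them is a finite combination of
  locally nilpotent elements.\<close>

lemma ex_finite_NN: "\<exists>Y. finite Y \<and> Y \<subseteq> NN \<and> N 1 = span Y"
proof -
  let ?C = "{T. \<exists>k\<le>s. liec X k T}"
  have "?C = (\<Union>k\<in>{..s}. {T. liec X k T})" by auto
  then have fin: "finite ?C" using finite_liec[OF finite_gens] by auto
  have "\<exists>S. finite S \<and> S \<subseteq> NN \<and> T \<in> span S" if "T \<in> ?C" for T
  proof -
    have "T \<in> span NN" using that liec_span_NN by blast
    then obtain t r where "finite t" "t \<subseteq> NN" "T = (\<Sum>a\<in>t. r a *\<^sub>R a)"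
      unfolding span_explicit by blast
    then show ?thesis
      by (intro exI[of _ t]) (auto intro: span_sum span_scale span_base)
  qed
  then have "\<forall>T. \<exists>S. T \<in> ?C \<longrightarrow> finite S \<and> S \<subseteq> NN \<and> T \<in> span S" by blast
  then obtain S where S: "\<And>T. T \<in> ?C \<Longrightarrow> finite (S T) \<and> S T \<subseteq> NN \<and> T \<in> span (S T)" by metis
  let ?Y = "\<Union>T\<in>?C. S T"
  have "T \<in> span ?Y" if "T \<in> ?C" for T
    using S[OF that] span_mono[of "S T" ?Y] that by blast
  then have 1: "N 1 \<subseteq> span ?Y"
    unfolding N_span_finite by (intro span_minimal) auto
  have "?Y \<subseteq> N 1" using S NN_def by blast
  then have "span ?Y \<subseteq> N 1"
    by (rule span_minimal) (simp add: subspace_N)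
  moreover have "finite ?Y" using fin S by blast
  moreover have "?Y \<subseteq> NN" using S by blast
  ultimately show ?thesis using 1 by blast
qed

end

section \<open>Ordered words, in the manner of Poincare, Birkhoff and Witt\<close>

context nilpotent_operators
begin

context
  fixes ys :: "('v \<Rightarrow> 'v) list"
  assumes ys_NN: "set ys \<subseteq> NN" and ys_span: "N 1 = span (set ys)"
begin

text \<open>Letters are positions in \<open>ys\<close>, so that words can be sorted.\<close>

definition actn :: "nat list \<Rightarrow> 'v \<Rightarrow> 'v" where
  "actn ks = act (map (\<lambda>i. ys ! i) ks)"

definition words :: "nat \<Rightarrow> nat list set" where
  "words p = {ks. set ks \<subseteq> {..<length ys} \<and> length ks < p}"

definition WW :: "nat \<Rightarrow> 'v set" where
  "WW p = span {actn ks f | ks. ks \<in> words p}"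

lemma actn_simps [simp]: "actn [] g = g" "actn (i # ks) g = (ys ! i) (actn ks g)"
  by (simp_all add: actn_def)

lemma subspace_WW: "subspace (WW p)" by (simp add: WW_def)

lemma actn_WW: "set ks \<subseteq> {..<length ys} \<Longrightarrow> length ks < p \<Longrightarrow> actn ks f \<in> WW p"
  unfolding WW_def by (rule span_base) (auto simp: words_def)

lemma ys_N: "i < length ys \<Longrightarrow> ys ! i \<in> N 1"
  using ys_NN NN_D1 nth_mem by blast

lemma ys_lin: "i < length ys \<Longrightarrow> linear (ys ! i)"
  using ys_N linear_N by blast

lemma ys_WW: assumes i: "i < length ys" and g: "g \<in> WW p" shows "(ys ! i) g \<in> WW (Suc p)"
proof (rule span_linear_image[OF ys_lin[OF i] g[unfolded WW_def] _ subspace_WW])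
  fix y assume "y \<in> {actn ks f |ks. ks \<in> words p}"
  then obtain ks where "y = actn ks f" "set ks \<subseteq> {..<length ys}" "length ks < p" by (auto simp: words_def)
  then show "(ys ! i) y \<in> WW (Suc p)"
    using actn_WW[of "i # ks" "Suc p"] i by simp
qed

lemma ys_comm:
  assumes i: "i < length ys" and j: "j < length ys" and g: "g = actn ks f" "set ks \<subseteq> {..<length ys}"
  shows "comm (ys ! i) (ys ! j) g \<in> WW (Suc (Suc (length ks)))"
proof -
  have "comm (ys ! i) (ys ! j) \<in> span (set ys)"
    using comm_N1[OF ys_N[OF i] ys_N[OF j]] unfolding ys_span .
  then show ?thesis
  proof (rule span_linear_image[OF linear_eval _ _ subspace_WW])
    fix y assume "y \<in> set ys"
    then obtain k where "k < length ys" "y = ys ! k" by (metis in_set_conv_nth)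
    then show "y g \<in> WW (Suc (Suc (length ks)))"
      using actn_WW[of "k # ks" "Suc (Suc (length ks))"] g by simp
  qed
qed

text \<open>Exchanging two letters costs a commutator, which is a combination of single letters
  because \<open>ys\<close> spans a Lie algebra; the error therefore consists of shorter
  words.\<close>

lemma insort_WW:
  assumes "i < length ys"
  shows "set ks \<subseteq> {..<length ys} \<Longrightarrow> sorted ks \<Longrightarrow> actn (i # ks) f - actn (insort i ks) f \<in> WW (Suc (length ks))"
proof (induction ks)
  case Nil
  then show ?case using subspace_0[OF subspace_WW] by simp
next
  case (Cons j ks)
  show ?case
  proof (cases "i \<le> j")
    case True
    then show ?thesis using subspace_0[OF subspace_WW] by simp
  next
    case False
    have j: "j < length ys" using Cons.prems by simp
    let ?g = "actn ks f"
    have 1: "actn (i # ks) f - actn (insort i ks) f \<in> WW (Suc (length ks))" using Cons by simp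
    have 2: "(ys ! j) (actn (i # ks) f - actn (insort i ks) f) \<in> WW (Suc (Suc (length ks)))"
      by (rule ys_WW[OF j 1])
    have 3: "comm (ys ! i) (ys ! j) ?g \<in> WW (Suc (Suc (length ks)))"
      by (rule ys_comm[OF assms j refl]) (use Cons.prems in simp)
    have "actn (i # j # ks) f - actn (insort i (j # ks)) f
      = comm (ys ! i) (ys ! j) ?g + (ys ! j) (actn (i # ks) f - actn (insort i ks) f)"
      using False ys_lin[OF j] by (simp add: comm_def linear_diff)
    then show ?thesis using subspace_add[OF subspace_WW 3 2] by simp
  qed
qed

lemma sort_WW:
  "set ks \<subseteq> {..<length ys} \<Longrightarrow> actn ks f - actn (sort ks) f \<in> WW (length ks)"
proof (induction ks)
  case Nil
  then show ?case using subspace_0[OF subspace_WW] by simp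
next
  case (Cons i ks)
  have i: "i < length ys" using Cons.prems by simp
  have 1: "(ys ! i) (actn ks f - actn (sort ks) f) \<in> WW (Suc (length ks))"
    by (rule ys_WW[OF i]) (use Cons in simp)
  have 2: "actn (i # sort ks) f - actn (insort i (sort ks)) f \<in> WW (Suc (length (sort ks)))"
    by (rule insort_WW[OF i]) (use Cons.prems in simp_all)
  have "actn (i # ks) f - actn (sort (i # ks)) f
    = (ys ! i) (actn ks f - actn (sort ks) f) + (actn (i # sort ks) f - actn (insort i (sort ks)) f)"
    using ys_lin[OF i] by (simp add: linear_diff)
  then show ?case using subspace_add[OF subspace_WW 1, of "actn (i # sort ks) f - actn (insort i (sort ks)) f"] 2
    by (simp only: length_sort list.size)
      simp
qed

definition SS :: "'v set" where
  "SS = span {actn ks f | ks. set ks \<subseteq> {..<length ys} \<and> sorted ks}"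

lemma actn_SS: "set ks \<subseteq> {..<length ys} \<Longrightarrow> actn ks f \<in> SS"
proof (induction ks rule: length_induct)
  case (1 ks)
  have "WW (length ks) \<subseteq> SS"
    unfolding WW_def using 1 by (intro span_minimal) (auto simp: words_def SS_def)
  then have "actn ks f - actn (sort ks) f \<in> SS" using sort_WW[OF "1.prems"] by blast
  moreover have "actn (sort ks) f \<in> SS"
    unfolding SS_def by (rule span_base) (use "1.prems" in \<open>auto intro!: exI[of _ "sort ks"]\<close>)
  ultimately have "(actn ks f - actn (sort ks) f) + actn (sort ks) f \<in> SS"
    unfolding SS_def by (rule span_add)
  then show ?case by simp
qed

lemma actn_cyc: "set ks \<subseteq> {..<length ys} \<Longrightarrow> actn ks f \<in> cyc"
proof (induction ks)
  case (Cons k ks)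
  then show ?case using N_cyc[OF ys_N, of k "actn ks f"] by simp
next
  case Nil
  show ?case unfolding cyc_def actn_simps by (intro span_base CollectI exI[of _ "[]"]) auto
qed

lemma actn_replicate: "actn (replicate a k @ ks) g = ((ys ! k) ^^ a) (actn ks g)"
  by (induction a) auto

text \<open>Induction on the number of admissible last positions. A sorted word is a run of the
  smallest letter in front of a word in the others. Only finitely many of the latter are nonzero on
  \<open>f\<close>, each resulting vector is killed by a power of the new letter, and the largest
  such power bounds the run.\<close>

lemma sorted_bounded:
  "d \<le> length ys \<Longrightarrow> \<exists>B. \<forall>ks. set ks \<subseteq> {length ys - d..<length ys} \<longrightarrow> sorted ks \<longrightarrow> length ks > B \<longrightarrow> actn ks f = 0"
proof (induction d)
  case 0
  then show ?case by auto
next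
  case (Suc d)
  let ?k = "length ys - Suc d"
  have k: "?k < length ys" and k1: "Suc ?k = length ys - d" using Suc.prems by auto
  obtain B where B: "\<And>ks. set ks \<subseteq> {length ys - d..<length ys} \<Longrightarrow> sorted ks \<Longrightarrow> length ks > B \<Longrightarrow> actn ks f = 0"
    using Suc by auto
  let ?F = "{ks. set ks \<subseteq> {length ys - d..<length ys} \<and> length ks \<le> B}"
  have fin: "finite ?F" by (rule finite_lists_length_le) simp
  have "\<exists>K. ((ys ! ?k) ^^ K) (actn ks f) = 0" if "ks \<in> ?F" for ks
  proof (rule NN_D2)
    show "ys ! ?k \<in> NN" using subsetD[OF ys_NN nth_mem[OF k]] .
    show "actn ks f \<in> cyc" by (rule actn_cyc) (use that in auto)
  qed
  then have "\<forall>ks\<in>?F. \<exists>K. ((ys ! ?k) ^^ K) (actn ks f) = 0" by (intro ballI)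
  then obtain K where "\<forall>ks\<in>?F. ((ys ! ?k) ^^ K ks) (actn ks f) = 0" by (rule bchoice[THEN exE])
  then have K: "\<And>ks. ks \<in> ?F \<Longrightarrow> ((ys ! ?k) ^^ K ks) (actn ks f) = 0" by (elim bspec)
  define A where "A = Max (insert 0 (K ` ?F))"
  have A: "K ks \<le> A" if "ks \<in> ?F" for ks
    unfolding A_def using fin that by (intro Max_ge) auto
  show ?case
  proof (intro exI[of _ "A + B"] allI impI)
    fix ks assume ks: "set ks \<subseteq> {?k..<length ys}" "sorted ks" "length ks > A + B"
    define us where "us = takeWhile (\<lambda>x. x = ?k) ks"
    define vs where "vs = dropWhile (\<lambda>x. x = ?k) ks"
    have "us = replicate (length us) ?k"
      unfolding us_def by (metis (full_types) replicate_eqI set_takeWhileD)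
    moreover have ks_eq: "ks = us @ vs" by (simp add: us_def vs_def)
    ultimately have e: "actn ks f = ((ys ! ?k) ^^ length us) (actn vs f)"
      using actn_replicate[of "length us" ?k vs f] by simp
    have svs: "sorted vs" using ks(2) ks_eq by (simp add: sorted_append)
    have vs: "set vs \<subseteq> {length ys - d..<length ys}"
    proof (cases vs)
      case (Cons v vs')
      have "dropWhile (\<lambda>x. x = ?k) ks \<noteq> []" using Cons by (simp add: vs_def)
      then have "v \<noteq> ?k" using hd_dropWhile[of "\<lambda>x. x = ?k" ks] Cons unfolding vs_def by simp
      moreover have "set vs \<subseteq> {?k..<length ys}" using ks(1) ks_eq by auto
      ultimately have "v \<ge> Suc ?k" using Cons by auto
      then have "\<forall>x\<in>set vs. x \<ge> Suc ?k" using svs Cons by auto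
      then show ?thesis using \<open>set vs \<subseteq> {?k..<length ys}\<close> k1 by auto
    qed simp
    show "actn ks f = 0"
    proof (cases "length vs > B")
      case True
      then show ?thesis using e B[OF vs svs] linear_0[OF linear_funpow[OF ys_lin[OF k]]] by simp
    next
      case False
      then have "vs \<in> ?F" using vs by simp
      moreover have "length us \<ge> A" using ks(3) ks_eq False by simp
      ultimately show ?thesis
        unfolding e by (intro funpow_zero_mono[OF ys_lin[OF k] K[OF \<open>vs \<in> ?F\<close>] order_trans[OF A]])
    qed
  qed
qed

definition XX :: "nat \<Rightarrow> 'v set" where
  "XX p = span {act ws f | ws. set ws \<subseteq> X \<and> length ws \<le> p}"

lemma subspace_XX: "subspace (XX p)" by (simp add: XX_def)

lemma XX_mono: "p \<le> q \<Longrightarrow> XX p \<subseteq> XX q"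
  unfolding XX_def by (rule span_mono) auto

lemma X_XX: assumes x: "x \<in> X" and g: "g \<in> XX p" shows "x g \<in> XX (Suc p)"
proof (rule span_linear_image[OF linear_gens[OF x] g[unfolded XX_def] _ subspace_XX])
  fix y assume "y \<in> {act ws f |ws. set ws \<subseteq> X \<and> length ws \<le> p}"
  then obtain ws where ws: "y = act ws f" "set ws \<subseteq> X" "length ws \<le> p" by auto
  then show "x y \<in> XX (Suc p)" unfolding XX_def using x
    by (intro span_base CollectI exI[of _ "x # ws"]) auto
qed

lemma liec_XX: "liec X k T \<Longrightarrow> g \<in> XX p \<Longrightarrow> T g \<in> XX (p + k)"
proof (induction arbitrary: g p rule: liec.induct)
  case (gen x)
  then show ?case using X_XX by simp
next
  case (brk x k T)
  have "x (T g) \<in> XX (p + Suc k)" using X_XX[OF brk(1) brk.IH[OF brk.prems]] by simp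
  moreover have "T (x g) \<in> XX (p + Suc k)" using brk.IH[OF X_XX[OF brk(1) brk.prems]] by simp
  ultimately show ?case unfolding comm_def by (rule subspace_diff[OF subspace_XX])
qed

text \<open>An element of the Lie algebra is a combination of brackets of length at most
  \<open>s\<close>, so applying it lengthens words in the generators by at most
  \<open>s\<close>.\<close>

lemma N_XX: assumes T: "T \<in> N 1" and g: "g \<in> XX p" shows "T g \<in> XX (p + s)"
proof (rule span_linear_image[OF linear_eval T[unfolded N_span_finite] _ subspace_XX])
  fix S assume "S \<in> {T. \<exists>k\<le>s. liec X k T}"
  then obtain k where "k \<le> s" "liec X k S" by auto
  then show "S g \<in> XX (p + s)" using liec_XX[OF _ g] XX_mono[of "p + k" "p + s"] by auto
qed

lemma actn_XX: "set ks \<subseteq> {..<length ys} \<Longrightarrow> actn ks f \<in> XX (length ks * s)"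
proof (induction ks)
  case Nil
  then show ?case unfolding XX_def by (auto intro!: span_base exI[of _ "[]"])
next
  case (Cons k ks)
  then show ?case using N_XX[OF ys_N, of k "actn ks f" "length ks * s"] by (simp add: add.commute)
qed

lemma SS_XX: "\<exists>B. SS \<subseteq> XX B"
proof -
  obtain B where B: "\<And>ks. set ks \<subseteq> {..<length ys} \<Longrightarrow> sorted ks \<Longrightarrow> length ks > B \<Longrightarrow> actn ks f = 0"
    using sorted_bounded[of "length ys"] by (auto simp: atLeast0LessThan)
  have "actn ks f \<in> XX (B * s)" if "set ks \<subseteq> {..<length ys}" "sorted ks" for ks
  proof (cases "length ks > B")
    case True
    then show ?thesis using B[OF that] subspace_0[OF subspace_XX] by simp
  next
    case False
    then show ?thesis using actn_XX[OF that(1)] XX_mono[of "length ks * s" "B * s"] by auto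
  qed
  then have "SS \<subseteq> XX (B * s)" unfolding SS_def by (intro span_minimal subspace_XX) auto
  then show ?thesis by blast
qed

lemma X_SS: assumes x: "x \<in> X" and g: "g \<in> SS" shows "x g \<in> SS"
proof -
  have S: "subspace SS" by (simp add: SS_def)
  have "(ys ! i) g \<in> SS" if i: "i < length ys" for i
  proof (rule span_linear_image[OF ys_lin[OF i] g[unfolded SS_def] _ S])
    fix y assume "y \<in> {actn ks f |ks. set ks \<subseteq> {..<length ys} \<and> sorted ks}"
    then obtain ks where "y = actn ks f" "set ks \<subseteq> {..<length ys}" by auto
    then show "(ys ! i) y \<in> SS" using actn_SS[of "i # ks"] i by simp
  qed
  then have 1: "y g \<in> SS" if "y \<in> set ys" for y
    using that by (metis in_set_conv_nth)
  have 2: "x \<in> span (set ys)" using gens_N[OF x] ys_span by simp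
  show ?thesis by (rule span_linear_image[OF linear_eval 2 1 S])
qed

text \<open>The span of the sorted words contains \<open>f\<close> and is invariant under the
  generators, hence contains all words; bounded sorted words are finally rewritten in the
  generators.\<close>

lemma act_bounded_aux: "\<exists>B. \<forall>ws. set ws \<subseteq> X \<longrightarrow> act ws f \<in> span {act vs f | vs. set vs \<subseteq> X \<and> length vs \<le> B}"
proof -
  have "act ws f \<in> SS" if "set ws \<subseteq> X" for ws
    using that
  proof (induction ws)
    case Nil
    then show ?case using actn_SS[of "[]"] by simp
  next
    case (Cons x ws)
    then show ?case using X_SS by simp
  qed
  then show ?thesis using SS_XX unfolding XX_def by blast
qed

end

theorem act_bounded:
  "\<exists>B. \<forall>ws. set ws \<subseteq> X \<longrightarrow> act ws f \<in> span {act vs f | vs. set vs \<subseteq> X \<and> length vs \<le> B}"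
proof -
  obtain Y where Y: "finite Y" "Y \<subseteq> NN" "N 1 = span Y" using ex_finite_NN by blast
  then obtain ys where "set ys = Y" using finite_list by blast
  then show ?thesis using act_bounded_aux[of ys] Y by simp
qed

end

section \<open>Polynomial functions\<close>

text \<open>Polynomials are kept as functions: identities are proved by evaluation, and derivatives
  are Frechet derivatives.\<close>

inductive polyfun :: "(complex ^ 'v::finite \<Rightarrow> complex) \<Rightarrow> bool" where
  const: "polyfun (\<lambda>x. c)"
| coord: "polyfun (\<lambda>x. x $ i)"
| add: "polyfun f \<Longrightarrow> polyfun g \<Longrightarrow> polyfun (\<lambda>x. f x + g x)"
| mult: "polyfun f \<Longrightarrow> polyfun g \<Longrightarrow> polyfun (\<lambda>x. f x * g x)"

lemma polyfun_uminus: "polyfun f \<Longrightarrow> polyfun (\<lambda>x. - f x)"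
  using polyfun.mult[OF polyfun.const[of "-1"], of f] by simp

lemma polyfun_diff: "polyfun f \<Longrightarrow> polyfun g \<Longrightarrow> polyfun (\<lambda>x. f x - g x)"
  using polyfun.add[OF _ polyfun_uminus, of f g] by simp

lemma polyfun_sum: "(\<And>i. i \<in> A \<Longrightarrow> polyfun (f i)) \<Longrightarrow> polyfun (\<lambda>x. \<Sum>i\<in>A. f i x)"
  by (induction A rule: infinite_finite_induct) (auto intro: polyfun.intros)

lemma polyfun_prod: "(\<And>i. i \<in> A \<Longrightarrow> polyfun (f i)) \<Longrightarrow> polyfun (\<lambda>x. \<Prod>i\<in>A. f i x)"
  by (induction A rule: infinite_finite_induct) (auto intro: polyfun.intros)

lemma polyfun_power: "polyfun f \<Longrightarrow> polyfun (\<lambda>x. f x ^ n)"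
  by (induction n) (auto intro: polyfun.intros)

lemma polyfun_compose:
  "polyfun f \<Longrightarrow> (\<And>i. polyfun (\<lambda>x. g x $ i)) \<Longrightarrow> polyfun (\<lambda>x. f (g x))"
  by (induction rule: polyfun.induct) (auto intro: polyfun.intros)

lemma polyfun_has_derivative:
  "polyfun f \<Longrightarrow> \<exists>D. (\<forall>i. polyfun (D i)) \<and> (\<forall>x. (f has_derivative (\<lambda>h. \<Sum>i\<in>UNIV. D i x * h $ i)) (at x))"
proof (induction rule: polyfun.induct)
  case (const c)
  show ?case by (rule exI[of _ "\<lambda>_ _. 0"]) (auto intro: polyfun.intros)
next
  case (coord j)
  have "((\<lambda>x. x $ j) has_derivative (\<lambda>h. h $ j)) (at x)" for x :: "complex ^ 'a"
    by (intro bounded_linear.has_derivative[OF bounded_linear_vec_nth] has_derivative_ident)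
  then show ?case
    by (intro exI[of _ "\<lambda>i _. if i = j then 1 else 0"])
      (auto intro: polyfun.intros simp: if_distrib[of "\<lambda>c. c * _"] cong: if_cong)
next
  case (add f g)
  then obtain D E where "\<forall>i. polyfun (D i)" "\<And>x. (f has_derivative (\<lambda>h. \<Sum>i\<in>UNIV. D i x * h $ i)) (at x)"
    "\<forall>i. polyfun (E i)" "\<And>x. (g has_derivative (\<lambda>h. \<Sum>i\<in>UNIV. E i x * h $ i)) (at x)" by auto
  then show ?case
    by (intro exI[of _ "\<lambda>i x. D i x + E i x"] conjI allI)
      (auto intro!: polyfun.intros derivative_eq_intros simp: distrib_right sum.distrib)
next
  case (mult f g)
  then obtain D E where D: "\<forall>i. polyfun (D i)" "\<And>x. (f has_derivative (\<lambda>h. \<Sum>i\<in>UNIV. D i x * h $ i)) (at x)"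
    "\<forall>i. polyfun (E i)" "\<And>x. (g has_derivative (\<lambda>h. \<Sum>i\<in>UNIV. E i x * h $ i)) (at x)" by auto
  show ?case
  proof (intro exI[of _ "\<lambda>i x. f x * E i x + D i x * g x"] conjI allI)
    show "polyfun (\<lambda>x. f x * E i x + D i x * g x)" for i
      using D mult by (auto intro!: polyfun.intros)
    show "((\<lambda>x. f x * g x) has_derivative (\<lambda>h. \<Sum>i\<in>UNIV. (f x * E i x + D i x * g x) * h $ i)) (at x)" for x
      by (rule has_derivative_eq_rhs[OF has_derivative_mult[OF D(2) D(4)]])
        (auto simp: sum_distrib_left sum_distrib_right sum.distrib[symmetric] algebra_simps)
  qed
qed

lemma sum_mult_axis: "(\<Sum>i\<in>UNIV. D i * (axis j c :: complex ^ 'v::finite) $ i) = D j * c"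
  by (simp add: axis_def if_distrib cong: if_cong)

lemma frechet_derivative_axis:
  fixes D :: "'v::finite \<Rightarrow> complex"
  shows "(f has_derivative (\<lambda>h. \<Sum>i\<in>UNIV. D i * h $ i)) (at x) \<Longrightarrow> frechet_derivative f (at x) (axis i c) = D i * c"
  by (simp add: frechet_derivative_at[symmetric] sum_mult_axis[where D = D])

lemma polyfun_line: "polyfun f \<Longrightarrow> \<exists>q. \<forall>t. f (x + t *s v) = poly q t"
proof (induction rule: polyfun.induct)
  case (const c)
  show ?case by (rule exI[of _ "[:c:]"]) simp
next
  case (coord i)
  show ?case by (rule exI[of _ "[:x $ i, v $ i:]"]) (simp add: algebra_simps)
next
  case (add f g)
  then show ?case by (metis poly_add)
next
  case (mult f g)
  then show ?case by (metis poly_mult)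
qed

text \<open>Both factors restrict to nonzero polynomials in one variable on the complex line through
  \<open>x\<close> and \<open>y\<close>.\<close>

lemma polyfun_no_zero_divisors:
  assumes "polyfun f" "polyfun g" "f x \<noteq> 0" "g y \<noteq> 0"
  shows "\<exists>z. f z * g z \<noteq> 0"
proof -
  obtain p q where p: "\<And>t. f (x + t *s (y - x)) = poly p t" and q: "\<And>t. g (x + t *s (y - x)) = poly q t"
    using polyfun_line[OF assms(1)] polyfun_line[OF assms(2)] by metis
  have "p \<noteq> 0" using p[of 0] assms(3) by auto
  moreover have "q \<noteq> 0" using q[of 1] assms(4) by auto
  ultimately have "p * q \<noteq> 0" by simp
  then have "finite {t. poly (p * q) t = 0}" by (rule poly_roots_finite)
  then obtain t where "poly (p * q) t \<noteq> 0" by (metis (mono_tags, lifting) UNIV_I ex_new_if_finite infinite_UNIV_char_0 mem_Collect_eq)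
  then show ?thesis using p q by (metis poly_mult)
qed

text \<open>The coordinates are freed one at a time: in the coordinate \<open>a\<close> the function
  is a polynomial in one variable that vanishes at infinitely many points.\<close>

lemma polyfun_zero_if_zero_on_reals:
  assumes "polyfun f" "\<And>x. (\<And>i. x $ i \<in> \<real>) \<Longrightarrow> f x = 0"
  shows "f x = 0"
proof -
  have "f x = 0" if "\<And>i. i \<notin> A \<Longrightarrow> x $ i \<in> \<real>" "finite A" for A x
    using that(2,1)
  proof (induction A arbitrary: x rule: finite_induct)
    case empty
    then show ?case using assms(2) by simp
  next
    case (insert a A)
    obtain q where q: "\<And>t. f (x + t *s axis a 1) = poly q t" using polyfun_line[OF assms(1)] by metis
    have "poly q (of_real r - x $ a) = 0" for r :: real
      unfolding q[symmetric]
      by (rule insert.IH) (use insert.prems in \<open>auto simp: axis_def\<close>)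
    then have "(\<lambda>r. complex_of_real r - x $ a) ` UNIV \<subseteq> {t. poly q t = 0}" by auto
    moreover have "inj (\<lambda>r. complex_of_real r - x $ a)" by (auto simp: inj_def)
    ultimately have "infinite {t. poly q t = 0}"
      using infinite_super infinite_UNIV_char_0 finite_imageD by metis
    then have "q = 0" using poly_roots_finite by auto
    then show ?case using q[of 0] by simp
  qed
  from this[of UNIV] show ?thesis by simp
qed

section \<open>The ring of polynomial functions with its partial derivatives and
  substitutions\<close>

typedef (overloaded) 'v pf = "{f :: complex ^ 'v::finite \<Rightarrow> complex. polyfun f}"
  morphisms ev Abs_pf
  by (rule exI[of _ "\<lambda>x. 0"]) (auto intro: polyfun.intros)

setup_lifting type_definition_pf

instantiation pf :: (finite) idom
begin

lift_definition zero_pf :: "'a pf" is "\<lambda>x. 0" by (rule polyfun.const)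
lift_definition one_pf :: "'a pf" is "\<lambda>x. 1" by (rule polyfun.const)
lift_definition plus_pf :: "'a pf \<Rightarrow> 'a pf \<Rightarrow> 'a pf" is "\<lambda>f g x. f x + g x" by (rule polyfun.add)
lift_definition minus_pf :: "'a pf \<Rightarrow> 'a pf \<Rightarrow> 'a pf" is "\<lambda>f g x. f x - g x" by (rule polyfun_diff)
lift_definition uminus_pf :: "'a pf \<Rightarrow> 'a pf" is "\<lambda>f x. - f x" by (rule polyfun_uminus)
lift_definition times_pf :: "'a pf \<Rightarrow> 'a pf \<Rightarrow> 'a pf" is "\<lambda>f g x. f x * g x" by (rule polyfun.mult)

instance
proof
  fix a b :: "'a pf"
  show "a \<noteq> 0 \<Longrightarrow> b \<noteq> 0 \<Longrightarrow> a * b \<noteq> 0"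
    by transfer (metis polyfun_no_zero_divisors)
qed (transfer; auto simp: algebra_simps fun_eq_iff)+

end

instantiation pf :: (finite) real_vector
begin

lift_definition scaleR_pf :: "real \<Rightarrow> 'a pf \<Rightarrow> 'a pf" is "\<lambda>r f x. of_real r * f x"
  by (intro polyfun.mult polyfun.const)

instance
  by standard (transfer; auto simp: algebra_simps fun_eq_iff)+

end

lift_definition cst :: "complex \<Rightarrow> 'v::finite pf" is "\<lambda>c x. c" by (rule polyfun.const)
lift_definition var :: "'v \<Rightarrow> 'v::finite pf" is "\<lambda>i x. x $ i" by (rule polyfun.coord)

lemma ev_simps [simp]:
  "ev 0 x = 0" "ev 1 x = 1" "ev (p + q) x = ev p x + ev q x" "ev (p - q) x = ev p x - ev q x"
  "ev (- p) x = - ev p x" "ev (p * q) x = ev p x * ev q x" "ev (r *\<^sub>R p) x = of_real r * ev p x"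
  "ev (cst c) x = c" "ev (var i) x = x $ i"
  by (transfer; simp)+

lemma ev_sum [simp]: "ev (sum f A) x = (\<Sum>i\<in>A. ev (f i) x)"
  by (induction A rule: infinite_finite_induct) auto

lemma pf_eqI: "(\<And>x. ev p x = ev q x) \<Longrightarrow> p = q"
  by (metis ev_inject ext)

lemma polyfun_ev: "polyfun (ev p)"
  using ev[of p] by simp

lemma ex_pf: "polyfun f \<Longrightarrow> \<exists>p. \<forall>x. ev p x = f x"
  by (metis Abs_pf_inverse mem_Collect_eq)

lemma pf_induct [case_names cst var add mult]:
  assumes "\<And>c. Q (cst c)" "\<And>i. Q (var i)" "\<And>p q. Q p \<Longrightarrow> Q q \<Longrightarrow> Q (p + q)" "\<And>p q. Q p \<Longrightarrow> Q q \<Longrightarrow> Q (p * q)"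
  shows "Q p"
proof -
  have "polyfun f \<Longrightarrow> \<exists>p. Q p \<and> (\<forall>x. ev p x = f x)" for f
  proof (induction rule: polyfun.induct)
    case (const c)
    then show ?case using assms(1)[of c] by force
  next
    case (coord i)
    then show ?case using assms(2)[of i] by force
  next
    case (add f g)
    then obtain p q where "Q p" "\<forall>x. ev p x = f x" "Q q" "\<forall>x. ev q x = g x" by blast
    then show ?case using assms(3)[of p q] by (intro exI[of _ "p + q"]) simp
  next
    case (mult f g)
    then obtain p q where "Q p" "\<forall>x. ev p x = f x" "Q q" "\<forall>x. ev q x = g x" by blast
    then show ?case using assms(4)[of p q] by (intro exI[of _ "p * q"]) simp
  qed
  from this[OF polyfun_ev[of p]] obtain p' where "Q p'" "\<forall>x. ev p' x = ev p x" by blast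
  then show ?thesis using pf_eqI by metis
qed

lift_definition pd :: "'v \<Rightarrow> 'v::finite pf \<Rightarrow> 'v pf" is "\<lambda>i f x. frechet_derivative f (at x) (axis i 1)"
proof -
  fix i and f :: "complex ^ 'v \<Rightarrow> complex" assume "polyfun f"
  then obtain D where D: "\<forall>i. polyfun (D i)" "\<And>x. (f has_derivative (\<lambda>h. \<Sum>i\<in>UNIV. D i x * h $ i)) (at x)"
    using polyfun_has_derivative by blast
  have "frechet_derivative f (at x) (axis i 1) = D i x" for x
    using frechet_derivative_axis[OF D(2)] by simp
  then show "polyfun (\<lambda>x. frechet_derivative f (at x) (axis i 1))" using D by simp
qed

lemma ev_has_derivative: "(ev p has_derivative (\<lambda>h. \<Sum>i\<in>UNIV. ev (pd i p) x * h $ i)) (at x)"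
proof -
  obtain D where D: "\<And>x. (ev p has_derivative (\<lambda>h. \<Sum>i\<in>UNIV. D i x * h $ i)) (at x)"
    using polyfun_has_derivative[OF polyfun_ev[of p]] by blast
  have "frechet_derivative (ev p) (at x) (axis i 1) = D i x" for i x
    using frechet_derivative_axis[OF D] by simp
  then have "ev (pd i p) x = D i x" for i by (simp add: pd.rep_eq)
  then show ?thesis using D by simp
qed

lemma pd_unique:
  assumes "\<And>x. (ev p has_derivative (\<lambda>h. \<Sum>i\<in>UNIV. ev (D i) x * h $ i)) (at x)"
  shows "pd i p = D i"
proof (rule pf_eqI)
  fix x
  show "ev (pd i p) x = ev (D i) x"
    using frechet_derivative_axis[OF assms] by (simp add: pd.rep_eq)
qed

lemma pd_simps [simp]:
  "pd i (cst c) = 0" "pd i 0 = 0" "pd i 1 = 0" "pd i (var j) = (if i = j then 1 else 0)"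
  "pd i (p + q) = pd i p + pd i q" "pd i (p - q) = pd i p - pd i q" "pd i (- p) = - pd i p"
  "pd i (p * q) = p * pd i q + pd i p * q" "pd i (r *\<^sub>R p) = r *\<^sub>R pd i p"
proof -
  have c: "pd i (cst c) = 0" for c :: complex and i :: 'a
    by (rule pd_unique[where D = "\<lambda>_. 0"]) (simp add: cst.rep_eq)
  show "pd i (cst c) = 0" by (rule c)
  have "(0 :: 'a pf) = cst 0" "(1 :: 'a pf) = cst 1" by (auto intro: pf_eqI)
  then show "pd i 0 = 0" "pd i 1 = 0" using c by metis+
  have "((\<lambda>x. x $ j) has_derivative (\<lambda>h. h $ j)) (at x)" for x :: "complex ^ 'a"
    by (intro bounded_linear.has_derivative[OF bounded_linear_vec_nth] has_derivative_ident)
  then show "pd i (var j) = (if i = j then 1 else 0)"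
    by (intro pd_unique[where D = "\<lambda>i. if i = j then 1 else 0"])
      (auto simp: var.rep_eq if_distrib[of "\<lambda>p. ev p _"] if_distrib[of "\<lambda>c. c * _"] cong: if_cong)
  have ee: "ev (p + q) = (\<lambda>x. ev p x + ev q x)" "ev (p - q) = (\<lambda>x. ev p x - ev q x)"
    "ev (- p) = (\<lambda>x. - ev p x)" "ev (p * q) = (\<lambda>x. ev p x * ev q x)" "ev (r *\<^sub>R p) = (\<lambda>x. of_real r * ev p x)"
    for p q :: "'a pf" by auto
  show "pd i (p + q) = pd i p + pd i q"
    by (rule pd_unique[where D = "\<lambda>i. pd i p + pd i q"], unfold ee,
        rule has_derivative_eq_rhs[OF has_derivative_add[OF ev_has_derivative ev_has_derivative]])
      (simp add: distrib_right sum.distrib)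
  show "pd i (p - q) = pd i p - pd i q"
    by (rule pd_unique[where D = "\<lambda>i. pd i p - pd i q"], unfold ee,
        rule has_derivative_eq_rhs[OF has_derivative_diff[OF ev_has_derivative ev_has_derivative]])
      (simp add: left_diff_distrib sum_subtractf)
  show "pd i (- p) = - pd i p"
    by (rule pd_unique[where D = "\<lambda>i. - pd i p"], unfold ee,
        rule has_derivative_eq_rhs[OF has_derivative_minus[OF ev_has_derivative]])
      (simp add: sum_negf)
  show "pd i (p * q) = p * pd i q + pd i p * q"
    by (rule pd_unique[where D = "\<lambda>i. p * pd i q + pd i p * q"], unfold ee,
        rule has_derivative_eq_rhs[OF has_derivative_mult[OF ev_has_derivative ev_has_derivative]])
      (simp add: sum_distrib_left sum_distrib_right sum.distrib[symmetric] algebra_simps)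
  show "pd i (r *\<^sub>R p) = r *\<^sub>R pd i p"
    by (rule pd_unique[where D = "\<lambda>i. r *\<^sub>R pd i p"], unfold ee,
        rule has_derivative_eq_rhs[OF has_derivative_mult_right[OF ev_has_derivative]])
      (simp add: sum_distrib_left mult.assoc)
qed

lemma pd_sum [simp]: "pd i (sum f A) = (\<Sum>k\<in>A. pd i (f k))"
  by (induction A rule: infinite_finite_induct) auto

lemma pd_commute: "pd i (pd j p) = pd j (pd i p)"
  by (induction p rule: pf_induct) (auto simp: algebra_simps)

lift_definition subst :: "('v \<Rightarrow> 'w::finite pf) \<Rightarrow> 'v::finite pf \<Rightarrow> 'w pf"
  is "\<lambda>s f x. f (\<chi> i. s i x)"
  by (rule polyfun_compose) auto

lemma ev_subst [simp]: "ev (subst s p) x = ev p (\<chi> i. ev (s i) x)"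
  by transfer simp

lemma subst_simps [simp]:
  "subst s (cst c) = cst c" "subst s 0 = 0" "subst s 1 = 1" "subst s (var i) = s i"
  "subst s (p + q) = subst s p + subst s q" "subst s (p * q) = subst s p * subst s q"
  by (auto intro!: pf_eqI)

lemma pd_subst: "pd j (subst s p) = (\<Sum>i\<in>UNIV. subst s (pd i p) * pd j (s i))"
proof (induction p rule: pf_induct)
  case (var i)
  have "subst s (if k = i then 1 else 0) * pd j (s k) = (if k = i then pd j (s k) else 0)" for k
    by auto
  then show ?case by simp
qed (auto simp: sum.distrib sum_distrib_left sum_distrib_right algebra_simps)

lemma pf_zero_if_zero_on_reals:
  assumes "\<And>x. (\<And>i. x $ i \<in> \<real>) \<Longrightarrow> ev p x = 0"
  shows "p = 0"
  by (rule pf_eqI) (use polyfun_zero_if_zero_on_reals[OF polyfun_ev assms] in auto)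

section \<open>Dilations and weighted homogeneity\<close>

definition dil :: "('v \<Rightarrow> nat) \<Rightarrow> complex \<Rightarrow> complex ^ 'v \<Rightarrow> complex ^ 'v::finite" where
  "dil wt t x = (\<chi> i. t ^ wt i * x $ i)"

lemma dil_nth [simp]: "dil wt t x $ i = t ^ wt i * x $ i"
  by (simp add: dil_def)

text \<open>Homogeneity is tested by scaling, without reference to monomials. Degrees are integers
  because differentiation may push them below 0, where by \<open>hom_neg_zero\<close> only the zero
  polynomial is left.\<close>

definition hom :: "('v \<Rightarrow> nat) \<Rightarrow> int \<Rightarrow> 'v::finite pf \<Rightarrow> bool" where
  "hom wt \<sigma> p \<longleftrightarrow> (\<forall>t::real. t > 0 \<longrightarrow> (\<forall>x. ev p (dil wt (of_real t) x) = of_real t powi \<sigma> * ev p x))"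

lemma hom_0 [simp]: "hom wt \<sigma> 0" by (simp add: hom_def)

lemma hom_add: "hom wt \<sigma> p \<Longrightarrow> hom wt \<sigma> q \<Longrightarrow> hom wt \<sigma> (p + q)"
  by (simp add: hom_def distrib_left)

lemma hom_mult: "hom wt \<sigma> p \<Longrightarrow> hom wt \<tau> q \<Longrightarrow> hom wt (\<sigma> + \<tau>) (p * q)"
  by (simp add: hom_def power_int_add)

lemma hom_sum: "(\<And>i. i \<in> A \<Longrightarrow> hom wt \<sigma> (f i)) \<Longrightarrow> hom wt \<sigma> (sum f A)"
  by (induction A rule: infinite_finite_induct) (auto intro: hom_add)

lemma hom_cst: "hom wt 0 (cst c)" by (simp add: hom_def)

lemma hom_cst_mult: "hom wt \<sigma> p \<Longrightarrow> hom wt \<sigma> (cst c * p)"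
  using hom_mult[OF hom_cst] by fastforce

lemma hom_minus: "hom wt \<sigma> p \<Longrightarrow> hom wt \<sigma> q \<Longrightarrow> hom wt \<sigma> (p - q)"
  by (simp add: hom_def right_diff_distrib)

lemma hom_scaleR: "hom wt \<sigma> p \<Longrightarrow> hom wt \<sigma> (r *\<^sub>R p)"
  by (simp add: hom_def)

lemma hom_var: "hom wt (int (wt i)) (var i)" by (simp add: hom_def)

lemma dil_has_derivative: "(dil wt t has_derivative dil wt t) (at x)"
proof -
  have "linear (dil wt t)"
    by (rule linearI) (auto simp: vec_eq_iff algebra_simps scaleR_conv_of_real)
  then show ?thesis by (simp add: linear_imp_has_derivative linear_conv_bounded_linear)
qed

lemma hom_pd: assumes "hom wt \<sigma> p" shows "hom wt (\<sigma> - int (wt i)) (pd i p)"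
  unfolding hom_def
proof (intro allI impI)
  fix t :: real and x assume t: "t > 0"
  have e: "(\<lambda>x. ev p (dil wt (of_real t) x)) = (\<lambda>x. of_real t powi \<sigma> * ev p x)"
    using assms t by (auto simp: hom_def)
  have 1: "((\<lambda>x. ev p (dil wt (of_real t) x)) has_derivative (\<lambda>h. \<Sum>i\<in>UNIV. ev (pd i p) (dil wt (of_real t) x) * dil wt (of_real t) h $ i)) (at x)"
    by (rule has_derivative_compose[OF dil_has_derivative ev_has_derivative])
  have 2: "((\<lambda>x. ev p (dil wt (of_real t) x)) has_derivative (\<lambda>h. of_real t powi \<sigma> * (\<Sum>i\<in>UNIV. ev (pd i p) x * h $ i))) (at x)"
    unfolding e by (rule has_derivative_mult_right[OF ev_has_derivative])
  have "(\<Sum>j\<in>UNIV. ev (pd j p) (dil wt (of_real t) x) * dil wt (of_real t) (axis i 1) $ j)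
    = of_real t powi \<sigma> * (\<Sum>j\<in>UNIV. ev (pd j p) x * axis i 1 $ j)"
    using has_derivative_unique[OF 1 2] by (rule fun_cong)
  moreover have "ev (pd j p) (dil wt (of_real t) x) * dil wt (of_real t) (axis i 1) $ j
    = (ev (pd j p) (dil wt (of_real t) x) * of_real t ^ wt j) * axis i 1 $ j" for j
    by simp
  ultimately have "ev (pd i p) (dil wt (of_real t) x) * of_real t ^ wt i = of_real t powi \<sigma> * ev (pd i p) x"
    by (simp only: sum_mult_axis mult_1_right)
  then show "ev (pd i p) (dil wt (of_real t) x) = of_real t powi (\<sigma> - int (wt i)) * ev (pd i p) x"
    using t by (simp add: power_int_diff field_simps)
qed

lemma hom_limit:
  assumes "hom wt \<sigma> p" "\<And>i. wt i > 0"
  shows "((\<lambda>t::real. of_real t powi \<sigma> * ev p x) \<longlongrightarrow> ev p 0) (at_right 0)"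
proof -
  have "((\<lambda>t::real. ev p (dil wt (of_real t) x)) \<longlongrightarrow> ev p (dil wt 0 x)) (at_right 0)"
  proof (rule isCont_tendsto_compose[of _ "ev p"])
    show "isCont (ev p) (dil wt 0 x)" using ev_has_derivative has_derivative_continuous by blast
    show "((\<lambda>t::real. dil wt (of_real t) x) \<longlongrightarrow> dil wt 0 x) (at_right 0)"
      unfolding dil_def by (intro tendsto_intros) (simp add: tendsto_of_real_iff[where 'a = complex, of _ 0, simplified])
  qed
  moreover have d0: "dil wt 0 x = 0" using assms(2) by (simp add: dil_def vec_eq_iff)
  moreover have ev: "\<forall>\<^sub>F t in at_right (0::real). ev p (dil wt (of_real t) x) = of_real t powi \<sigma> * ev p x"
    using assms(1) by (auto simp: hom_def eventually_at_filter)
  ultimately show ?thesis unfolding d0 tendsto_cong[OF ev] by simp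
qed

text \<open>After multiplication by the compensating power of \<open>t\<close> the scaled value is
  constant in \<open>t\<close>, while its limit at 0 vanishes.\<close>

lemma hom_neg_zero:
  assumes "hom wt \<sigma> p" "\<sigma> < 0" "\<And>i. wt i > 0"
  shows "p = 0"
proof (rule pf_eqI)
  fix x
  have "((\<lambda>t::real. of_real t ^ nat (- \<sigma>) * (of_real t powi \<sigma> * ev p x)) \<longlongrightarrow> of_real 0 ^ nat (- \<sigma>) * ev p 0) (at_right 0)"
    by (intro tendsto_mult hom_limit[OF assms(1,3)] tendsto_power tendsto_of_real tendsto_ident_at)
  moreover have "\<forall>\<^sub>F t in at_right (0::real). of_real t ^ nat (- \<sigma>) * (of_real t powi \<sigma> * ev p x) = ev p x"
    using assms(2) by (auto simp: eventually_at_filter power_int_def field_simps)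
  ultimately have "((\<lambda>t::real. ev p x) \<longlongrightarrow> of_real 0 ^ nat (- \<sigma>) * ev p 0) (at_right 0)"
    by (rule Lim_transform_eventually)
  then have "ev p x = of_real 0 ^ nat (- \<sigma>) * ev p 0" by (simp add: tendsto_const_iff)
  then show "ev p x = ev 0 x" using assms(2) by simp
qed

lemma hom_pos_zero:
  assumes "hom wt \<sigma> p" "\<sigma> > 0" "\<And>i. wt i > 0"
  shows "ev p 0 = 0"
proof -
  have "ev p (dil wt (of_real 2) 0) = of_real 2 powi \<sigma> * ev p 0"
    using assms(1)[unfolded hom_def, rule_format, of 2] by simp
  then have "ev p 0 = 2 powi \<sigma> * ev p 0" by (simp add: dil_def zero_vec_def)
  moreover have "(2 :: complex) powi \<sigma> \<noteq> 1"
  proof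
    assume "(2 :: complex) powi \<sigma> = 1"
    then have "(2::complex) ^ nat \<sigma> = 1" using assms(2) by (simp add: power_int_def)
    then have "(2::real) ^ nat \<sigma> = 1" by (metis norm_numeral norm_one norm_power)
    moreover have "(1::real) < 2 ^ nat \<sigma>" by (rule one_less_power) (use assms(2) in auto)
    ultimately show False by simp
  qed
  ultimately show ?thesis by simp
qed

section \<open>Locally nilpotent derivations\<close>

definition derivation :: "('a::comm_ring_1 \<Rightarrow> 'a) \<Rightarrow> bool" where
  "derivation D \<longleftrightarrow> (\<forall>p q. D (p + q) = D p + D q) \<and> (\<forall>p q. D (p * q) = p * D q + D p * q)"

lemma derivation_0: "derivation D \<Longrightarrow> D 0 = 0"
  unfolding derivation_def by (metis add_cancel_right_right)

lemma derivation_funpow_0: "derivation D \<Longrightarrow> (D ^^ n) 0 = 0"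
  by (induction n) (auto simp: derivation_0)

lemma derivation_funpow_add: "derivation D \<Longrightarrow> (D ^^ n) (p + q) = (D ^^ n) p + (D ^^ n) q"
  by (induction n arbitrary: p q) (auto simp: derivation_def)

lemma derivation_Leibniz:
  assumes "derivation D"
  shows "(D ^^ n) (p * q) = (\<Sum>i\<le>n. of_nat (n choose i) * ((D ^^ i) p * (D ^^ (n - i)) q))"
proof (induction n)
  case 0
  then show ?case by simp
next
  case (Suc n)
  have dsum: "D (sum g A) = (\<Sum>i\<in>A. D (g i))" for g :: "nat \<Rightarrow> 'a" and A
    by (induction A rule: infinite_finite_induct) (use assms in \<open>auto simp: derivation_0 derivation_def\<close>)
  have dadd: "D (a + b) = D a + D b" for a b using assms by (simp add: derivation_def)
  have dnat: "D (of_nat k * p) = of_nat k * D p" for k p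
    by (induction k) (simp_all add: derivation_0[OF assms] distrib_right dadd)
  have "(D ^^ Suc n) (p * q) = (\<Sum>i\<le>n. of_nat (n choose i) * ((D ^^ i) p * (D ^^ Suc (n - i)) q))
     + (\<Sum>i\<le>n. of_nat (n choose i) * ((D ^^ Suc i) p * (D ^^ (n - i)) q))"
    using assms unfolding funpow.simps comp_apply Suc.IH dsum dnat
    by (simp add: derivation_def distrib_left sum.distrib)
  also have "(\<Sum>i\<le>n. of_nat (n choose i) * ((D ^^ i) p * (D ^^ Suc (n - i)) q))
     = (\<Sum>i\<le>Suc n. of_nat (n choose i) * ((D ^^ i) p * (D ^^ (Suc n - i)) q))"
  proof -
    have c: "n choose Suc n = 0" by (rule binomial_eq_0) simp
    have d: "(\<Sum>i\<le>n. of_nat (n choose i) * ((D ^^ i) p * (D ^^ Suc (n - i)) q))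
      = (\<Sum>i\<le>n. of_nat (n choose i) * ((D ^^ i) p * (D ^^ (Suc n - i)) q))"
      by (rule sum.cong) (simp_all only: atMost_iff Suc_diff_le)
    show ?thesis unfolding sum.atMost_Suc c d by simp
  qed
  also have "\<dots> = p * (D ^^ Suc n) q + (\<Sum>i\<le>n. of_nat (n choose Suc i) * ((D ^^ Suc i) p * (D ^^ (n - i)) q))"
    by (subst sum.atMost_Suc_shift) simp
  finally have "(D ^^ Suc n) (p * q) = p * (D ^^ Suc n) q
      + (\<Sum>i\<le>n. of_nat (Suc n choose Suc i) * ((D ^^ Suc i) p * (D ^^ (n - i)) q))"
    by (simp add: sum.distrib[symmetric] algebra_simps)
  then show ?case by (subst sum.atMost_Suc_shift) simp
qed

lemma derivation_funpow_zero_mono: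
  "derivation D \<Longrightarrow> (D ^^ K) p = 0 \<Longrightarrow> K \<le> N \<Longrightarrow> (D ^^ N) p = 0"
  by (metis comp_apply derivation_funpow_0 funpow_add le_add_diff_inverse2)

lemma derivation_mult_nil:
  assumes D: "derivation D" and "(D ^^ K) p = 0" "(D ^^ L) q = 0"
  shows "(D ^^ (K + L)) (p * q) = 0"
  unfolding derivation_Leibniz[OF D]
proof (rule sum.neutral, intro ballI)
  fix i assume "i \<in> {..K + L}"
  then have "K \<le> i \<or> L \<le> K + L - i" by auto
  then have "(D ^^ i) p = 0 \<or> (D ^^ (K + L - i)) q = 0"
    using derivation_funpow_zero_mono[OF D] assms(2,3) by blast
  then show "of_nat (K + L choose i) * ((D ^^ i) p * (D ^^ (K + L - i)) q) = 0" by auto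
qed

text \<open>In a domain of characteristic 0, the number of times that \<open>D\<close> can be
  applied before reaching 0 is additive on products. So the exponent \<open>K\<close> of the product
  serves for \<open>q\<close>, whatever power was known to kill \<open>q\<close>; this keeps
  exponents uniform in \<open>tang_nil\<close>.\<close>

lemma derivation_nil_cancel:
  fixes D :: "'a::{idom, ring_char_0} \<Rightarrow> 'a"
  assumes D: "derivation D" and "(D ^^ M) p = 0" "p \<noteq> 0" and pq: "(D ^^ K) (p * q) = 0" and q: "\<exists>L. (D ^^ L) q = 0"
  shows "(D ^^ K) q = 0"
proof (rule ccontr)
  assume nz: "(D ^^ K) q \<noteq> 0"
  define a where "a = (LEAST n. (D ^^ Suc n) p = 0)"
  define b where "b = (LEAST n. (D ^^ Suc n) q = 0)"
  have exp: "\<exists>n. (D ^^ Suc n) p = 0" using assms(2,3) by (metis funpow_0 not0_implies_Suc)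
  have exq: "\<exists>n. (D ^^ Suc n) q = 0" using q nz by (metis derivation_funpow_zero_mono[OF D] le_add2 plus_1_eq_Suc)
  have a1: "(D ^^ Suc a) p = 0" unfolding a_def using exp by (rule LeastI_ex)
  have b1: "(D ^^ Suc b) q = 0" unfolding b_def using exq by (rule LeastI_ex)
  have a2: "(D ^^ a) p \<noteq> 0"
  proof (cases a)
    case (Suc n)
    then show ?thesis using not_less_Least[of n "\<lambda>n. (D ^^ Suc n) p = 0"] unfolding a_def by auto
  qed (use assms(3) in simp)
  have b2: "(D ^^ b) q \<noteq> 0"
  proof (cases b)
    case 0
    then show ?thesis using nz derivation_funpow_0[OF D] by auto
  next
    case (Suc n)
    then show ?thesis using not_less_Least[of n "\<lambda>n. (D ^^ Suc n) q = 0"] unfolding b_def by auto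
  qed
  \<comment> \<open>Only the index \<open>a\<close> survives in the Leibniz rule: a larger index
    kills \<open>p\<close>, and a smaller one leaves more than \<open>b\<close> derivatives for
    \<open>q\<close>.\<close>
  have "(D ^^ (a + b)) (p * q) = (\<Sum>i\<le>a + b. if i = a then of_nat (a + b choose a) * ((D ^^ a) p * (D ^^ b) q) else 0)"
    unfolding derivation_Leibniz[OF D]
  proof (rule sum.cong[OF refl])
    fix i assume "i \<in> {..a + b}"
    then consider "i = a" | "i \<ge> Suc a" | "a + b - i \<ge> Suc b" by force
    then show "of_nat (a + b choose i) * ((D ^^ i) p * (D ^^ (a + b - i)) q)
       = (if i = a then of_nat (a + b choose a) * ((D ^^ a) p * (D ^^ b) q) else 0)"
    proof cases
      case 2
      then show ?thesis using derivation_funpow_zero_mono[OF D a1] by simp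
    next
      case 3
      then show ?thesis using derivation_funpow_zero_mono[OF D b1] by simp
    qed simp
  qed
  also have "\<dots> = of_nat (a + b choose a) * ((D ^^ a) p * (D ^^ b) q)" by simp
  also have "\<dots> \<noteq> 0" using a2 b2 by simp
  finally have "\<not> K \<le> a + b" using derivation_funpow_zero_mono[OF D pq] by blast
  then have "Suc b \<le> K" by simp
  then show False using derivation_funpow_zero_mono[OF D b1] nz by simp
qed

instance pf :: (finite) ring_char_0
proof
  show "inj (of_nat :: nat \<Rightarrow> 'a pf)"
  proof (rule injI)
    fix m n :: nat assume "(of_nat m :: 'a pf) = of_nat n"
    moreover have "ev (of_nat k :: 'a pf) 0 = of_nat k" for k by (induction k) auto
    ultimately show "m = n" by (metis of_nat_eq_iff)
  qed
qed

instance crvar :: (finite, finite) finite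
proof
  have "(UNIV :: ('a, 'b) crvar set) = range Z \<union> range Zbar \<union> range U"
    by (auto, metis crvar.exhaust rangeI)
  then show "finite (UNIV :: ('a, 'b) crvar set)" by (metis finite_Un finite_imageI finite)
qed

lemma sum_crvar: "(\<Sum>v\<in>UNIV. f v) = (\<Sum>i\<in>UNIV. f (Z i)) + (\<Sum>i\<in>UNIV. f (Zbar i)) + (\<Sum>l\<in>UNIV. f (U l))"
  for f :: "('n::finite, 'd::finite) crvar \<Rightarrow> 'c::comm_monoid_add"
proof -
  have u: "(UNIV :: ('n, 'd) crvar set) = range Z \<union> range Zbar \<union> range U"
    by (auto, metis crvar.exhaust rangeI)
  have "(\<Sum>v\<in>UNIV. f v) = sum f (range Z) + sum f (range Zbar) + sum f (range U)"
    unfolding u by (subst sum.union_disjoint; (subst sum.union_disjoint)?) auto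
  then show ?thesis by (simp add: sum.reindex inj_def)
qed

lemma sum_Plus_UNIV: "(\<Sum>v\<in>UNIV. f v) = (\<Sum>i\<in>UNIV. f (Inl i)) + (\<Sum>l\<in>UNIV. f (Inr l))"
  for f :: "'n::finite + 'd::finite \<Rightarrow> 'c::comm_monoid_add"
  by (subst UNIV_Plus_UNIV[symmetric], subst sum.Plus) auto

text \<open>Recursion along the values of \<open>m\<close>. The systems solved with it are
  triangular since \<open>P l\<close> contains \<open>U s\<close> only for
  \<open>m s < m l\<close>.\<close>

lemma triangular_recursion:
  fixes m :: "'d \<Rightarrow> nat" and F :: "('d \<Rightarrow> 'a) \<Rightarrow> 'd \<Rightarrow> 'a"
  assumes "\<And>f g l. (\<And>s. m s < m l \<Longrightarrow> f s = g s) \<Longrightarrow> F f l = F g l"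
  shows "\<exists>f. \<forall>l. f l = F f l"
proof -
  have "adm_wf (Wellfounded.measure m) F"
    unfolding adm_wf_def by (intro allI impI assms) simp
  then have "wfrec (Wellfounded.measure m) F = F (wfrec (Wellfounded.measure m) F)"
    by (rule wfrec_fixpoint[OF wf_measure])
  then show ?thesis by (intro exI[of _ "wfrec (Wellfounded.measure m) F"] allI) (rule fun_cong)
qed

lemma polyfun_poly_eval: "polyfun (\<lambda>x. poly_eval (($) x) p)"
  unfolding poly_eval_def by (intro polyfun_sum polyfun.mult polyfun.const polyfun_prod polyfun_power polyfun.coord)

definition pfc :: "'v cpoly \<Rightarrow> 'v::finite pf" where
  "pfc p = (SOME q. \<forall>x. ev q x = poly_eval (($) x) p)"

lemma ev_pfc [simp]: "ev (pfc p) x = poly_eval (($) x) p"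
  using someI_ex[OF ex_pf[OF polyfun_poly_eval[of p]]] by (simp add: pfc_def)

lemma poly_eval_cong:
  assumes "\<And>M v. M \<in> Poly_Mapping.keys p \<Longrightarrow> v \<in> Poly_Mapping.keys M \<Longrightarrow> x v = y v"
  shows "poly_eval x p = poly_eval y p"
  unfolding poly_eval_def using assms by (intro sum.cong prod.cong arg_cong2[where f = "(*)"] refl) simp

lemma pd_independent:
  assumes "\<And>x y. (\<And>j. j \<noteq> i \<Longrightarrow> x $ j = y $ j) \<Longrightarrow> ev p x = ev p y"
  shows "pd i p = 0"
proof (rule pf_eqI)
  fix x :: "complex ^ 'a"
  have l: "((\<lambda>t::real. x + axis i (of_real t)) has_derivative (\<lambda>t. axis i (of_real t))) (at 0)"
  proof -
    have "linear (\<lambda>t::real. axis i (complex_of_real t))"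
      by (rule linearI) (auto simp: vec_eq_iff axis_def vector_scaleR_component scaleR_conv_of_real[where 'a = complex])
    then have "((\<lambda>t::real. axis i (complex_of_real t)) has_derivative (\<lambda>t. axis i (of_real t))) (at 0)"
      by (simp add: linear_imp_has_derivative linear_conv_bounded_linear)
    then show ?thesis by (rule has_derivative_eq_rhs[OF has_derivative_add[OF has_derivative_const]]) simp
  qed
  have "((\<lambda>t::real. ev p (x + axis i (of_real t))) has_derivative
      (\<lambda>t. \<Sum>j\<in>UNIV. ev (pd j p) (x + axis i (of_real 0)) * axis i (complex_of_real t) $ j)) (at 0)"
    by (rule has_derivative_compose[OF l ev_has_derivative])
  moreover have "(\<lambda>t::real. ev p (x + axis i (of_real t))) = (\<lambda>t. ev p x)"
    by (intro ext assms) (auto simp: axis_def)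
  moreover have "((\<lambda>t::real. ev p x) has_derivative (\<lambda>t. 0)) (at 0)" by simp
  ultimately have "(\<lambda>t. \<Sum>j\<in>UNIV. ev (pd j p) (x + axis i (of_real 0)) * axis i (complex_of_real t) $ j) = (\<lambda>t::real. 0)"
    by (metis (mono_tags, lifting) has_derivative_unique)
  from fun_cong[OF this, of 1] have "ev (pd i p) (x + axis i (of_real 0)) = 0"
    by (simp only: sum_mult_axis[where D = "\<lambda>j. ev (pd j p) (x + axis i (of_real 0))"]) simp
  moreover have "x + axis i (of_real 0) = x" by (simp add: vec_eq_iff axis_def)
  ultimately show "ev (pd i p) x = ev 0 x" by (simp only: ev_simps)
qed

section \<open>The complexified model and the fields that annihilate \<zeta> and \<tau>\<close>

locale cr_model =
  fixes m :: "'d::finite \<Rightarrow> nat" and P :: "'d \<Rightarrow> ('n::finite, 'd) crvar cpoly"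
  assumes mp: "model_polynomials m P" and m2: "m l \<ge> 2"
begin

definition PP :: "'d \<Rightarrow> ('n, 'd) crvar pf" where "PP l = pfc (P l)"

text \<open>The weights of the statement multiplied by the first Hoermander number, which makes them
  integral.\<close>

fun wt :: "('n, 'd) crvar \<Rightarrow> nat" where
  "wt (Z i) = 1" | "wt (Zbar i) = 1" | "wt (U l) = m l"

lemma wt_pos: "wt v > 0" using m2 by (cases v) (auto intro: less_le_trans[of 0 2])

lemma cr_eval_PP: "cr_eval (P l) z \<zeta> u = ev (PP l) (\<chi> v. case v of Z i \<Rightarrow> z $ i | Zbar i \<Rightarrow> \<zeta> $ i | U l \<Rightarrow> of_real (u $ l))"
  unfolding cr_eval_def PP_def ev_pfc by (rule poly_eval_cong) (auto split: crvar.split)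

lemma PP_cong:
  assumes "\<And>i. x $ Z i = y $ Z i" "\<And>i. x $ Zbar i = y $ Zbar i" "\<And>s. m s < m l \<Longrightarrow> x $ U s = y $ U s"
  shows "ev (PP l) x = ev (PP l) y"
  unfolding PP_def ev_pfc
proof (rule poly_eval_cong)
  fix M v assume M: "M \<in> Poly_Mapping.keys (P l)" "v \<in> Poly_Mapping.keys M"
  show "x $ v = y $ v"
  proof (cases v)
    case (U s)
    then have "m s < m l" using mp M unfolding model_polynomials_def by blast
    then show ?thesis using assms(3) U by simp
  qed (use assms in auto)
qed

lemma pd_U_PP: "\<not> m s < m l \<Longrightarrow> pd (U s) (PP l) = 0"
  by (rule pd_independent, rule PP_cong) (auto, metis crvar.inject(3))

text \<open>The assumption on \<open>P\<close> concerns real \<open>u\<close> only. The difference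
  of both sides is a polynomial that vanishes at real arguments, so the identity holds for complex
  \<open>u\<close> as well.\<close>

lemma hom_PP: "hom wt (int (m l)) (PP l)"
  unfolding hom_def
proof (intro allI impI)
  fix t :: real and x :: "complex ^ ('n, 'd) crvar" assume t: "t > 0"
  let ?q = "subst (\<lambda>v. cst (of_real t ^ wt v) * var v) (PP l) - cst (of_real t ^ m l) * PP l"
  have "?q = 0"
  proof (rule pf_zero_if_zero_on_reals)
    fix x :: "complex ^ ('n, 'd) crvar" assume r: "\<And>i. x $ i \<in> \<real>"
    let ?z = "\<chi> i. x $ Z i" and ?\<zeta> = "\<chi> i. x $ Zbar i" and ?u = "\<chi> s. Re (x $ U s)"
    have 1: "cr_eval (P l) (t *\<^sub>R ?z) (t *\<^sub>R ?\<zeta>) (\<chi> k. t ^ m k * ?u $ k) = of_real (t ^ m l) * cr_eval (P l) ?z ?\<zeta> ?u"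
      using mp unfolding model_polynomials_def by blast
    have 2: "(\<chi> v. case v of Z i \<Rightarrow> ?z $ i | Zbar i \<Rightarrow> ?\<zeta> $ i | U l \<Rightarrow> of_real (?u $ l)) = x"
      using r by (auto simp: vec_eq_iff split: crvar.split)
    have 3: "(\<chi> v. case v of Z i \<Rightarrow> (t *\<^sub>R ?z) $ i | Zbar i \<Rightarrow> (t *\<^sub>R ?\<zeta>) $ i | U l \<Rightarrow> of_real ((\<chi> k. t ^ m k * ?u $ k) $ l))
      = (\<chi> v. of_real t ^ wt v * x $ v)"
      using r by (auto simp: vec_eq_iff vector_scaleR_component scaleR_conv_of_real[where 'a = complex] split: crvar.split)
    have "ev (PP l) (\<chi> v. of_real t ^ wt v * x $ v) = of_real (t ^ m l) * ev (PP l) x"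
      using 1 unfolding cr_eval_PP 2 3 .
    then show "ev ?q x = 0" by simp
  qed
  then have "ev ?q x = 0" by simp
  then show "ev (PP l) (dil wt (of_real t) x) = of_real t powi int (m l) * ev (PP l) x"
    by (simp add: dil_def)
qed

definition sig :: "('d \<Rightarrow> ('n, 'd) crvar pf) \<Rightarrow> ('n, 'd) crvar \<Rightarrow> ('n, 'd) crvar pf" where
  "sig f v = (case v of Z i \<Rightarrow> var (Z i) | Zbar i \<Rightarrow> var (Zbar i) | U s \<Rightarrow> f s)"

lemma sig_simps [simp]: "sig f (Z i) = var (Z i)" "sig f (Zbar i) = var (Zbar i)" "sig f (U s) = f s"
  by (simp_all add: sig_def)

text \<open>On \<open>complex ^ crvar\<close> the coordinate \<open>U l\<close> stands for \<open>w\<^sub>l\<close>; \<open>uu l\<close> is \<open>u\<^sub>l\<close> as a function of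
  \<open>(z, w, \<zeta>)\<close>, obtained by solving \<open>u + i P(z, \<zeta>, u) = w\<close>.\<close>

definition uu :: "'d \<Rightarrow> ('n, 'd) crvar pf" where
  "uu = (SOME f. \<forall>l. f l = var (U l) - cst \<i> * subst (sig f) (PP l))"

lemma uu: "uu l = var (U l) - cst \<i> * subst (sig uu) (PP l)"
proof -
  have "\<exists>f. \<forall>l. f l = var (U l) - cst \<i> * subst (sig f) (PP l)"
  proof (rule triangular_recursion[of m "\<lambda>f l. var (U l) - cst \<i> * subst (sig f) (PP l)"])
    fix f g :: "'d \<Rightarrow> ('n, 'd) crvar pf" and l
    assume fg: "\<And>s. m s < m l \<Longrightarrow> f s = g s"
    have "subst (sig f) (PP l) = subst (sig g) (PP l)"
      by (rule pf_eqI, unfold ev_subst, rule PP_cong) (auto simp: fg)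
    then show "var (U l) - cst \<i> * subst (sig f) (PP l) = var (U l) - cst \<i> * subst (sig g) (PP l)" by simp
  qed
  from someI_ex[OF this] show ?thesis unfolding uu_def by blast
qed

text \<open>Rewrites a function of (z, \<zeta>, u) in the coordinates (z, \<zeta>, w).\<close>

definition SB :: "('n, 'd) crvar pf \<Rightarrow> ('n, 'd) crvar pf" where "SB = subst (sig uu)"

lemma SB_simps [simp]: "SB 0 = 0" "SB 1 = 1" "SB (p + q) = SB p + SB q" "SB (p * q) = SB p * SB q"
  by (simp_all add: SB_def)

definition tau :: "'d \<Rightarrow> ('n, 'd) crvar pf" where
  "tau l = var (U l) - cst (2 * \<i>) * SB (PP l)"

lemma uu_SB: "uu l = var (U l) - cst \<i> * SB (PP l)"
  using uu[of l] by (simp add: SB_def)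

lemma tau_uu: "tau l = cst 2 * uu l - var (U l)"
  by (rule pf_eqI) (simp add: tau_def uu_SB algebra_simps)

text \<open>Where the system comes from: \<open>LL j\<close> is to annihilate \<open>tau l\<close>,
  hence by \<open>tau_uu\<close> it maps \<open>uu l\<close> to half of \<open>RR l j\<close>.
  Inserting this into the derivative of \<open>var (U l) - cst (2 * \<i>) * SB (PP l)\<close> gives
  a linear system for \<open>RR\<close> that is triangular in \<open>m\<close>.\<close>

definition RR :: "'d \<Rightarrow> 'n \<Rightarrow> ('n, 'd) crvar pf" where
  "RR = (SOME R. \<forall>l. R l = (\<lambda>j. cst (2 * \<i>) * SB (pd (Z j) (PP l)) + cst \<i> * (\<Sum>s\<in>UNIV. SB (pd (U s) (PP l)) * R s j)))"

lemma RR: "RR l j = cst (2 * \<i>) * SB (pd (Z j) (PP l)) + cst \<i> * (\<Sum>s\<in>UNIV. SB (pd (U s) (PP l)) * RR s j)"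
proof -
  let ?F = "\<lambda>R l j. cst (2 * \<i>) * SB (pd (Z j) (PP l)) + cst \<i> * (\<Sum>s\<in>UNIV. SB (pd (U s) (PP l)) * R s j)"
  have "\<exists>R. \<forall>l. R l = ?F R l"
  proof (rule triangular_recursion[of m ?F])
    fix f g :: "'d \<Rightarrow> 'n \<Rightarrow> ('n, 'd) crvar pf" and l
    assume fg: "\<And>s. m s < m l \<Longrightarrow> f s = g s"
    have "SB (pd (U s) (PP l)) * f s j = SB (pd (U s) (PP l)) * g s j" for s j
      using fg[of s] pd_U_PP[of s l] by (cases "m s < m l") auto
    then show "?F f l = ?F g l" by (simp only:)
  qed
  from someI_ex[OF this] have "RR l = ?F RR l" unfolding RR_def by blast
  then show ?thesis by (rule fun_cong)
qed

definition LL :: "'n \<Rightarrow> ('n, 'd) crvar pf \<Rightarrow> ('n, 'd) crvar pf" where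
  "LL j p = pd (Z j) p + (\<Sum>l\<in>UNIV. RR l j * pd (U l) p)"

lemma LL_simps [simp]: "LL j (p + q) = LL j p + LL j q" "LL j (p - q) = LL j p - LL j q" "LL j (cst c) = 0"
  "LL j (p * q) = p * LL j q + LL j p * q" "LL j 0 = 0"
  "LL j (var (Z i)) = (if j = i then 1 else 0)" "LL j (var (Zbar i)) = 0" "LL j (var (U l)) = RR l j"
proof -
  show "LL j (var (U l)) = RR l j"
    unfolding LL_def by (simp add: if_distrib[of "\<lambda>p. _ * p"] cong: if_cong)
qed (auto simp: LL_def distrib_left distrib_right sum.distrib sum_subtractf right_diff_distrib sum_distrib_left
    sum_distrib_right algebra_simps if_distrib[of "\<lambda>p. _ * p"] cong: if_cong)

lemma LL_scaleR: "LL j (r *\<^sub>R p) = r *\<^sub>R LL j p"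
  by (rule pf_eqI) (simp add: LL_def algebra_simps sum_distrib_left)

lemma derivation_LL: "derivation (LL j)" by (simp add: derivation_def)
lemma derivation_pd: "derivation (pd i)" by (simp add: derivation_def)

lemma linear_LL: "linear (LL j)" by (rule linearI) (auto simp: LL_scaleR)
lemma linear_pd: "linear (pd i)" by (rule linearI) auto

lemma LL_subst: "LL j (subst s p) = (\<Sum>v\<in>UNIV. subst s (pd v p) * LL j (s v))"
  unfolding LL_def pd_subst
  by (simp add: distrib_left sum.distrib sum_distrib_left sum_distrib_right mult.assoc mult.left_commute)
    (subst sum.swap, simp)

text \<open>The ansatz behind \<open>RR\<close>, verified level by level in
  \<open>m\<close>.\<close>

lemma LL_uu: "LL j (uu l) = cst (1/2) * RR l j"
proof (induction "m l" arbitrary: l rule: less_induct)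
  case less
  have IH: "SB (pd (U s) (PP l)) * LL j (uu s) = SB (pd (U s) (PP l)) * (cst (1/2) * RR s j)" for s
    using less[of s] pd_U_PP[of s l] by (cases "m s < m l") auto
  have d: "SB (pd (Z k) (PP l)) * (if j = k then 1 else 0) = (if j = k then SB (pd (Z k) (PP l)) else 0)" for k
    by simp
  have "LL j (SB (PP l)) = SB (pd (Z j) (PP l)) + (\<Sum>s\<in>UNIV. SB (pd (U s) (PP l)) * (cst (1/2) * RR s j))"
    unfolding SB_def LL_subst sum_crvar by (simp add: IH[unfolded SB_def] d[unfolded SB_def])
  then have 1: "LL j (uu l) = RR l j - cst \<i> * (SB (pd (Z j) (PP l)) + (\<Sum>s\<in>UNIV. SB (pd (U s) (PP l)) * (cst (1/2) * RR s j)))"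
    unfolding uu_SB[of l] by simp
  have s: "(\<Sum>s\<in>UNIV. SB (pd (U s) (PP l)) * (cst (1/2) * RR s j)) = cst (1/2) * (\<Sum>s\<in>UNIV. SB (pd (U s) (PP l)) * RR s j)"
    by (simp add: sum_distrib_left mult.left_commute)
  show ?case unfolding 1 s
    by (rule pf_eqI) (subst (1 2) RR[of l j], simp add: field_simps)
qed

lemma LL_tau: "LL j (tau l) = 0"
  unfolding tau_uu by (rule pf_eqI) (simp add: LL_uu)

lemma hom_subst:
  assumes "hom w' \<sigma> p" "\<And>v. hom w (int (w' v)) (s v)"
  shows "hom w \<sigma> (subst s p)"
  unfolding hom_def
proof (intro allI impI)
  fix t :: real and x assume t: "t > 0"
  have "(\<chi> i. ev (s i) (dil w (of_real t) x)) = dil w' (of_real t) (\<chi> i. ev (s i) x)"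
    using assms(2) t by (auto simp: vec_eq_iff hom_def)
  then show "ev (subst s p) (dil w (of_real t) x) = of_real t powi \<sigma> * ev (subst s p) x"
    using assms(1) t by (simp add: hom_def)
qed

lemma hom_uu: "hom wt (int (m l)) (uu l)"
proof (induction "m l" arbitrary: l rule: less_induct)
  case less
  \<comment> \<open>Only \<open>U s\<close> with \<open>m s < m l\<close> matter in
    \<open>PP l\<close>. Plain variables in the other places leave the substitution unchanged, and
    they are homogeneous without appeal to the induction hypothesis.\<close>
  define f where "f s = (if m s < m l then uu s else var (U s))" for s
  have "SB (PP l) = subst (sig f) (PP l)"
    unfolding SB_def by (rule pf_eqI, unfold ev_subst, rule PP_cong) (auto simp: f_def)
  moreover have "hom wt (int (wt v)) (sig f v)" for v
  proof (cases v)
    case (U s)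
    then show ?thesis using less[of s] hom_var[of wt v] by (simp add: f_def)
  qed (use hom_var[of wt v] in simp_all)
  ultimately have "hom wt (int (m l)) (SB (PP l))"
    using hom_subst[OF hom_PP, of wt "sig f" l] by simp
  then show ?case unfolding uu_SB[of l]
    using hom_minus[OF hom_var[of wt "U l"] hom_cst_mult] by simp
qed

lemma hom_SB: "hom wt \<sigma> p \<Longrightarrow> hom wt \<sigma> (SB p)"
  unfolding SB_def
proof (erule hom_subst)
  show "hom wt (int (wt v)) (sig uu v)" for v
    using hom_uu hom_var[of wt v] by (cases v) auto
qed

lemma hom_RR: "hom wt (int (m l) - 1) (RR l j)"
proof (induction "m l" arbitrary: l rule: less_induct)
  case less
  have 1: "hom wt (int (m l) - 1) (SB (pd (Z j) (PP l)))"
    using hom_SB[OF hom_pd[OF hom_PP[of l], of "Z j"]] by simp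
  have 2: "hom wt (int (m l) - 1) (SB (pd (U s) (PP l)) * RR s j)" for s
  proof (cases "m s < m l")
    case True
    from hom_mult[OF hom_SB[OF hom_pd[OF hom_PP[of l], of "U s"]] less[OF True]] show ?thesis by simp
  next
    case False
    then show ?thesis using pd_U_PP by simp
  qed
  show ?case by (subst RR) (intro hom_add hom_cst_mult hom_sum 1 2)
qed

lemma hom_LL: assumes "hom wt \<sigma> p" shows "hom wt (\<sigma> - 1) (LL j p)"
proof -
  have "hom wt (\<sigma> - 1) (RR l j * pd (U l) p)" for l
    using hom_mult[OF hom_RR[of l j] hom_pd[OF assms, of "U l"]] by simp
  moreover have "hom wt (\<sigma> - 1) (pd (Z j) p)" using hom_pd[OF assms, of "Z j"] by simp
  ultimately show ?thesis unfolding LL_def by (intro hom_add hom_sum)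
qed

lemma hom_DD: assumes "hom wt \<sigma> p" shows "hom wt (\<sigma> - 1) (pd (Zbar j) p)"
  using hom_pd[OF assms, of "Zbar j"] by simp

lemma hom_LL_funpow: "hom wt \<sigma> p \<Longrightarrow> hom wt (\<sigma> - int k) ((LL j ^^ k) p)"
proof (induction k)
  case (Suc k)
  then show ?case using hom_LL[of "\<sigma> - int k" "(LL j ^^ k) p" j] by (simp add: algebra_simps)
qed simp

lemma hom_LL_nil: "hom wt \<sigma> p \<Longrightarrow> \<exists>K. (LL j ^^ K) p = 0"
  by (rule exI[of _ "nat (\<sigma> + 1)"], rule hom_neg_zero[OF hom_LL_funpow _ wt_pos]) auto

text \<open>Coordinates are homogeneous and \<open>LL j\<close> lowers the degree by 1; sums and
  products inherit nilpotency. The exponent depends on \<open>p\<close>, so this alone gives no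
  bound for tangent fields.\<close>

lemma LL_nil: "\<exists>K. (LL j ^^ K) p = 0"
proof (induction p rule: pf_induct)
  case (cst c)
  then show ?case by (intro exI[of _ 1]) simp
next
  case (var i)
  then show ?case using hom_LL_nil[OF hom_var] .
next
  case (add p q)
  then show ?case using subspace_add[OF nil_subspace[OF linear_LL]] by blast
next
  case (mult p q)
  then show ?case using derivation_mult_nil[OF derivation_LL] by blast
qed

lemma pd_nil: "\<exists>K. (pd i ^^ K) p = 0"
proof (induction p rule: pf_induct)
  case (cst c)
  then show ?case by (intro exI[of _ 1]) simp
next
  case (var j)
  then show ?case by (intro exI[of _ 2]) (simp add: numeral_2_eq_2)
next
  case (add p q)
  then show ?case using subspace_add[OF nil_subspace[OF linear_pd]] by blast
next
  case (mult p q)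
  then show ?case using derivation_mult_nil[OF derivation_pd] by blast
qed

end

section \<open>Tangent vectors of the model\<close>

text \<open>\<open>eP\<close> lists the arguments of the polynomials \<open>P l\<close>, with
  \<open>u\<close> in the last slots. \<open>rp\<close>, with \<open>w\<close> there instead, embeds
  the space into the complexification, on whose coordinates \<zeta> and \<tau> are
  functions.\<close>

definition eP :: "complex ^ ('n::finite + 'd::finite) \<Rightarrow> complex ^ ('n, 'd) crvar" where
  "eP p = (\<chi> v. case v of Z i \<Rightarrow> p $ Inl i | Zbar i \<Rightarrow> cnj (p $ Inl i) | U l \<Rightarrow> of_real (Re (p $ Inr l)))"

definition rp :: "complex ^ ('n::finite + 'd::finite) \<Rightarrow> complex ^ ('n, 'd) crvar" where
  "rp p = (\<chi> v. case v of Z i \<Rightarrow> p $ Inl i | Zbar i \<Rightarrow> cnj (p $ Inl i) | U l \<Rightarrow> p $ Inr l)"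

lemma eP_nth [simp]: "eP p $ Z i = p $ Inl i" "eP p $ Zbar i = cnj (p $ Inl i)" "eP p $ U l = of_real (Re (p $ Inr l))"
  by (simp_all add: eP_def)

lemma rp_nth [simp]: "rp p $ Z i = p $ Inl i" "rp p $ Zbar i = cnj (p $ Inl i)" "rp p $ U l = p $ Inr l"
  by (simp_all add: rp_def)

lemma vec_eq_crvar: "x = y \<longleftrightarrow> (\<forall>i. x $ Z i = y $ Z i) \<and> (\<forall>i. x $ Zbar i = y $ Zbar i) \<and> (\<forall>l. x $ U l = y $ U l)"
  unfolding vec_eq_iff by (metis crvar.exhaust)

lemma vec_eq_Plus: "x = y \<longleftrightarrow> (\<forall>i. x $ Inl i = y $ Inl i) \<and> (\<forall>l. x $ Inr l = y $ Inr l)"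
  unfolding vec_eq_iff by (metis sum.exhaust)

lemma linear_eP: "linear eP"
  by (rule linearI) (auto simp: vec_eq_crvar vector_scaleR_component scaleR_conv_of_real[where 'a = complex])

lemma eP_has_derivative: "(eP has_derivative eP) (at x)"
  by (rule linear_imp_has_derivative[OF linear_eP])

lemma has_vector_derivative_unique_eventually:
  assumes "(f has_vector_derivative a) (at (0::real))" "(g has_vector_derivative b) (at 0)" "\<forall>\<^sub>F t in nhds 0. f t = g t"
  shows "a = b"
proof -
  obtain S where S: "open S" "0 \<in> S" "\<And>t. t \<in> S \<Longrightarrow> f t = g t"
    using assms(3) unfolding eventually_nhds by blast
  have "(g has_vector_derivative a) (at 0)"
    by (rule has_vector_derivative_transform_within_open[OF assms(1) S])
  then show ?thesis by (rule vector_derivative_unique_at[OF _ assms(2)])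
qed

lemma has_derivative_vecI:
  fixes f :: "'a::real_normed_vector \<Rightarrow> complex ^ 'b::finite"
  assumes "\<And>a. ((\<lambda>t. f t $ a) has_derivative (\<lambda>t. f' t $ a)) (at x)"
  shows "(f has_derivative f') (at x)"
proof (subst has_derivative_componentwise_within, intro ballI)
  fix i :: "complex ^ 'b" assume "i \<in> Basis"
  then obtain a c where i: "i = axis a c" by (auto simp: Basis_vec_def)
  show "((\<lambda>x. f x \<bullet> i) has_derivative (\<lambda>x. f' x \<bullet> i)) (at x)"
    unfolding i inner_axis by (intro has_derivative_inner_left assms)
qed

context cr_model
begin

abbreviation MM :: "(complex ^ ('n + 'd)) set" where "MM \<equiv> model P"

lemma mem_MM: "p \<in> MM \<longleftrightarrow> (\<forall>l. of_real (Im (p $ Inr l)) = ev (PP l) (eP p))"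
proof -
  have "(\<chi> v. case v of Z i \<Rightarrow> zpart p $ i | Zbar i \<Rightarrow> vcnj (zpart p) $ i | U l \<Rightarrow> of_real (upart p $ l)) = eP p"
    by (auto simp: vec_eq_crvar zpart_def vcnj_def upart_def)
  then show ?thesis unfolding model_def mem_Collect_eq cr_eval_PP by simp
qed

lemma PP_real: "ev (PP l) (eP p) \<in> \<real>"
proof -
  have "(\<chi> v. case v of Z i \<Rightarrow> zpart p $ i | Zbar i \<Rightarrow> vcnj (zpart p) $ i | U l \<Rightarrow> of_real (upart p $ l)) = eP p"
    by (auto simp: vec_eq_crvar zpart_def vcnj_def upart_def)
  then show ?thesis using mp unfolding model_polynomials_def cr_eval_PP by metis
qed

definition DP :: "'d \<Rightarrow> complex ^ ('n + 'd) \<Rightarrow> complex ^ ('n + 'd) \<Rightarrow> complex" where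
  "DP l p v = (\<Sum>a\<in>UNIV. ev (pd a (PP l)) (eP p) * eP v $ a)"

lemma DP_has_derivative: "((\<lambda>p. ev (PP l) (eP p)) has_derivative DP l p) (at p)"
  unfolding DP_def by (rule has_derivative_compose[OF eP_has_derivative ev_has_derivative])

lemma DP_real: "DP l p v \<in> \<real>"
proof -
  have "((\<lambda>p. Im (ev (PP l) (eP p))) has_derivative (\<lambda>v. Im (DP l p v))) (at p)"
    by (rule bounded_linear.has_derivative[OF bounded_linear_Im DP_has_derivative])
  moreover have "(\<lambda>p. Im (ev (PP l) (eP p))) = (\<lambda>p. 0)"
    using PP_real by (auto simp: complex_is_Real_iff)
  moreover have "((\<lambda>p::complex ^ ('n + 'd). 0::real) has_derivative (\<lambda>v. 0)) (at p)" by simp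
  ultimately have "(\<lambda>v. Im (DP l p v)) = (\<lambda>v. 0)" by (metis has_derivative_unique)
  then show ?thesis by (metis complex_is_Real_iff)
qed

text \<open>One direction differentiates the defining equations along a curve. For the other, the
  straight line \<open>p + t *\<^sub>R v\<close> is lifted back to the model without changing its
  (z, u) coordinates.\<close>

lemma tangent_MM:
  assumes p: "p \<in> MM"
  shows "v \<in> tangent_space MM p \<longleftrightarrow> (\<forall>l. of_real (Im (v $ Inr l)) = DP l p v)"
proof
  assume "v \<in> tangent_space MM p"
  then obtain \<gamma> where g0: "\<gamma> 0 = p" and g: "(\<gamma> has_vector_derivative v) (at 0)" and gM: "\<forall>\<^sub>F t in nhds (0::real). \<gamma> t \<in> MM"
    unfolding tangent_space_def by blast
  show "\<forall>l. of_real (Im (v $ Inr l)) = DP l p v"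
  proof
    fix l
    have "((\<lambda>t. complex_of_real (Im (\<gamma> t $ Inr l))) has_vector_derivative of_real (Im (v $ Inr l))) (at 0)"
      by (intro bounded_linear.has_vector_derivative[OF bounded_linear_of_real]
          bounded_linear.has_vector_derivative[OF bounded_linear_Im]
          bounded_linear.has_vector_derivative[OF bounded_linear_vec_nth] g)
    moreover have "((\<lambda>t. ev (PP l) (eP (\<gamma> t))) has_vector_derivative DP l p v) (at 0)"
    proof -
      have "((\<lambda>t. ev (PP l) (eP (\<gamma> t))) has_derivative (\<lambda>t. DP l (\<gamma> 0) (t *\<^sub>R v))) (at 0)"
        by (rule has_derivative_compose[OF g[unfolded has_vector_derivative_def] DP_has_derivative])
      moreover have "DP l (\<gamma> 0) (t *\<^sub>R v) = t *\<^sub>R DP l p v" for t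
        using linear_scale[OF has_derivative_linear[OF DP_has_derivative]] g0 by simp
      ultimately show ?thesis unfolding has_vector_derivative_def by simp
    qed
    moreover have "\<forall>\<^sub>F t in nhds 0. complex_of_real (Im (\<gamma> t $ Inr l)) = ev (PP l) (eP (\<gamma> t))"
      using gM by eventually_elim (simp add: mem_MM)
    ultimately show "of_real (Im (v $ Inr l)) = DP l p v"
      by (rule has_vector_derivative_unique_eventually)
  qed
next
  assume v: "\<forall>l. of_real (Im (v $ Inr l)) = DP l p v"

  define \<gamma> where "\<gamma> t = (\<chi> a. case a of Inl i \<Rightarrow> p $ Inl i + of_real t * v $ Inl i
     | Inr l \<Rightarrow> of_real (Re (p $ Inr l) + t * Re (v $ Inr l)) + \<i> * ev (PP l) (eP (p + t *\<^sub>R v)))" for t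
  have eg: "eP (\<gamma> t) = eP (p + t *\<^sub>R v)" for t
  proof -
    have "Im (ev (PP l) (eP (p + t *\<^sub>R v))) = 0" for l using PP_real complex_is_Real_iff by blast
    then show ?thesis
      by (auto simp: vec_eq_crvar \<gamma>_def vector_scaleR_component scaleR_conv_of_real[where 'a = complex])
  qed
  have "\<gamma> t \<in> MM" for t
    unfolding mem_MM eg
  proof
    fix l
    have "ev (PP l) (eP (p + t *\<^sub>R v)) = of_real (Re (ev (PP l) (eP (p + t *\<^sub>R v))))"
      using PP_real[of l "p + t *\<^sub>R v"] by (metis of_real_Re)
    then show "of_real (Im (\<gamma> t $ Inr l)) = ev (PP l) (eP (p + t *\<^sub>R v))"
      by (simp add: \<gamma>_def)
  qed
  moreover have "\<gamma> 0 = p"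
  proof -
    have "p $ Inr l = of_real (Re (p $ Inr l)) + \<i> * ev (PP l) (eP p)" for l
      using p complex_eq[of "p $ Inr l"] unfolding mem_MM by metis
    then show ?thesis by (auto simp: vec_eq_Plus \<gamma>_def)
  qed
  moreover have "(\<gamma> has_vector_derivative v) (at 0)"
  proof -
    have 1: "((\<lambda>t. p + t *\<^sub>R v) has_derivative (\<lambda>t. t *\<^sub>R v)) (at 0)"
      by (auto intro!: derivative_eq_intros)
    have "((\<lambda>t. \<gamma> t $ a) has_derivative (\<lambda>t. (t *\<^sub>R v) $ a)) (at 0)" for a
    proof (cases a)
      case (Inl i)
      have "((\<lambda>t. p $ Inl i + complex_of_real t * v $ Inl i) has_derivative (\<lambda>t. complex_of_real t * v $ Inl i)) (at 0)"
        by (auto intro!: derivative_eq_intros)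
      then show ?thesis using Inl by (simp add: \<gamma>_def vector_scaleR_component scaleR_conv_of_real[where 'a = complex])
    next
      case (Inr l)
      have 2: "((\<lambda>t. ev (PP l) (eP (p + t *\<^sub>R v))) has_derivative (\<lambda>t. DP l (p + 0 *\<^sub>R v) (t *\<^sub>R v))) (at 0)"
        by (rule has_derivative_compose[OF 1 DP_has_derivative])
      have D: "DP l (p + 0 *\<^sub>R v) (t *\<^sub>R v) = of_real t * of_real (Im (v $ Inr l))" for t
        using linear_scale[OF has_derivative_linear[OF DP_has_derivative]] v by (simp add: scaleR_conv_of_real)
      have "((\<lambda>t. complex_of_real (Re (p $ Inr l) + t * Re (v $ Inr l)) + \<i> * ev (PP l) (eP (p + t *\<^sub>R v)))
         has_derivative (\<lambda>t. of_real (t * Re (v $ Inr l)) + \<i> * (of_real t * of_real (Im (v $ Inr l))))) (at 0)"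
        by (rule derivative_eq_intros 2[unfolded D] refl)+ (auto simp: algebra_simps)
      moreover have "of_real (t * Re (v $ Inr l)) + \<i> * (of_real t * of_real (Im (v $ Inr l))) = (t *\<^sub>R v) $ Inr l" for t
        by (simp add: complex_eq_iff vector_scaleR_component)
      ultimately show ?thesis using Inr by (simp add: \<gamma>_def)
    qed
    then show ?thesis unfolding has_vector_derivative_def
      by (rule has_derivative_vecI)
  qed
  ultimately show "v \<in> tangent_space MM p" unfolding tangent_space_def
    by (intro CollectI exI[of _ \<gamma>]) simp
qed

lemma ev_uu_rp: "p \<in> MM \<Longrightarrow> ev (uu l) (rp p) = of_real (Re (p $ Inr l))"
proof (induction "m l" arbitrary: l rule: less_induct)
  case less
  have "ev (PP l) (\<chi> v. ev (sig uu v) (rp p)) = ev (PP l) (eP p)"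
    by (rule PP_cong) (use less in auto)
  then have "ev (uu l) (rp p) = p $ Inr l - \<i> * of_real (Im (p $ Inr l))"
    using less.prems by (simp add: uu_SB[of l] SB_def mem_MM)
  then show ?case by (simp add: complex_eq_iff)
qed

lemma SB_rp: "p \<in> MM \<Longrightarrow> ev (SB q) (rp p) = ev q (eP p)"
proof -
  assume "p \<in> MM"
  then have "(\<chi> v. ev (sig uu v) (rp p)) = eP p" by (simp add: vec_eq_crvar ev_uu_rp)
  then show ?thesis by (simp add: SB_def)
qed

lemma tau_rp: "p \<in> MM \<Longrightarrow> ev (tau l) (rp p) = cnj (p $ Inr l)"
  by (simp add: tau_uu ev_uu_rp complex_eq_iff)

lemma DP_expand: "p \<in> MM \<Longrightarrow> DP l p v = (\<Sum>j\<in>UNIV. ev (SB (pd (Z j) (PP l))) (rp p) * v $ Inl j)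
   + (\<Sum>j\<in>UNIV. ev (SB (pd (Zbar j) (PP l))) (rp p) * cnj (v $ Inl j))
   + (\<Sum>s\<in>UNIV. ev (SB (pd (U s) (PP l))) (rp p) * of_real (Re (v $ Inr s)))"
  by (simp add: DP_def sum_crvar SB_rp)

text \<open>Tangency of \<open>v\<close> and of \<open>\<i> *s v\<close> gives two real equations
  for each \<open>l\<close>. They combine into one complex equation, and the solution of this
  triangular system has the coefficients of the fields \<open>LL j\<close>.\<close>

lemma complex_tangent_MM:
  assumes p: "p \<in> MM"
  shows "v \<in> complex_tangent_space MM p \<longleftrightarrow> (\<forall>l. v $ Inr l = (\<Sum>j\<in>UNIV. ev (RR l j) (rp p) * v $ Inl j))"
proof -
  let ?B = "\<lambda>l. \<Sum>j\<in>UNIV. ev (SB (pd (Z j) (PP l))) (rp p) * v $ Inl j"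
  let ?C = "\<lambda>l. \<Sum>j\<in>UNIV. ev (SB (pd (Zbar j) (PP l))) (rp p) * cnj (v $ Inl j)"
  let ?A = "\<lambda>l s. ev (SB (pd (U s) (PP l))) (rp p)"
  have D1: "DP l p v = ?B l + ?C l + (\<Sum>s\<in>UNIV. ?A l s * of_real (Re (v $ Inr s)))" for l
    by (rule DP_expand[OF p])
  have D2: "DP l p (\<i> *s v) = \<i> * ?B l - \<i> * ?C l - (\<Sum>s\<in>UNIV. ?A l s * of_real (Im (v $ Inr s)))" for l
    unfolding DP_expand[OF p] by (simp add: sum_distrib_left sum_negf mult.left_commute)
  have cs: "(\<Sum>s\<in>UNIV. ?A l s * v $ Inr s) = (\<Sum>s\<in>UNIV. ?A l s * of_real (Re (v $ Inr s))) + \<i> * (\<Sum>s\<in>UNIV. ?A l s * of_real (Im (v $ Inr s)))" for l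
    unfolding sum_distrib_left sum.distrib[symmetric]
    by (rule sum.cong[OF refl]) (simp add: complex_eq_iff algebra_simps)
  \<comment> \<open>In this combination the conjugate-linear terms \<open>?C\<close> cancel.\<close>
  have key: "2 * \<i> * ?B l + \<i> * (\<Sum>s\<in>UNIV. ?A l s * v $ Inr s) = \<i> * DP l p v + DP l p (\<i> *s v)" for l
    unfolding D1 D2 cs by (simp add: algebra_simps)
  have RRe: "ev (RR l j) (rp p) = 2 * \<i> * ev (SB (pd (Z j) (PP l))) (rp p) + \<i> * (\<Sum>s\<in>UNIV. ?A l s * ev (RR s j) (rp p))" for l j
    by (subst RR) simp
  have 1: "(v \<in> complex_tangent_space MM p) \<longleftrightarrow> (\<forall>l. v $ Inr l = 2 * \<i> * ?B l + \<i> * (\<Sum>s\<in>UNIV. ?A l s * v $ Inr s))"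
  proof -
    have "of_real (Im (v $ Inr l)) = DP l p v \<and> of_real (Im ((\<i> *s v) $ Inr l)) = DP l p (\<i> *s v)
       \<longleftrightarrow> v $ Inr l = \<i> * DP l p v + DP l p (\<i> *s v)" for l
    proof -
      obtain a b where ab: "DP l p v = of_real a" "DP l p (\<i> *s v) = of_real b"
        using DP_real by (metis Reals_cases)
      show ?thesis unfolding ab by (auto simp: complex_eq_iff)
    qed
    then show ?thesis unfolding complex_tangent_space_def mem_Collect_eq tangent_MM[OF p] key by blast
  qed
  \<comment> \<open>The vector built from \<open>RR\<close> solves the same system, so uniqueness
    for triangular systems identifies the two.\<close>
  have sol: "(\<Sum>j\<in>UNIV. ev (RR l j) (rp p) * v $ Inl j)
     = 2 * \<i> * ?B l + \<i> * (\<Sum>s\<in>UNIV. ?A l s * (\<Sum>j\<in>UNIV. ev (RR s j) (rp p) * v $ Inl j))" for l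
  proof -
    have "(\<Sum>j\<in>UNIV. (\<Sum>s\<in>UNIV. ?A l s * ev (RR s j) (rp p)) * v $ Inl j)
       = (\<Sum>s\<in>UNIV. ?A l s * (\<Sum>j\<in>UNIV. ev (RR s j) (rp p) * v $ Inl j))"
      unfolding sum_distrib_left sum_distrib_right by (subst sum.swap) (simp add: mult.assoc)
    then show ?thesis
      by (subst RRe) (simp add: distrib_right sum.distrib sum_distrib_left[symmetric] mult.assoc)
  qed
  have A0: "?A l s = 0" if "\<not> m s < m l" for l s using pd_U_PP[OF that] by simp
  show ?thesis unfolding 1
  proof
    assume h: "\<forall>l. v $ Inr l = 2 * \<i> * ?B l + \<i> * (\<Sum>s\<in>UNIV. ?A l s * v $ Inr s)"
    have "v $ Inr l = (\<Sum>j\<in>UNIV. ev (RR l j) (rp p) * v $ Inl j)" for l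
    proof (induction "m l" arbitrary: l rule: less_induct)
      case less
      have "?A l s * v $ Inr s = ?A l s * (\<Sum>j\<in>UNIV. ev (RR s j) (rp p) * v $ Inl j)" for s
        using less[of s] A0[of s l] by (cases "m s < m l") auto
      then show ?case using h[rule_format, of l] sol[of l] by (simp only:)
    qed
    then show "\<forall>l. v $ Inr l = (\<Sum>j\<in>UNIV. ev (RR l j) (rp p) * v $ Inl j)" by blast
  next
    assume h: "\<forall>l. v $ Inr l = (\<Sum>j\<in>UNIV. ev (RR l j) (rp p) * v $ Inl j)"
    show "\<forall>l. v $ Inr l = 2 * \<i> * ?B l + \<i> * (\<Sum>s\<in>UNIV. ?A l s * v $ Inr s)"
      by (intro allI, simp only: h[rule_format], rule sol)
  qed
qed

text \<open>The model is parametrized by the real and imaginary parts of z and by u. The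
  complexified parametrization reaches every point of (z, \<zeta>, w), so a polynomial that vanishes
  for real parameters vanishes everywhere.\<close>

lemma pf_zero_on_MM:
  assumes "\<And>p. p \<in> MM \<Longrightarrow> ev q (rp p) = 0"
  shows "q = 0"
proof -
  \<comment> \<open>\<open>\<kappa>\<close> passes from u to w on the model, \<open>\<mu>\<close>
    below from real and imaginary parts to z and its conjugate.\<close>
  define \<kappa> :: "('n, 'd) crvar \<Rightarrow> ('n, 'd) crvar pf" where
    "\<kappa> v = (case v of Z i \<Rightarrow> var (Z i) | Zbar i \<Rightarrow> var (Zbar i) | U l \<Rightarrow> var (U l) + cst \<i> * PP l)" for v
  define \<mu> :: "('n, 'd) crvar \<Rightarrow> ('n, 'd) crvar pf" where
    "\<mu> v = (case v of Z i \<Rightarrow> var (Z i) + cst \<i> * var (Zbar i) | Zbar i \<Rightarrow> var (Z i) - cst \<i> * var (Zbar i) | U l \<Rightarrow> var (U l))" for v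
  have 0: "subst \<mu> (subst \<kappa> q) = 0"
  proof (rule pf_zero_if_zero_on_reals)
    fix x :: "complex ^ ('n, 'd) crvar" assume r: "\<And>i. x $ i \<in> \<real>"
    define p0 where "p0 = (\<chi> a. case a of Inl i \<Rightarrow> x $ Z i + \<i> * x $ Zbar i | Inr l \<Rightarrow> x $ U l :: complex)"
    define p where "p = (\<chi> a. case a of Inl i \<Rightarrow> x $ Z i + \<i> * x $ Zbar i | Inr l \<Rightarrow> x $ U l + \<i> * ev (PP l) (eP p0))"
    have cr: "cnj (x $ v) = x $ v" "Im (x $ v) = 0" "of_real (Re (x $ v)) = x $ v" for v
      using r[of v] by (auto simp: Reals_cnj_iff complex_is_Real_iff complex_eq_iff)
    have PI: "Im (ev (PP l) (eP p0)) = 0" "complex_of_real (Re (ev (PP l) (eP p0))) = ev (PP l) (eP p0)" for l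
      using PP_real[of l p0] by (auto simp: complex_is_Real_iff complex_eq_iff)
    have e0: "(\<chi> i. ev (\<mu> i) x) = eP p0"
      by (auto simp: vec_eq_crvar \<mu>_def p0_def cr)
    have ep: "eP p = eP p0"
      using PI by (auto simp: vec_eq_crvar p_def) (auto simp: p0_def)
    have "p \<in> MM" unfolding mem_MM ep by (simp add: p_def cr PI)
    moreover have "(\<chi> i. ev (\<kappa> i) (eP p0)) = rp p"
      by (auto simp: vec_eq_crvar \<kappa>_def p_def cr) (auto simp: p0_def cr)
    ultimately show "ev (subst \<mu> (subst \<kappa> q)) x = 0" using assms by (simp add: e0)
  qed
  have 1: "ev (subst \<kappa> q) y = 0" for y
  proof -
    define x where "x = (\<chi> v. case v of Z i \<Rightarrow> (y $ Z i + y $ Zbar i) / 2 | Zbar i \<Rightarrow> (y $ Z i - y $ Zbar i) / (2 * \<i>) | U l \<Rightarrow> y $ U l)"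
    have "(\<chi> i. ev (\<mu> i) x) = y"
      by (auto simp: vec_eq_crvar \<mu>_def x_def field_simps)
    then show ?thesis using arg_cong[OF 0, of "\<lambda>q. ev q x"] by simp
  qed
  show ?thesis
  proof (rule pf_eqI)
    fix x
    define y where "y = (\<chi> v. ev (sig uu v) x)"
    have "(\<chi> i. ev (\<kappa> i) y) = x"
      using uu by (auto simp: vec_eq_crvar \<kappa>_def y_def)
    then show "ev q x = ev 0 x" using 1[of y] by simp
  qed
qed

end

section \<open>Elimination and the weights of tangent fields\<close>

inductive lin :: "('n \<Rightarrow> 'a::comm_ring_1) set \<Rightarrow> ('n \<Rightarrow> 'a) \<Rightarrow> bool" for R where
  zero: "lin R (\<lambda>_. 0)"
| step: "r \<in> R \<Longrightarrow> lin R g \<Longrightarrow> lin R (\<lambda>i. c * r i + g i)"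

lemma lin_add: "lin R g \<Longrightarrow> lin R h \<Longrightarrow> lin R (\<lambda>i. g i + h i)"
proof (induction rule: lin.induct)
  case (step r g c)
  then show ?case using lin.step[of r R "\<lambda>i. g i + h i" c] by (simp add: add.assoc)
qed simp

lemma lin_scale: "lin R g \<Longrightarrow> lin R (\<lambda>i. d * g i)"
proof (induction rule: lin.induct)
  case (step r g c)
  then show ?case using lin.step[of r R "\<lambda>i. d * g i" "d * c"] by (simp add: distrib_left mult.assoc)
qed (simp add: lin.zero)

lemma lin_sum: "(\<And>k. k \<in> A \<Longrightarrow> lin R (g k)) \<Longrightarrow> lin R (\<lambda>i. \<Sum>k\<in>A. g k i)"
  by (induction A rule: infinite_finite_induct) (auto intro: lin.zero lin_add)

text \<open>Gaussian elimination over a domain: either the rows \<open>R\<close> have a common kernel vector supported in \<open>J\<close>, or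
  every unit vector on \<open>J\<close> is, up to a nonzero factor, a combination of rows.\<close>

lemma elimination_aux:
  fixes R :: "('n \<Rightarrow> 'a::idom) set"
  assumes "finite J"
  shows "(\<exists>F. (\<exists>j\<in>J. F j \<noteq> 0) \<and> (\<forall>j. j \<notin> J \<longrightarrow> F j = 0) \<and> (\<forall>r\<in>R. (\<Sum>j\<in>J. r j * F j) = 0)) \<or>
    (\<forall>j\<in>J. \<exists>D g. D \<noteq> 0 \<and> lin R g \<and> (\<forall>i\<in>J. g i = (if i = j then D else 0)))"
  using assms
proof (induction J rule: finite_induct)
  case empty
  then show ?case by simp
next
  case (insert j0 J)
  from insert.IH show ?case
  proof (elim disjE exE conjE)
    fix F assume F: "\<exists>j\<in>J. F j \<noteq> 0" "\<forall>j. j \<notin> J \<longrightarrow> F j = 0" "\<forall>r\<in>R. (\<Sum>j\<in>J. r j * F j) = 0"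
    have "\<exists>F. (\<exists>j\<in>insert j0 J. F j \<noteq> 0) \<and> (\<forall>j. j \<notin> insert j0 J \<longrightarrow> F j = 0) \<and> (\<forall>r\<in>R. (\<Sum>j\<in>insert j0 J. r j * F j) = 0)"
      using F insert.hyps by (intro exI[of _ F]) simp
    then show ?thesis by (rule disjI1)
  next
    assume "\<forall>j\<in>J. \<exists>D g. D \<noteq> 0 \<and> lin R g \<and> (\<forall>i\<in>J. g i = (if i = j then D else 0))"
    then obtain D where "\<forall>j\<in>J. \<exists>g. D j \<noteq> 0 \<and> lin R g \<and> (\<forall>i\<in>J. g i = (if i = j then D j else 0))"
      by (rule bchoice[THEN exE])
    then obtain g where Dg: "\<forall>j\<in>J. D j \<noteq> 0 \<and> lin R (g j) \<and> (\<forall>i\<in>J. g j i = (if i = j then D j else 0))"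
      by (rule bchoice[THEN exE])
    define p where "p = prod D J"
    define c where "c j = prod D (J - {j})" for j
    have p0: "p \<noteq> 0" unfolding p_def using Dg insert.hyps by simp
    have cD: "c j * D j = p" if "j \<in> J" for j
      unfolding c_def p_def using that insert.hyps prod.remove[of J j D] by (simp add: mult.commute)
    \<comment> \<open>The row \<open>r\<close> with its entries in \<open>J\<close> cleared;
      multiplication by \<open>p\<close> replaces the division by the pivots
      \<open>D j\<close>.\<close>
    define r' where "r' r i = p * r i + (\<Sum>j\<in>J. (- (c j * r j)) * g j i)" for r i
    have r'_lin: "lin R (r' r)" if "r \<in> R" for r
      unfolding r'_def by (intro lin.step that lin_sum lin_scale) (use Dg in auto)
    have r'_0: "r' r i = 0" if "i \<in> J" for r i
    proof -
      have "(\<Sum>j\<in>J. (- (c j * r j)) * g j i) = (\<Sum>j\<in>J. if i = j then - (p * r i) else 0)"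
        by (rule sum.cong[OF refl]) (use Dg that cD in \<open>auto simp: algebra_simps\<close>)
      then show ?thesis unfolding r'_def using that insert.hyps by simp
    qed
    show ?thesis
    proof (cases "\<forall>r\<in>R. r' r j0 = 0")
      case True
      \<comment> \<open>No cleared row has an entry at \<open>j0\<close>, so this unknown is free.
        \<open>F\<close> is the resulting solution with denominators removed.\<close>
      define F where "F j = (if j = j0 then p else if j \<in> J then - (c j * g j j0) else 0)" for j
      have "(\<Sum>j\<in>insert j0 J. r j * F j) = 0" if "r \<in> R" for r
      proof -
        have "(\<Sum>j\<in>J. r j * F j) = (\<Sum>j\<in>J. (- (c j * r j)) * g j j0)"
          by (rule sum.cong[OF refl]) (use insert.hyps in \<open>auto simp: F_def algebra_simps\<close>)
        then have "(\<Sum>j\<in>insert j0 J. r j * F j) = r' r j0"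
          using insert.hyps unfolding r'_def by (simp add: F_def mult.commute)
        then show ?thesis using True that by simp
      qed
      then have "\<exists>F. (\<exists>j\<in>insert j0 J. F j \<noteq> 0) \<and> (\<forall>j. j \<notin> insert j0 J \<longrightarrow> F j = 0) \<and> (\<forall>r\<in>R. (\<Sum>j\<in>insert j0 J. r j * F j) = 0)"
        using p0 by (intro exI[of _ F]) (simp add: F_def)
      then show ?thesis by (rule disjI1)
    next
      case False
      then obtain r where r: "r \<in> R" "r' r j0 \<noteq> 0" by blast
      have "\<exists>E h. E \<noteq> 0 \<and> lin R h \<and> (\<forall>i\<in>insert j0 J. h i = (if i = j then E else 0))" if "j \<in> insert j0 J" for j
      proof (cases "j = j0")
        case True
        then show ?thesis using r r'_lin[OF r(1)] r'_0 insert.hyps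
          by (intro exI[of _ "r' r j0"] exI[of _ "r' r"]) auto
      next
        case False
        then have j: "j \<in> J" using that by simp
        have "lin R (\<lambda>i. r' r j0 * g j i + (- g j j0) * r' r i)"
          by (intro lin_add lin_scale r'_lin r) (use Dg j in auto)
        moreover have "r' r j0 * g j i + (- g j j0) * r' r i = (if i = j then r' r j0 * D j else 0)" if "i \<in> insert j0 J" for i
          using that Dg j r'_0 False by auto
        moreover have "r' r j0 * D j \<noteq> 0" using r Dg j by simp
        ultimately show ?thesis
          by (intro exI[of _ "r' r j0 * D j"] exI[of _ "\<lambda>i. r' r j0 * g j i + (- g j j0) * r' r i"]) simp
      qed
      then show ?thesis by (intro disjI2 ballI)
    qed
  qed
qed

lemma elimination:
  fixes R :: "('n::finite \<Rightarrow> 'a::idom) set"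
  obtains (kernel) F j where "F j \<noteq> 0" "\<And>r. r \<in> R \<Longrightarrow> (\<Sum>j\<in>UNIV. r j * F j) = 0"
  | (full) "\<And>j. \<exists>D g. D \<noteq> 0 \<and> lin R g \<and> (\<forall>i. g i = (if i = j then D else 0))"
proof -
  have "finite (UNIV :: 'n set)" by simp
  from elimination_aux[OF this, of R] show thesis
  proof (elim disjE exE conjE bexE)
    fix F j assume "F j \<noteq> 0" "\<forall>r\<in>R. (\<Sum>j\<in>UNIV. r j * F j) = 0"
    then show thesis using kernel by simp
  next
    assume "\<forall>j\<in>UNIV. \<exists>D g. D \<noteq> 0 \<and> lin R g \<and> (\<forall>i\<in>UNIV. g i = (if i = j then D else 0))"
    then show thesis by (intro full) simp
  qed
qed

text \<open>Conjugates the coefficients only, so that the conjugate of a polynomial in (z, w) is a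
  polynomial in the conjugate variables.\<close>

lift_definition cj :: "'v::finite pf \<Rightarrow> 'v pf" is "\<lambda>f x. cnj (f (vcnj x))"
proof -
  fix f :: "complex ^ 'v \<Rightarrow> complex"
  show "polyfun f \<Longrightarrow> polyfun (\<lambda>x. cnj (f (vcnj x)))"
    by (induction rule: polyfun.induct) (auto simp: vcnj_def intro: polyfun.intros)
qed

lemma ev_cj: "ev (cj p) x = cnj (ev p (vcnj x))"
  by transfer simp

section \<open>Tangency as a relation between a field and its conjugate\<close>

context cr_model
begin

text \<open>\<open>sz\<close> pulls polynomials in (z, w), and \<open>sb\<close> polynomials in
  (\<zeta>, \<tau>), back to the common coordinates (z, \<zeta>, w).\<close>

definition sz :: "'n + 'd \<Rightarrow> ('n, 'd) crvar pf" where
  "sz a = (case a of Inl i \<Rightarrow> var (Z i) | Inr l \<Rightarrow> var (U l))"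

definition sb :: "'n + 'd \<Rightarrow> ('n, 'd) crvar pf" where
  "sb a = (case a of Inl i \<Rightarrow> var (Zbar i) | Inr l \<Rightarrow> tau l)"

text \<open>Expressions in the derivatives of the conjugate field along \<open>(\<zeta>, \<tau>)\<close>, with coefficients that do not
  depend on the field.\<close>

inductive Om :: "(('n + 'd \<Rightarrow> ('n + 'd) pf) \<Rightarrow> ('n, 'd) crvar pf) \<Rightarrow> bool" where
  base: "Om (\<lambda>Y. subst sb (foldr pd bs (Y a)))"
| add: "Om f \<Longrightarrow> Om g \<Longrightarrow> Om (\<lambda>Y. f Y + g Y)"
| mult: "Om f \<Longrightarrow> Om (\<lambda>Y. c * f Y)"

lemma Om_0: "Om (\<lambda>Y. 0)"
  using Om.mult[OF Om.base, of 0] by simp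

lemma Om_sum: "(\<And>i. i \<in> A \<Longrightarrow> Om (f i)) \<Longrightarrow> Om (\<lambda>Y. \<Sum>i\<in>A. f i Y)"
  by (induction A rule: infinite_finite_induct) (auto intro: Om_0 Om.add)

lemma Om_uminus: "Om f \<Longrightarrow> Om (\<lambda>Y. - f Y)"
  using Om.mult[of f "-1"] by simp

lemma Om_pd: "Om f \<Longrightarrow> Om (\<lambda>Y. pd k (f Y))"
proof (induction rule: Om.induct)
  case (base bs a)
  have "Om (\<lambda>Y. \<Sum>i\<in>UNIV. pd k (sb i) * subst sb (foldr pd (i # bs) (Y a)))"
    by (intro Om_sum Om.mult Om.base)
  then show ?case unfolding pd_subst by (simp add: mult.commute)
next
  case (add f g)
  then show ?case by (simp add: Om.add)
next
  case (mult f c)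
  have "Om (\<lambda>Y. c * pd k (f Y) + pd k c * f Y)" by (intro Om.add Om.mult mult)
  then show ?case by simp
qed

lemma LL_sb: "LL j (sb a) = 0"
  by (cases a) (auto simp: sb_def LL_tau)

text \<open>The exponent does not depend on \<open>Y\<close>: a function of (\<zeta>, \<tau>) is
  already killed by \<open>LL i\<close>, so only the fixed coefficients contribute.\<close>

lemma Om_nil: "Om f \<Longrightarrow> \<exists>K. \<forall>Y. (LL i ^^ K) (f Y) = 0"
proof (induction rule: Om.induct)
  case (base bs a)
  show ?case by (rule exI[of _ 1]) (simp add: LL_subst LL_sb)
next
  case (add f g)
  then obtain K L where KL: "\<And>Y. (LL i ^^ K) (f Y) = 0" "\<And>Y. (LL i ^^ L) (g Y) = 0" by blast
  have "(LL i ^^ (K + L)) (f Y + g Y) = 0" for Y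
    using derivation_funpow_zero_mono[OF derivation_LL KL(1), of "K + L"]
      derivation_funpow_zero_mono[OF derivation_LL KL(2), of "K + L"]
    by (simp add: derivation_funpow_add[OF derivation_LL])
  then show ?case by blast
next
  case (mult f c)
  then obtain K where "\<And>Y. (LL i ^^ K) (f Y) = 0" by blast
  moreover obtain L where "(LL i ^^ L) c = 0" using LL_nil by blast
  ultimately have "(LL i ^^ (L + K)) (c * f Y) = 0" for Y
    by (intro derivation_mult_nil[OF derivation_LL])
  then show ?case by blast
qed

text \<open>Tangency at every point of the model, with the tangent space in the form of
  \<open>tangent_MM\<close>.\<close>

definition tang :: "('n + 'd \<Rightarrow> ('n + 'd) pf) \<Rightarrow> bool" where
  "tang X \<longleftrightarrow> (\<forall>p\<in>MM. \<forall>l. of_real (Im (ev (X (Inr l)) p)) = DP l p (\<chi> a. ev (X a) p))"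

lemma ev_sz_rp: "ev (subst sz q) (rp p) = ev q p"
proof -
  have "(\<chi> i. ev (sz i) (rp p)) = p" by (auto simp: vec_eq_Plus sz_def)
  then show ?thesis by simp
qed

lemma ev_sb_rp: "p \<in> MM \<Longrightarrow> ev (subst sb (cj q)) (rp p) = cnj (ev q p)"
proof -
  assume "p \<in> MM"
  then have "(\<chi> i. ev (sb i) (rp p)) = vcnj p" by (auto simp: vec_eq_Plus sb_def tau_rp vcnj_def)
  moreover have "vcnj (vcnj p) = p" by (simp add: vcnj_def vec_eq_iff)
  ultimately show ?thesis by (simp add: ev_cj)
qed

definition rhs :: "'d \<Rightarrow> ('n + 'd \<Rightarrow> ('n + 'd) pf) \<Rightarrow> ('n, 'd) crvar pf" where
  "rhs l Y = subst sb (Y (Inr l)) + (\<Sum>s\<in>UNIV. (cst \<i> * SB (pd (U s) (PP l))) * subst sb (Y (Inr s)))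
     + (\<Sum>j\<in>UNIV. (cst (2 * \<i>) * SB (pd (Zbar j) (PP l))) * subst sb (Y (Inl j)))"

lemma Om_rhs: "Om (rhs l)"
proof -
  have *: "Om (\<lambda>Y. subst sb (Y a))" for a using Om.base[of "[]" a] by simp
  have "Om (\<lambda>Y. subst sb (Y (Inr l)) + (\<Sum>s\<in>UNIV. (cst \<i> * SB (pd (U s) (PP l))) * subst sb (Y (Inr s)))
     + (\<Sum>j\<in>UNIV. (cst (2 * \<i>) * SB (pd (Zbar j) (PP l))) * subst sb (Y (Inl j))))"
    by (intro Om.add Om_sum Om.mult *)
  then show ?thesis unfolding rhs_def[abs_def] .
qed

text \<open>The part of \<open>X\<close> transversal to the complex tangent space: by
  \<open>complex_tangent_MM\<close>, along the model it vanishes exactly where \<open>X\<close> is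
  complex tangent.\<close>

definition HH :: "('n + 'd \<Rightarrow> ('n + 'd) pf) \<Rightarrow> 'd \<Rightarrow> ('n, 'd) crvar pf" where
  "HH X l = subst sz (X (Inr l)) - (\<Sum>j\<in>UNIV. RR l j * subst sz (X (Inl j)))"

text \<open>The tangency equation with real and imaginary parts expressed through conjugates. On the
  model conjugates are polynomials in (\<zeta>, \<tau>), and \<open>pf_zero_on_MM\<close> turns the
  equation on the model into a polynomial identity.\<close>

lemma reflection:
  assumes "tang X"
  shows "HH X l = rhs l (\<lambda>a. cj (X a)) + (\<Sum>s\<in>UNIV. (cst \<i> * SB (pd (U s) (PP l))) * HH X s)"
proof -
  have "HH X l - (rhs l (\<lambda>a. cj (X a)) + (\<Sum>s\<in>UNIV. (cst \<i> * SB (pd (U s) (PP l))) * HH X s)) = 0"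
  proof (rule pf_zero_on_MM)
    fix p assume p: "p \<in> MM"
    let ?F = "\<lambda>j. ev (X (Inl j)) p" and ?G = "\<lambda>l. ev (X (Inr l)) p"
    let ?A = "\<lambda>s. ev (SB (pd (U s) (PP l))) (rp p)"
    let ?B = "\<lambda>j. ev (SB (pd (Z j) (PP l))) (rp p)" and ?C = "\<lambda>j. ev (SB (pd (Zbar j) (PP l))) (rp p)"
    let ?r = "\<lambda>s j. ev (RR s j) (rp p)"
    have T: "of_real (Im (?G l)) = (\<Sum>j\<in>UNIV. ?B j * ?F j) + (\<Sum>j\<in>UNIV. ?C j * cnj (?F j)) + (\<Sum>s\<in>UNIV. ?A s * of_real (Re (?G s)))"
      using assms p unfolding tang_def by (simp add: DP_expand[OF p])
    have R: "?r l j = 2 * \<i> * ?B j + \<i> * (\<Sum>s\<in>UNIV. ?A s * ?r s j)" for j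
      by (subst RR) simp
    have Re2: "complex_of_real (Re x) = (x + cnj x) / 2" and Im2: "2 * \<i> * complex_of_real (Im x) = x - cnj x" for x
      by (simp_all add: complex_eq_iff)
    have H: "ev (HH X s) (rp p) = ?G s - (\<Sum>j\<in>UNIV. ?r s j * ?F j)" for s
      by (simp only: HH_def ev_simps ev_sum ev_sz_rp)
    have "?G l - cnj (?G l) = 2 * \<i> * (\<Sum>j\<in>UNIV. ?B j * ?F j) + 2 * \<i> * (\<Sum>j\<in>UNIV. ?C j * cnj (?F j))
      + \<i> * (\<Sum>s\<in>UNIV. ?A s * ?G s) + \<i> * (\<Sum>s\<in>UNIV. ?A s * cnj (?G s))"
      unfolding Im2[symmetric] T Re2 by (simp add: sum_divide_distrib[symmetric] distrib_left sum.distrib)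
    moreover have "(\<Sum>j\<in>UNIV. ?r l j * ?F j) = 2 * \<i> * (\<Sum>j\<in>UNIV. ?B j * ?F j)
      + \<i> * (\<Sum>s\<in>UNIV. ?A s * (\<Sum>j\<in>UNIV. ?r s j * ?F j))"
    proof -
      have "(\<Sum>j\<in>UNIV. (\<Sum>s\<in>UNIV. ?A s * ?r s j) * ?F j) = (\<Sum>s\<in>UNIV. ?A s * (\<Sum>j\<in>UNIV. ?r s j * ?F j))"
        unfolding sum_distrib_left sum_distrib_right by (subst sum.swap) (simp add: mult.assoc)
      then show ?thesis
        by (subst R) (simp add: distrib_right sum.distrib sum_distrib_left[symmetric] mult.assoc)
    qed
    moreover have "(\<Sum>s\<in>UNIV. \<i> * ?A s * (?G s - (\<Sum>j\<in>UNIV. ?r s j * ?F j)))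
       = \<i> * (\<Sum>s\<in>UNIV. ?A s * ?G s) - \<i> * (\<Sum>s\<in>UNIV. ?A s * (\<Sum>j\<in>UNIV. ?r s j * ?F j))"
      by (simp add: right_diff_distrib sum_subtractf sum_distrib_left mult.assoc)
    moreover have "(\<Sum>s\<in>UNIV. \<i> * ?A s * cnj (?G s)) = \<i> * (\<Sum>s\<in>UNIV. ?A s * cnj (?G s))"
      "(\<Sum>j\<in>UNIV. 2 * \<i> * ?C j * cnj (?F j)) = 2 * \<i> * (\<Sum>j\<in>UNIV. ?C j * cnj (?F j))"
      by (simp_all add: sum_distrib_left mult.assoc)
    moreover have "ev (HH X l - (rhs l (\<lambda>a. cj (X a)) + (\<Sum>s\<in>UNIV. (cst \<i> * SB (pd (U s) (PP l))) * HH X s))) (rp p)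
      = ?G l - (\<Sum>j\<in>UNIV. ?r l j * ?F j) - (cnj (?G l) + (\<Sum>s\<in>UNIV. \<i> * ?A s * cnj (?G s))
        + (\<Sum>j\<in>UNIV. 2 * \<i> * ?C j * cnj (?F j)) + (\<Sum>s\<in>UNIV. \<i> * ?A s * (?G s - (\<Sum>j\<in>UNIV. ?r s j * ?F j))))"
      by (simp only: ev_simps ev_sum H rhs_def ev_sb_rp[OF p])
    moreover have "a - ca = B + C + G + Gc \<Longrightarrow> r = B + AR \<Longrightarrow> t = G - AR \<Longrightarrow> g = Gc \<Longrightarrow> c = C
      \<Longrightarrow> e = a - r - (ca + g + c + t) \<Longrightarrow> e = 0" for a ca B C G Gc r AR t e g c :: complex
      by algebra
    ultimately show "ev (HH X l - (rhs l (\<lambda>a. cj (X a)) + (\<Sum>s\<in>UNIV. (cst \<i> * SB (pd (U s) (PP l))) * HH X s))) (rp p) = 0"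
      by blast
  qed
  then show ?thesis by simp
qed

text \<open>The system of \<open>reflection\<close> is triangular with coefficients independent of
  the field, so one solution formula \<open>w\<close> serves for all tangent
  \<open>X\<close>.\<close>

lemma HH_Om: "\<exists>w. \<forall>l. Om (w l) \<and> (\<forall>X. tang X \<longrightarrow> HH X l = w l (\<lambda>a. cj (X a)))"
proof -
  let ?F = "\<lambda>w l Y. rhs l Y + (\<Sum>s\<in>UNIV. (cst \<i> * SB (pd (U s) (PP l))) * w s Y)"
  have A0: "cst \<i> * SB (pd (U s) (PP l)) = 0" if "\<not> m s < m l" for s l
    using pd_U_PP[OF that] by simp
  have "\<exists>w. \<forall>l. w l = ?F w l"
  proof (rule triangular_recursion[of m ?F])
    fix f g :: "'d \<Rightarrow> ('n + 'd \<Rightarrow> ('n + 'd) pf) \<Rightarrow> ('n, 'd) crvar pf" and l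
    assume fg: "\<And>s. m s < m l \<Longrightarrow> f s = g s"
    have "(cst \<i> * SB (pd (U s) (PP l))) * f s Y = (cst \<i> * SB (pd (U s) (PP l))) * g s Y" for s Y
      using fg[of s] A0[of s l] by (cases "m s < m l") auto
    then show "?F f l = ?F g l" by (simp only:)
  qed
  then obtain w where w: "\<And>l. w l = ?F w l" by blast
  have "Om (w l)" for l
  proof (induction "m l" arbitrary: l rule: less_induct)
    case less
    have "Om (\<lambda>Y. (cst \<i> * SB (pd (U s) (PP l))) * w s Y)" for s
    proof (cases "m s < m l")
      case True
      then show ?thesis by (intro Om.mult less)
    next
      case False
      then show ?thesis unfolding A0[OF False] using Om_0 by simp
    qed
    then have "Om (?F w l)" by (intro Om.add Om_sum Om_rhs)
    then show ?case using w[of l] by simp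
  qed
  moreover have "HH X l = w l (\<lambda>a. cj (X a))" if X: "tang X" for X l
  proof (induction "m l" arbitrary: l rule: less_induct)
    case less
    have "(cst \<i> * SB (pd (U s) (PP l))) * HH X s = (cst \<i> * SB (pd (U s) (PP l))) * w s (\<lambda>a. cj (X a))" for s
      using less[of s] A0[of s l] by (cases "m s < m l") auto
    then show ?case unfolding reflection[OF X, of l] by (subst w) (simp only:)
  qed
  ultimately show ?thesis by blast
qed

abbreviation Dw :: "'n list \<Rightarrow> ('n, 'd) crvar pf \<Rightarrow> ('n, 'd) crvar pf" where
  "Dw v \<equiv> foldr (\<lambda>k. pd (Zbar k)) v"

lemma pd_Zbar_sz: "pd (Zbar k) (subst sz q) = 0"
proof -
  have "pd (Zbar k) (sz i) = 0" for i by (cases i) (auto simp: sz_def)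
  then show ?thesis by (simp add: pd_subst)
qed

text \<open>The empty word is excluded because one derivative in \<zeta> is needed to remove the
  w-component of \<open>X\<close> from \<open>HH\<close>; the z-components then remain as the only
  unknowns.\<close>

definition Rset :: "('n \<Rightarrow> ('n, 'd) crvar pf) set" where
  "Rset = {\<lambda>j. Dw v (RR l j) | v l. v \<noteq> []}"

lemma Dw_HH: "v \<noteq> [] \<Longrightarrow> Dw v (HH X l) = - (\<Sum>j\<in>UNIV. Dw v (RR l j) * subst sz (X (Inl j)))"
proof (induction v)
  case (Cons k v)
  show ?case
  proof (cases "v = []")
    case True
    then show ?thesis by (simp add: HH_def pd_Zbar_sz)
  next
    case False
    then show ?thesis using Cons by (simp add: pd_Zbar_sz)
  qed
qed simp

lemma lin_Rset_Om:
  "lin Rset g \<Longrightarrow> \<exists>w. Om w \<and> (\<forall>X. tang X \<longrightarrow> (\<Sum>j\<in>UNIV. g j * subst sz (X (Inl j))) = w (\<lambda>a. cj (X a)))"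
proof (induction rule: lin.induct)
  case zero
  show ?case by (rule exI[of _ "\<lambda>_. 0"]) (simp add: Om_0)
next
  case (step r g c)
  obtain w where w: "Om w" "\<And>X. tang X \<Longrightarrow> (\<Sum>j\<in>UNIV. g j * subst sz (X (Inl j))) = w (\<lambda>a. cj (X a))"
    using step.IH by blast
  obtain v l where v: "v \<noteq> []" "r = (\<lambda>j. Dw v (RR l j))" using step.hyps(1) unfolding Rset_def by blast
  obtain h where h: "Om (h l)" "\<And>X. tang X \<Longrightarrow> HH X l = h l (\<lambda>a. cj (X a))" using HH_Om by blast
  have "Om (\<lambda>Y. Dw v (h l Y))"
    by (induction v) (auto intro: Om_pd h(1))
  then have "Om (\<lambda>Y. c * (- Dw v (h l Y)) + w Y)" by (intro Om.add Om.mult Om_uminus w(1))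
  moreover have "(\<Sum>j\<in>UNIV. (c * r j + g j) * subst sz (X (Inl j))) = c * (- Dw v (h l (\<lambda>a. cj (X a)))) + w (\<lambda>a. cj (X a))" if "tang X" for X
  proof -
    have "(\<Sum>j\<in>UNIV. r j * subst sz (X (Inl j))) = - Dw v (h l (\<lambda>a. cj (X a)))"
      using Dw_HH[OF v(1), of X l] h(2)[OF that] v(2) by simp
    then show ?thesis using w(2)[OF that]
      by (simp add: distrib_right sum.distrib mult.assoc sum_distrib_left[symmetric])
  qed
  ultimately show ?case by (intro exI[of _ "\<lambda>Y. c * (- Dw v (h l Y)) + w Y"]) simp
qed

text \<open>Full rank makes each z-component, up to one nonzero factor, an \<open>Om\<close>
  expression in the conjugate field. \<open>derivation_nil_cancel\<close> drops the factor and keeps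
  the exponent. The w-components are then recovered from \<open>HH\<close>.\<close>

lemma tang_nil:
  assumes full: "\<And>j. \<exists>D g. D \<noteq> 0 \<and> lin Rset g \<and> (\<forall>i. g i = (if i = j then D else 0))"
  shows "\<exists>K. \<forall>X. tang X \<longrightarrow> (LL k ^^ K) (subst sz (X a)) = 0"
proof -
  have inl: "\<exists>K. \<forall>X. tang X \<longrightarrow> (LL k ^^ K) (subst sz (X (Inl j))) = 0" for j
  proof -
    obtain D g where Dg: "D \<noteq> 0" "lin Rset g" "\<And>i. g i = (if i = j then D else 0)" using full by blast
    obtain w where w: "Om w" "\<And>X. tang X \<Longrightarrow> (\<Sum>j\<in>UNIV. g j * subst sz (X (Inl j))) = w (\<lambda>a. cj (X a))"
      using lin_Rset_Om[OF Dg(2)] by blast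
    obtain K where K: "\<And>Y. (LL k ^^ K) (w Y) = 0" using Om_nil[OF w(1)] by blast
    obtain M where M: "(LL k ^^ M) D = 0" using LL_nil by blast
    have "(LL k ^^ K) (subst sz (X (Inl j))) = 0" if "tang X" for X
    proof (rule derivation_nil_cancel[OF derivation_LL M Dg(1) _ LL_nil])
      have "(\<Sum>i\<in>UNIV. g i * subst sz (X (Inl i))) = (\<Sum>i\<in>UNIV. if i = j then D * subst sz (X (Inl j)) else 0)"
        by (rule sum.cong) (auto simp: Dg(3))
      then have e: "D * subst sz (X (Inl j)) = w (\<lambda>a. cj (X a))" using w(2)[OF that] by simp
      show "(LL k ^^ K) (D * subst sz (X (Inl j))) = 0" unfolding e by (rule K)
    qed
    then show ?thesis by blast
  qed
  show ?thesis
  proof (cases a)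
    case (Inl j)
    then show ?thesis using inl by simp
  next
    case (Inr l)
    obtain K where K: "\<And>j X. tang X \<Longrightarrow> (LL k ^^ K j) (subst sz (X (Inl j))) = 0"
      using inl by metis
    have "\<exists>L. (LL k ^^ L) (RR l j) = 0" for j using LL_nil by blast
    then obtain L where L: "\<And>j. (LL k ^^ L j) (RR l j) = 0" by metis
    obtain h where h: "Om (h l)" "\<And>X. tang X \<Longrightarrow> HH X l = h l (\<lambda>a. cj (X a))" using HH_Om by blast
    obtain N where N: "\<And>Y. (LL k ^^ N) (h l Y) = 0" using Om_nil[OF h(1)] by blast
    define B where "B = N + (\<Sum>j\<in>UNIV. L j + K j)"
    have "(LL k ^^ B) (subst sz (X (Inr l))) = 0" if X: "tang X" for X
    proof -
      have s: "(LL k ^^ B) (\<Sum>j\<in>A. RR l j * subst sz (X (Inl j))) = 0" for A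
      proof (induction A rule: infinite_finite_induct)
        case (insert j A)
        have "(LL k ^^ (L j + K j)) (RR l j * subst sz (X (Inl j))) = 0"
          by (rule derivation_mult_nil[OF derivation_LL L K[OF X]])
        moreover have "L j + K j \<le> B" unfolding B_def by (rule trans_le_add2, rule member_le_sum) auto
        ultimately show ?case using insert derivation_funpow_zero_mono[OF derivation_LL]
          by (simp add: derivation_funpow_add[OF derivation_LL])
      qed (simp_all add: derivation_funpow_0[OF derivation_LL])
      have "(LL k ^^ B) (HH X l) = 0"
        using derivation_funpow_zero_mono[OF derivation_LL N, of B] h(2)[OF X] by (simp add: B_def)
      moreover have "subst sz (X (Inr l)) = HH X l + (\<Sum>j\<in>UNIV. RR l j * subst sz (X (Inl j)))"
        by (simp add: HH_def)
      ultimately show ?thesis using s by (simp add: derivation_funpow_add[OF derivation_LL])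
    qed
    then show ?thesis using Inr by blast
  qed
qed

end

lemma pf_zero_near_0:
  assumes "\<forall>\<^sub>F x in nhds 0. ev p x = 0"
  shows "p = 0"
proof (rule pf_eqI)
  fix x
  obtain q where q: "\<And>t. ev p (0 + t *s x) = poly q t" using polyfun_line[OF polyfun_ev] by metis
  have "((\<lambda>t::real. of_real t *s x) \<longlongrightarrow> of_real 0 *s x) (at_right 0)"
    unfolding vector_scalar_mult_def by (intro tendsto_intros)
  then have "filterlim (\<lambda>t::real. complex_of_real t *s x) (nhds 0) (at_right 0)" by (simp add: vec_eq_iff zero_vec_def[symmetric] vector_scalar_mult_def)
  then have "\<forall>\<^sub>F t in at_right (0::real). ev p (of_real t *s x) = 0"
    using assms by (rule eventually_compose_filterlim[rotated])
  then have "\<forall>\<^sub>F t in at_right (0::real). poly q (of_real t) = 0" using q by simp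
  then obtain b where b: "b > 0" "\<And>t::real. t > 0 \<Longrightarrow> t < b \<Longrightarrow> poly q (of_real t) = 0"
    unfolding eventually_at_right_field by auto
  have "complex_of_real ` {0<..<b} \<subseteq> {t. poly q t = 0}" using b by auto
  moreover have "infinite (complex_of_real ` {0<..<b})"
    using b(1) by (subst finite_image_iff) (auto simp: inj_on_def infinite_Ioo)
  ultimately have "infinite {t. poly q t = 0}" using infinite_super by blast
  then have "q = 0" using poly_roots_finite by blast
  then show "ev p x = ev 0 x" using q[of 1] by simp
qed

text \<open>The commutator of two first-order operators has order one, since second derivatives
  commute.\<close>

lemma pd_sum_form:
  "(\<Sum>v\<in>UNIV. a v * pd v (\<Sum>w\<in>UNIV. c w * pd w p)) - (\<Sum>v\<in>UNIV. c v * pd v (\<Sum>w\<in>UNIV. a w * pd w p))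
   = (\<Sum>w\<in>UNIV. ((\<Sum>v\<in>UNIV. a v * pd v (c w)) - (\<Sum>v\<in>UNIV. c v * pd v (a w))) * pd w p)"
proof -
  have "(\<Sum>v\<in>UNIV. \<Sum>w\<in>UNIV. a v * (c w * pd v (pd w p))) = (\<Sum>v\<in>UNIV. \<Sum>w\<in>UNIV. c v * (a w * pd v (pd w p)))"
    by (subst sum.swap) (simp add: pd_commute[of _ _ p] mult.left_commute)
  moreover have "(\<Sum>v\<in>UNIV. \<Sum>w\<in>UNIV. a v * (pd v (c w) * pd w p)) = (\<Sum>w\<in>UNIV. (\<Sum>v\<in>UNIV. a v * pd v (c w)) * pd w p)" for a c
    by (subst sum.swap) (simp add: sum_distrib_right mult.assoc)
  ultimately show ?thesis
    by (simp add: sum_distrib_left sum.distrib distrib_left left_diff_distrib sum_subtractf)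
qed

section \<open>Holomorphic nondegeneracy as full rank, and the bound on degrees\<close>

context cr_model
begin

lemma Zbar_free:
  assumes "\<And>k. pd (Zbar k) g = 0"
  shows "\<exists>q. g = subst sz q"
proof -
  define s :: "('n, 'd) crvar \<Rightarrow> ('n + 'd) pf" where
    "s v = (case v of Z i \<Rightarrow> var (Inl i) | Zbar i \<Rightarrow> 0 | U l \<Rightarrow> var (Inr l))" for v
  have "g = subst sz (subst s g)"
  proof (rule pf_eqI)
    fix x :: "complex ^ ('n, 'd) crvar"
    let ?y = "(\<chi> v. case v of Z i \<Rightarrow> x $ Z i | Zbar i \<Rightarrow> 0 | U l \<Rightarrow> x $ U l) :: complex ^ ('n, 'd) crvar"
    have y: "(\<chi> i. ev (s i) (\<chi> i. ev (sz i) x)) = ?y"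
      by (auto simp: vec_eq_crvar s_def sz_def)
    have "((\<lambda>t::real. ev g (?y + t *\<^sub>R (x - ?y))) has_derivative (\<lambda>t. 0)) (at t within {0..1})" for t
    proof -
      have l: "((\<lambda>t::real. ?y + t *\<^sub>R (x - ?y)) has_derivative (\<lambda>t. t *\<^sub>R (x - ?y))) (at t within {0..1})"
        by (auto intro!: derivative_eq_intros)
      have "((\<lambda>t::real. ev g (?y + t *\<^sub>R (x - ?y))) has_derivative
          (\<lambda>h. \<Sum>i\<in>UNIV. ev (pd i g) (?y + t *\<^sub>R (x - ?y)) * (h *\<^sub>R (x - ?y)) $ i)) (at t within {0..1})"
        by (rule has_derivative_compose[OF l ev_has_derivative])
      moreover have "(\<Sum>i\<in>UNIV. ev (pd i g) (?y + t *\<^sub>R (x - ?y)) * (h *\<^sub>R (x - ?y)) $ i) = 0" for h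
        by (simp add: sum_crvar assms)
      ultimately show ?thesis by simp
    qed
    then obtain c where "\<And>t. t \<in> {0..1} \<Longrightarrow> ev g (?y + t *\<^sub>R (x - ?y)) = c"
      using has_derivative_zero_constant[of "{0..1::real}" "\<lambda>t. ev g (?y + t *\<^sub>R (x - ?y))"] by auto
    from this[of 0] this[of 1] have "ev g x = ev g ?y" by simp
    then show "ev g x = ev (subst sz (subst s g)) x" by (simp add: y)
  qed
  then show ?thesis by blast
qed

lemma pd_Rset: "r \<in> Rset \<Longrightarrow> (\<lambda>j. pd (Zbar k) (r j)) \<in> Rset"
proof -
  assume "r \<in> Rset"
  then obtain v l where "v \<noteq> []" "r = (\<lambda>j. Dw v (RR l j))" unfolding Rset_def by blast
  then show ?thesis unfolding Rset_def by (intro CollectI exI[of _ "k # v"] exI[of _ l]) simp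
qed

text \<open>The kernel is stable under derivatives in \<zeta> because the set of rows is.
  Differentiating in one variable as long as some component survives makes that variable disappear;
  variables removed before stay absent, as derivatives commute.\<close>

lemma kernel_Zbar_free:
  assumes F: "F j0 \<noteq> 0" "\<And>r. r \<in> Rset \<Longrightarrow> (\<Sum>j\<in>UNIV. r j * F j) = 0" and "finite K"
  shows "\<exists>F. (\<exists>j. F j \<noteq> 0) \<and> (\<forall>r\<in>Rset. (\<Sum>j\<in>UNIV. r j * F j) = 0) \<and> (\<forall>k\<in>K. \<forall>j. pd (Zbar k) (F j) = 0)"
  using \<open>finite K\<close>
proof (induction K rule: finite_induct)
  case empty
  show ?case using F by (intro exI[of _ F]) auto
next
  case (insert k K)
  then obtain F where F: "\<exists>j. F j \<noteq> 0" "\<And>r. r \<in> Rset \<Longrightarrow> (\<Sum>j\<in>UNIV. r j * F j) = 0" "\<And>k j. k \<in> K \<Longrightarrow> pd (Zbar k) (F j) = 0"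
    by blast
  let ?D = "pd (Zbar k)"
  have rel: "r \<in> Rset \<Longrightarrow> (\<Sum>j\<in>UNIV. r j * (?D ^^ N) (F j)) = 0" for r N
  proof (induction N arbitrary: r)
    case (Suc N)
    have "?D (\<Sum>j\<in>UNIV. r j * (?D ^^ N) (F j)) = 0" unfolding Suc.IH[OF Suc.prems] by simp
    then have "(\<Sum>j\<in>UNIV. r j * (?D ^^ Suc N) (F j)) + (\<Sum>j\<in>UNIV. ?D (r j) * (?D ^^ N) (F j)) = 0"
      by (simp add: sum.distrib)
    then show ?case using Suc.IH[OF pd_Rset[OF Suc.prems]] by simp
  qed (use F in simp)
  have kill: "pd (Zbar i) ((?D ^^ N) (F j)) = 0" if "i \<in> K" for i N j
    by (induction N) (use F(3)[OF that] in \<open>auto simp: pd_commute[of "Zbar i"]\<close>)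
  have "\<exists>N. (?D ^^ N) (F j) = 0" for j by (rule pd_nil)
  then have "\<forall>j. \<exists>N. (?D ^^ N) (F j) = 0" by (intro allI)
  then obtain N where "\<forall>j. (?D ^^ N j) (F j) = 0" by (rule choice[THEN exE])
  then have N: "\<And>j. (?D ^^ N j) (F j) = 0" by (elim allE)
  have ex: "\<exists>M. \<forall>j. (?D ^^ M) (F j) = 0"
  proof (intro exI allI)
    fix j show "(?D ^^ (sum N UNIV)) (F j) = 0"
      by (rule derivation_funpow_zero_mono[OF derivation_pd N]) (simp add: member_le_sum)
  qed
  \<comment> \<open>The least power that kills all components; the power just below it is a nonzero
    kernel vector.\<close>
  define M where "M = (LEAST M. \<forall>j. (?D ^^ M) (F j) = 0)"
  have M: "\<forall>j. (?D ^^ M) (F j) = 0" unfolding M_def using ex by (rule LeastI_ex)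
  then obtain M' where M': "M = Suc M'" using F(1) by (cases M) auto
  then have nz: "\<not> (\<forall>j. (?D ^^ M') (F j) = 0)"
    using not_less_Least[of M' "\<lambda>M. \<forall>j. (?D ^^ M) (F j) = 0"] unfolding M_def by simp
  have "?D ((?D ^^ M') (F j)) = 0" for j using M M' by simp
  then show ?case using nz rel kill
    by (intro exI[of _ "\<lambda>j. (?D ^^ M') (F j)"]) auto
qed

definition pfield :: "('n + 'd \<Rightarrow> ('n + 'd) pf) \<Rightarrow> complex ^ ('n + 'd) \<Rightarrow> complex ^ ('n + 'd)" where
  "pfield X p = (\<chi> a. ev (X a) p)"

lemma pfield_nth [simp]: "pfield X p $ a = ev (X a) p" by (simp add: pfield_def)

lemma pfield_holomorphic: "holomorphic_map_on (pfield X) S"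
  unfolding holomorphic_map_on_def
proof
  fix p
  show "\<exists>L. (pfield X has_derivative L) (at p) \<and> (\<forall>c v. L (c *s v) = c *s L v)"
    by (intro exI[of _ "\<lambda>h. \<chi> a. \<Sum>i\<in>UNIV. ev (pd i (X a)) p * h $ i"] conjI has_derivative_vecI)
      (auto simp: ev_has_derivative vec_eq_iff sum_distrib_left mult.left_commute)
qed

lemma germ_pfield_0: "germ (pfield X) = 0 \<longleftrightarrow> (\<forall>a. X a = 0)"
proof
  assume "germ (pfield X) = 0"
  then have "\<forall>\<^sub>F p in nhds 0. pfield X p = 0"
    unfolding zero_germ_def germ.abs_eq_iff germ_eq_def by simp
  then have "\<forall>\<^sub>F p in nhds 0. ev (X a) p = 0" for a
    by eventually_elim (metis pfield_nth zero_index)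
  then show "\<forall>a. X a = 0" using pf_zero_near_0 by blast
next
  assume "\<forall>a. X a = 0"
  then show "germ (pfield X) = 0"
    unfolding zero_germ_def germ.abs_eq_iff germ_eq_def by (simp add: pfield_def zero_vec_def)
qed

text \<open>A kernel vector free of \<zeta> is the z-part of a holomorphic field. The matching
  w-part is free of \<zeta> too, because the kernel annihilates every derivative of
  \<open>RR\<close> in \<zeta>. This field would be complex tangent along the model and
  nonzero.\<close>

lemma nondegenerate_full:
  assumes "holomorphically_nondegenerate_at_0 MM"
  shows "\<exists>D g. D \<noteq> 0 \<and> lin Rset g \<and> (\<forall>i. g i = (if i = j then D else 0))"
proof (rule elimination[of Rset])
  fix F j0 assume "F j0 \<noteq> 0" "\<And>r. r \<in> Rset \<Longrightarrow> (\<Sum>j\<in>UNIV. r j * F j) = 0"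
  from kernel_Zbar_free[where K = UNIV, OF this finite]
  obtain F where F: "\<exists>j. F j \<noteq> 0" "\<And>r. r \<in> Rset \<Longrightarrow> (\<Sum>j\<in>UNIV. r j * F j) = 0" "\<And>k j. pd (Zbar k) (F j) = 0"
    by auto
  have "\<forall>j. \<exists>q. F j = subst sz q" using Zbar_free F(3) by blast
  then obtain f where f: "\<And>j. F j = subst sz (f j)" by metis
  have "pd (Zbar k) (\<Sum>j\<in>UNIV. RR l j * F j) = 0" for k l
  proof -
    have "(\<lambda>j. pd (Zbar k) (RR l j)) \<in> Rset"
      unfolding Rset_def by (intro CollectI exI[of _ "[k]"] exI[of _ l]) simp
    from F(2)[OF this] show ?thesis by (simp add: F(3))
  qed
  then have "\<forall>l. \<exists>q. (\<Sum>j\<in>UNIV. RR l j * F j) = subst sz q" using Zbar_free by blast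
  then obtain g where g: "\<And>l. (\<Sum>j\<in>UNIV. RR l j * F j) = subst sz (g l)" by metis
  define X where "X a = (case a of Inl j \<Rightarrow> f j | Inr l \<Rightarrow> g l)" for a
  have "pfield X p \<in> complex_tangent_space MM p" if p: "p \<in> MM" for p
    unfolding complex_tangent_MM[OF p]
  proof
    fix l
    have "ev (subst sz (g l)) (rp p) = (\<Sum>j\<in>UNIV. ev (RR l j) (rp p) * ev (subst sz (f j)) (rp p))"
      unfolding g[symmetric] f[symmetric] by simp
    then show "pfield X p $ Inr l = (\<Sum>j\<in>UNIV. ev (RR l j) (rp p) * pfield X p $ Inl j)"
      unfolding ev_sz_rp by (simp add: X_def)
  qed
  moreover have "germ (pfield X) \<noteq> 0"
  proof -
    obtain j where "F j \<noteq> 0" using F(1) by blast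
    then have "f j \<noteq> 0" using f[of j] by auto
    then have "X (Inl j) \<noteq> 0" by (simp add: X_def)
    then show ?thesis unfolding germ_pfield_0 by blast
  qed
  ultimately have "\<exists>X S. open S \<and> 0 \<in> S \<and> holomorphic_map_on X S \<and>
             (\<forall>p\<in>S \<inter> MM. X p \<in> complex_tangent_space MM p) \<and> germ X \<noteq> 0"
    by (intro exI[of _ "pfield X"] exI[of _ UNIV]) (auto simp: pfield_holomorphic)
  then show ?thesis using assms unfolding holomorphically_nondegenerate_at_0_def by blast
next
  assume "\<And>j. \<exists>D g. D \<noteq> 0 \<and> lin Rset g \<and> (\<forall>i. g i = (if i = j then D else 0))"
  then show ?thesis by blast
qed

lemma LL_form: "LL j p = (\<Sum>v\<in>UNIV. (case v of Z i \<Rightarrow> if i = j then 1 else 0 | Zbar i \<Rightarrow> 0 | U l \<Rightarrow> RR l j) * pd v p)"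
  by (simp add: LL_def sum_crvar if_distrib[of "\<lambda>c. c * _"] cong: if_cong)

lemma pd_form: "pd i p = (\<Sum>v\<in>UNIV. (if v = i then 1 else 0) * pd v p)"
  by (simp add: if_distrib[of "\<lambda>c. c * _"] cong: if_cong)

definition gens :: "(('n, 'd) crvar pf \<Rightarrow> ('n, 'd) crvar pf) set" where
  "gens = range LL \<union> range (\<lambda>k. pd (Zbar k))"

text \<open>Operators act entrywise on families of polynomials, so that one abstract vector can
  represent the components of all tangent fields.\<close>

definition lift_op :: "('a \<Rightarrow> 'a) \<Rightarrow> ('b \<Rightarrow> 'a) \<Rightarrow> 'b \<Rightarrow> 'a" where
  "lift_op T f = (\<lambda>x. T (f x))"

lemma gens_form:
  assumes "T \<in> gens"
  shows "\<exists>c. (\<forall>v. hom wt (int (wt v) - int 1) (c v)) \<and> T = (\<lambda>p. \<Sum>v\<in>UNIV. c v * pd v p)"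
proof -
  consider j where "T = LL j" | j where "T = pd (Zbar j)"
    using assms unfolding gens_def by auto
  then show ?thesis
  proof cases
    case (1 j)
    have "hom wt (int (wt v) - int 1) (case v of Z i \<Rightarrow> if i = j then 1 else 0 | Zbar i \<Rightarrow> 0 | U l \<Rightarrow> RR l j)" for v
      using hom_cst[of wt 1] hom_RR by (cases v) (auto simp: hom_def)
    moreover have "T = (\<lambda>p. \<Sum>v\<in>UNIV. (case v of Z i \<Rightarrow> if i = j then 1 else 0 | Zbar i \<Rightarrow> 0 | U l \<Rightarrow> RR l j) * pd v p)"
      unfolding 1 by (rule ext) (rule LL_form)
    ultimately show ?thesis by (intro exI conjI allI)
  next
    case (2 j)
    have "hom wt (int (wt v) - int 1) (if v = Zbar j then 1 else 0)" for v
      by (auto simp: hom_def)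
    moreover have "T = (\<lambda>p. \<Sum>v\<in>UNIV. (if v = Zbar j then 1 else 0) * pd v p)"
      unfolding 2 by (rule ext) (rule pd_form)
    ultimately show ?thesis by (intro exI conjI allI)
  qed
qed

text \<open>A bracket of length \<open>k\<close> is a first-order operator whose coefficients have
  lost \<open>k\<close> in degree. Beyond the largest weight the degrees are negative and the
  bracket vanishes, which is the nilpotency of the Lie algebra.\<close>

lemma liec_form:
  "liec (lift_op ` gens) k T \<Longrightarrow>
    \<exists>c. (\<forall>v. hom wt (int (wt v) - int k) (c v)) \<and>
        T = lift_op (\<lambda>p. \<Sum>v\<in>UNIV. c v * pd v p)"
  for T :: "('b \<Rightarrow> ('n, 'd) crvar pf) \<Rightarrow> ('b \<Rightarrow> ('n, 'd) crvar pf)"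
proof (induction rule: liec.induct)
  case (gen x)
  then obtain T where T: "T \<in> gens" "x = lift_op T" by blast
  from gens_form[OF T(1)] show ?case unfolding T(2) by (elim exE) (auto intro: arg_cong[where f = lift_op])
next
  case (brk x k T)
  obtain x' where x': "x' \<in> gens" "x = lift_op x'" using brk.hyps(1) by blast
  obtain a where a: "\<And>v. hom wt (int (wt v) - 1) (a v)" "x = lift_op (\<lambda>p. \<Sum>v\<in>UNIV. a v * pd v p)"
    using gens_form[OF x'(1)] x'(2) by auto
  obtain c where c: "\<And>v. hom wt (int (wt v) - int k) (c v)" "T = lift_op (\<lambda>p. \<Sum>v\<in>UNIV. c v * pd v p)"
    using brk.IH by blast
  define e where "e w = (\<Sum>v\<in>UNIV. a v * pd v (c w)) - (\<Sum>v\<in>UNIV. c v * pd v (a w))" for w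
  have "comm x T = lift_op (\<lambda>p. \<Sum>v\<in>UNIV. e v * pd v p)"
    unfolding comm_def a(2) c(2) lift_op_def e_def by (intro ext) (simp only: pd_sum_form minus_apply fun_diff_def)
  moreover have "hom wt (int (wt w) - int (Suc k)) (e w)" for w
  proof -
    have "hom wt (int (wt w) - int (Suc k)) (a v * pd v (c w))" for v
      using hom_mult[OF a(1)[of v] hom_pd[OF c(1)[of w], of v]] by (simp add: algebra_simps)
    moreover have "hom wt (int (wt w) - int (Suc k)) (c v * pd v (a w))" for v
      using hom_mult[OF c(1)[of v] hom_pd[OF a(1)[of w], of v]] by (simp add: algebra_simps)
    ultimately show ?thesis unfolding e_def by (intro hom_minus hom_sum)
  qed
  ultimately show ?case by blast
qed

definition wz :: "'n + 'd \<Rightarrow> nat" where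
  "wz a = (case a of Inl i \<Rightarrow> 1 | Inr l \<Rightarrow> m l)"

lemma wz_pos: "wz a > 0"
  using m2 by (cases a) (auto simp: wz_def intro: less_le_trans[of 0 2])

lemma hom_sz: assumes "hom wz \<sigma> q" shows "hom wt \<sigma> (subst sz q)"
proof (rule hom_subst[OF assms])
  show "hom wt (int (wz v)) (sz v)" for v
    using hom_var[of wt "Z _"] hom_var[of wt "U _"] by (cases v) (auto simp: wz_def sz_def)
qed

text \<open>A longest word that does not kill the component produces a polynomial annihilated by all
  generators, hence a constant. The same polynomial is a combination of values of words of length at
  most \<open>B\<close>. If the degree of the component exceeds \<open>B\<close>, those values have
  positive degree and vanish at 0, so the constant is 0.\<close>

theorem tang_weight_bounded:
  assumes full: "\<And>j. \<exists>D g. D \<noteq> 0 \<and> lin Rset g \<and> (\<forall>i. g i = (if i = j then D else 0))"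
    and minimal: "\<And>q. (\<And>k. LL k (subst sz q) = 0) \<Longrightarrow> \<exists>c. q = cst c"
  shows "\<exists>B. \<forall>X a \<sigma>. tang X \<longrightarrow> hom wz \<sigma> (X a) \<longrightarrow> X a \<noteq> 0 \<longrightarrow> \<sigma> \<le> int B"
proof -
  define TS where "TS = {subst sz (X a) | X a. tang X}"
  \<comment> \<open>The family of all components, indexed by the components themselves. It is 0 off
    \<open>TS\<close>, so a power that kills every member of \<open>TS\<close> kills
    \<open>f\<close>.\<close>
  define f where "f g = (if g \<in> TS then g else 0)" for g
  \<comment> \<open>The sum of the weights bounds each of them, so longer brackets have coefficients
    of negative degree.\<close>
  let ?s = "\<Sum>v\<in>UNIV. wt v"
  let ?X = "lift_op ` gens :: ((('n, 'd) crvar pf \<Rightarrow> ('n, 'd) crvar pf) \<Rightarrow> ('n, 'd) crvar pf \<Rightarrow> ('n, 'd) crvar pf) set"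
  interpret nilpotent_operators ?X ?s f
  proof (rule nilpotent_operators.intro)
    show "finite (?X)" by (simp add: gens_def)
    fix x assume "x \<in> ?X"
    then obtain T where T: "T \<in> gens" "x = lift_op T" by blast
    then have "linear T" using linear_LL linear_pd unfolding gens_def by blast
    then show "linear x" unfolding T by (auto simp: lift_op_def linear_iff fun_eq_iff)
    have pw: "(x ^^ K) \<phi> = (\<lambda>g. (T ^^ K) (\<phi> g))" for K \<phi>
      unfolding T by (induction K) (auto simp: lift_op_def)
    consider k where "T = LL k" | k where "T = pd (Zbar k)" using T(1) unfolding gens_def by blast
    then have "\<exists>K. \<forall>g\<in>TS. (T ^^ K) g = 0"
    proof cases
      case (1 k)
      obtain K where K: "\<And>a X. tang X \<Longrightarrow> (LL k ^^ K a) (subst sz (X a)) = 0"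
        using tang_nil[OF full] by metis
      have "(LL k ^^ (\<Sum>a\<in>UNIV. K a)) (subst sz (X a)) = 0" if "tang X" for X a
        by (rule derivation_funpow_zero_mono[OF derivation_LL K[OF that]]) (simp add: member_le_sum)
      then show ?thesis unfolding TS_def 1 by blast
    next
      case (2 k)
      show ?thesis unfolding TS_def 2 by (rule exI[of _ 1]) (auto simp: pd_Zbar_sz)
    qed
    then obtain K where K: "\<And>g. g \<in> TS \<Longrightarrow> (T ^^ K) g = 0" by blast
    have "(T ^^ K) 0 = 0" using linear_0[OF linear_funpow[OF \<open>linear T\<close>]] .
    then have "(x ^^ K) f = 0" unfolding pw using K by (auto simp: f_def fun_eq_iff)
    then show "\<exists>K. (x ^^ K) f = 0" by blast
  next
    fix k T assume T: "liec (?X) k T" and k: "k > ?s"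
    obtain c where c: "\<And>v. hom wt (int (wt v) - int k) (c v)" "T = lift_op (\<lambda>p. \<Sum>v\<in>UNIV. c v * pd v p)"
      using liec_form[OF T] by blast
    have "c v = 0" for v
    proof (rule hom_neg_zero[OF c(1) _ wt_pos])
      have "wt v \<le> ?s" by (rule member_le_sum) auto
      then show "int (wt v) - int k < 0" using k by simp
    qed
    then show "T = 0" unfolding c(2) by (auto simp: lift_op_def fun_eq_iff)
  qed
  obtain B where B: "\<And>ws. set ws \<subseteq> ?X \<Longrightarrow> act ws f \<in> span {act vs f | vs. set vs \<subseteq> ?X \<and> length vs \<le> B}"
    using act_bounded by blast
  have "\<sigma> \<le> int B" if X: "tang X" and h: "hom wz \<sigma> (X a)" and nz: "X a \<noteq> 0" for X a \<sigma>
  proof (rule ccontr)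
    assume s: "\<not> \<sigma> \<le> int B"
    define q where "q = subst sz (X a)"
    have qS: "q \<in> TS" unfolding q_def TS_def using X by blast
    have qnz: "q \<noteq> 0"
    proof
      assume q0: "q = 0"
      have "ev (X a) x = 0" for x
      proof -
        have "ev q (rp x) = 0" using q0 by simp
        then show ?thesis unfolding q_def ev_sz_rp .
      qed
      then show False using nz pf_eqI[of "X a" 0] by simp
    qed
    have homw: "set ws \<subseteq> ?X \<Longrightarrow> hom wt (\<sigma> - int (length ws)) (act ws f q)" for ws
    proof (induction ws)
      case Nil
      then show ?case using qS hom_sz[OF h] by (simp add: f_def q_def)
    next
      case (Cons x ws)
      then obtain T where T: "T \<in> gens" "x = lift_op T" by auto
      have "hom wt (\<sigma> - int (length ws) - 1) (T (act ws f q))"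
        using T(1) hom_LL hom_DD Cons unfolding gens_def by auto
      then show ?case by (simp add: T(2) lift_op_def algebra_simps)
    qed
    define LS where "LS = {length ws | ws. set ws \<subseteq> ?X \<and> act ws f q \<noteq> 0}"
    have "LS \<subseteq> {..nat \<sigma>}"
    proof
      fix n assume "n \<in> LS"
      then obtain ws where ws: "n = length ws" "set ws \<subseteq> ?X" "act ws f q \<noteq> 0" unfolding LS_def by blast
      then have "\<not> \<sigma> - int (length ws) < 0" using hom_neg_zero[OF homw[OF ws(2)] _ wt_pos] by blast
      then show "n \<in> {..nat \<sigma>}" using ws(1) by auto
    qed
    then have fin: "finite LS" using finite_subset by blast
    have "0 \<in> LS" unfolding LS_def using qnz qS by (intro CollectI exI[of _ "[]"]) (simp add: f_def)
    then have "Max LS \<in> LS" using fin by (intro Max_in) auto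
    then obtain ws where ws: "Max LS = length ws" "set ws \<subseteq> ?X" "act ws f q \<noteq> 0" unfolding LS_def by blast
    define g where "g = act ws f q"
    have kill: "T g = 0" if "T \<in> gens" for T
    proof (rule ccontr)
      assume "T g \<noteq> 0"
      then have "act (lift_op T # ws) f q \<noteq> 0" by (simp add: g_def lift_op_def)
      then have "length (lift_op T # ws) \<in> LS" unfolding LS_def using that ws(2)
        by (intro CollectI exI[of _ "lift_op T # ws"]) auto
      then have "length (lift_op T # ws) \<le> Max LS" using fin by simp
      then show False using ws(1) by simp
    qed
    have "pd (Zbar k) g = 0" for k using kill unfolding gens_def by blast
    then obtain g' where g': "g = subst sz g'" using Zbar_free by blast
    have "LL k (subst sz g') = 0" for k using kill g' unfolding gens_def by blast
    then obtain c where "g' = cst c" using minimal by blast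
    then have gc: "g = cst c" using g' by simp
    have "ev g 0 = 0"
    proof -
      \<comment> \<open>The expansion into bounded words is an identity between families; here it is
        evaluated at the entry \<open>q\<close>.\<close>
      have "act ws f q \<in> {p. ev p 0 = 0}"
      proof (rule span_linear_image[OF linear_eval B[OF ws(2)]])
        show "subspace {p :: ('n, 'd) crvar pf. ev p 0 = 0}" by (auto simp: subspace_def)
        fix y assume "y \<in> {act vs f |vs. set vs \<subseteq> ?X \<and> length vs \<le> B}"
        then obtain vs where vs: "y = act vs f" "set vs \<subseteq> ?X" "length vs \<le> B" by blast
        have "ev (act vs f q) 0 = 0"
          by (rule hom_pos_zero[OF homw[OF vs(2)] _ wt_pos]) (use s vs(3) in simp)
        then show "y q \<in> {p. ev p 0 = 0}" using vs(1) by simp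
      qed
      then show ?thesis by (simp add: g_def)
    qed
    then have "g = 0" using gc by (intro pf_eqI) simp
    then show False using ws(3) by (simp add: g_def)
  qed
  then show ?thesis by blast
qed

end

section \<open>Brackets of tangent fields and finite type\<close>

lemma frechet_derivative_cong_open:
  assumes "open S" "x \<in> S" "\<And>y. y \<in> S \<Longrightarrow> f y = g y"
  shows "frechet_derivative f (at x) = frechet_derivative g (at x)"
proof -
  have "(f has_derivative L) (at x) \<longleftrightarrow> (g has_derivative L) (at x)" for L
    using assms by (metis has_derivative_transform_within_open)
  then show ?thesis by (simp add: frechet_derivative_def)
qed

lemma Ck_on_cong:
  "open S \<Longrightarrow> (\<And>x. x \<in> S \<Longrightarrow> f x = g x) \<Longrightarrow> Ck_on k f S \<Longrightarrow> Ck_on k g S"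
proof (induction k arbitrary: f g)
  case 0
  then show ?case by (simp cong: continuous_on_cong)
next
  case (Suc k)
  have d: "g differentiable (at x)" if "x \<in> S" for x
  proof -
    obtain L where "(f has_derivative L) (at x)" using Suc.prems(3) \<open>x \<in> S\<close> by (auto simp: differentiable_def)
    then have "(g has_derivative L) (at x)"
      by (rule has_derivative_transform_within_open[OF _ Suc.prems(1) \<open>x \<in> S\<close> Suc.prems(2)])
    then show ?thesis by (auto simp: differentiable_def)
  qed
  have "Ck_on k (\<lambda>x. frechet_derivative g (at x) v) S" for v
  proof (rule Suc.IH[OF Suc.prems(1)])
    show "Ck_on k (\<lambda>x. frechet_derivative f (at x) v) S" using Suc.prems(3) by simp
    fix x assume "x \<in> S"
    then show "frechet_derivative f (at x) v = frechet_derivative g (at x) v"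
      using frechet_derivative_cong_open[OF Suc.prems(1) _ Suc.prems(2)] by simp
  qed
  then show ?case using d by simp
qed

lemma Ck_on_Suc_D: "Ck_on (Suc k) f S \<Longrightarrow> Ck_on k f S"
proof (induction k arbitrary: f)
  case 0
  then show ?case
    by (auto intro!: continuous_at_imp_continuous_on differentiable_imp_continuous_within)
next
  case (Suc k)
  then show ?case by simp
qed

lemma Ck_on_subset: "Ck_on k f S \<Longrightarrow> T \<subseteq> S \<Longrightarrow> Ck_on k f T"
  by (induction k arbitrary: f) (auto intro: continuous_on_subset)

lemma Ck_on_add:
  "open S \<Longrightarrow> Ck_on k f S \<Longrightarrow> Ck_on k g S \<Longrightarrow> Ck_on k (\<lambda>x. f x + g x) S"
proof (induction k arbitrary: f g)
  case 0
  then show ?case by (simp add: continuous_on_add)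
next
  case (Suc k)
  have D: "((\<lambda>x. f x + g x) has_derivative (\<lambda>v. frechet_derivative f (at x) v + frechet_derivative g (at x) v)) (at x)" if "x \<in> S" for x
    using Suc.prems that by (intro has_derivative_add) (auto simp: frechet_derivative_works)
  have "Ck_on k (\<lambda>x. frechet_derivative (\<lambda>x. f x + g x) (at x) v) S" for v
  proof (rule Ck_on_cong[OF Suc.prems(1)])
    show "Ck_on k (\<lambda>x. frechet_derivative f (at x) v + frechet_derivative g (at x) v) S"
      using Suc by simp
    fix x assume "x \<in> S"
    then show "frechet_derivative f (at x) v + frechet_derivative g (at x) v = frechet_derivative (\<lambda>x. f x + g x) (at x) v"
      using fun_cong[OF frechet_derivative_at[OF D], of x v] by simp
  qed
  moreover have "(\<lambda>x. f x + g x) differentiable (at x)" if "x \<in> S" for x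
    using D[OF that] by (auto simp: differentiable_def)
  ultimately show ?case by simp
qed

lemma Ck_on_const: "Ck_on k (\<lambda>x. c) S"
proof (induction k arbitrary: c)
  case (Suc k)
  have "frechet_derivative (\<lambda>x. c) (at x) = (\<lambda>v. 0)" for x :: 'a
    by (simp add: frechet_derivative_const)
  then show ?case using Suc[of 0] by simp
qed simp

lemma Ck_on_sum: "open S \<Longrightarrow> (\<And>i. i \<in> A \<Longrightarrow> Ck_on k (f i) S) \<Longrightarrow> Ck_on k (\<lambda>x. \<Sum>i\<in>A. f i x) S"
  by (induction A rule: infinite_finite_induct) (simp_all add: Ck_on_const Ck_on_add)

lemma Ck_on_bilinear:
  assumes B: "bounded_bilinear B" and S: "open S"
  shows "Ck_on k f S \<Longrightarrow> Ck_on k g S \<Longrightarrow> Ck_on k (\<lambda>x. B (f x) (g x)) S"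
proof (induction k arbitrary: f g)
  case 0
  then show ?case by (simp add: bounded_bilinear.continuous_on[OF B])
next
  case (Suc k)
  have D: "((\<lambda>x. B (f x) (g x)) has_derivative (\<lambda>v. B (f x) (frechet_derivative g (at x) v) + B (frechet_derivative f (at x) v) (g x))) (at x)"
    if "x \<in> S" for x
    using Suc.prems that by (intro bounded_bilinear.FDERIV[OF B]) (auto simp: frechet_derivative_works)
  have "Ck_on k (\<lambda>x. frechet_derivative (\<lambda>x. B (f x) (g x)) (at x) v) S" for v
  proof (rule Ck_on_cong[OF S])
    show "Ck_on k (\<lambda>x. B (f x) (frechet_derivative g (at x) v) + B (frechet_derivative f (at x) v) (g x)) S"
      by (intro Ck_on_add[OF S] Suc.IH Ck_on_Suc_D[OF Suc.prems(1)] Ck_on_Suc_D[OF Suc.prems(2)])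
        (use Suc.prems in simp_all)
    fix x assume "x \<in> S"
    then show "B (f x) (frechet_derivative g (at x) v) + B (frechet_derivative f (at x) v) (g x)
       = frechet_derivative (\<lambda>x. B (f x) (g x)) (at x) v"
      using fun_cong[OF frechet_derivative_at[OF D], of x v] by simp
  qed
  moreover have "(\<lambda>x. B (f x) (g x)) differentiable (at x)" if "x \<in> S" for x
    using D[OF that] by (auto simp: differentiable_def)
  ultimately show ?case by simp
qed

lemma Ck_on_linear:
  assumes L: "bounded_linear L" and S: "open S"
  shows "Ck_on k f S \<Longrightarrow> Ck_on k (\<lambda>x. L (f x)) S"
proof (induction k arbitrary: f)
  case 0
  then show ?case by (simp add: bounded_linear.continuous_on[OF L])
next
  case (Suc k)
  have D: "((\<lambda>x. L (f x)) has_derivative (\<lambda>v. L (frechet_derivative f (at x) v))) (at x)"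
    if "x \<in> S" for x
    using Suc.prems that by (intro bounded_linear.has_derivative[OF L]) (auto simp: frechet_derivative_works)
  have "Ck_on k (\<lambda>x. frechet_derivative (\<lambda>x. L (f x)) (at x) v) S" for v
  proof (rule Ck_on_cong[OF S])
    show "Ck_on k (\<lambda>x. L (frechet_derivative f (at x) v)) S" using Suc by simp
    fix x assume "x \<in> S"
    then show "L (frechet_derivative f (at x) v) = frechet_derivative (\<lambda>x. L (f x)) (at x) v"
      using fun_cong[OF frechet_derivative_at[OF D], of x v] by simp
  qed
  moreover have "(\<lambda>x. L (f x)) differentiable (at x)" if "x \<in> S" for x
    using D[OF that] by (auto simp: differentiable_def)
  ultimately show ?case by simp
qed

lemma linear_Basis_expansion:
  fixes L :: "'a::euclidean_space \<Rightarrow> 'b::real_vector"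
  assumes "linear L"
  shows "L x = (\<Sum>b\<in>Basis. (x \<bullet> b) *\<^sub>R L b)"
proof -
  have "L x = L (\<Sum>b\<in>Basis. (x \<bullet> b) *\<^sub>R b)" by (simp add: euclidean_representation)
  then show ?thesis by (simp add: linear_sum[OF assms] linear_scale[OF assms])
qed

text \<open>\<open>Ck_on\<close> differentiates in fixed directions, whereas the bracket
  differentiates in the varying direction \<open>X p\<close>; expanding this direction in a basis
  separates the two.\<close>

lemma Ck_on_lie_bracket:
  fixes X Y :: "'a::euclidean_space \<Rightarrow> 'a"
  assumes S: "open S" and "\<And>k. Ck_on k X S" "\<And>k. Ck_on k Y S"
  shows "Ck_on k (lie_bracket X Y) S"
proof (rule Ck_on_cong[OF S])
  have *: "Ck_on k (\<lambda>p. \<Sum>b\<in>Basis. (X p \<bullet> b) *\<^sub>R frechet_derivative Y (at p) b) S"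
    if "\<And>k. Ck_on k X S" "\<And>k. Ck_on k Y S" for X Y :: "'a \<Rightarrow> 'a"
  proof (intro Ck_on_sum[OF S] Ck_on_bilinear[OF bounded_bilinear_scaleR S])
    fix b
    show "Ck_on k (\<lambda>p. X p \<bullet> b) S" by (rule Ck_on_linear[OF bounded_linear_inner_left S that(1)])
    show "Ck_on k (\<lambda>p. frechet_derivative Y (at p) b) S" using that(2)[of "Suc k"] by simp
  qed
  show "Ck_on k (\<lambda>p. (\<Sum>b\<in>Basis. (X p \<bullet> b) *\<^sub>R frechet_derivative Y (at p) b)
     + (-1) *\<^sub>R (\<Sum>b\<in>Basis. (Y p \<bullet> b) *\<^sub>R frechet_derivative X (at p) b)) S"
    by (intro Ck_on_add[OF S] * assms Ck_on_linear[OF bounded_linear_scaleR_right S])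
  fix p assume p: "p \<in> S"
  have "linear (frechet_derivative Y (at p))" "linear (frechet_derivative X (at p))"
    using assms(2,3)[of 1] p by (auto simp: linear_frechet_derivative)
  then show "(\<Sum>b\<in>Basis. (X p \<bullet> b) *\<^sub>R frechet_derivative Y (at p) b)
     + (-1) *\<^sub>R (\<Sum>b\<in>Basis. (Y p \<bullet> b) *\<^sub>R frechet_derivative X (at p) b) = lie_bracket X Y p"
    by (simp add: lie_bracket_def linear_Basis_expansion[symmetric])
qed

lemma tangent_kill:
  fixes g :: "'a::real_normed_vector \<Rightarrow> 'b::real_normed_vector"
  assumes g: "(g has_derivative g') (at p)" and z: "\<And>q. q \<in> S \<inter> M \<Longrightarrow> g q = 0" and S: "open S" "p \<in> S"
    and v: "v \<in> tangent_space M p"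
  shows "g' v = 0"
proof -
  obtain \<gamma> where \<gamma>: "\<gamma> 0 = p" "(\<gamma> has_vector_derivative v) (at 0)" "\<forall>\<^sub>F t in nhds (0::real). \<gamma> t \<in> M"
    using v unfolding tangent_space_def by blast
  have "((\<lambda>t. g (\<gamma> t)) has_derivative (\<lambda>t. g' (t *\<^sub>R v))) (at 0)"
    using \<gamma>(2) g unfolding has_vector_derivative_def \<gamma>(1)[symmetric] by (rule has_derivative_compose)
  then have 1: "((\<lambda>t. g (\<gamma> t)) has_vector_derivative g' v) (at 0)"
    unfolding has_vector_derivative_def linear_scale[OF has_derivative_linear[OF g]] .
  have "isCont \<gamma> 0" using \<gamma>(2) has_vector_derivative_continuous by blast
  then have "(\<gamma> \<longlongrightarrow> \<gamma> 0) (nhds 0)" unfolding isCont_def tendsto_at_iff_tendsto_nhds .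
  then have "(\<gamma> \<longlongrightarrow> p) (nhds 0)" using \<gamma>(1) by simp
  then have "\<forall>\<^sub>F t in nhds 0. \<gamma> t \<in> S" using S by (rule topological_tendstoD)
  then have 2: "\<forall>\<^sub>F t in nhds 0. g (\<gamma> t) = 0"
    using \<gamma>(3) by eventually_elim (use z in blast)
  have "((\<lambda>t::real. 0::'b) has_vector_derivative 0) (at 0)" by (rule has_vector_derivative_const)
  from has_vector_derivative_unique_eventually[OF 1 this 2] show ?thesis .
qed

text \<open>Real polynomial functions of a point become polynomials in the point and its conjugate,
  so their higher derivatives stay within the calculus of \<open>pf\<close>.\<close>

definition dbl :: "complex ^ 'a \<Rightarrow> complex ^ ('a::finite + 'a)" where
  "dbl p = (\<chi> a. case a of Inl a \<Rightarrow> p $ a | Inr a \<Rightarrow> cnj (p $ a))"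

lemma dbl_nth [simp]: "dbl p $ Inl a = p $ a" "dbl p $ Inr a = cnj (p $ a)"
  by (simp_all add: dbl_def)

lemma linear_dbl: "linear dbl"
  by (rule linearI) (auto simp: vec_eq_Plus vector_scaleR_component)

definition dir :: "('a::finite + 'a) pf \<Rightarrow> complex ^ 'a \<Rightarrow> complex ^ 'a \<Rightarrow> complex" where
  "dir Q p v = (\<Sum>a\<in>UNIV. ev (pd a Q) (dbl p) * dbl v $ a)"

lemma dir_has_derivative: "((\<lambda>p. ev Q (dbl p)) has_derivative dir Q p) (at p)"
  unfolding dir_def
  by (rule has_derivative_compose[OF linear_imp_has_derivative[OF linear_dbl] ev_has_derivative])

lemma linear_dir: "linear (dir Q p)"
  using dir_has_derivative has_derivative_linear by blast

lemma dir_field_has_derivative: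
  assumes "(Y has_derivative Y') (at p)"
  shows "((\<lambda>q. dir Q q (Y q)) has_derivative
    (\<lambda>u. (\<Sum>a\<in>UNIV. \<Sum>b\<in>UNIV. ev (pd b (pd a Q)) (dbl p) * dbl u $ b * dbl (Y p) $ a) + dir Q p (Y' u))) (at p)"
proof -
  have 1: "((\<lambda>q. dbl (Y q) $ a) has_derivative (\<lambda>u. dbl (Y' u) $ a)) (at p)" for a
    by (intro bounded_linear.has_derivative[OF bounded_linear_vec_nth]
        has_derivative_compose[OF assms linear_imp_has_derivative[OF linear_dbl]])
  have "((\<lambda>q. \<Sum>a\<in>UNIV. ev (pd a Q) (dbl q) * dbl (Y q) $ a) has_derivative
    (\<lambda>u. \<Sum>a\<in>UNIV. ev (pd a Q) (dbl p) * dbl (Y' u) $ a + dir (pd a Q) p u * dbl (Y p) $ a)) (at p)"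
    by (intro has_derivative_sum has_derivative_mult dir_has_derivative 1)
  moreover have "(\<lambda>q. \<Sum>a\<in>UNIV. ev (pd a Q) (dbl q) * dbl (Y q) $ a) = (\<lambda>q. dir Q q (Y q))"
    by (simp add: dir_def)
  ultimately have "((\<lambda>q. dir Q q (Y q)) has_derivative
    (\<lambda>u. \<Sum>a\<in>UNIV. ev (pd a Q) (dbl p) * dbl (Y' u) $ a + dir (pd a Q) p u * dbl (Y p) $ a)) (at p)"
    by simp
  then show ?thesis
    by (rule has_derivative_eq_rhs) (simp add: dir_def sum.distrib sum_distrib_right add.commute)
qed

text \<open>\<open>dir Q q (Y q)\<close> is known to vanish only on \<open>M\<close>, which suffices
  to differentiate it along the tangent vector \<open>X p\<close>. In the difference of the two
  resulting equations the second derivatives of \<open>Q\<close> cancel by symmetry.\<close>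

lemma bracket_kill:
  assumes XY: "X differentiable (at p)" "Y differentiable (at p)" and S: "open S" "p \<in> S"
    and k: "\<And>q. q \<in> S \<inter> M \<Longrightarrow> dir Q q (X q) = 0" "\<And>q. q \<in> S \<inter> M \<Longrightarrow> dir Q q (Y q) = 0"
    and t: "X p \<in> tangent_space M p" "Y p \<in> tangent_space M p"
  shows "dir Q p (lie_bracket X Y p) = 0"
proof -
  have DX: "(X has_derivative frechet_derivative X (at p)) (at p)" and DY: "(Y has_derivative frechet_derivative Y (at p)) (at p)"
    using XY by (simp_all add: frechet_derivative_works)
  have 1: "(\<Sum>a\<in>UNIV. \<Sum>b\<in>UNIV. ev (pd b (pd a Q)) (dbl p) * dbl (X p) $ b * dbl (Y p) $ a) + dir Q p (frechet_derivative Y (at p) (X p)) = 0"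
    by (rule tangent_kill[OF dir_field_has_derivative[OF DY] k(2) S t(1)])
  have 2: "(\<Sum>a\<in>UNIV. \<Sum>b\<in>UNIV. ev (pd b (pd a Q)) (dbl p) * dbl (Y p) $ b * dbl (X p) $ a) + dir Q p (frechet_derivative X (at p) (Y p)) = 0"
    by (rule tangent_kill[OF dir_field_has_derivative[OF DX] k(1) S t(2)])
  have "(\<Sum>a\<in>UNIV. \<Sum>b\<in>UNIV. ev (pd b (pd a Q)) (dbl p) * dbl (X p) $ b * dbl (Y p) $ a)
    = (\<Sum>a\<in>UNIV. \<Sum>b\<in>UNIV. ev (pd b (pd a Q)) (dbl p) * dbl (Y p) $ b * dbl (X p) $ a)"
    by (subst sum.swap) (simp add: pd_commute[of _ _ Q] mult.assoc mult.commute[of "dbl (X p) $ _"])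
  then show ?thesis using 1 2 unfolding lie_bracket_def linear_diff[OF linear_dir] by (simp add: add_eq_0_iff)
qed

section \<open>The model as a graph over (z, u), and functions annihilated by its tangent
  fields\<close>

context cr_model
begin

text \<open>The defining function \<open>Im w - P\<close> as a polynomial in a point and its
  conjugate; its derivative describes the tangent space.\<close>

definition Phi :: "'d \<Rightarrow> (('n + 'd) + ('n + 'd)) pf" where
  "Phi l = cst (1 / (2 * \<i>)) * (var (Inl (Inr l)) - var (Inr (Inr l)))
     - subst (\<lambda>v. case v of Z i \<Rightarrow> var (Inl (Inl i)) | Zbar i \<Rightarrow> var (Inr (Inl i))
          | U s \<Rightarrow> cst (1/2) * (var (Inl (Inr s)) + var (Inr (Inr s)))) (PP l)"

lemma ev_Phi: "ev (Phi l) (dbl p) = of_real (Im (p $ Inr l)) - ev (PP l) (eP p)"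
proof -
  have "(\<chi> i. ev (case i of Z i \<Rightarrow> var (Inl (Inl i)) | Zbar i \<Rightarrow> var (Inr (Inl i))
          | U s \<Rightarrow> cst (1/2) * (var (Inl (Inr s)) + var (Inr (Inr s)))) (dbl p)) = eP p"
    by (auto simp: vec_eq_crvar complex_eq_iff)
  then show ?thesis by (simp add: Phi_def complex_eq_iff)
qed

lemma dir_Phi: "dir (Phi l) p v = of_real (Im (v $ Inr l)) - DP l p v"
proof -
  have "((\<lambda>p. ev (Phi l) (dbl p)) has_derivative (\<lambda>v. of_real (Im (v $ Inr l)) - DP l p v)) (at p)"
    unfolding ev_Phi
    by (intro has_derivative_diff DP_has_derivative bounded_linear.has_derivative[OF bounded_linear_of_real]
        bounded_linear.has_derivative[OF bounded_linear_Im] bounded_linear.has_derivative[OF bounded_linear_vec_nth]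
        has_derivative_ident)
  from fun_cong[OF has_derivative_unique[OF dir_has_derivative this], of v] show ?thesis .
qed

lemma tangent_dir: "p \<in> MM \<Longrightarrow> v \<in> tangent_space MM p \<longleftrightarrow> (\<forall>l. dir (Phi l) p v = 0)"
  by (simp add: tangent_MM dir_Phi)

lemma tangent_bracket:
  assumes S: "open S" and X: "\<And>q. q \<in> S \<Longrightarrow> X differentiable (at q)" "\<And>q. q \<in> S \<inter> MM \<Longrightarrow> X q \<in> tangent_space MM q"
    and Y: "\<And>q. q \<in> S \<Longrightarrow> Y differentiable (at q)" "\<And>q. q \<in> S \<inter> MM \<Longrightarrow> Y q \<in> tangent_space MM q"
    and p: "p \<in> S \<inter> MM"
  shows "lie_bracket X Y p \<in> tangent_space MM p"
proof -
  have "dir (Phi l) p (lie_bracket X Y p) = 0" for l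
    by (rule bracket_kill[where M = MM, OF X(1) Y(1) S]) (use p X(2) Y(2) tangent_dir in auto)
  then show ?thesis using p tangent_dir by blast
qed

definition gr :: "(complex ^ 'n) \<times> (real ^ 'd) \<Rightarrow> complex ^ ('n + 'd)" where
  "gr x = (let e = (\<chi> v. case v of Z i \<Rightarrow> fst x $ i | Zbar i \<Rightarrow> cnj (fst x $ i) | U l \<Rightarrow> of_real (snd x $ l)) in
     (\<chi> a. case a of Inl i \<Rightarrow> fst x $ i | Inr l \<Rightarrow> of_real (snd x $ l) + \<i> * ev (PP l) e))"

definition eW :: "(complex ^ 'n) \<times> (real ^ 'd) \<Rightarrow> complex ^ ('n, 'd) crvar" where
  "eW x = (\<chi> v. case v of Z i \<Rightarrow> fst x $ i | Zbar i \<Rightarrow> cnj (fst x $ i) | U l \<Rightarrow> of_real (snd x $ l))"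

lemma eW_nth [simp]: "eW x $ Z i = fst x $ i" "eW x $ Zbar i = cnj (fst x $ i)" "eW x $ U l = of_real (snd x $ l)"
  by (simp_all add: eW_def)

lemma linear_eW: "linear eW"
  by (rule linearI) (auto simp: vec_eq_crvar vector_scaleR_component scaleR_conv_of_real[where 'a = complex])

lemma gr_nth [simp]: "gr x $ Inl i = fst x $ i" "gr x $ Inr l = of_real (snd x $ l) + \<i> * ev (PP l) (eW x)"
  by (simp_all add: gr_def eW_def Let_def)

lemma eW_eP: "eW x = eP (\<chi> a. case a of Inl i \<Rightarrow> fst x $ i | Inr l \<Rightarrow> of_real (snd x $ l))"
  by (simp add: vec_eq_crvar)

lemma PP_eW_real: "ev (PP l) (eW x) \<in> \<real>"
  unfolding eW_eP by (rule PP_real)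

lemma PP_eW_Im [simp]: "Im (ev (PP l) (eW x)) = 0"
  using PP_eW_real complex_is_Real_iff by blast

lemma PP_eW_Re [simp]: "of_real (Re (ev (PP l) (eW x))) = ev (PP l) (eW x)"
  by (simp add: complex_eq_iff)

lemma eP_gr [simp]: "eP (gr x) = eW x"
  by (auto simp: vec_eq_crvar)

lemma gr_MM: "gr x \<in> MM"
  unfolding mem_MM by simp

definition prj :: "complex ^ ('n + 'd) \<Rightarrow> (complex ^ 'n) \<times> (real ^ 'd)" where
  "prj p = (zpart p, upart p)"

lemma prj_nth [simp]: "fst (prj p) $ i = p $ Inl i" "snd (prj p) $ l = Re (p $ Inr l)"
  by (simp_all add: prj_def zpart_def upart_def)

lemma pair_vec_eq: "x = y \<longleftrightarrow> (\<forall>i. fst x $ i = fst y $ i) \<and> (\<forall>l. snd x $ l = snd y $ l)"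
  for x y :: "(complex ^ 'n) \<times> (real ^ 'd)"
  by (auto simp: prod_eq_iff vec_eq_iff)

lemma prj_gr [simp]: "prj (gr x) = x"
  by (simp add: pair_vec_eq)

lemma eW_prj [simp]: "eW (prj p) = eP p"
  by (simp add: vec_eq_crvar)

lemma gr_prj: "p \<in> MM \<Longrightarrow> gr (prj p) = p"
  by (auto simp: vec_eq_Plus mem_MM) (metis complex_eq)

lemma linear_prj: "linear prj"
  by (rule linearI) (auto simp: pair_vec_eq vector_scaleR_component)

lemma gr_has_derivative:
  "(gr has_derivative (\<lambda>w. \<chi> a. case a of Inl i \<Rightarrow> fst w $ i
      | Inr l \<Rightarrow> of_real (snd w $ l) + \<i> * (\<Sum>v\<in>UNIV. ev (pd v (PP l)) (eW x) * eW w $ v))) (at x)"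
proof (rule has_derivative_vecI)
  fix a :: "'n + 'd"
  show "((\<lambda>t. gr t $ a) has_derivative (\<lambda>w. (\<chi> a. case a of Inl i \<Rightarrow> fst w $ i
      | Inr l \<Rightarrow> of_real (snd w $ l) + \<i> * (\<Sum>v\<in>UNIV. ev (pd v (PP l)) (eW x) * eW w $ v)) $ a)) (at x)"
  proof (cases a)
    case (Inl i)
    have "((\<lambda>t :: (complex ^ 'n) \<times> (real ^ 'd). fst t $ i) has_derivative (\<lambda>w. fst w $ i)) (at x)"
      by (intro bounded_linear.has_derivative[OF bounded_linear_vec_nth] has_derivative_fst has_derivative_ident)
    then show ?thesis using Inl by simp
  next
    case (Inr l)
    have "((\<lambda>t :: (complex ^ 'n) \<times> (real ^ 'd). complex_of_real (snd t $ l) + \<i> * ev (PP l) (eW t)) has_derivative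
       (\<lambda>w. of_real (snd w $ l) + \<i> * (\<Sum>v\<in>UNIV. ev (pd v (PP l)) (eW x) * eW w $ v))) (at x)"
      by (intro has_derivative_add has_derivative_mult_right has_derivative_compose[OF linear_imp_has_derivative[OF linear_eW] ev_has_derivative]
          bounded_linear.has_derivative[OF bounded_linear_of_real] bounded_linear.has_derivative[OF bounded_linear_vec_nth]
          has_derivative_snd has_derivative_ident)
    then show ?thesis using Inr by simp
  qed
qed

definition Dgr :: "(complex ^ 'n) \<times> (real ^ 'd) \<Rightarrow> (complex ^ 'n) \<times> (real ^ 'd) \<Rightarrow> complex ^ ('n + 'd)" where
  "Dgr x w = (\<chi> a. case a of Inl i \<Rightarrow> fst w $ i
      | Inr l \<Rightarrow> of_real (snd w $ l) + \<i> * (\<Sum>v\<in>UNIV. ev (pd v (PP l)) (eW x) * eW w $ v))"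

lemma gr_has_Dgr: "(gr has_derivative Dgr x) (at x)"
  using gr_has_derivative unfolding Dgr_def .

lemma Dgr_tangent: "Dgr x w \<in> tangent_space MM (gr x)"
proof -
  have l: "((\<lambda>t::real. x + t *\<^sub>R w) has_derivative (\<lambda>t. t *\<^sub>R w)) (at 0)"
    by (auto intro!: derivative_eq_intros)
  have "((\<lambda>t::real. gr (x + t *\<^sub>R w)) has_derivative (\<lambda>t. Dgr (x + 0 *\<^sub>R w) (t *\<^sub>R w))) (at 0)"
    by (rule has_derivative_compose[OF l gr_has_Dgr])
  then have "((\<lambda>t::real. gr (x + t *\<^sub>R w)) has_vector_derivative Dgr x w) (at 0)"
    unfolding has_vector_derivative_def by (simp add: linear_scale[OF has_derivative_linear[OF gr_has_Dgr]])
  then show ?thesis unfolding tangent_space_def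
    by (intro CollectI exI[of _ "\<lambda>t. gr (x + t *\<^sub>R w)"]) (simp add: gr_MM)
qed

lemma prj_Dgr [simp]: "prj (Dgr x w) = w"
proof -
  have "((\<lambda>x. prj (gr x)) has_derivative (\<lambda>w. prj (Dgr x w))) (at x)"
    by (rule has_derivative_compose[OF gr_has_Dgr linear_imp_has_derivative[OF linear_prj]])
  then have "((\<lambda>x. x) has_derivative (\<lambda>w. prj (Dgr x w))) (at x)" by simp
  from fun_cong[OF has_derivative_unique[OF this has_derivative_ident], of w] show ?thesis .
qed

lemma tangent_prj_inj:
  assumes "p \<in> MM" "v \<in> tangent_space MM p" "v' \<in> tangent_space MM p" "prj v = prj v'"
  shows "v = v'"
proof -
  have e: "eP v = eP v'" using assms(4) by (metis eW_prj)
  have "DP l p v = DP l p v'" for l by (simp add: DP_def e)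
  then have "Im (v $ Inr l) = Im (v' $ Inr l)" for l
    using assms(2,3) tangent_MM[OF assms(1)] by (metis of_real_eq_iff)
  moreover have "v $ Inl i = v' $ Inl i" "Re (v $ Inr l) = Re (v' $ Inr l)" for i l
    using arg_cong[OF assms(4), of "\<lambda>x. fst x $ i"] arg_cong[OF assms(4), of "\<lambda>x. snd x $ l"] by simp_all
  ultimately show ?thesis by (simp add: vec_eq_Plus complex_eq_iff)
qed

lemma subspace_tangent: assumes "p \<in> MM" shows "subspace (tangent_space MM p)"
proof -
  have "tangent_space MM p = {v. \<forall>l. dir (Phi l) p v = 0}" using tangent_dir[OF assms] by blast
  then show ?thesis
    by (simp add: subspace_def linear_0[OF linear_dir] linear_add[OF linear_dir] linear_scale[OF linear_dir])
qed

lemma zero_MM: "0 \<in> MM"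
proof -
  have "ev (PP l) 0 = 0" for l
    by (rule hom_pos_zero[OF hom_PP _ wt_pos]) (use m2[of l] in simp)
  moreover have "eP 0 = (0 :: complex ^ ('n, 'd) crvar)" by (simp add: vec_eq_crvar)
  ultimately show ?thesis unfolding mem_MM by simp
qed

definition hq :: "('n + 'd) pf \<Rightarrow> (('n + 'd) + ('n + 'd)) pf" where
  "hq q = subst (\<lambda>a. var (Inl a)) q"

lemma dir_hq: "dir (hq q) p v = (\<Sum>a\<in>UNIV. ev (pd a q) p * v $ a)"
proof -
  have "(\<chi> a. ev (var (Inl a)) (dbl x)) = x" for x :: "complex ^ ('n + 'd)" by (simp add: vec_eq_iff)
  then have "ev (hq q) (dbl x) = ev q x" for x by (simp add: hq_def)
  then have "(\<lambda>x. ev (hq q) (dbl x)) = ev q" by auto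
  then have "(ev q has_derivative dir (hq q) p) (at p)" using dir_has_derivative[of "hq q" p] by simp
  from fun_cong[OF has_derivative_unique[OF this ev_has_derivative], of v] show ?thesis .
qed

text \<open>Along the model the fields \<open>LL j\<close> span the complex tangent directions, so a
  polynomial in (z, w) that they annihilate has zero derivative there.\<close>

lemma complex_tangent_kill:
  assumes LL: "\<And>k. LL k (subst sz q) = 0" and p: "p \<in> MM" and v: "v \<in> complex_tangent_space MM p"
  shows "dir (hq q) p v = 0"
proof -
  have v': "v $ Inr l = (\<Sum>j\<in>UNIV. ev (RR l j) (rp p) * v $ Inl j)" for l
    using v unfolding complex_tangent_MM[OF p] by blast
  have k: "ev (pd (Inl j) q) p + (\<Sum>l\<in>UNIV. ev (pd (Inr l) q) p * ev (RR l j) (rp p)) = 0" for j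
  proof -
    have z: "LL j (sz (Inl i)) = (if j = i then 1 else 0)" "LL j (sz (Inr l)) = RR l j" for i l
      by (simp_all add: sz_def)
    have "LL j (subst sz q) = subst sz (pd (Inl j) q) + (\<Sum>l\<in>UNIV. subst sz (pd (Inr l) q) * RR l j)"
      unfolding LL_subst sum_Plus_UNIV z by (simp add: if_distrib[of "\<lambda>c. _ * c"] cong: if_cong)
    from arg_cong[OF this, of "\<lambda>g. ev g (rp p)"] show ?thesis
      unfolding LL by (simp add: ev_sz_rp del: ev_subst)
  qed
  have "dir (hq q) p v = (\<Sum>j\<in>UNIV. ev (pd (Inl j) q) p * v $ Inl j) + (\<Sum>l\<in>UNIV. ev (pd (Inr l) q) p * (\<Sum>j\<in>UNIV. ev (RR l j) (rp p) * v $ Inl j))"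
    unfolding dir_hq sum_Plus_UNIV v' ..
  also have "(\<Sum>l\<in>UNIV. ev (pd (Inr l) q) p * (\<Sum>j\<in>UNIV. ev (RR l j) (rp p) * v $ Inl j))
     = (\<Sum>j\<in>UNIV. (\<Sum>l\<in>UNIV. ev (pd (Inr l) q) p * ev (RR l j) (rp p)) * v $ Inl j)"
    unfolding sum_distrib_left sum_distrib_right by (subst sum.swap) (simp add: mult.assoc)
  finally show ?thesis
    unfolding sum.distrib[symmetric] distrib_right[symmetric] k by simp
qed

text \<open>\<open>bracket_kill\<close> carries the vanishing from a field to its brackets. It needs
  the vanishing on the model near the point, so the induction keeps a neighbourhood, and smoothness
  of all orders keeps the next bracket differentiable.\<close>

lemma commutator_kill:
  assumes LL: "\<And>k. LL k (subst sz q) = 0"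
  shows "commutator MM k Y \<Longrightarrow> \<exists>S. open S \<and> 0 \<in> S \<and> (\<forall>k. Ck_on k Y S) \<and>
    (\<forall>p\<in>S \<inter> MM. Y p \<in> tangent_space MM p \<and> dir (hq q) p (Y p) = 0)"
proof (induction rule: commutator.induct)
  case (1 X)
  then obtain S where "open S" "0 \<in> S" "\<forall>k. Ck_on k X S" "\<forall>p\<in>S \<inter> MM. X p \<in> complex_tangent_space MM p"
    unfolding complex_tangent_sections_def by blast
  then show ?case using complex_tangent_kill[OF LL]
    by (intro exI[of _ S]) (auto simp: complex_tangent_space_def)
next
  case (2 X k Y)
  then obtain S where S: "open S" "0 \<in> S" "\<And>k. Ck_on k X S" "\<And>p. p \<in> S \<inter> MM \<Longrightarrow> X p \<in> complex_tangent_space MM p"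
    unfolding complex_tangent_sections_def by blast
  obtain T where T: "open T" "0 \<in> T" "\<And>k. Ck_on k Y T"
    "\<And>p. p \<in> T \<inter> MM \<Longrightarrow> Y p \<in> tangent_space MM p \<and> dir (hq q) p (Y p) = 0"
    using 2 by blast
  let ?S = "S \<inter> T"
  have o: "open ?S" "0 \<in> ?S" using S T by auto
  have C: "Ck_on k X ?S" "Ck_on k Y ?S" for k
    using Ck_on_subset[OF S(3)] Ck_on_subset[OF T(3)] by auto
  have d: "X differentiable (at p)" "Y differentiable (at p)" if "p \<in> ?S" for p
    using C[of 1] that by auto
  have X: "X p \<in> tangent_space MM p" "dir (hq q) p (X p) = 0" if "p \<in> ?S \<inter> MM" for p
    using S(4)[of p] that complex_tangent_kill[OF LL] by (auto simp: complex_tangent_space_def)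
  have "lie_bracket X Y p \<in> tangent_space MM p" "dir (hq q) p (lie_bracket X Y p) = 0" if p: "p \<in> ?S \<inter> MM" for p
  proof -
    show "lie_bracket X Y p \<in> tangent_space MM p"
      by (rule tangent_bracket[OF o(1) d(1) X(1) d(2) _ p]) (use T(4) in auto)
    show "dir (hq q) p (lie_bracket X Y p) = 0"
      by (rule bracket_kill[where M = MM, OF d o(1)]) (use T(4) X p in auto)
  qed
  then show ?case using o Ck_on_lie_bracket[OF o(1) C] by blast
qed

end

lemma poly_zero_if_zero_near_0:
  assumes "b > 0" "\<And>t::real. 0 < t \<Longrightarrow> t < b \<Longrightarrow> poly q (complex_of_real t) = 0"
  shows "q = 0"
proof -
  have "complex_of_real ` {0<..<b} \<subseteq> {t. poly q t = 0}" using assms(2) by auto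
  moreover have "infinite (complex_of_real ` {0<..<b})"
    using assms(1) by (subst finite_image_iff) (auto simp: inj_on_def infinite_Ioo)
  ultimately have "infinite {t. poly q t = 0}" using infinite_super by blast
  then show ?thesis using poly_roots_finite by blast
qed

lemma linear_near_id_surj:
  fixes A :: "'a::euclidean_space \<Rightarrow> 'a"
  assumes "linear A" "\<And>x. norm (A x - x) \<le> c * norm x" "c < 1"
  shows "surj A"
proof (rule linear_injective_imp_surjective[OF assms(1)])
  show "inj A"
    unfolding linear_injective_0[OF assms(1)]
  proof (intro allI impI)
    fix x assume "A x = 0"
    then have "norm x \<le> c * norm x" using assms(2)[of x] by simp
    then have "(1 - c) * norm x \<le> 0" by (simp add: algebra_simps)
    then show "x = 0" using assms(3) by (simp add: mult_le_0_iff)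
  qed
qed simp

context cr_model
begin

text \<open>In the parameters (z, u) the function is a polynomial along every real ray, and it
  vanishes for small times.\<close>

lemma pf_zero_near_0_MM:
  assumes e: "e > 0" and z: "\<And>x. x \<in> ball 0 e \<Longrightarrow> ev Q (rp (gr x)) = 0"
  shows "Q = 0"
proof (rule pf_zero_on_MM)
  fix p assume p: "p \<in> MM"
  define \<kappa> :: "('n, 'd) crvar \<Rightarrow> ('n, 'd) crvar pf" where
    "\<kappa> v = (case v of Z i \<Rightarrow> var (Z i) | Zbar i \<Rightarrow> var (Zbar i) | U l \<Rightarrow> var (U l) + cst \<i> * PP l)" for v
  have k: "(\<chi> v. ev (\<kappa> v) (eW x)) = rp (gr x)" for x
    by (auto simp: vec_eq_crvar \<kappa>_def)
  obtain r where r: "\<And>t. ev (subst \<kappa> Q) (0 + t *s eW (prj p)) = poly r t"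
    using polyfun_line[OF polyfun_ev] by metis
  have s: "of_real t *s eW x = eW (t *\<^sub>R x)" for t x
    by (auto simp: vec_eq_crvar vector_scaleR_component scaleR_conv_of_real[where 'a = complex])
  have "r = 0"
  proof (rule poly_zero_if_zero_near_0)
    show "e / (norm (prj p) + 1) > 0" using e by (intro divide_pos_pos add_nonneg_pos) auto
    fix t :: real assume t: "0 < t" "t < e / (norm (prj p) + 1)"
    have "t * norm (prj p) \<le> t * (norm (prj p) + 1)" using t by simp
    also have "\<dots> < e" using t by (simp add: pos_less_divide_eq add_nonneg_pos)
    finally have "t *\<^sub>R prj p \<in> ball 0 e" using t by simp
    then show "poly r (complex_of_real t) = 0" using z unfolding r[symmetric] by (simp add: s k del: eW_prj)
  qed
  then have "ev (subst \<kappa> Q) (0 + 1 *s eW (prj p)) = 0" using r[of 1] by simp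
  then show "ev Q (rp p) = 0" using gr_prj[OF p] by (simp add: k del: eW_prj)
qed

text \<open>Less than a commutator, but stable under linear combinations; continuity is what carries
  the spanning property from 0 to nearby points.\<close>

definition good_field :: "('n + 'd) pf \<Rightarrow> (complex ^ ('n + 'd) \<Rightarrow> complex ^ ('n + 'd)) \<Rightarrow> bool" where
  "good_field q Y \<longleftrightarrow> (\<exists>S. open S \<and> 0 \<in> S \<and> continuous_on S Y \<and>
    (\<forall>p\<in>S \<inter> MM. Y p \<in> tangent_space MM p \<and> dir (hq q) p (Y p) = 0))"

lemma good_field_subspace: "subspace {Y 0 | Y. good_field q Y}"
  unfolding subspace_def
proof (intro conjI ballI allI)
  have "good_field q (\<lambda>_. 0)"
    unfolding good_field_def
    by (intro exI[of _ UNIV]) (simp add: subspace_0[OF subspace_tangent] linear_0[OF linear_dir])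
  then show "0 \<in> {Y 0 | Y. good_field q Y}" by (intro CollectI exI[of _ "\<lambda>_. 0"]) simp
next
  fix x y assume "x \<in> {Y 0 | Y. good_field q Y}" "y \<in> {Y 0 | Y. good_field q Y}"
  then obtain X Y where XY: "x = X 0" "good_field q X" "y = Y 0" "good_field q Y" by blast
  obtain S where S: "open S" "0 \<in> S" "continuous_on S X" "\<And>p. p \<in> S \<inter> MM \<Longrightarrow> X p \<in> tangent_space MM p \<and> dir (hq q) p (X p) = 0"
    using XY(2) unfolding good_field_def by blast
  obtain T where T: "open T" "0 \<in> T" "continuous_on T Y" "\<And>p. p \<in> T \<inter> MM \<Longrightarrow> Y p \<in> tangent_space MM p \<and> dir (hq q) p (Y p) = 0"
    using XY(4) unfolding good_field_def by blast
  have "good_field q (\<lambda>p. X p + Y p)"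
    unfolding good_field_def
  proof (intro exI[of _ "S \<inter> T"] conjI ballI)
    show "continuous_on (S \<inter> T) (\<lambda>p. X p + Y p)"
      using S T by (intro continuous_on_add) (auto intro: continuous_on_subset)
    fix p assume p: "p \<in> S \<inter> T \<inter> MM"
    then show "X p + Y p \<in> tangent_space MM p" using S(4)[of p] T(4)[of p] by (intro subspace_add subspace_tangent) auto
    show "dir (hq q) p (X p + Y p) = 0" using p S(4)[of p] T(4)[of p] by (simp add: linear_add[OF linear_dir])
  qed (use S T in auto)
  then show "x + y \<in> {Y 0 | Y. good_field q Y}" unfolding XY by (intro CollectI exI[of _ "\<lambda>p. X p + Y p"]) simp
next
  fix c :: real and x assume "x \<in> {Y 0 | Y. good_field q Y}"
  then obtain X where X: "x = X 0" "good_field q X" by blast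
  obtain S where S: "open S" "0 \<in> S" "continuous_on S X" "\<And>p. p \<in> S \<inter> MM \<Longrightarrow> X p \<in> tangent_space MM p \<and> dir (hq q) p (X p) = 0"
    using X(2) unfolding good_field_def by blast
  have "good_field q (\<lambda>p. c *\<^sub>R X p)"
    unfolding good_field_def
  proof (intro exI[of _ S] conjI ballI)
    show "continuous_on S (\<lambda>p. c *\<^sub>R X p)" using S by (intro continuous_intros)
    fix p assume p: "p \<in> S \<inter> MM"
    then show "c *\<^sub>R X p \<in> tangent_space MM p" using S(4)[of p] by (intro subspace_scale subspace_tangent) auto
    show "dir (hq q) p (c *\<^sub>R X p) = 0" using p S(4)[of p] by (simp add: linear_scale[OF linear_dir])
  qed (use S in auto)
  then show "c *\<^sub>R x \<in> {Y 0 | Y. good_field q Y}" unfolding X by (intro CollectI exI[of _ "\<lambda>p. c *\<^sub>R X p"]) simp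
qed

lemma prj_0 [simp]: "prj 0 = 0" using linear_0[OF linear_prj] .

lemma gr_0 [simp]: "gr 0 = 0"
  using gr_prj[OF zero_MM] by simp

text \<open>Finite type is a condition at the point 0 alone. Fields that realize a basis of the
  tangent space at 0 remain spanning at nearby points of the model, and all of them annihilate
  \<open>q\<close>.\<close>

lemma commutators_span_near_0:
  assumes LL: "\<And>k. LL k (subst sz q) = 0" and ft: "finite_type_at_0 MM"
  shows "\<exists>S. open S \<and> 0 \<in> S \<and> (\<forall>p\<in>S \<inter> MM. \<forall>v\<in>tangent_space MM p. dir (hq q) p v = 0)"
proof -
  obtain k where k: "commutator_space MM k = tangent_space MM 0"
    using ft unfolding finite_type_at_0_def by blast
  have "{X 0 |X j. j \<le> k \<and> commutator MM j X} \<subseteq> {Y 0 | Y. good_field q Y}"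
  proof safe
    fix X j assume "commutator MM j X"
    from commutator_kill[OF LL this] obtain S where S: "open S" "0 \<in> S" "\<And>k. Ck_on k X S"
      "\<forall>p\<in>S \<inter> MM. X p \<in> tangent_space MM p \<and> dir (hq q) p (X p) = 0" by blast
    have "good_field q X" unfolding good_field_def using S(1,2,4) S(3)[of 0] by (intro exI[of _ S]) simp
    then show "\<exists>Y. X 0 = Y 0 \<and> good_field q Y" by blast
  qed
  from span_minimal[OF this good_field_subspace]
  have sub: "tangent_space MM 0 \<subseteq> {Y 0 | Y. good_field q Y}"
    using k unfolding commutator_space_def by simp
  have "\<forall>b\<in>Basis. \<exists>Y. Y 0 = Dgr 0 b \<and> good_field q Y"
  proof
    fix b
    have "Dgr 0 b \<in> tangent_space MM 0" using Dgr_tangent[of 0 b] by simp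
    from subsetD[OF sub this] show "\<exists>Y. Y 0 = Dgr 0 b \<and> good_field q Y" by auto
  qed
  then obtain Y where Y: "\<forall>b\<in>Basis. Y b 0 = Dgr 0 b \<and> good_field q (Y b)" by (rule bchoice[THEN exE])
  then have "\<forall>b\<in>Basis. \<exists>S. open S \<and> 0 \<in> S \<and> continuous_on S (Y b) \<and>
    (\<forall>p\<in>S \<inter> MM. Y b p \<in> tangent_space MM p \<and> dir (hq q) p (Y b p) = 0)"
    unfolding good_field_def by blast
  then obtain S where S: "\<forall>b\<in>Basis. open (S b) \<and> 0 \<in> S b \<and> continuous_on (S b) (Y b) \<and>
    (\<forall>p\<in>S b \<inter> MM. Y b p \<in> tangent_space MM p \<and> dir (hq q) p (Y b p) = 0)" by (rule bchoice[THEN exE])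
  \<comment> \<open>Distance of the frame, seen in (z, u), from the standard basis. A value below 1
    keeps the frame spanning, by \<open>linear_near_id_surj\<close>.\<close>
  define E where "E p = (\<Sum>b\<in>Basis. norm (prj (Y b p) - b))" for p
  have E0: "E 0 = 0" unfolding E_def using Y by simp
  define S0 where "S0 = (\<Inter>b\<in>Basis. S b)"
  have S0: "open S0" "0 \<in> S0" unfolding S0_def using S by (auto intro!: open_INT)
  have "continuous_on S0 E"
    unfolding E_def
  proof (intro continuous_on_sum continuous_on_norm continuous_on_diff continuous_on_const)
    fix b :: "(complex ^ 'n) \<times> (real ^ 'd)" assume "b \<in> Basis"
    then have "continuous_on S0 (Y b)" using S continuous_on_subset[of "S b" "Y b" S0] unfolding S0_def by auto
    then show "continuous_on S0 (\<lambda>p. prj (Y b p))"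
      using bounded_linear.continuous_on[OF linear_conv_bounded_linear[THEN iffD1, OF linear_prj]] by blast
  qed
  then have o: "open (S0 \<inter> E -` {..<1/2})" by (rule continuous_open_preimage[OF _ S0(1)]) simp
  show ?thesis
  proof (intro exI[of _ "S0 \<inter> E -` {..<1/2}"] conjI ballI)
    show "0 \<in> S0 \<inter> E -` {..<1/2}" using S0 E0 by simp
    fix p v assume p: "p \<in> S0 \<inter> E -` {..<1/2} \<inter> MM" and v: "v \<in> tangent_space MM p"
    have pM: "p \<in> MM" using p by simp
    have Yp: "Y b p \<in> tangent_space MM p" "dir (hq q) p (Y b p) = 0" if "b \<in> Basis" for b
      using S that p unfolding S0_def by auto
    define A where "A w = (\<Sum>b\<in>Basis. (w \<bullet> b) *\<^sub>R prj (Y b p))" for w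
    have "surj A"
    proof (rule linear_near_id_surj)
      show "linear A" by (rule linearI) (auto simp: A_def inner_add_left scaleR_add_left sum.distrib scaleR_sum_right)
      fix w
      have "A w - w = (\<Sum>b\<in>Basis. (w \<bullet> b) *\<^sub>R (prj (Y b p) - b))"
        unfolding A_def scaleR_diff_right sum_subtractf by (simp add: euclidean_representation)
      then have "norm (A w - w) \<le> (\<Sum>b\<in>Basis. \<bar>w \<bullet> b\<bar> * norm (prj (Y b p) - b))"
        by (simp add: norm_sum[THEN order_trans])
      also have "\<dots> \<le> (\<Sum>b\<in>Basis. norm w * norm (prj (Y b p) - b))"
        by (intro sum_mono mult_right_mono Basis_le_norm) auto
      also have "\<dots> = E p * norm w" by (simp add: E_def sum_distrib_left mult.commute)
      finally show "norm (A w - w) \<le> E p * norm w" .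
      show "E p < 1" using p by simp
    qed
    then obtain w where w: "A w = prj v" by (metis surjD)
    define v' where "v' = (\<Sum>b\<in>Basis. (w \<bullet> b) *\<^sub>R Y b p)"
    have "v' \<in> tangent_space MM p" unfolding v'_def
      by (intro subspace_sum subspace_scale subspace_tangent pM Yp)
    moreover have "prj v' = prj v" unfolding v'_def w[symmetric] A_def
      by (simp add: linear_sum[OF linear_prj] linear_scale[OF linear_prj])
    ultimately have "v = v'" using tangent_prj_inj[OF pM v] by simp
    then show "dir (hq q) p v = 0" unfolding v'_def
      by (simp add: linear_sum[OF linear_dir] linear_scale[OF linear_dir] Yp)
  qed (rule o)
qed

text \<open>Along the graph the derivative of \<open>q\<close> vanishes near 0, so \<open>q\<close>
  is constant on this piece of the model, and a polynomial is determined by such a piece.\<close>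

lemma minimal:
  assumes ft: "finite_type_at_0 MM" and LL: "\<And>k. LL k (subst sz q) = 0"
  shows "\<exists>c. q = cst c"
proof -
  obtain S where S: "open S" "0 \<in> S" "\<And>p v. p \<in> S \<inter> MM \<Longrightarrow> v \<in> tangent_space MM p \<Longrightarrow> dir (hq q) p v = 0"
    using commutators_span_near_0[OF LL ft] by blast
  have "continuous_on UNIV gr"
    by (intro continuous_at_imp_continuous_on ballI has_derivative_continuous[OF gr_has_Dgr])
  then have "open (gr -` S)" by (rule open_vimage[OF S(1)])
  moreover have "0 \<in> gr -` S" using S(2) by simp
  ultimately obtain e where e: "e > 0" "ball 0 e \<subseteq> gr -` S" by (meson openE)
  have hqq: "ev (hq q) (dbl x) = ev q x" for x
  proof -
    have "(\<chi> a. ev (var (Inl a)) (dbl x)) = x" by (simp add: vec_eq_iff)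
    then show ?thesis by (simp add: hq_def)
  qed
  have "((\<lambda>x. ev q (gr x)) has_derivative (\<lambda>w. 0)) (at x within ball 0 e)" if "x \<in> ball 0 e" for x
  proof -
    have "((\<lambda>x. ev (hq q) (dbl (gr x))) has_derivative (\<lambda>w. dir (hq q) (gr x) (Dgr x w))) (at x)"
      by (rule has_derivative_compose[OF gr_has_Dgr dir_has_derivative])
    moreover have "dir (hq q) (gr x) (Dgr x w) = 0" for w
      using S(3)[OF _ Dgr_tangent] e(2) that gr_MM by blast
    ultimately show ?thesis by (simp add: hqq has_derivative_at_withinI)
  qed
  then obtain c where c: "\<And>x. x \<in> ball 0 e \<Longrightarrow> ev q (gr x) = c"
    using has_derivative_zero_constant[of "ball 0 e" "\<lambda>x. ev q (gr x)"] by auto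
  have "subst sz q - cst c = 0"
    by (rule pf_zero_near_0_MM[OF e(1)]) (simp add: c ev_sz_rp del: ev_subst)
  then have "ev (subst sz q) (rp p) = c" for p by simp
  then have "ev q p = c" for p unfolding ev_sz_rp .
  then have "q = cst c" by (intro pf_eqI) simp
  then show ?thesis by blast
qed

theorem weight_bounded:
  assumes "finite_type_at_0 MM" "holomorphically_nondegenerate_at_0 MM"
  shows "\<exists>B. \<forall>X a \<sigma>. tang X \<longrightarrow> hom wz \<sigma> (X a) \<longrightarrow> X a \<noteq> 0 \<longrightarrow> \<sigma> \<le> int B"
  by (rule tang_weight_bounded[OF nondegenerate_full[OF assms(2)] minimal[OF assms(1)]])

end

section \<open>Weighted Taylor expansions\<close>

text \<open>The estimate is made for modulus at most \<open>R / 2\<close>, where discs of radius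
  \<open>R / 4\<close> for the Cauchy inequality still fit into the domain.\<close>

lemma taylor_bound:
  fixes \<phi> :: "complex \<Rightarrow> complex"
  assumes h: "\<phi> holomorphic_on ball 0 R" and R: "R > 0" and M: "\<And>x. x \<in> ball 0 R \<Longrightarrow> norm (\<phi> x) \<le> M"
    and s: "norm s \<le> R / 2"
  shows "norm (\<phi> s - (\<Sum>i\<le>n. (deriv ^^ i) \<phi> 0 * s ^ i / fact i)) \<le> (fact (Suc n) * M / (R / 4) ^ Suc n) * norm s ^ Suc n / fact n"
proof -
  have "norm ((deriv ^^ 0) \<phi> s - (\<Sum>i\<le>n. (deriv ^^ i) \<phi> 0 * (s - 0) ^ i / fact i)) \<le> (fact (Suc n) * M / (R / 4) ^ Suc n) * norm (s - 0) ^ Suc n / fact n"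
  proof (rule field_Taylor)
    show "convex (cball (0::complex) (R / 2))" by simp
    fix i and x :: complex assume x: "x \<in> cball 0 (R / 2)"
    then have xR: "x \<in> ball 0 R" using R by simp
    have "(deriv ^^ i) \<phi> holomorphic_on ball 0 R" by (rule holomorphic_higher_deriv[OF h]) simp
    then have "((deriv ^^ i) \<phi> has_field_derivative deriv ((deriv ^^ i) \<phi>) x) (at x)"
      using holomorphic_derivI xR by blast
    then show "((deriv ^^ i) \<phi> has_field_derivative (deriv ^^ Suc i) \<phi> x) (at x within cball 0 (R / 2))"
      by (simp add: has_field_derivative_at_within)
  next
    fix x :: complex assume x: "x \<in> cball 0 (R / 2)"
    have sub: "cball x (R / 4) \<subseteq> ball 0 R"
    proof
      fix y assume "y \<in> cball x (R / 4)"
      then have "norm y \<le> norm x + R / 4" using norm_triangle_ineq2[of y x] by (simp add: dist_norm norm_minus_commute)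
      then show "y \<in> ball 0 R" using x R by simp
    qed
    show "norm ((deriv ^^ Suc n) \<phi> x) \<le> fact (Suc n) * M / (R / 4) ^ Suc n"
    proof (rule Cauchy_inequality)
      show "\<phi> holomorphic_on ball x (R / 4)" using h sub ball_subset_cball holomorphic_on_subset by blast
      show "continuous_on (cball x (R / 4)) \<phi>" using h sub holomorphic_on_imp_continuous_on continuous_on_subset by blast
      show "norm (\<phi> y) \<le> M" if "norm (x - y) = R / 4" for y
        using M sub that by (auto simp: dist_norm subset_eq)
    qed (use R in simp)
  qed (use s R in auto)
  then show ?thesis by simp
qed

text \<open>Taylor's formula of order 1; the constant 32 is 2! times the square of 4.\<close>

lemma difference_quotient_bound:
  fixes \<phi> :: "complex \<Rightarrow> complex"
  assumes h: "\<phi> holomorphic_on ball 0 R" and R: "R > 0" and M: "\<And>x. x \<in> ball 0 R \<Longrightarrow> norm (\<phi> x) \<le> M"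
    and s: "norm s \<le> R / 2" "s \<noteq> 0"
  shows "norm ((\<phi> s - \<phi> 0) / s - deriv \<phi> 0) \<le> 32 * M / R\<^sup>2 * norm s"
proof -
  have "norm (\<phi> s - (\<phi> 0 + deriv \<phi> 0 * s)) \<le> 32 * M / R\<^sup>2 * norm s ^ 2"
    using taylor_bound[OF h R M s(1), of 1] by (simp add: power2_eq_square field_simps)
  moreover have "(\<phi> s - \<phi> 0) / s - deriv \<phi> 0 = (\<phi> s - (\<phi> 0 + deriv \<phi> 0 * s)) / s"
    using s(2) by (simp add: field_simps)
  ultimately show ?thesis using s(2)
    by (simp add: norm_divide power2_eq_square divide_le_eq mult.assoc)
qed

lemma dist_add_le: "dist p0 (p + v) \<le> dist p0 p + norm v" for p :: "'a::real_normed_vector"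
  using dist_triangle[of p0 "p + v" p] by (simp add: dist_norm)

lemma ball_dist_add: "p \<in> ball p0 R \<Longrightarrow> norm v \<le> R' \<Longrightarrow> p + v \<in> ball p0 (R + R')"
  for p :: "'a::real_normed_vector"
  using dist_add_le[of p0 p v] by simp

lemma norm_vector_smult: "norm (c *s v) = cmod c * norm v" for v :: "complex ^ 'a::finite"
  by (simp add: norm_vec_def L2_set_right_distrib norm_mult)

lemma norm_axis: "norm (axis a c :: complex ^ 'a::finite) = norm c"
  by (simp add: norm_vec_def L2_set_def axis_def if_distrib[of "\<lambda>x. (norm x)\<^sup>2"] cong: if_cong)

lemma smult_axis_sum: "(v :: complex ^ 'a::finite) = (\<Sum>a\<in>UNIV. (v $ a) *s axis a 1)"
  by (simp add: vec_eq_iff axis_def if_distrib[of "\<lambda>c. _ * c"] cong: if_cong)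

text \<open>Holomorphy as Frechet differentiability with complex linear derivative. That derivatives
  are again of this kind is proved in \<open>cdiff_coord_derivative\<close>.\<close>

definition cdiff :: "(complex ^ 'a::finite \<Rightarrow> complex) \<Rightarrow> (complex ^ 'a) set \<Rightarrow> bool" where
  "cdiff f S \<longleftrightarrow> (\<forall>p\<in>S. \<exists>L. (f has_derivative L) (at p) \<and> (\<forall>c v. L (c *s v) = c * L v))"

lemma cdiff_subset: "cdiff f S \<Longrightarrow> T \<subseteq> S \<Longrightarrow> cdiff f T"
  by (auto simp: cdiff_def)

lemma cdiff_derivative:
  assumes "cdiff f S" "p \<in> S"
  shows "(f has_derivative frechet_derivative f (at p)) (at p)"
    "frechet_derivative f (at p) (c *s v) = c * frechet_derivative f (at p) v"
proof -
  obtain L where L: "(f has_derivative L) (at p)" "\<And>c v. L (c *s v) = c * L v"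
    using assms unfolding cdiff_def by blast
  have e: "frechet_derivative f (at p) = L" using frechet_derivative_at[OF L(1)] by simp
  show "(f has_derivative frechet_derivative f (at p)) (at p)"
    "frechet_derivative f (at p) (c *s v) = c * frechet_derivative f (at p) v"
    unfolding e using L by auto
qed

lemma cdiff_coord:
  assumes "cdiff f S" "p \<in> S"
  shows "frechet_derivative f (at p) v = (\<Sum>a\<in>UNIV. coord_derivative a f p * v $ a)"
proof -
  have lin: "linear (frechet_derivative f (at p))"
    using cdiff_derivative(1)[OF assms] has_derivative_linear by blast
  have "frechet_derivative f (at p) v = frechet_derivative f (at p) (\<Sum>a\<in>UNIV. (v $ a) *s axis a 1)"
    by (subst smult_axis_sum) simp
  then show ?thesis
    by (simp add: linear_sum[OF lin] cdiff_derivative(2)[OF assms] coord_derivative_def mult.commute)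
qed

lemma cdiff_compose_curve:
  assumes f: "cdiff f S" "\<gamma> t \<in> S" and g: "\<And>a. ((\<lambda>t. \<gamma> t $ a) has_field_derivative \<gamma>' $ a) (at t)"
  shows "((\<lambda>t. f (\<gamma> t)) has_field_derivative frechet_derivative f (at (\<gamma> t)) \<gamma>') (at t)"
proof -
  have "(\<gamma> has_derivative (\<lambda>h. h *s \<gamma>')) (at t)"
    by (rule has_derivative_vecI) (use g in \<open>simp add: has_field_derivative_def mult_commute_abs\<close>)
  then have "((\<lambda>t. f (\<gamma> t)) has_derivative (\<lambda>h. frechet_derivative f (at (\<gamma> t)) (h *s \<gamma>'))) (at t)"
    by (rule has_derivative_compose[of \<gamma> _ t UNIV f, OF _ cdiff_derivative(1)[OF f]])
  then show ?thesis unfolding has_field_derivative_def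
    by (simp add: cdiff_derivative(2)[OF f] mult_commute_abs mult.commute)
qed

lemma cdiff_line:
  assumes "cdiff f S" "p + t *s v \<in> S"
  shows "((\<lambda>t. f (p + t *s v)) has_field_derivative frechet_derivative f (at (p + t *s v)) v) (at t)"
  by (rule cdiff_compose_curve[where \<gamma> = "\<lambda>t. p + t *s v", OF assms]) (auto intro!: derivative_eq_intros)

lemma cdiff_continuous: "cdiff f S \<Longrightarrow> continuous_on S f"
  by (meson cdiff_derivative(1) continuous_at_imp_continuous_on has_derivative_continuous)

lemma line_holomorphic:
  assumes "cdiff f S" "\<And>t. t \<in> T \<Longrightarrow> p + t *s v \<in> S" "open T"
  shows "(\<lambda>t. f (p + t *s v)) holomorphic_on T"
  unfolding holomorphic_on_open[OF assms(3)] using cdiff_line[OF assms(1,2)] by blast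

text \<open>Both estimates restrict \<open>f\<close> to the complex line through \<open>p\<close> in
  direction \<open>h\<close>, on the disc of radius \<open>r / norm h\<close> that stays in the
  larger ball.\<close>

lemma cdiff_cauchy:
  assumes f: "cdiff f (ball p0 (4 * r))" and r: "r > 0" and M: "\<And>x. x \<in> ball p0 (4 * r) \<Longrightarrow> norm (f x) \<le> M"
    and p: "p \<in> ball p0 (3 * r)"
  shows "norm (frechet_derivative f (at p) h) \<le> 2 * M / r * norm h"
    and "\<And>s. s \<noteq> 0 \<Longrightarrow> norm s * norm h \<le> r / 2 \<Longrightarrow>
       norm ((f (p + s *s h) - f p) / s - frechet_derivative f (at p) h) \<le> 32 * M * (norm h)\<^sup>2 / r\<^sup>2 * norm s"
proof -
  have lin: "linear (frechet_derivative f (at p))"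
    by (rule has_derivative_linear[OF cdiff_derivative(1)[OF f]]) (use p r in simp)
  have in4: "p + t *s h \<in> ball p0 (4 * r)" if "norm t * norm h < r" for t
  proof -
    have "dist p0 (p + t *s h) \<le> dist p0 p + norm (t *s h)" by (rule dist_add_le)
    then show ?thesis using p that by (simp add: norm_vector_smult)
  qed
  have H: "(\<lambda>t. f (p + t *s h)) holomorphic_on ball 0 (r / norm h)" if "h \<noteq> 0"
    by (rule line_holomorphic[OF f in4]) (use that in \<open>auto simp: field_simps\<close>)
  have B: "norm (f (p + t *s h)) \<le> M" if "h \<noteq> 0" "t \<in> ball 0 (r / norm h)" for t
    by (rule M[OF in4]) (use that in \<open>auto simp: field_simps\<close>)
  have d: "deriv (\<lambda>t. f (p + t *s h)) 0 = frechet_derivative f (at p) h"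
    using cdiff_line[OF f, of p 0 h] in4[of 0] r by (simp add: DERIV_imp_deriv)
  show "norm (frechet_derivative f (at p) h) \<le> 2 * M / r * norm h"
  proof (cases "h = 0")
    case True
    then show ?thesis by (simp add: linear_0[OF lin])
  next
    case False
    have "norm ((deriv ^^ 1) (\<lambda>t. f (p + t *s h)) 0) \<le> fact 1 * M / (r / (2 * norm h)) ^ 1"
    proof (rule Cauchy_inequality)
      have sub: "cball 0 (r / (2 * norm h)) \<subseteq> ball 0 (r / norm h)" for x :: complex
        using r False by (auto simp: field_simps)
      show "(\<lambda>t. f (p + t *s h)) holomorphic_on ball 0 (r / (2 * norm h))"
        using H[OF False] sub ball_subset_cball holomorphic_on_subset by blast
      show "continuous_on (cball 0 (r / (2 * norm h))) (\<lambda>t. f (p + t *s h))"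
        using H[OF False] sub holomorphic_on_imp_continuous_on continuous_on_subset by blast
      show "0 < r / (2 * norm h)" using r False by simp
      show "norm (f (p + x *s h)) \<le> M" if "norm (0 - x) = r / (2 * norm h)" for x
        by (rule B[OF False]) (use that r False in \<open>auto simp: field_simps\<close>)
    qed
    then show ?thesis using d r False by (simp add: field_simps)
  qed
  fix s :: complex assume s: "s \<noteq> 0" "norm s * norm h \<le> r / 2"
  show "norm ((f (p + s *s h) - f p) / s - frechet_derivative f (at p) h) \<le> 32 * M * (norm h)\<^sup>2 / r\<^sup>2 * norm s"
  proof (cases "h = 0")
    case True
    then show ?thesis by (simp add: linear_0[OF lin])
  next
    case False
    have "norm ((f (p + s *s h) - f (p + 0 *s h)) / s - deriv (\<lambda>t. f (p + t *s h)) 0) \<le> 32 * M / (r / norm h)\<^sup>2 * norm s"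
      by (rule difference_quotient_bound[OF H[OF False] _ B[OF False]]) (use r s False in \<open>auto simp: field_simps\<close>)
    then show ?thesis by (simp add: d power_divide)
  qed
qed

text \<open>The directional derivative is a uniform limit of difference quotients, which are
  holomorphic along the line. The steps \<open>n0 n\<close> are scaled by \<open>norm h + 1\<close>,
  positive also for \<open>h = 0\<close>, to keep all points in the domain.\<close>

lemma frechet_line_holomorphic:
  assumes f: "cdiff f (ball p0 (4 * r))" and r: "r > 0" and M: "\<And>x. x \<in> ball p0 (4 * r) \<Longrightarrow> norm (f x) \<le> M"
    and p: "p \<in> ball p0 (2 * r)"
  shows "(\<lambda>s. frechet_derivative f (at (p + s *s axis a 1)) h) holomorphic_on ball 0 (r / 2)"
proof -
  define n0 where "n0 n = r / (2 * (norm h + 1)) * inverse (real (Suc n))" for n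
  have h1: "norm h + 1 > 0" by (rule add_nonneg_pos) auto
  have inv: "0 < inverse (real (Suc n))" "inverse (real (Suc n)) \<le> 1" for n by (auto simp: inverse_le_1_iff)
  have n0: "n0 n > 0" for n unfolding n0_def using r h1 inv[of n] by (intro mult_pos_pos divide_pos_pos) auto
  have n1: "n0 n * norm h \<le> r / 2" for n
  proof -
    have "n0 n \<le> r / (2 * (norm h + 1))"
      unfolding n0_def using r h1 inv[of n] by (intro mult_left_le) auto
    then have "n0 n * norm h \<le> r / (2 * (norm h + 1)) * norm h" by (intro mult_right_mono) auto
    also have "\<dots> \<le> r / (2 * (norm h + 1)) * (norm h + 1)" using r h1 by (intro mult_left_mono) auto
    also have "\<dots> = r / 2" using h1 by (simp add: field_simps)
    finally show ?thesis .
  qed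
  have lim0: "n0 \<longlonglongrightarrow> 0"
  proof -
    have "(\<lambda>n. r / (2 * (norm h + 1)) * inverse (real (Suc n))) \<longlonglongrightarrow> r / (2 * (norm h + 1)) * 0"
      by (intro tendsto_mult tendsto_const LIMSEQ_inverse_real_of_nat)
    then show ?thesis unfolding n0_def by simp
  qed
  have in3: "p + s *s axis a 1 \<in> ball p0 (3 * r)" if "norm s \<le> r / 2" for s
  proof -
    have "dist p0 (p + s *s axis a 1) \<le> dist p0 p + norm (s *s axis a (1::complex))"
      by (rule dist_add_le)
    then show ?thesis using p that r by (simp add: norm_vector_smult norm_axis)
  qed
  let ?q = "\<lambda>n s. (f (p + s *s axis a 1 + of_real (n0 n) *s h) - f (p + s *s axis a 1)) / of_real (n0 n)"
  have in4: "p + s *s axis a 1 + of_real (n0 n) *s h \<in> ball p0 (4 * r)" if "norm s \<le> r / 2" for s n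
  proof -
    have "dist p0 (p + s *s axis a 1 + of_real (n0 n) *s h) \<le> dist p0 (p + s *s axis a 1) + norm (of_real (n0 n) *s h)"
      by (rule dist_add_le)
    then show ?thesis using in3[OF that] n1[of n] n0[of n] r by (simp add: norm_vector_smult)
  qed
  have hol: "?q n holomorphic_on cball 0 (r / 2)" for n
  proof -
    have "((\<lambda>s. f ((p + of_real (n0 n) *s h) + s *s axis a 1)) has_field_derivative
       frechet_derivative f (at ((p + of_real (n0 n) *s h) + s *s axis a 1)) (axis a 1)) (at s)"
      if "s \<in> cball 0 (r / 2)" for s
      by (rule cdiff_line[OF f]) (use in4[of s n] that in \<open>simp add: add_ac\<close>)
    moreover have "((\<lambda>s. f (p + s *s axis a 1)) has_field_derivative
       frechet_derivative f (at (p + s *s axis a 1)) (axis a 1)) (at s)"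
      if "s \<in> cball 0 (r / 2)" for s
      by (rule cdiff_line[OF f]) (use in3[of s] that r in \<open>auto simp: dist_norm\<close>)
    ultimately have "(\<lambda>s. f ((p + of_real (n0 n) *s h) + s *s axis a 1)) holomorphic_on cball 0 (r / 2)"
      "(\<lambda>s. f (p + s *s axis a 1)) holomorphic_on cball 0 (r / 2)"
      unfolding holomorphic_on_def field_differentiable_def by (blast intro: has_field_derivative_at_within)+
    then show ?thesis
      by (intro holomorphic_intros) (use n0[of n] in \<open>simp_all add: add_ac\<close>)
  qed
  have M0: "M \<ge> 0" using order_trans[OF norm_ge_zero M[of p0]] r by simp
  have ul: "uniform_limit (cball 0 (r / 2)) ?q (\<lambda>s. frechet_derivative f (at (p + s *s axis a 1)) h) sequentially"
  proof (rule uniform_limitI)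
    fix e :: real assume e: "e > 0"
    have "(\<lambda>n. 32 * M * (norm h)\<^sup>2 / r\<^sup>2 * n0 n) \<longlonglongrightarrow> 32 * M * (norm h)\<^sup>2 / r\<^sup>2 * 0"
      by (intro tendsto_mult tendsto_const lim0)
    then have "\<forall>\<^sub>F n in sequentially. 32 * M * (norm h)\<^sup>2 / r\<^sup>2 * n0 n < e"
      using e by (intro order_tendstoD(2)) auto
    then show "\<forall>\<^sub>F n in sequentially. \<forall>s\<in>cball 0 (r / 2). dist (?q n s) (frechet_derivative f (at (p + s *s axis a 1)) h) < e"
    proof eventually_elim
      case (elim n)
      show ?case
      proof
        fix s :: complex assume "s \<in> cball 0 (r / 2)"
        then have "p + s *s axis a 1 \<in> ball p0 (3 * r)" by (intro in3) simp
        from cdiff_cauchy(2)[OF f r M this, of "of_real (n0 n)" h]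
        have "norm (?q n s - frechet_derivative f (at (p + s *s axis a 1)) h) \<le> 32 * M * (norm h)\<^sup>2 / r\<^sup>2 * n0 n"
          using n0[of n] n1[of n] by simp
        then show "dist (?q n s) (frechet_derivative f (at (p + s *s axis a 1)) h) < e"
          using elim by (simp add: dist_norm)
      qed
    qed
  qed
  show ?thesis
    by (rule holomorphic_uniform_limit[OF _ ul])
      (use hol holomorphic_on_imp_continuous_on holomorphic_on_subset[OF hol ball_subset_cball] in \<open>auto intro!: always_eventually\<close>)
qed

text \<open>The partial derivative is a limit of the difference quotients \<open>q n\<close>. Their
  Frechet derivatives \<open>q' n\<close> converge uniformly to the mixed derivative
  \<open>g'\<close>, so the limit is differentiable. Complex linearity of \<open>g'\<close> is
  inherited from the derivatives of \<open>f\<close> at nearby points.\<close>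

lemma cdiff_coord_derivative_ball:
  assumes f: "cdiff f (ball p0 (4 * r))" and r: "r > 0" and M: "\<And>x. x \<in> ball p0 (4 * r) \<Longrightarrow> norm (f x) \<le> M"
  shows "cdiff (coord_derivative a f) (ball p0 r)"
proof -
  let ?e = "axis a (1::complex)"
  define t where "t n = r / 4 * inverse (real (Suc n))" for n
  have inv: "0 < inverse (real (Suc n))" "inverse (real (Suc n)) \<le> 1" for n by (auto simp: inverse_le_1_iff)
  have t: "t n > 0" "t n \<le> r / 4" for n
    unfolding t_def using r inv[of n] by (auto intro: mult_left_le)
  have t0: "t \<longlonglongrightarrow> 0"
  proof -
    have "(\<lambda>n. r / 4 * inverse (real (Suc n))) \<longlonglongrightarrow> r / 4 * 0"
      by (intro tendsto_mult tendsto_const LIMSEQ_inverse_real_of_nat)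
    then show ?thesis unfolding t_def by simp
  qed
  have M0: "M \<ge> 0" using order_trans[OF norm_ge_zero M[of p0]] r by simp
  let ?F = "\<lambda>p h s. frechet_derivative f (at (p + s *s ?e)) h"
  define q where "q n p = (f (p + of_real (t n) *s ?e) - f p) / of_real (t n)" for n p
  define q' where "q' n p h = (?F p h (of_real (t n)) - frechet_derivative f (at p) h) / of_real (t n)" for n p h
  define g' where "g' p h = deriv (?F p h) 0" for p h
  have in2: "p + of_real (t n) *s ?e \<in> ball p0 (2 * r)" if "p \<in> ball p0 r" for p n
    using ball_dist_add[OF that, of "of_real (t n) *s ?e" r] t[of n] r by (simp add: norm_vector_smult norm_axis)
  have qd: "(q n has_derivative q' n p) (at p within ball p0 r)" if p: "p \<in> ball p0 r" for n p
  proof -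
    have 1: "((\<lambda>p. p + of_real (t n) *s ?e) has_derivative (\<lambda>h. h)) (at p)"
      by (auto intro!: derivative_eq_intros)
    have "p + of_real (t n) *s ?e \<in> ball p0 (4 * r)" "p \<in> ball p0 (4 * r)" using in2[OF p, of n] p r by auto
    then have "((\<lambda>p. (f (p + of_real (t n) *s ?e) - f p) / of_real (t n)) has_derivative (\<lambda>h. (?F p h (of_real (t n)) - frechet_derivative f (at p) h) / of_real (t n))) (at p)"
      by (intro bounded_linear.has_derivative[OF bounded_linear_divide] has_derivative_diff
          has_derivative_compose[of "\<lambda>p. p + of_real (t n) *s ?e" "\<lambda>h. h" p UNIV f, OF 1] cdiff_derivative(1)[OF f])
    then show ?thesis unfolding q_def[abs_def] q'_def[abs_def] by (rule has_derivative_at_withinI)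
  qed
  have Fh: "?F p h holomorphic_on ball 0 (r / 2)" if "p \<in> ball p0 r" for p h
    by (rule frechet_line_holomorphic[OF f r M]) (use that r in auto)
  have FM: "norm (?F p h s) \<le> 2 * M / r * norm h" if p: "p \<in> ball p0 r" and s: "s \<in> ball 0 (r / 2)" for p h s
  proof (rule cdiff_cauchy(1)[OF f r M])
    show "p + s *s ?e \<in> ball p0 (3 * r)"
      using ball_dist_add[OF p, of "s *s ?e" "2 * r"] s r by (simp add: norm_vector_smult norm_axis)
  qed
  have est: "norm (q' n p h - g' p h) \<le> (32 * (2 * M / r) / (r / 2)\<^sup>2 * t n) * norm h" if p: "p \<in> ball p0 r" for n p h
  proof -
    have "norm ((?F p h (of_real (t n)) - ?F p h 0) / of_real (t n) - deriv (?F p h) 0) \<le> 32 * (2 * M / r * norm h) / (r / 2)\<^sup>2 * norm (complex_of_real (t n))"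
      by (rule difference_quotient_bound[OF Fh[OF p] _ FM[OF p]]) (use r t[of n] in auto)
    then show ?thesis unfolding q'_def g'_def using t[of n] by (simp add: field_simps)
  qed
  have qlim: "(\<lambda>n. q n p) \<longlonglongrightarrow> frechet_derivative f (at p) ?e" if p: "p \<in> ball p0 r" for p
  proof (rule LIM_zero_cancel, rule Lim_null_comparison[where g = "\<lambda>n. 32 * M / r\<^sup>2 * t n"])
    show "\<forall>\<^sub>F n in sequentially. norm (q n p - frechet_derivative f (at p) ?e) \<le> 32 * M / r\<^sup>2 * t n"
    proof (intro always_eventually allI)
      fix n
      show "norm (q n p - frechet_derivative f (at p) ?e) \<le> 32 * M / r\<^sup>2 * t n"
        using cdiff_cauchy(2)[OF f r M, of p "of_real (t n)" ?e] t[of n] r p by (simp add: q_def norm_axis)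
    qed
    have "(\<lambda>n. 32 * M / r\<^sup>2 * t n) \<longlonglongrightarrow> 32 * M / r\<^sup>2 * 0" by (intro tendsto_mult tendsto_const t0)
    then show "(\<lambda>n. 32 * M / r\<^sup>2 * t n) \<longlonglongrightarrow> 0" by simp
  qed
  have "\<exists>g. \<forall>p\<in>ball p0 r. (\<lambda>n. q n p) \<longlonglongrightarrow> g p \<and> (g has_derivative g' p) (at p within ball p0 r)"
  proof (rule has_derivative_sequence[OF _ qd])
    show "convex (ball p0 r)" by simp
    show "p0 \<in> ball p0 r" using r by simp
    fix e :: real assume e: "e > 0"
    have "(\<lambda>n. 32 * (2 * M / r) / (r / 2)\<^sup>2 * t n) \<longlonglongrightarrow> 32 * (2 * M / r) / (r / 2)\<^sup>2 * 0"
      by (intro tendsto_mult tendsto_const t0)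
    then have "\<forall>\<^sub>F n in sequentially. 32 * (2 * M / r) / (r / 2)\<^sup>2 * t n < e"
      using e by (intro order_tendstoD(2)) auto
    then show "\<forall>\<^sub>F n in sequentially. \<forall>x\<in>ball p0 r. \<forall>h. norm (q' n x h - g' x h) \<le> e * norm h"
    proof eventually_elim
      case (elim n)
      show ?case
      proof (intro ballI allI)
        fix x h assume "x \<in> ball p0 r"
        from est[OF this, of n h] show "norm (q' n x h - g' x h) \<le> e * norm h"
          by (rule order_trans) (use elim in \<open>intro mult_right_mono, auto\<close>)
      qed
    qed
  next
    show "(\<lambda>n. q n p0) \<longlonglongrightarrow> frechet_derivative f (at p0) ?e" by (rule qlim) (use r in simp)
  qed
  then obtain g where g: "\<And>p. p \<in> ball p0 r \<Longrightarrow> (\<lambda>n. q n p) \<longlonglongrightarrow> g p"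
    "\<And>p. p \<in> ball p0 r \<Longrightarrow> (g has_derivative g' p) (at p within ball p0 r)" by blast
  have ge: "g p = coord_derivative a f p" if p: "p \<in> ball p0 r" for p
    using LIMSEQ_unique[OF g(1)[OF p] qlim[OF p]] by (simp add: coord_derivative_def)
  show ?thesis
    unfolding cdiff_def
  proof (intro ballI exI conjI allI)
    fix p assume p: "p \<in> ball p0 r"
    have "(g has_derivative g' p) (at p)" using g(2)[OF p] p by (simp add: at_within_open[of p "ball p0 r"])
    then show "(coord_derivative a f has_derivative g' p) (at p)"
      by (rule has_derivative_transform_within_open[OF _ open_ball p]) (rule ge)
    fix c v
    have d: "?F p v field_differentiable at 0"
      using Fh[OF p, of v] r by (auto simp: holomorphic_on_open field_differentiable_def)
    have e: "\<forall>\<^sub>F s in nhds 0. ?F p (c *s v) s = c * ?F p v s"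
    proof -
      have "?F p (c *s v) s = c * ?F p v s" if "s \<in> ball 0 r" for s
        by (rule cdiff_derivative(2)[OF f]) (use ball_dist_add[OF p, of "s *s ?e" r] that r in \<open>auto simp: norm_vector_smult norm_axis\<close>)
      then show ?thesis using r by (intro eventually_nhds_in_open[of "ball 0 r", THEN eventually_mono]) auto
    qed
    have "g' p (c *s v) = deriv (\<lambda>s. c * ?F p v s) 0"
      unfolding g'_def by (rule deriv_cong_ev[OF e refl])
    also have "\<dots> = c * g' p v" unfolding g'_def using d by (rule deriv_cmult)
    finally show "g' p (c *s v) = c * g' p v" .
  qed
qed

lemma cdiff_coord_derivative:
  assumes f: "cdiff f S" and S: "open S"
  shows "cdiff (coord_derivative a f) S"
  unfolding cdiff_def
proof
  fix p assume p: "p \<in> S"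
  obtain e where e: "e > 0" "cball p e \<subseteq> S" using S p open_contains_cball by blast
  have "continuous_on (cball p e) f" using cdiff_continuous[OF f] e continuous_on_subset by blast
  then have "bounded (f ` cball p e)" by (intro compact_imp_bounded compact_continuous_image) auto
  then obtain M where M: "\<And>x. x \<in> cball p e \<Longrightarrow> norm (f x) \<le> M" unfolding bounded_iff by blast
  have s: "ball p (4 * (e / 4)) \<subseteq> cball p e" by auto
  have "cdiff (coord_derivative a f) (ball p (e / 4))"
  proof (rule cdiff_coord_derivative_ball)
    show "cdiff f (ball p (4 * (e / 4)))" by (rule cdiff_subset[OF f]) (use s e in blast)
    show "e / 4 > 0" using e by simp
    show "norm (f x) \<le> M" if "x \<in> ball p (4 * (e / 4))" for x using M subsetD[OF s that] by blast
  qed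
  then show "\<exists>L. (coord_derivative a f has_derivative L) (at p) \<and> (\<forall>c v. L (c *s v) = c * L v)"
    unfolding cdiff_def using e by simp
qed

lemma cdiff_foldr: "cdiff f S \<Longrightarrow> open S \<Longrightarrow> cdiff (foldr coord_derivative as f) S"
  by (induction as) (auto intro: cdiff_coord_derivative)

lemma lists_length_finite: "finite {as :: 'a::finite list. length as = k}"
  using finite_lists_length_eq[of "UNIV :: 'a set" k] by simp

lemma sum_lists_Suc:
  "(\<Sum>as | length as = Suc k. f as) = (\<Sum>a\<in>UNIV. \<Sum>as | length as = k. f (a # as))"
  for f :: "'a::finite list \<Rightarrow> 'b::comm_monoid_add"
proof -
  have "{as :: 'a list. length as = Suc k} = (\<lambda>(a, as). a # as) ` (UNIV \<times> {as. length as = k})"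
    by (auto simp: length_Suc_conv image_iff)
  then have "(\<Sum>as | length as = Suc k. f as) = (\<Sum>(a, as)\<in>UNIV \<times> {as. length as = k}. f (a # as))"
    by (simp add: sum.reindex inj_on_def case_prod_unfold prod_eq_iff)
  then show ?thesis by (simp add: sum.cartesian_product)
qed

lemma higher_deriv_line:
  assumes f: "cdiff f S" and S: "open S"
  shows "t *s v \<in> S \<Longrightarrow> (deriv ^^ k) (\<lambda>t. f (t *s v)) t
    = (\<Sum>as | length as = k. foldr coord_derivative as f (t *s v) * prod_list (map (($) v) as))"
proof (induction k arbitrary: t)
  case 0
  then show ?case by simp
next
  case (Suc k)
  let ?T = "(\<lambda>t. t *s v) -` S"
  have "continuous_on UNIV (\<lambda>t. t *s v)"
    unfolding vector_scalar_mult_def by (intro continuous_intros)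
  then have oT: "open ?T" by (rule open_vimage[OF S])
  have ev: "\<forall>\<^sub>F s in nhds t. (deriv ^^ k) (\<lambda>t. f (t *s v)) s
    = (\<Sum>as | length as = k. foldr coord_derivative as f (s *s v) * prod_list (map (($) v) as))"
    using Suc oT by (intro eventually_nhds_in_open[of ?T t, THEN eventually_mono]) auto
  have d: "((\<lambda>s. foldr coord_derivative as f (s *s v)) has_field_derivative
      (\<Sum>a\<in>UNIV. foldr coord_derivative (a # as) f (t *s v) * v $ a)) (at t)" for as
    using cdiff_line[OF cdiff_foldr[OF f S, of as], of 0 t v] cdiff_coord[OF cdiff_foldr[OF f S, of as], of "t *s v" v] Suc.prems
    by simp
  have "((\<lambda>s. \<Sum>as | length as = k. foldr coord_derivative as f (s *s v) * prod_list (map (($) v) as)) has_field_derivative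
     (\<Sum>as | length as = k. (\<Sum>a\<in>UNIV. foldr coord_derivative (a # as) f (t *s v) * v $ a) * prod_list (map (($) v) as))) (at t)"
    by (intro DERIV_sum DERIV_cmult_right d)
  then have "deriv ((deriv ^^ k) (\<lambda>t. f (t *s v))) t
    = (\<Sum>as | length as = k. (\<Sum>a\<in>UNIV. foldr coord_derivative (a # as) f (t *s v) * v $ a) * prod_list (map (($) v) as))"
    unfolding deriv_cong_ev[OF ev refl] by (rule DERIV_imp_deriv)
  also have "\<dots> = (\<Sum>as | length as = Suc k. foldr coord_derivative as f (t *s v) * prod_list (map (($) v) as))"
    unfolding sum_lists_Suc by (subst sum.swap) (simp add: sum_distrib_right mult.assoc)
  finally show ?case by simp
qed

text \<open>Coefficients are indexed by ordered lists of coordinates, as in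
  \<open>homogeneous_part\<close>; the factorial of the length accounts for the repeated
  orderings.\<close>

definition tcoef :: "(complex ^ 'a::finite \<Rightarrow> complex) \<Rightarrow> 'a list \<Rightarrow> complex" where
  "tcoef f as = foldr coord_derivative as f 0 / fact (length as)"

definition hpart :: "(complex ^ 'a::finite \<Rightarrow> complex) \<Rightarrow> nat \<Rightarrow> complex ^ 'a \<Rightarrow> complex" where
  "hpart f k p = (\<Sum>as | length as = k. tcoef f as * prod_list (map (($) p) as))"

definition wpart :: "('a \<Rightarrow> nat) \<Rightarrow> (complex ^ 'a::finite \<Rightarrow> complex) \<Rightarrow> nat \<Rightarrow> complex ^ 'a \<Rightarrow> complex" where
  "wpart w f k p = (\<Sum>as | sum_list (map w as) = k. tcoef f as * prod_list (map (($) p) as))"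

text \<open>Taylor's formula in one variable on the complex line through \<open>p\<close>, with the
  direction rescaled to length \<open>R / 2\<close>; in this way one constant serves all
  directions.\<close>

lemma hpart_bound:
  assumes f: "cdiff f (ball 0 R)" and R: "R > 0"
  shows "\<exists>C r. r > 0 \<and> C \<ge> 0 \<and> (\<forall>p. norm p < r \<longrightarrow> p \<in> ball 0 R \<and> norm (f p - (\<Sum>k\<le>n. hpart f k p)) \<le> C * norm p ^ Suc n)"
proof -
  have "continuous_on (cball 0 (R / 2)) f" using cdiff_continuous[OF f] R by (auto intro: continuous_on_subset)
  then have "bounded (f ` cball 0 (R / 2))" by (intro compact_imp_bounded compact_continuous_image) auto
  then obtain M where M: "\<And>x. x \<in> cball 0 (R / 2) \<Longrightarrow> norm (f x) \<le> M" unfolding bounded_iff by blast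
  have M0: "M \<ge> 0" using order_trans[OF norm_ge_zero M[of 0]] R by simp
  define C where "C = (fact (Suc n) * M / (1 / 4) ^ Suc n) / fact n * (1 / (R / 2)) ^ Suc n"
  have "norm (f p - (\<Sum>k\<le>n. hpart f k p)) \<le> C * norm p ^ Suc n" if p: "norm p < R / 4" for p
  proof (cases "p = 0")
    case True
    have h0: "hpart f k 0 = (if k = 0 then f 0 else 0)" for k
    proof (cases "k = 0")
      case False
      have "tcoef f as * prod_list (map (($) 0) as) = 0" if "length as = k" for as
        using that False by (cases as) auto
      then have "hpart f k 0 = 0" unfolding hpart_def by (intro sum.neutral) simp
      then show ?thesis using False by simp
    qed (simp add: hpart_def tcoef_def)
    show ?thesis unfolding True h0 by simp
  next
    case False
    define v where "v = (of_real (R / 2 / norm p)) *s p"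
    have nv: "norm v = R / 2" unfolding v_def norm_vector_smult norm_of_real using False R by simp
    define s where "s = complex_of_real (norm p / (R / 2))"
    have sv: "s *s v = p" using False R by (simp add: s_def v_def vec_eq_iff)
    have sn: "norm s = norm p / (R / 2)" unfolding s_def norm_of_real using R by simp
    have inb: "t *s v \<in> cball 0 (R / 2)" if "t \<in> ball 0 1" for t
    proof -
      have "norm t * norm v \<le> 1 * norm v" using that by (intro mult_right_mono) auto
      then show ?thesis using nv unfolding mem_cball_0 norm_vector_smult by linarith
    qed
    have H: "(\<lambda>t. f (t *s v)) holomorphic_on ball 0 1"
      using line_holomorphic[OF f, of "ball 0 1" 0 v] inb R by fastforce
    have T: "norm (f (s *s v) - (\<Sum>i\<le>n. (deriv ^^ i) (\<lambda>t. f (t *s v)) 0 * s ^ i / fact i)) \<le> (fact (Suc n) * M / (1 / 4) ^ Suc n) * norm s ^ Suc n / fact n"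
      by (rule taylor_bound[OF H]) (use M inb p R in \<open>auto simp: sn field_simps\<close>)
    have pw: "prod_list (map (($) (s *s v)) as) = s ^ length as * prod_list (map (($) v) as)" for as
      by (induction as) auto
    have "(deriv ^^ i) (\<lambda>t. f (t *s v)) 0 * s ^ i / fact i = hpart f i p" for i
    proof -
      have "(deriv ^^ i) (\<lambda>t. f (t *s v)) 0 = (\<Sum>as | length as = i. foldr coord_derivative as f 0 * prod_list (map (($) v) as))"
        using higher_deriv_line[OF f open_ball, of 0 v i] R by simp
      moreover have "hpart f i p = (\<Sum>as | length as = i. (foldr coord_derivative as f 0 * prod_list (map (($) v) as)) * (s ^ i / fact i))"
        unfolding hpart_def tcoef_def sv[symmetric] pw by (rule sum.cong) (auto simp: mult_ac)
      ultimately show ?thesis unfolding sum_distrib_right[symmetric] by simp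
    qed
    then have "norm (f p - (\<Sum>k\<le>n. hpart f k p)) \<le> (fact (Suc n) * M / (1 / 4) ^ Suc n) * norm s ^ Suc n / fact n"
      using T sv by simp
    also have "\<dots> = C * norm p ^ Suc n" unfolding C_def sn by (simp add: power_divide field_simps)
    finally show ?thesis .
  qed
  moreover have "C \<ge> 0" unfolding C_def using M0 R by simp
  ultimately show ?thesis using R by (intro exI[of _ C] exI[of _ "R / 4"]) auto
qed

lemma length_le_weight:
  assumes "\<And>a. w a > (0::nat)"
  shows "length as \<le> sum_list (map w as)"
proof (induction as)
  case (Cons a as)
  then show ?case using assms[of a] by simp
qed simp

lemma finite_weight_lists:
  fixes w :: "'a::finite \<Rightarrow> nat"
  assumes "\<And>a. w a > 0"
  shows "finite {as. sum_list (map w as) = k}"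
proof -
  have "{as. sum_list (map w as) = k} \<subseteq> {as. set as \<subseteq> UNIV \<and> length as \<le> k}"
    using length_le_weight[of w, OF assms] by auto
  then show ?thesis by (rule finite_subset) (rule finite_lists_length_le[OF finite])
qed

lemma norm_dil_le:
  assumes "\<And>a. w a > 0" "norm t \<le> 1"
  shows "norm (dil w t p) \<le> norm t * norm p"
proof -
  have "norm (dil w t p) \<le> norm (t *s p)"
  proof (rule norm_le_componentwise_cart)
    fix a
    have "norm t ^ w a \<le> norm t ^ 1" using assms(1)[of a] assms(2) by (intro power_decreasing) auto
    then show "norm (dil w t p $ a) \<le> norm ((t *s p) $ a)"
      by (simp add: norm_mult norm_power mult_right_mono)
  qed
  then show ?thesis by (simp add: norm_vector_smult)
qed

lemma prod_list_dil: "prod_list (map (($) (dil w t p)) as) = t ^ sum_list (map w as) * prod_list (map (($) p) as)"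
  by (induction as) (auto simp: power_add)

lemma norm_prod_list_le: "norm p \<le> B \<Longrightarrow> norm (prod_list (map (($) p) as)) \<le> B ^ length as" for p :: "complex ^ 'a::finite"
proof (induction as)
  case (Cons a as)
  have "norm (p $ a) \<le> B" using Finite_Cartesian_Product.norm_nth_le[of p a] Cons.prems by simp
  then show ?case using Cons by (auto simp: norm_mult intro!: mult_mono intro: order_trans[OF norm_ge_zero])
qed simp

text \<open>Weights are at least 1, so a list of weight at most \<open>n\<close> has length at most
  \<open>n\<close>, and the ordinary expansion of order \<open>n\<close> contains all weighted parts
  up to \<open>n\<close>. What is left over has weight above \<open>n\<close> and is of the order of
  the error.\<close>

lemma wpart_expansion:
  fixes w :: "'a::finite \<Rightarrow> nat"
  assumes f: "cdiff f S" and S: "open S" "0 \<in> S" and w: "\<And>a. w a > 0"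
  shows "\<exists>C t0. t0 > 0 \<and> t0 \<le> 1 \<and> (\<forall>t p. norm t < t0 \<longrightarrow> norm p \<le> B \<longrightarrow> dil w t p \<in> S \<and>
     norm (f (dil w t p) - (\<Sum>k\<le>n. t ^ k * wpart w f k p)) \<le> C * norm t ^ Suc n)"
proof -
  obtain R where R: "R > 0" "ball 0 R \<subseteq> S" using S openE by blast
  have fR: "cdiff f (ball 0 R)" by (rule cdiff_subset[OF f R(2)])
  obtain C r where Cr0: "r > 0 \<and> C \<ge> 0 \<and> (\<forall>p. norm p < r \<longrightarrow> p \<in> ball 0 R \<and> norm (f p - (\<Sum>k\<le>n. hpart f k p)) \<le> C * norm p ^ Suc n)"
    using hpart_bound[OF fR R(1), of n] by (elim exE)
  have Cr: "r > 0" "C \<ge> 0" "\<And>p :: complex ^ 'a. norm p < r \<Longrightarrow> p \<in> ball 0 R"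
      "\<And>p. norm p < r \<Longrightarrow> norm (f p - (\<Sum>k\<le>n. hpart f k p)) \<le> C * norm p ^ Suc n"
    using Cr0 Cr0[THEN conjunct2, THEN conjunct2, rule_format] by simp_all
  define B' where "B' = \<bar>B\<bar> + 1"
  have B': "B' > 0" by (simp add: B'_def)
  define LL where "LL = {as :: 'a list. length as \<le> n}"
  have finL: "finite LL" unfolding LL_def using finite_lists_length_le[of "UNIV :: 'a set" n] by simp
  define D where "D = (\<Sum>as\<in>LL. norm (tcoef f as) * B' ^ length as)"
  show ?thesis
  proof (intro exI conjI allI impI)
    show "min 1 (r / B') > 0" using Cr B' by simp
    show "min 1 (r / B') \<le> 1" by simp
    fix t :: complex and p :: "complex ^ 'a" assume t: "norm t < min 1 (r / B')" and p: "norm p \<le> B"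
    have p': "norm p \<le> B'" using p by (simp add: B'_def)
    have nd: "norm (dil w t p) \<le> norm t * B'"
      by (rule order_trans[OF norm_dil_le[OF w] mult_left_mono[OF p' norm_ge_zero]]) (use t in simp)
    also have "\<dots> < r"
    proof -
      have "norm t < r / B'" using t by simp
      then show ?thesis by (simp only: pos_less_divide_eq[OF B'])
    qed
    finally have dr: "norm (dil w t p) < r" .
    show "dil w t p \<in> S" using Cr(3)[OF dr] R(2) by blast
    have 1: "norm (f (dil w t p) - (\<Sum>k\<le>n. hpart f k (dil w t p))) \<le> (C * B' ^ Suc n) * norm t ^ Suc n"
    proof -
      have "norm (f (dil w t p) - (\<Sum>k\<le>n. hpart f k (dil w t p))) \<le> C * norm (dil w t p) ^ Suc n" by (rule Cr(4)[OF dr])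
      also have "\<dots> \<le> C * (norm t * B') ^ Suc n" using Cr(2) nd by (intro mult_left_mono power_mono) auto
      finally show ?thesis by (simp add: power_mult_distrib mult_ac)
    qed
    have LU: "LL = (\<Union>k\<in>{..n}. {as. length as = k})" by (auto simp: LL_def)
    have "(\<Sum>k\<le>n. hpart f k (dil w t p)) = (\<Sum>as\<in>LL. tcoef f as * (t ^ sum_list (map w as) * prod_list (map (($) p) as)))"
      unfolding LU hpart_def prod_list_dil
      by (rule sum.UNION_disjoint[symmetric]) (auto intro: lists_length_finite)
    also have "\<dots> = (\<Sum>as\<in>LL \<inter> {as. sum_list (map w as) \<le> n}. tcoef f as * (t ^ sum_list (map w as) * prod_list (map (($) p) as)))
      + (\<Sum>as\<in>LL \<inter> {as. sum_list (map w as) > n}. tcoef f as * (t ^ sum_list (map w as) * prod_list (map (($) p) as)))"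
      by (subst sum.union_disjoint[symmetric]) (use finL in \<open>auto intro!: sum.cong\<close>)
    also have "LL \<inter> {as. sum_list (map w as) \<le> n} = (\<Union>k\<in>{..n}. {as. sum_list (map w as) = k})"
      unfolding LL_def using length_le_weight[of w, OF w] by (auto intro: order_trans)
    also have "(\<Sum>as\<in>(\<Union>k\<in>{..n}. {as. sum_list (map w as) = k}). tcoef f as * (t ^ sum_list (map w as) * prod_list (map (($) p) as)))
       = (\<Sum>k\<le>n. t ^ k * wpart w f k p)"
      unfolding wpart_def sum_distrib_left
      by (subst sum.UNION_disjoint) (auto intro!: finite_weight_lists w sum.cong simp: mult_ac)
    finally have 2: "(\<Sum>k\<le>n. hpart f k (dil w t p)) - (\<Sum>k\<le>n. t ^ k * wpart w f k p)
      = (\<Sum>as\<in>LL \<inter> {as. sum_list (map w as) > n}. tcoef f as * (t ^ sum_list (map w as) * prod_list (map (($) p) as)))" by simp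
    have 3: "norm (\<Sum>as\<in>LL \<inter> {as. sum_list (map w as) > n}. tcoef f as * (t ^ sum_list (map w as) * prod_list (map (($) p) as))) \<le> D * norm t ^ Suc n"
    proof -
      have "norm (\<Sum>as\<in>LL \<inter> {as. sum_list (map w as) > n}. tcoef f as * (t ^ sum_list (map w as) * prod_list (map (($) p) as)))
        \<le> (\<Sum>as\<in>LL \<inter> {as. sum_list (map w as) > n}. norm (tcoef f as) * B' ^ length as * norm t ^ Suc n)"
      proof (rule sum_norm_le)
        fix as assume as: "as \<in> LL \<inter> {as. sum_list (map w as) > n}"
        have "norm t ^ sum_list (map w as) \<le> norm t ^ Suc n" using as t by (intro power_decreasing) auto
        then have "norm t ^ sum_list (map w as) * norm (prod_list (map (($) p) as)) \<le> norm t ^ Suc n * B' ^ length as"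
          using norm_prod_list_le[OF p'] by (intro mult_mono) auto
        then have "norm (tcoef f as) * (norm t ^ sum_list (map w as) * norm (prod_list (map (($) p) as))) \<le> norm (tcoef f as) * (norm t ^ Suc n * B' ^ length as)"
          by (rule mult_left_mono) simp
        then show "norm (tcoef f as * (t ^ sum_list (map w as) * prod_list (map (($) p) as))) \<le> norm (tcoef f as) * B' ^ length as * norm t ^ Suc n"
          by (simp add: norm_mult norm_power mult_ac)
      qed
      also have "\<dots> = (\<Sum>as\<in>LL \<inter> {as. sum_list (map w as) > n}. norm (tcoef f as) * B' ^ length as) * norm t ^ Suc n"
        by (simp add: sum_distrib_right)
      also have "\<dots> \<le> D * norm t ^ Suc n"
        unfolding D_def by (intro mult_right_mono sum_mono2 finL) (use B' in auto)
      finally show ?thesis .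
    qed
    have "norm (f (dil w t p) - (\<Sum>k\<le>n. t ^ k * wpart w f k p))
      \<le> norm (f (dil w t p) - (\<Sum>k\<le>n. hpart f k (dil w t p))) + norm ((\<Sum>k\<le>n. hpart f k (dil w t p)) - (\<Sum>k\<le>n. t ^ k * wpart w f k p))"
      using norm_triangle_ineq[of "f (dil w t p) - (\<Sum>k\<le>n. hpart f k (dil w t p))" "(\<Sum>k\<le>n. hpart f k (dil w t p)) - (\<Sum>k\<le>n. t ^ k * wpart w f k p)"] by simp
    also have "\<dots> \<le> (C * B' ^ Suc n) * norm t ^ Suc n + D * norm t ^ Suc n" using 1 3 unfolding 2 by (rule add_mono)
    finally show "norm (f (dil w t p) - (\<Sum>k\<le>n. t ^ k * wpart w f k p)) \<le> (C * B' ^ Suc n + D) * norm t ^ Suc n"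
      by (simp add: distrib_right)
  qed
qed

text \<open>The limit at 0 removes the constant term, and dividing by \<open>t\<close> reduces the
  degree.\<close>

lemma small_polynomial_zero:
  fixes a :: "nat \<Rightarrow> complex"
  assumes "t0 > 0" "\<And>t::real. 0 < t \<Longrightarrow> t < t0 \<Longrightarrow> norm (\<Sum>k\<le>n. of_real t ^ k * a k) \<le> C * t ^ Suc n"
  shows "k \<le> n \<Longrightarrow> a k = 0"
  using assms(2)
proof (induction n arbitrary: a k)
  case 0
  have "((\<lambda>t. C * t ^ Suc 0) \<longlongrightarrow> C * 0 ^ Suc 0) (at_right (0::real))" by (intro tendsto_intros)
  moreover have "\<forall>\<^sub>F t in at_right (0::real). norm (a 0) \<le> C * t ^ Suc 0"
    using eventually_at_right_real[OF assms(1)] by eventually_elim (use 0(2) in auto)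
  ultimately have "norm (a 0) \<le> C * 0 ^ Suc 0"
    by (intro tendsto_lowerbound[OF _ _ trivial_limit_at_right_real])
  then show ?case using 0 by simp
next
  case (Suc n)
  have "((\<lambda>t. norm (\<Sum>k\<le>Suc n. complex_of_real t ^ k * a k)) \<longlongrightarrow> norm (\<Sum>k\<le>Suc n. of_real 0 ^ k * a k)) (at_right 0)"
    by (intro tendsto_intros)
  moreover have "((\<lambda>t. C * t ^ Suc (Suc n)) \<longlongrightarrow> C * 0 ^ Suc (Suc n)) (at_right (0::real))" by (intro tendsto_intros)
  moreover have "\<forall>\<^sub>F t in at_right (0::real). norm (\<Sum>k\<le>Suc n. complex_of_real t ^ k * a k) \<le> C * t ^ Suc (Suc n)"
    using eventually_at_right_real[OF assms(1)] by eventually_elim (use Suc.prems(2) in auto)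
  ultimately have "norm (\<Sum>k\<le>Suc n. complex_of_real 0 ^ k * a k) \<le> C * 0 ^ Suc (Suc n)"
    by (intro tendsto_le[OF trivial_limit_at_right_real])
  then have a0: "a 0 = 0" by (subst (asm) sum.atMost_Suc_shift) simp
  have sh: "(\<Sum>k\<le>Suc n. complex_of_real t ^ k * a k) = of_real t * (\<Sum>k\<le>n. of_real t ^ k * a (Suc k))" for t
    by (subst sum.atMost_Suc_shift) (simp add: a0 sum_distrib_left mult.assoc)
  have "a (Suc j) = 0" if "j \<le> n" for j
  proof (rule Suc.IH[of j "\<lambda>k. a (Suc k)", OF that])
    fix t :: real assume t: "0 < t" "t < t0"
    have "t * norm (\<Sum>k\<le>n. of_real t ^ k * a (Suc k)) \<le> C * t ^ Suc (Suc n)"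
      using Suc.prems(2)[OF t] t unfolding sh by (simp add: norm_mult)
    then have "t * norm (\<Sum>k\<le>n. of_real t ^ k * a (Suc k)) \<le> t * (C * t ^ Suc n)" by (simp add: mult_ac)
    then show "norm (\<Sum>k\<le>n. of_real t ^ k * a (Suc k)) \<le> C * t ^ Suc n" using t by (simp only: mult_le_cancel_left_pos)
  qed
  then show ?case using a0 Suc.prems(1) by (cases k) auto
qed

lemma dil_curve_holomorphic:
  assumes f: "cdiff f S" and T: "\<And>t. t \<in> T \<Longrightarrow> dil w t p \<in> S" "open T"
  shows "(\<lambda>t. f (dil w t p)) holomorphic_on T"
  unfolding holomorphic_on_open[OF T(2)]
proof
  fix t assume t: "t \<in> T"
  show "\<exists>f'. ((\<lambda>t. f (dil w t p)) has_field_derivative f') (at t)"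
  proof (rule exI, rule cdiff_compose_curve[where \<gamma> = "\<lambda>t. dil w t p" and \<gamma>' = "\<chi> a. of_nat (w a) * t ^ (w a - 1) * p $ a", OF f T(1)[OF t]])
    fix a
    show "((\<lambda>t. dil w t p $ a) has_field_derivative (\<chi> a. of_nat (w a) * t ^ (w a - 1) * p $ a) $ a) (at t)"
      by (auto intro!: derivative_eq_intros)
  qed
qed

text \<open>For a fixed small \<open>p\<close> the difference of both sides is holomorphic in the
  dilation parameter on a disc of radius 2 and all its derivatives at 0 vanish. At parameter 1 this
  is the claim.\<close>

lemma finite_wparts:
  fixes w :: "'a::finite \<Rightarrow> nat"
  assumes f: "cdiff f S" and S: "open S" "0 \<in> S" and w: "\<And>a. w a > 0" and z: "\<And>k p. k > n \<Longrightarrow> wpart w f k p = 0"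
  shows "\<exists>e>0. \<forall>p\<in>ball 0 e. f p = (\<Sum>k\<le>n. wpart w f k p)"
proof -
  obtain R where R: "R > 0" "ball 0 R \<subseteq> S" using S openE by blast
  \<comment> \<open>Bounds dilations with parameters of modulus at most 2, so that small points stay
    in the domain on the whole disc.\<close>
  define c where "c = (\<Sum>a\<in>UNIV. 2 ^ w a :: real)"
  have c: "c > 0" unfolding c_def by (intro sum_pos) auto
  have c2: "norm (dil w t p) \<le> c * norm p" if "norm t \<le> 2" for t p
  proof -
    have "norm (dil w t p) \<le> (\<Sum>a\<in>UNIV. norm (dil w t p $ a))" by (simp add: norm_vec_def L2_set_le_sum)
    also have "\<dots> \<le> (\<Sum>a\<in>UNIV. 2 ^ w a * norm p)"
      using Finite_Cartesian_Product.norm_nth_le[of p] that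
      by (intro sum_mono) (auto simp: norm_mult norm_power intro!: mult_mono power_mono)
    finally show ?thesis by (simp add: c_def sum_distrib_right)
  qed
  have "f p = (\<Sum>k\<le>n. wpart w f k p)" if p: "p \<in> ball 0 (R / c)" for p
  proof -
    have inS: "dil w t p \<in> S" if "t \<in> ball 0 2" for t
    proof -
      have "norm (dil w t p) \<le> c * norm p" using that by (intro c2) simp
      also have "\<dots> < R" using p c by (simp add: pos_less_divide_eq mult.commute)
      finally show ?thesis using R(2) by auto
    qed
    define g where "g t = f (dil w t p) - (\<Sum>k\<le>n. t ^ k * wpart w f k p)" for t
    have gh: "g holomorphic_on ball 0 2"
      unfolding g_def using dil_curve_holomorphic[OF f inS open_ball] by (intro holomorphic_intros)
    have gcont: "continuous_on (cball 0 1) g"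
      by (rule holomorphic_on_imp_continuous_on, rule holomorphic_on_subset[OF gh]) auto
    then have "bounded (g ` cball 0 1)" by (intro compact_imp_bounded compact_continuous_image) auto
    then obtain M where M: "\<And>x. x \<in> cball 0 1 \<Longrightarrow> norm (g x) \<le> M" unfolding bounded_iff by blast
    have gh1: "g holomorphic_on ball 0 1" by (rule holomorphic_on_subset[OF gh]) auto
    have "(deriv ^^ i) g 0 = 0" for i
    proof -
      \<comment> \<open>Raising the order of the expansion does not change the finite sum, and it
        gives access to the \<open>i\<close>-th derivative.\<close>
      let ?N = "n + i"
      obtain C t0 where C0: "t0 > 0 \<and> t0 \<le> 1 \<and> (\<forall>t q. norm t < t0 \<longrightarrow> norm q \<le> norm p \<longrightarrow> dil w t q \<in> S \<and>
          norm (f (dil w t q) - (\<Sum>k\<le>?N. t ^ k * wpart w f k q)) \<le> C * norm t ^ Suc ?N)"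
        using wpart_expansion[where n = ?N and w = w and B = "norm p", OF f S w] by (elim exE)
      have C: "t0 > 0" "t0 \<le> 1" "\<And>t q. norm t < t0 \<Longrightarrow> norm q \<le> norm p \<Longrightarrow>
          norm (f (dil w t q) - (\<Sum>k\<le>?N. t ^ k * wpart w f k q)) \<le> C * norm t ^ Suc ?N"
        using C0 C0[THEN conjunct2, THEN conjunct2, rule_format] by simp_all
      have same: "(\<Sum>k\<le>?N. t ^ k * wpart w f k p) = (\<Sum>k\<le>n. t ^ k * wpart w f k p)" for t
        by (rule sum.mono_neutral_right) (auto simp: z)
      define D where "D = (fact (Suc ?N) * M / (1 / 4) ^ Suc ?N) / fact ?N"
      have "norm (\<Sum>k\<le>?N. of_real t ^ k * ((deriv ^^ k) g 0 / fact k)) \<le> (C + D) * t ^ Suc ?N" if t: "0 < t" "t < min t0 (1 / 2)" for t :: real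
      proof -
        have 1: "norm (g (of_real t)) \<le> C * t ^ Suc ?N"
          using C(3)[of "of_real t" p] t unfolding g_def same by simp
        have "norm (g (of_real t) - (\<Sum>i\<le>?N. (deriv ^^ i) g 0 * of_real t ^ i / fact i)) \<le> (fact (Suc ?N) * M / (1 / 4) ^ Suc ?N) * norm (complex_of_real t) ^ Suc ?N / fact ?N"
          by (rule taylor_bound[OF gh1 _ M]) (use t in auto)
        then have 2: "norm (g (of_real t) - (\<Sum>k\<le>?N. of_real t ^ k * ((deriv ^^ k) g 0 / fact k))) \<le> D * t ^ Suc ?N"
          using t by (simp add: D_def mult_ac)
        have "norm (\<Sum>k\<le>?N. of_real t ^ k * ((deriv ^^ k) g 0 / fact k)) \<le> norm (g (of_real t)) + norm (g (of_real t) - (\<Sum>k\<le>?N. of_real t ^ k * ((deriv ^^ k) g 0 / fact k)))"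
          unfolding norm_minus_commute[of "g (of_real t)"] by (rule norm_triangle_sub)
        then show ?thesis using 1 2 by (simp add: distrib_right)
      qed
      from small_polynomial_zero[of "min t0 (1 / 2)" "\<lambda>k. (deriv ^^ k) g 0 / fact k" ?N "C + D" i, OF _ this] C(1)
      have "(deriv ^^ i) g 0 / fact i = 0" by simp
      then show ?thesis by simp
    qed
    then have "g 1 = 0" by (intro holomorphic_fun_eq_0_on_ball[OF gh]) auto
    moreover have "dil w 1 p = p" by (simp add: vec_eq_iff)
    ultimately show ?thesis by (simp add: g_def)
  qed
  then show ?thesis using R c by (intro exI[of _ "R / c"]) simp
qed

lemma polyfun_wpart: "polyfun (wpart w f k)"
proof -
  have "polyfun (\<lambda>p. prod_list (map (($) p) as))" for as
    by (induction as) (auto intro: polyfun.intros)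
  then show ?thesis unfolding wpart_def[abs_def] by (intro polyfun_sum polyfun.mult polyfun.const)
qed

lemma wpart_dil: "wpart w f k (dil w t p) = t ^ k * wpart w f k p"
  unfolding wpart_def prod_list_dil by (auto simp: sum_distrib_left mult_ac intro: sum.cong)

section \<open>The weighted grading\<close>

lemma poly_eval_superset:
  fixes p :: "'v::finite cpoly"
  assumes "finite A" "Poly_Mapping.keys p \<subseteq> A"
  shows "poly_eval x p = (\<Sum>M\<in>A. Poly_Mapping.lookup p M * (\<Prod>v\<in>UNIV. x v ^ Poly_Mapping.lookup M v))"
proof -
  have "(\<Prod>v\<in>Poly_Mapping.keys M. x v ^ Poly_Mapping.lookup M v) = (\<Prod>v\<in>UNIV. x v ^ Poly_Mapping.lookup M v)" for M
    by (rule prod.mono_neutral_left) (auto simp: in_keys_iff)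
  then have "poly_eval x p = (\<Sum>M\<in>Poly_Mapping.keys p. Poly_Mapping.lookup p M * (\<Prod>v\<in>UNIV. x v ^ Poly_Mapping.lookup M v))"
    by (simp add: poly_eval_def)
  also have "\<dots> = (\<Sum>M\<in>A. Poly_Mapping.lookup p M * (\<Prod>v\<in>UNIV. x v ^ Poly_Mapping.lookup M v))"
    by (rule sum.mono_neutral_left) (use assms in \<open>auto simp: in_keys_iff\<close>)
  finally show ?thesis .
qed

lemma poly_eval_add:
  fixes p q :: "'v::finite cpoly"
  shows "poly_eval x (p + q) = poly_eval x p + poly_eval x q"
proof -
  let ?A = "Poly_Mapping.keys p \<union> Poly_Mapping.keys q"
  have "Poly_Mapping.keys (p + q) \<subseteq> ?A" by (rule Poly_Mapping.keys_add)
  then show ?thesis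
    by (subst (1 2 3) poly_eval_superset[of ?A]) (auto simp: lookup_add distrib_right sum.distrib)
qed

lemma poly_eval_0: "poly_eval x 0 = 0"
  by (simp add: poly_eval_def)

lemma poly_eval_sum: "poly_eval x (sum f A) = (\<Sum>i\<in>A. poly_eval x (f i))" for f :: "'i \<Rightarrow> 'v::finite cpoly"
  by (induction A rule: infinite_finite_induct) (auto simp: poly_eval_0 poly_eval_add)

lemma poly_eval_single: "poly_eval x (Poly_Mapping.single M c) = c * (\<Prod>v\<in>UNIV. x v ^ Poly_Mapping.lookup M v)"
  for M :: "'v::finite \<Rightarrow>\<^sub>0 nat"
  by (subst poly_eval_superset[of "{M}"]) (auto simp: lookup_single)

text \<open>Forgets the order of a list; several lists contribute to the same monomial, which is why
  \<open>wpart_cpoly\<close> adds up single terms.\<close>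

definition lmono :: "'v list \<Rightarrow> 'v \<Rightarrow>\<^sub>0 nat" where
  "lmono as = sum_list (map (\<lambda>a. Poly_Mapping.single a 1) as)"

lemma lookup_lmono_Cons: "Poly_Mapping.lookup (lmono (a # as)) v = (if v = a then 1 else 0) + Poly_Mapping.lookup (lmono as) v"
  by (simp add: lmono_def lookup_add lookup_single when_def)

lemma prod_lmono: "(\<Prod>v\<in>UNIV. x v ^ Poly_Mapping.lookup (lmono as) v) = prod_list (map x as)" for x :: "'v::finite \<Rightarrow> complex"
proof (induction as)
  case Nil
  then show ?case by (simp add: lmono_def)
next
  case (Cons a as)
  have "(\<Prod>v\<in>UNIV. x v ^ (if v = a then 1 else 0)) = (\<Prod>v\<in>UNIV. if v = a then x a else 1)"
    by (rule prod.cong) auto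
  then show ?case using Cons by (simp add: lookup_lmono_Cons power_add prod.distrib)
qed

lemma monomial_weight_UNIV: "monomial_weight w M = (\<Sum>v\<in>UNIV. w v * real (Poly_Mapping.lookup M v))" for w :: "'v::finite \<Rightarrow> real"
  unfolding monomial_weight_def by (rule sum.mono_neutral_left) (auto simp: in_keys_iff)

lemma monomial_weight_lmono: "monomial_weight w (lmono as) = sum_list (map w as)" for w :: "'v::finite \<Rightarrow> real"
proof (induction as)
  case Nil
  then show ?case by (simp add: lmono_def monomial_weight_UNIV)
next
  case (Cons a as)
  have "(\<Sum>v\<in>UNIV. w v * real (if v = a then 1 else 0)) = (\<Sum>v\<in>UNIV. if v = a then w a else 0)"
    by (rule sum.cong) auto
  then show ?case using Cons by (simp add: monomial_weight_UNIV lookup_lmono_Cons distrib_left sum.distrib)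
qed

lemma weighted_homogeneous_sum:
  "(\<And>i. i \<in> A \<Longrightarrow> weighted_homogeneous w \<sigma> (f i)) \<Longrightarrow> weighted_homogeneous w \<sigma> (sum f A)"
proof (induction A rule: infinite_finite_induct)
  case (insert i A)
  then have "weighted_homogeneous w \<sigma> (f i)" "weighted_homogeneous w \<sigma> (sum f A)" by auto
  moreover have "Poly_Mapping.keys (f i + sum f A) \<subseteq> Poly_Mapping.keys (f i) \<union> Poly_Mapping.keys (sum f A)"
    by (rule Poly_Mapping.keys_add)
  ultimately show ?case using insert by (auto simp: weighted_homogeneous_def)
qed (auto simp: weighted_homogeneous_def)

lemma wpart_cpoly:
  fixes w :: "'a::finite \<Rightarrow> nat"
  assumes c: "c > 0"
  shows "\<exists>F. weighted_homogeneous (\<lambda>a. real (w a) / c) (real k / c) F \<and> (\<forall>p. wpart w f k p = poly_eval (($) p) F)"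
proof (intro exI conjI allI)
  let ?F = "\<Sum>as | sum_list (map w as) = k. Poly_Mapping.single (lmono as) (tcoef f as)"
  show "wpart w f k p = poly_eval (($) p) ?F" for p
    by (simp add: wpart_def poly_eval_sum poly_eval_single prod_lmono)
  show "weighted_homogeneous (\<lambda>a. real (w a) / c) (real k / c) ?F"
  proof (rule weighted_homogeneous_sum)
    fix as assume "as \<in> {as. sum_list (map w as) = k}"
    moreover have "sum_list (map (\<lambda>a. real (w a) / c) as) = real (sum_list (map w as)) / c"
      by (induction as) (auto simp: add_divide_distrib)
    ultimately show "weighted_homogeneous (\<lambda>a. real (w a) / c) (real k / c) (Poly_Mapping.single (lmono as) (tcoef f as))"
      by (auto simp: weighted_homogeneous_def monomial_weight_lmono)
  qed
qed

lemma wpart_unique: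
  fixes w :: "'a::finite \<Rightarrow> nat"
  assumes f: "cdiff f S" and S: "open S" "0 \<in> S" and w: "\<And>a. w a > 0"
    and e: "tt > 0" "\<And>t::real. 0 < t \<Longrightarrow> t < tt \<Longrightarrow> f (dil w (of_real t) p) = (\<Sum>k\<le>n. of_real t ^ k * a k)"
    and k: "k \<le> n"
  shows "wpart w f k p = a k"
proof -
  obtain C t0 where C0: "t0 > 0 \<and> t0 \<le> 1 \<and> (\<forall>t q. norm t < t0 \<longrightarrow> norm q \<le> norm p \<longrightarrow> dil w t q \<in> S \<and>
          norm (f (dil w t q) - (\<Sum>k\<le>n. t ^ k * wpart w f k q)) \<le> C * norm t ^ Suc n)"
    using wpart_expansion[where n = n and w = w and B = "norm p", OF f S w] by (elim exE)
  have "a k - wpart w f k p = 0"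
  proof (rule small_polynomial_zero[of "min t0 tt" "\<lambda>k. a k - wpart w f k p" n C k, OF _ _ k])
    show "min t0 tt > 0" using C0 e(1) by simp
    fix t :: real assume t: "0 < t" "t < min t0 tt"
    have "norm (f (dil w (of_real t) p) - (\<Sum>k\<le>n. of_real t ^ k * wpart w f k p)) \<le> C * norm (complex_of_real t) ^ Suc n"
      using C0[THEN conjunct2, THEN conjunct2, rule_format, of "of_real t" p] t by simp
    moreover have "f (dil w (of_real t) p) = (\<Sum>k\<le>n. of_real t ^ k * a k)" by (rule e(2)) (use t in auto)
    ultimately show "norm (\<Sum>k\<le>n. of_real t ^ k * (a k - wpart w f k p)) \<le> C * t ^ Suc n"
      using t by (simp add: right_diff_distrib sum_subtractf)
  qed
  then show ?thesis by simp
qed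

lemma cdiff_ev: "cdiff (ev q) S"
  unfolding cdiff_def
  by (intro ballI exI conjI allI, rule ev_has_derivative) (simp add: sum_distrib_left mult_ac)

lemma hom_wpart:
  fixes w :: "'a::finite \<Rightarrow> nat"
  assumes "hom w (int \<sigma>) q" and w: "\<And>a. w a > 0"
  shows "wpart w (ev q) \<sigma> p = ev q p"
proof -
  have "wpart w (ev q) \<sigma> p = (if \<sigma> = \<sigma> then ev q p else 0)"
  proof (rule wpart_unique[where tt = 1 and n = \<sigma> and a = "\<lambda>k. if k = \<sigma> then ev q p else 0", OF cdiff_ev open_UNIV UNIV_I w])
  fix t :: real assume "0 < t"
  then have "ev q (dil w (of_real t) p) = of_real t ^ \<sigma> * ev q p" using assms(1) by (simp add: hom_def)
  also have "\<dots> = (\<Sum>k\<le>\<sigma>. if k = \<sigma> then of_real t ^ \<sigma> * ev q p else 0)" by simp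
  also have "\<dots> = (\<Sum>k\<le>\<sigma>. of_real t ^ k * (if k = \<sigma> then ev q p else 0))" by (rule sum.cong) auto
  finally show "ev q (dil w (of_real t) p) = (\<Sum>k\<le>\<sigma>. of_real t ^ k * (if k = \<sigma> then ev q p else 0))" .
  qed auto
  then show ?thesis by simp
qed

lemma germ_sum: "finite A \<Longrightarrow> (\<Sum>i\<in>A. germ (X i)) = germ (\<lambda>p. \<Sum>i\<in>A. X i p)"
  for X :: "'i \<Rightarrow> 'a::real_normed_vector \<Rightarrow> 'b::real_vector"
  by (induction A rule: finite_induct) (simp_all add: zero_germ_def plus_germ.abs_eq)

lemma germ_eq_iff: "germ X = germ Y \<longleftrightarrow> (\<forall>\<^sub>F p in nhds 0. X p = Y p)"
  by (simp add: germ.abs_eq_iff germ_eq_def)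

lemma holomorphic_map_cdiff: "holomorphic_map_on X S \<Longrightarrow> cdiff (\<lambda>p. X p $ a) S"
  unfolding holomorphic_map_on_def cdiff_def
proof (intro ballI)
  fix p assume h: "\<forall>p\<in>S. \<exists>L. (X has_derivative L) (at p) \<and> (\<forall>c v. L (c *s v) = c *s L v)" and "p \<in> S"
  then obtain L where "(X has_derivative L) (at p)" "\<forall>c v. L (c *s v) = c *s L v" by blast
  then show "\<exists>L. ((\<lambda>p. X p $ a) has_derivative L) (at p) \<and> (\<forall>c v. L (c *s v) = c * L v)"
    by (intro exI[of _ "\<lambda>v. L v $ a"]) (simp add: bounded_linear.has_derivative[OF bounded_linear_vec_nth])
qed

lemma holomorphic_map_on_subset: "holomorphic_map_on X S \<Longrightarrow> T \<subseteq> S \<Longrightarrow> holomorphic_map_on X T"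
  by (auto simp: holomorphic_map_on_def)

lemma holomorphic_map_differentiable: "holomorphic_map_on X S \<Longrightarrow> p \<in> S \<Longrightarrow> X differentiable (at p)"
  by (auto simp: holomorphic_map_on_def differentiable_def)

lemma holomorphic_map_add:
  assumes "holomorphic_map_on X S" "holomorphic_map_on Y S"
  shows "holomorphic_map_on (\<lambda>p. X p + Y p) S"
  unfolding holomorphic_map_on_def
proof
  fix p assume p: "p \<in> S"
  obtain L where L: "(X has_derivative L) (at p)" "\<And>c v. L (c *s v) = c *s L v"
    using assms(1) p unfolding holomorphic_map_on_def by blast
  obtain K where K: "(Y has_derivative K) (at p)" "\<And>c v. K (c *s v) = c *s K v"
    using assms(2) p unfolding holomorphic_map_on_def by blast
  show "\<exists>L. ((\<lambda>p. X p + Y p) has_derivative L) (at p) \<and> (\<forall>c v. L (c *s v) = c *s L v)"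
    by (intro exI[of _ "\<lambda>v. L v + K v"] conjI has_derivative_add L(1) K(1))
      (simp add: L(2) K(2) vector_add_ldistrib)
qed

lemma holomorphic_map_scaleR:
  assumes "holomorphic_map_on X S"
  shows "holomorphic_map_on (\<lambda>p. r *\<^sub>R X p) S"
  unfolding holomorphic_map_on_def
proof
  fix p assume p: "p \<in> S"
  obtain L where L: "(X has_derivative L) (at p)" "\<And>c v. L (c *s v) = c *s L v"
    using assms(1) p unfolding holomorphic_map_on_def by blast
  show "\<exists>L. ((\<lambda>p. r *\<^sub>R X p) has_derivative L) (at p) \<and> (\<forall>c v. L (c *s v) = c *s L v)"
    by (intro exI[of _ "\<lambda>v. r *\<^sub>R L v"] conjI has_derivative_scaleR_right L(1))
      (simp add: L(2) vec_eq_iff)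
qed

section \<open>Homogeneous tangent fields and their brackets\<close>

context cr_model
begin

abbreviation m1 :: real where "m1 \<equiv> real (first_hoermander m)"

lemma m1_pos: "m1 > 0"
proof -
  have "Min (range m) \<in> range m" by (rule Min_in) auto
  then obtain l where "Min (range m) = m l" by (rule rangeE)
  then show ?thesis using m2[of l] by (simp add: first_hoermander_def)
qed

lemma coord_weight_wz: "coord_weight m = (\<lambda>a. real (wz a) / m1)"
proof
  fix a :: "'n + 'd" show "coord_weight m a = real (wz a) / m1"
    by (cases a) (auto simp: wz_def)
qed

text \<open>The degree is real because \<open>G\<close> is indexed by all real weights; in a degree
  that is not an integer only the zero polynomial remains.\<close>

definition rhom :: "real \<Rightarrow> ('n + 'd) pf \<Rightarrow> bool" where
  "rhom \<rho> q \<longleftrightarrow> q = 0 \<or> (\<exists>\<sigma>::int. real_of_int \<sigma> = \<rho> \<and> hom wz \<sigma> q)"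

lemma rhom_0 [simp]: "rhom \<rho> 0" by (simp add: rhom_def)

lemma rhom_add: "rhom \<rho> p \<Longrightarrow> rhom \<rho> q \<Longrightarrow> rhom \<rho> (p + q)"
  unfolding rhom_def by (auto intro: hom_add)

lemma rhom_minus: "rhom \<rho> p \<Longrightarrow> rhom \<rho> q \<Longrightarrow> rhom \<rho> (p - q)"
  unfolding rhom_def by (auto intro: hom_minus simp: hom_def right_diff_distrib)

lemma rhom_scaleR: "rhom \<rho> p \<Longrightarrow> rhom \<rho> (r *\<^sub>R p)"
  unfolding rhom_def by (auto intro: hom_scaleR)

lemma rhom_mult: "rhom \<rho> p \<Longrightarrow> rhom \<rho>' q \<Longrightarrow> rhom (\<rho> + \<rho>') (p * q)"
  unfolding rhom_def by (auto intro: hom_mult) (metis hom_mult of_int_add)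

lemma rhom_pd: "rhom \<rho> p \<Longrightarrow> rhom (\<rho> - real (wz b)) (pd b p)"
  unfolding rhom_def by (auto, metis hom_pd of_int_diff of_int_of_nat_eq)

lemma rhom_sum: "(\<And>i. i \<in> A \<Longrightarrow> rhom \<rho> (f i)) \<Longrightarrow> rhom \<rho> (sum f A)"
  by (induction A rule: infinite_finite_induct) (auto intro: rhom_add)

lemma rhom_nat: "rhom \<rho> q \<Longrightarrow> q \<noteq> 0 \<Longrightarrow> \<exists>\<sigma>::nat. real \<sigma> = \<rho> \<and> hom wz (int \<sigma>) q"
proof -
  assume "rhom \<rho> q" "q \<noteq> 0"
  then obtain \<sigma> :: int where s: "real_of_int \<sigma> = \<rho>" "hom wz \<sigma> q" unfolding rhom_def by blast
  have "\<not> \<sigma> < 0" using hom_neg_zero[OF s(2) _ wz_pos] \<open>q \<noteq> 0\<close> by blast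
  then show ?thesis using s by (intro exI[of _ "nat \<sigma>"]) auto
qed

text \<open>Translates formal weighted homogeneity into scaling under dilations; the factor
  \<open>m1\<close> undoes the normalization of the weights.\<close>

lemma homogeneous_field_iff:
  "homogeneous_field (coord_weight m) \<nu> X \<longleftrightarrow> (\<exists>Xp. X = pfield Xp \<and> (\<forall>a. rhom (\<nu> * m1 + real (wz a)) (Xp a)))"
proof
  assume "homogeneous_field (coord_weight m) \<nu> X"
  then obtain F where F: "\<And>a. weighted_homogeneous (coord_weight m) (\<nu> + coord_weight m a) (F a)" "\<And>a p. X p $ a = poly_eval (($) p) (F a)"
    unfolding homogeneous_field_def by metis
  have "X = pfield (\<lambda>a. pfc (F a))"
    by (rule ext) (simp add: vec_eq_iff F(2))
  moreover have "rhom (\<nu> * m1 + real (wz a)) (pfc (F a))" for a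
  proof (cases "F a = 0")
    case True
    then have "pfc (F a) = 0" by (intro pf_eqI) (simp add: poly_eval_0)
    then show ?thesis by simp
  next
    case False
    define W where "W M = (\<Sum>v\<in>UNIV. wz v * Poly_Mapping.lookup M v)" for M :: "'n + 'd \<Rightarrow>\<^sub>0 nat"
    have Wm: "real (W M) = \<nu> * m1 + real (wz a)" if "M \<in> Poly_Mapping.keys (F a)" for M
    proof -
      have "monomial_weight (coord_weight m) M = \<nu> + coord_weight m a"
        using F(1)[of a] that by (simp add: weighted_homogeneous_def)
      moreover have "monomial_weight (coord_weight m) M = real (W M) / m1"
        by (simp add: monomial_weight_UNIV W_def coord_weight_wz sum_divide_distrib)
      ultimately have "real (W M) / m1 = \<nu> + real (wz a) / m1" by (simp add: coord_weight_wz)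
      then show ?thesis using m1_pos by (simp add: field_simps)
    qed
    obtain M0 where M0: "M0 \<in> Poly_Mapping.keys (F a)" using False by fastforce
    have WM: "W M = W M0" if "M \<in> Poly_Mapping.keys (F a)" for M
      using Wm[OF that] Wm[OF M0] by simp
    have "hom wz (int (W M0)) (pfc (F a))"
      unfolding hom_def
    proof (intro allI impI)
      fix t :: real and x :: "complex ^ ('n + 'd)" assume "t > 0"
      have "(\<Prod>v\<in>UNIV. (dil wz (of_real t) x $ v) ^ Poly_Mapping.lookup M v) = of_real t ^ W M * (\<Prod>v\<in>UNIV. (x $ v) ^ Poly_Mapping.lookup M v)" for M
        by (simp add: power_mult_distrib prod.distrib power_mult[symmetric] W_def power_sum)
      then have "poly_eval (($) (dil wz (of_real t) x)) (F a) = (\<Sum>M\<in>Poly_Mapping.keys (F a). Poly_Mapping.lookup (F a) M * (of_real t ^ W M * (\<Prod>v\<in>UNIV. (x $ v) ^ Poly_Mapping.lookup M v)))"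
        by (subst poly_eval_superset[of "Poly_Mapping.keys (F a)"]) auto
      also have "\<dots> = (\<Sum>M\<in>Poly_Mapping.keys (F a). of_real t ^ W M0 * (Poly_Mapping.lookup (F a) M * (\<Prod>v\<in>UNIV. (x $ v) ^ Poly_Mapping.lookup M v)))"
        by (rule sum.cong) (auto simp: WM mult_ac)
      also have "\<dots> = of_real t ^ W M0 * poly_eval (($) x) (F a)"
        by (subst poly_eval_superset[of "Poly_Mapping.keys (F a)"]) (auto simp: sum_distrib_left)
      finally show "ev (pfc (F a)) (dil wz (of_real t) x) = of_real t powi int (W M0) * ev (pfc (F a)) x" by simp
    qed
    then show ?thesis unfolding rhom_def using Wm[OF M0] by (intro disjI2 exI[of _ "int (W M0)"]) simp
  qed
  ultimately show "\<exists>Xp. X = pfield Xp \<and> (\<forall>a. rhom (\<nu> * m1 + real (wz a)) (Xp a))" by blast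
next
  assume "\<exists>Xp. X = pfield Xp \<and> (\<forall>a. rhom (\<nu> * m1 + real (wz a)) (Xp a))"
  then obtain Xp where X: "X = pfield Xp" "\<And>a. rhom (\<nu> * m1 + real (wz a)) (Xp a)" by blast
  show "homogeneous_field (coord_weight m) \<nu> X"
    unfolding homogeneous_field_def
  proof
    fix a
    show "\<exists>F. weighted_homogeneous (coord_weight m) (\<nu> + coord_weight m a) F \<and> (\<forall>p. X p $ a = poly_eval (($) p) F)"
    proof (cases "Xp a = 0")
      case True
      then show ?thesis using X(1)
        by (intro exI[of _ 0]) (simp add: weighted_homogeneous_def poly_eval_0)
    next
      case False
      obtain \<sigma> :: nat where s: "real \<sigma> = \<nu> * m1 + real (wz a)" "hom wz (int \<sigma>) (Xp a)"
        using rhom_nat[OF X(2) False] by blast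
      obtain F where F: "weighted_homogeneous (\<lambda>a. real (wz a) / m1) (real \<sigma> / m1) F" "\<And>p. wpart wz (ev (Xp a)) \<sigma> p = poly_eval (($) p) F"
        using wpart_cpoly[OF m1_pos, of wz \<sigma> "ev (Xp a)"] by blast
      have "real \<sigma> / m1 = \<nu> + coord_weight m a" using s(1) m1_pos by (simp add: coord_weight_wz field_simps)
      then show ?thesis using F hom_wpart[OF s(2) wz_pos] X(1)
        by (intro exI[of _ F]) (simp add: coord_weight_wz)
    qed
  qed
qed

lemma eP_dil: "eP (dil wz (of_real t) p) = dil wt (of_real t) (eP p)"
  by (auto simp: vec_eq_crvar wz_def Re_complex_of_real simp flip: of_real_power)

lemma DP_dil: "t > 0 \<Longrightarrow> DP l (dil wz (of_real t) p) (dil wz (of_real t) v) = of_real t ^ m l * DP l p v"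
proof -
  assume t: "t > 0"
  have "ev (pd a (PP l)) (dil wt (of_real t) e) * (of_real t ^ wt a * x) = of_real t ^ m l * (ev (pd a (PP l)) e * x)" for a e x
  proof -
    have "ev (pd a (PP l)) (dil wt (of_real t) e) = of_real t powi (int (m l) - int (wt a)) * ev (pd a (PP l)) e"
      using hom_pd[OF hom_PP[of l], of a] t unfolding hom_def by blast
    moreover have "complex_of_real t powi (int (m l) - int (wt a)) * of_real t ^ wt a = of_real t ^ m l"
      using t by (simp add: power_int_diff)
    ultimately have "ev (pd a (PP l)) (dil wt (of_real t) e) * of_real t ^ wt a = of_real t ^ m l * ev (pd a (PP l)) e"
      by simp
    then show ?thesis by (simp flip: mult.assoc)
  qed
  then show ?thesis by (simp only: DP_def eP_dil dil_nth sum_distrib_left)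
qed

lemma MM_dil: "t > 0 \<Longrightarrow> p \<in> MM \<Longrightarrow> dil wz (of_real t) p \<in> MM"
  unfolding mem_MM eP_dil
proof
  fix l assume t: "t > 0" and p: "\<forall>l. of_real (Im (p $ Inr l)) = ev (PP l) (eP p)"
  have "ev (PP l) (dil wt (of_real t) (eP p)) = of_real t powi int (m l) * ev (PP l) (eP p)"
    using hom_PP[of l] t unfolding hom_def by blast
  moreover have "Im (of_real t ^ m l * p $ Inr l) = t ^ m l * Im (p $ Inr l)"
    by (simp flip: of_real_power)
  ultimately show "of_real (Im (dil wz (of_real t) p $ Inr l)) = ev (PP l) (dil wt (of_real t) (eP p))"
    using p[rule_format, of l] by (simp add: wz_def)
qed

lemma tangent_dil:
  assumes t: "t > 0" and p: "p \<in> MM" and v: "dil wz (of_real t) v \<in> tangent_space MM (dil wz (of_real t) p)"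
  shows "v \<in> tangent_space MM p"
  unfolding tangent_MM[OF p]
proof
  fix l
  have "of_real (Im (dil wz (of_real t) v $ Inr l)) = of_real t ^ m l * DP l p v"
    using v unfolding tangent_MM[OF MM_dil[OF t p]] DP_dil[OF t] by blast
  moreover have "Im (of_real t ^ m l * v $ Inr l) = t ^ m l * Im (v $ Inr l)"
    by (simp flip: of_real_power)
  ultimately show "of_real (Im (v $ Inr l)) = DP l p v" using t by (simp add: wz_def)
qed

lemma tang_iff: "tang X \<longleftrightarrow> (\<forall>p\<in>MM. pfield X p \<in> tangent_space MM p)"
  by (simp add: tang_def tangent_MM pfield_def)

lemma dil_near_0:
  assumes S: "open S" "0 \<in> S"
  shows "\<exists>t0>0. \<forall>t::real. 0 < t \<longrightarrow> t < t0 \<longrightarrow> dil wz (of_real t) p \<in> S"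
proof -
  obtain C t0 where "t0 > 0 \<and> t0 \<le> 1 \<and> (\<forall>t q. norm t < t0 \<longrightarrow> norm q \<le> norm p \<longrightarrow> dil wz t q \<in> S \<and>
          norm (ev 0 (dil wz t q) - (\<Sum>k\<le>0. t ^ k * wpart wz (ev 0) k q)) \<le> C * norm t ^ Suc 0)"
    using wpart_expansion[where n = 0 and w = wz and B = "norm p", OF cdiff_ev[of 0] S wz_pos] by (elim exE)
  then show ?thesis by (intro exI[of _ t0]) (auto simp del: ev_simps)
qed

text \<open>Dilations preserve the model and its tangent spaces, and they reproduce a homogeneous
  field up to a positive factor. Tangency near 0 therefore decides tangency everywhere.\<close>

lemma near_tang:
  assumes r: "\<And>a. rhom (\<nu> * m1 + real (wz a)) (X a)" and S: "open S" "0 \<in> S" "\<And>p. p \<in> S \<inter> MM \<Longrightarrow> pfield X p \<in> tangent_space MM p"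
  shows "tang X"
  unfolding tang_iff
proof
  fix p assume p: "p \<in> MM"
  obtain t0 where t0: "t0 > 0" "\<And>t::real. 0 < t \<Longrightarrow> t < t0 \<Longrightarrow> dil wz (of_real t) p \<in> S"
    using dil_near_0[OF S(1,2)] by blast
  define t where "t = t0 / 2"
  have t: "t > 0" "t < t0" using t0(1) by (auto simp: t_def)
  \<comment> \<open>A real power, since \<open>\<nu> * m1\<close> is an arbitrary real number; on a
    nonzero component the total exponent is a natural number.\<close>
  define c where "c = t powr (\<nu> * m1)"
  have c: "c > 0" using t by (simp add: c_def)
  have "ev (X a) (dil wz (of_real t) p) = of_real c * (of_real t ^ wz a * ev (X a) p)" for a
  proof (cases "X a = 0")
    case False
    obtain \<sigma> :: nat where s: "real \<sigma> = \<nu> * m1 + real (wz a)" "hom wz (int \<sigma>) (X a)"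
      using rhom_nat[OF r False] by blast
    have "t ^ \<sigma> = t powr (\<nu> * m1 + real (wz a))" using t s(1) powr_realpow[of t \<sigma>] by simp
    also have "\<dots> = c * t ^ wz a" using t by (simp add: c_def powr_add powr_realpow)
    finally have "of_real t ^ \<sigma> = complex_of_real c * of_real t ^ wz a" by (metis of_real_mult of_real_power)
    then show ?thesis using s(2) t by (simp add: hom_def)
  qed simp
  then have e: "pfield X (dil wz (of_real t) p) = c *\<^sub>R dil wz (of_real t) (pfield X p)"
    by (simp add: vec_eq_iff vector_scaleR_component scaleR_conv_of_real[where 'a = complex])
  have q: "dil wz (of_real t) p \<in> MM" by (rule MM_dil[OF t(1) p])
  have "pfield X (dil wz (of_real t) p) \<in> tangent_space MM (dil wz (of_real t) p)"
    by (rule S(3)) (use t0(2)[OF t] q in simp)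
  then have "inverse c *\<^sub>R pfield X (dil wz (of_real t) p) \<in> tangent_space MM (dil wz (of_real t) p)"
    by (rule subspace_scale[OF subspace_tangent[OF q]])
  then have "dil wz (of_real t) (pfield X p) \<in> tangent_space MM (dil wz (of_real t) p)" unfolding e using c by simp
  then show "pfield X p \<in> tangent_space MM p" by (rule tangent_dil[OF t(1) p])
qed

abbreviation GG :: "real \<Rightarrow> (complex ^ ('n + 'd), complex ^ ('n + 'd)) germ set" where
  "GG \<equiv> Defs.G (coord_weight m) MM"

text \<open>A germ in \<open>G\<close> has one homogeneous and one tangent representative. They
  agree near 0, which by \<open>near_tang\<close> makes the homogeneous one tangent.\<close>

lemma G_rep: "g \<in> GG \<nu> \<Longrightarrow> \<exists>X. g = germ (pfield X) \<and> (\<forall>a. rhom (\<nu> * m1 + real (wz a)) (X a)) \<and> tang X"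
proof -
  assume g: "g \<in> GG \<nu>"
  then obtain X where X: "g = germ (pfield X)" "\<And>a. rhom (\<nu> * m1 + real (wz a)) (X a)"
    unfolding G_def homogeneous_field_iff by blast
  obtain Y S where Y: "g = germ Y" "open S" "0 \<in> S" "\<And>p. p \<in> S \<inter> MM \<Longrightarrow> Y p \<in> tangent_space MM p"
    using g unfolding G_def hol_def by blast
  have "\<forall>\<^sub>F p in nhds 0. pfield X p = Y p" using X(1) Y(1) germ_eq_iff by metis
  then obtain T where T: "open T" "0 \<in> T" "\<And>p. p \<in> T \<Longrightarrow> pfield X p = Y p" unfolding eventually_nhds by blast
  have "tang X"
    by (rule near_tang[OF X(2), of "S \<inter> T"]) (use Y T in auto)
  then show ?thesis using X by blast
qed

lemma G_intro: "(\<And>a. rhom (\<nu> * m1 + real (wz a)) (X a)) \<Longrightarrow> tang X \<Longrightarrow> germ (pfield X) \<in> GG \<nu>"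
  unfolding G_def hol_def tang_iff homogeneous_field_iff using pfield_holomorphic by blast

lemma subspace_hol: "subspace (hol MM)"
  unfolding subspace_def
proof (intro conjI ballI allI)
  have "germ (pfield (\<lambda>_. 0)) \<in> hol MM"
    unfolding hol_def using pfield_holomorphic subspace_0[OF subspace_tangent]
    by (intro CollectI exI[of _ "pfield (\<lambda>_. 0)"] conjI refl exI[of _ UNIV]) (auto simp: pfield_def zero_vec_def[symmetric])
  then show "0 \<in> hol MM" using germ_pfield_0[of "\<lambda>_. 0"] by simp
next
  fix x y assume "x \<in> hol MM" "y \<in> hol MM"
  then obtain X S Y T where X: "x = germ X" "open S" "0 \<in> S" "holomorphic_map_on X S" "\<forall>p\<in>S \<inter> MM. X p \<in> tangent_space MM p"
    and Y: "y = germ Y" "open T" "0 \<in> T" "holomorphic_map_on Y T" "\<forall>p\<in>T \<inter> MM. Y p \<in> tangent_space MM p"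
    unfolding hol_def by blast
  show "x + y \<in> hol MM"
    unfolding hol_def
  proof (intro CollectI exI[of _ "\<lambda>p. X p + Y p"] conjI exI[of _ "S \<inter> T"] ballI)
    show "x + y = germ (\<lambda>p. X p + Y p)" using X(1) Y(1) by (simp add: plus_germ.abs_eq)
    show "holomorphic_map_on (\<lambda>p. X p + Y p) (S \<inter> T)"
      by (intro holomorphic_map_add) (use X(4) Y(4) holomorphic_map_on_subset in blast)+
    fix p assume "p \<in> S \<inter> T \<inter> MM"
    then show "X p + Y p \<in> tangent_space MM p" using X(5) Y(5) by (intro subspace_add subspace_tangent) auto
  qed (use X Y in auto)
next
  fix c :: real and x assume "x \<in> hol MM"
  then obtain X S where X: "x = germ X" "open S" "0 \<in> S" "holomorphic_map_on X S" "\<forall>p\<in>S \<inter> MM. X p \<in> tangent_space MM p"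
    unfolding hol_def by blast
  show "c *\<^sub>R x \<in> hol MM"
    unfolding hol_def
  proof (intro CollectI exI[of _ "\<lambda>p. c *\<^sub>R X p"] conjI exI[of _ S] ballI)
    show "c *\<^sub>R x = germ (\<lambda>p. c *\<^sub>R X p)" using X(1) by (simp add: scaleR_germ.abs_eq)
    show "holomorphic_map_on (\<lambda>p. c *\<^sub>R X p) S" by (rule holomorphic_map_scaleR[OF X(4)])
    fix p assume "p \<in> S \<inter> MM"
    then show "c *\<^sub>R X p \<in> tangent_space MM p" using X(5) by (intro subspace_scale subspace_tangent) auto
  qed (use X in auto)
qed

lemma pfield_add: "(\<lambda>p. pfield X p + pfield Y p) = pfield (\<lambda>a. X a + Y a)"
  by (rule ext) (simp add: vec_eq_iff)

lemma pfield_scaleR: "(\<lambda>p. c *\<^sub>R pfield X p) = pfield (\<lambda>a. c *\<^sub>R X a)"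
  by (rule ext) (simp add: vec_eq_iff vector_scaleR_component scaleR_conv_of_real[where 'a = complex])

lemma subspace_G: "subspace (GG \<nu>)"
  unfolding subspace_def
proof (intro conjI ballI allI)
  have "germ (pfield (\<lambda>_. 0)) \<in> GG \<nu>"
    by (rule G_intro) (auto simp: tang_iff pfield_def zero_vec_def[symmetric] subspace_0[OF subspace_tangent])
  then show "0 \<in> GG \<nu>" using germ_pfield_0[of "\<lambda>_. 0"] by simp
next
  fix x y assume "x \<in> GG \<nu>" "y \<in> GG \<nu>"
  then obtain X Y where X: "x = germ (pfield X)" "\<And>a. rhom (\<nu> * m1 + real (wz a)) (X a)" "tang X"
    and Y: "y = germ (pfield Y)" "\<And>a. rhom (\<nu> * m1 + real (wz a)) (Y a)" "tang Y"
    using G_rep by metis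
  have "germ (pfield (\<lambda>a. X a + Y a)) \<in> GG \<nu>"
    using X(3) Y(3) by (intro G_intro rhom_add X Y) (simp add: tang_iff pfield_add[symmetric] subspace_add[OF subspace_tangent])
  then show "x + y \<in> GG \<nu>" using X(1) Y(1) by (simp add: plus_germ.abs_eq pfield_add)
next
  fix c :: real and x assume "x \<in> GG \<nu>"
  then obtain X where X: "x = germ (pfield X)" "\<And>a. rhom (\<nu> * m1 + real (wz a)) (X a)" "tang X"
    using G_rep by metis
  have "germ (pfield (\<lambda>a. c *\<^sub>R X a)) \<in> GG \<nu>"
    using X(3) by (intro G_intro rhom_scaleR X) (simp add: tang_iff pfield_scaleR[symmetric] subspace_scale[OF subspace_tangent])
  then show "c *\<^sub>R x \<in> GG \<nu>" using X(1) by (simp add: scaleR_germ.abs_eq pfield_scaleR)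
qed

lemma pfield_has_derivative:
  "(pfield X has_derivative (\<lambda>h. \<chi> a. \<Sum>i\<in>UNIV. ev (pd i (X a)) p * h $ i)) (at p)"
  by (rule has_derivative_vecI) (simp add: ev_has_derivative)

lemma lie_bracket_pfield:
  "lie_bracket (pfield X) (pfield Y) = pfield (\<lambda>a. (\<Sum>b\<in>UNIV. pd b (Y a) * X b) - (\<Sum>b\<in>UNIV. pd b (X a) * Y b))"
  by (rule ext) (simp add: lie_bracket_def frechet_derivative_at[OF pfield_has_derivative, symmetric] vec_eq_iff)

lemma G_bracket:
  assumes "x \<in> GG \<mu>" "y \<in> GG \<nu>"
  shows "germ_bracket x y \<in> GG (\<mu> + \<nu>)"
proof -
  obtain X Y where X: "x = germ (pfield X)" "\<And>a. rhom (\<mu> * m1 + real (wz a)) (X a)" "tang X"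
    and Y: "y = germ (pfield Y)" "\<And>a. rhom (\<nu> * m1 + real (wz a)) (Y a)" "tang Y"
    using G_rep[OF assms(1)] G_rep[OF assms(2)] by metis
  let ?Z = "\<lambda>a. (\<Sum>b\<in>UNIV. pd b (Y a) * X b) - (\<Sum>b\<in>UNIV. pd b (X a) * Y b)"
  have "germ (pfield ?Z) \<in> GG (\<mu> + \<nu>)"
  proof (rule G_intro)
    fix a
    have "rhom ((\<mu> + \<nu>) * m1 + real (wz a)) (pd b (Y a) * X b)" for b
      using rhom_mult[OF rhom_pd[OF Y(2)[of a], of b] X(2)[of b]] by (simp add: algebra_simps)
    moreover have "rhom ((\<mu> + \<nu>) * m1 + real (wz a)) (pd b (X a) * Y b)" for b
      using rhom_mult[OF rhom_pd[OF X(2)[of a], of b] Y(2)[of b]] by (simp add: algebra_simps)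
    ultimately show "rhom ((\<mu> + \<nu>) * m1 + real (wz a)) (?Z a)" by (intro rhom_minus rhom_sum)
  next
    show "tang ?Z"
      unfolding tang_iff lie_bracket_pfield[symmetric]
    proof
      fix p assume p: "p \<in> MM"
      have d: "pfield X differentiable (at q)" for X q using pfield_has_derivative differentiable_def by blast
      show "lie_bracket (pfield X) (pfield Y) p \<in> tangent_space MM p"
        by (rule tangent_bracket[OF open_UNIV d _ d]) (use X(3) Y(3) p in \<open>auto simp: tang_iff\<close>)
    qed
  qed
  then show ?thesis using X(1) Y(1) by (simp add: germ_bracket.abs_eq lie_bracket_pfield)
qed

end

definition wpf :: "('a \<Rightarrow> nat) \<Rightarrow> (complex ^ 'a::finite \<Rightarrow> complex) \<Rightarrow> nat \<Rightarrow> 'a pf" where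
  "wpf w f k = (SOME q. \<forall>x. ev q x = wpart w f k x)"

lemma ev_wpf [simp]: "ev (wpf w f k) x = wpart w f k x"
  using someI_ex[OF ex_pf[OF polyfun_wpart[of w f k]]] by (simp add: wpf_def)

lemma hom_wpf: "hom w (int k) (wpf w f k)"
  by (simp add: hom_def wpart_dil)

lemma norm_vec_le_sum: "norm (x :: complex ^ 'a::finite) \<le> (\<Sum>a\<in>UNIV. norm (x $ a))"
  by (simp add: norm_vec_def L2_set_le_sum)

section \<open>Weighted components of a tangent field\<close>

context cr_model
begin

text \<open>A common bound for the weights of all coordinates. Components of a field start at weight
  \<open>- WW\<close> or later, so this shift makes all exponents of \<open>t\<close> natural
  numbers; it also fixes the additional jet order.\<close>

definition WW :: nat where "WW = (\<Sum>a\<in>UNIV. wz (a :: 'n + 'd))"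

lemma wz_le_WW: "wz a \<le> WW"
  unfolding WW_def by (rule member_le_sum) auto

definition ppart :: "(complex ^ ('n + 'd) \<Rightarrow> complex ^ ('n + 'd)) \<Rightarrow> int \<Rightarrow> 'n + 'd \<Rightarrow> ('n + 'd) pf" where
  "ppart X \<mu> a = (if \<mu> + int (wz a) \<ge> 0 then wpf wz (\<lambda>p. X p $ a) (nat (\<mu> + int (wz a))) else 0)"

lemma rhom_ppart: "rhom (real_of_int \<mu> + real (wz a)) (ppart X \<mu> a)"
  using hom_wpf[of wz "nat (\<mu> + int (wz a))" "\<lambda>p. X p $ a"]
  by (auto simp: ppart_def rhom_def intro!: exI[of _ "\<mu> + int (wz a)"])

lemma ppart_sum:
  "(\<Sum>j\<le>WW + N. of_real t ^ j * ev (ppart X (int j - int WW) a) q)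
   = of_real t ^ (WW - wz a) * (\<Sum>k\<le>N + wz a. of_real t ^ k * wpart wz (\<lambda>p. X p $ a) k q)"
proof -
  let ?c = "WW - wz a"
  let ?g = "\<lambda>j. of_real t ^ j * ev (ppart X (int j - int WW) a) q"
  have "(\<Sum>j\<le>WW + N. ?g j) = (\<Sum>j\<in>(\<lambda>k. k + ?c) ` {..N + wz a}. ?g j)"
  proof (rule sum.mono_neutral_right)
    show "(\<lambda>k. k + ?c) ` {..N + wz a} \<subseteq> {..WW + N}" using wz_le_WW[of a] by auto
    show "\<forall>j\<in>{..WW + N} - (\<lambda>k. k + ?c) ` {..N + wz a}. ?g j = 0"
    proof
      fix j assume j: "j \<in> {..WW + N} - (\<lambda>k. k + ?c) ` {..N + wz a}"
      have "j < ?c"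
      proof (rule ccontr)
        assume "\<not> j < ?c"
        then have "j = (j - ?c) + ?c" "j - ?c \<le> N + wz a" using j wz_le_WW[of a] by auto
        then show False using j by blast
      qed
      then have "\<not> int j - int WW + int (wz a) \<ge> 0" using wz_le_WW[of a] by linarith
      then show "?g j = 0" by (simp add: ppart_def)
    qed
  qed simp
  also have "\<dots> = (\<Sum>k\<le>N + wz a. ?g (k + ?c))" by (subst sum.reindex) auto
  also have "\<dots> = (\<Sum>k\<le>N + wz a. of_real t ^ ?c * (of_real t ^ k * wpart wz (\<lambda>p. X p $ a) k q))"
  proof (rule sum.cong[OF refl])
    fix k
    have "int (k + ?c) - int WW + int (wz a) = int k" using wz_le_WW[of a] by simp
    moreover from this have "int (k + ?c) - int WW = int k - int (wz a)" by linarith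
    ultimately have "ppart X (int (k + ?c) - int WW) a = wpf wz (\<lambda>p. X p $ a) k" by (simp add: ppart_def)
    then show "?g (k + ?c) = of_real t ^ ?c * (of_real t ^ k * wpart wz (\<lambda>p. X p $ a) k q)"
      by (simp only: ev_wpf power_add mult_ac)
  qed
  finally show ?thesis by (simp add: sum_distrib_left)
qed

text \<open>Up to the factor \<open>t ^ WW\<close>, the vector with entries
  \<open>t ^ (WW - wz a) * X (dil wz t q) $ a\<close> is the field at the dilated point carried back
  by the inverse dilation; its expansion in \<open>t\<close> lists the homogeneous components of the
  field.\<close>

lemma vec_expansion:
  assumes X: "holomorphic_map_on X S" and S: "open S" "0 \<in> S"
  shows "\<exists>C t0. t0 > 0 \<and> C \<ge> 0 \<and> (\<forall>t::real. \<forall>q. 0 < t \<longrightarrow> t < t0 \<longrightarrow> norm q \<le> B \<longrightarrow> dil wz (of_real t) q \<in> S \<and>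
    norm ((\<chi> a. of_real t ^ (WW - wz a) * X (dil wz (of_real t) q) $ a) - (\<Sum>j\<le>WW + N. t ^ j *\<^sub>R pfield (ppart X (int j - int WW)) q))
      \<le> C * t ^ Suc (WW + N))"
proof -
  have "\<exists>C t0. t0 > 0 \<and> t0 \<le> 1 \<and> (\<forall>t q. norm t < t0 \<longrightarrow> norm q \<le> B \<longrightarrow> dil wz t q \<in> S \<and>
     norm (X (dil wz t q) $ a - (\<Sum>k\<le>N + wz a. t ^ k * wpart wz (\<lambda>p. X p $ a) k q)) \<le> C * norm t ^ Suc (N + wz a))" for a
  proof -
    have "cdiff (\<lambda>p. X p $ a) S" by (rule holomorphic_map_cdiff[OF X])
    from wpart_expansion[OF this S, of wz B "N + wz a"] show ?thesis using wz_pos by simp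
  qed
  then have "\<forall>a. \<exists>C t0. t0 > 0 \<and> t0 \<le> 1 \<and> (\<forall>t q. norm t < t0 \<longrightarrow> norm q \<le> B \<longrightarrow> dil wz t q \<in> S \<and>
     norm (X (dil wz t q) $ a - (\<Sum>k\<le>N + wz a. t ^ k * wpart wz (\<lambda>p. X p $ a) k q)) \<le> C * norm t ^ Suc (N + wz a))" by (intro allI)
  then obtain C where "\<forall>a. \<exists>t0. t0 > 0 \<and> t0 \<le> 1 \<and> (\<forall>t q. norm t < t0 \<longrightarrow> norm q \<le> B \<longrightarrow> dil wz t q \<in> S \<and>
     norm (X (dil wz t q) $ a - (\<Sum>k\<le>N + wz a. t ^ k * wpart wz (\<lambda>p. X p $ a) k q)) \<le> C a * norm t ^ Suc (N + wz a))"
    by (rule choice[THEN exE])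
  then obtain t0 where T0: "\<forall>a. t0 a > 0 \<and> t0 a \<le> 1 \<and> (\<forall>t q. norm t < t0 a \<longrightarrow> norm q \<le> B \<longrightarrow> dil wz t q \<in> S \<and>
     norm (X (dil wz t q) $ a - (\<Sum>k\<le>N + wz a. t ^ k * wpart wz (\<lambda>p. X p $ a) k q)) \<le> C a * norm t ^ Suc (N + wz a))"
    by (rule choice[THEN exE])
  have T: "\<And>a. t0 a > 0" "\<And>t q a. norm t < t0 a \<Longrightarrow> norm q \<le> B \<Longrightarrow> dil wz t q \<in> S"
    "\<And>t q a. norm t < t0 a \<Longrightarrow> norm q \<le> B \<Longrightarrow>
     norm (X (dil wz t q) $ a - (\<Sum>k\<le>N + wz a. t ^ k * wpart wz (\<lambda>p. X p $ a) k q)) \<le> C a * norm t ^ Suc (N + wz a)"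
    using T0 by simp_all
  define s0 where "s0 = Min (range t0)"
  have s0: "s0 > 0" unfolding s0_def using T(1) by (subst Min_gr_iff) auto
  have s0le: "s0 \<le> t0 a" for a unfolding s0_def by (rule Min_le) auto
  show ?thesis
  proof (rule exI[of _ "\<Sum>a\<in>UNIV. \<bar>C a\<bar>"], rule exI[of _ s0], intro conjI allI impI)
    show "s0 > 0" by (rule s0)
    show "(\<Sum>a\<in>UNIV. \<bar>C a\<bar>) \<ge> 0" by (rule sum_nonneg) simp
    fix t :: real and q :: "complex ^ ('n + 'd)" assume t: "0 < t" "t < s0" and q: "norm q \<le> B"
    have nt: "norm (complex_of_real t) < t0 a" for a using t s0le[of a] by simp
    show "dil wz (of_real t) q \<in> S" by (rule T(2)[OF nt q])
    have comp: "norm (((\<chi> a. of_real t ^ (WW - wz a) * X (dil wz (of_real t) q) $ a) - (\<Sum>j\<le>WW + N. t ^ j *\<^sub>R pfield (ppart X (int j - int WW)) q)) $ a)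
      \<le> \<bar>C a\<bar> * t ^ Suc (WW + N)" for a
    proof -
      let ?s = "\<Sum>k\<le>N + wz a. of_real t ^ k * wpart wz (\<lambda>p. X p $ a) k q"
      have "(\<Sum>j\<le>WW + N. t ^ j *\<^sub>R pfield (ppart X (int j - int WW)) q) $ a = of_real t ^ (WW - wz a) * ?s"
        unfolding ppart_sum[symmetric] by (simp add: vector_scaleR_component scaleR_conv_of_real[where 'a = complex])
      then have "((\<chi> a. of_real t ^ (WW - wz a) * X (dil wz (of_real t) q) $ a) - (\<Sum>j\<le>WW + N. t ^ j *\<^sub>R pfield (ppart X (int j - int WW)) q)) $ a
        = of_real t ^ (WW - wz a) * (X (dil wz (of_real t) q) $ a - ?s)"
        by (simp only: vector_minus_component vec_lambda_beta right_diff_distrib)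
      then have "norm (((\<chi> a. of_real t ^ (WW - wz a) * X (dil wz (of_real t) q) $ a) - (\<Sum>j\<le>WW + N. t ^ j *\<^sub>R pfield (ppart X (int j - int WW)) q)) $ a)
        = t ^ (WW - wz a) * norm (X (dil wz (of_real t) q) $ a - ?s)"
        using t(1) by (simp add: norm_mult norm_power)
      also have "\<dots> \<le> t ^ (WW - wz a) * (C a * t ^ Suc (N + wz a))"
        using T(3)[OF nt q, of a] t(1) by (intro mult_left_mono) auto
      also have "\<dots> = C a * t ^ (WW - wz a + Suc (N + wz a))" by (simp only: power_add mult_ac)
      also have "WW - wz a + Suc (N + wz a) = Suc (WW + N)" using wz_le_WW[of a] by simp
      also have "C a * t ^ Suc (WW + N) \<le> \<bar>C a\<bar> * t ^ Suc (WW + N)" using t(1) by (intro mult_right_mono) auto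
      finally show ?thesis .
    qed
    show "norm ((\<chi> a. of_real t ^ (WW - wz a) * X (dil wz (of_real t) q) $ a) - (\<Sum>j\<le>WW + N. t ^ j *\<^sub>R pfield (ppart X (int j - int WW)) q))
      \<le> (\<Sum>a\<in>UNIV. \<bar>C a\<bar>) * t ^ Suc (WW + N)"
      unfolding sum_distrib_right by (rule order_trans[OF norm_vec_le_sum sum_mono]) (rule comp)
  qed
qed

lemma ppart_neg: "\<mu> < - int WW \<Longrightarrow> ppart X \<mu> = (\<lambda>_. 0)"
  by (rule ext) (use wz_le_WW in \<open>auto simp: ppart_def, smt (verit) of_nat_mono\<close>)

text \<open>The field carried back by a small dilation is tangent at \<open>p\<close>. The
  differential of the defining function turns its expansion into a polynomial in \<open>t\<close>
  that is smaller than its degree permits, so every coefficient vanishes.\<close>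

lemma tang_ppart:
  assumes X: "holomorphic_map_on X S" and S: "open S" "0 \<in> S" and t: "\<And>p. p \<in> S \<inter> MM \<Longrightarrow> X p \<in> tangent_space MM p"
  shows "tang (ppart X \<mu>)"
proof (cases "\<mu> < - int WW")
  case True
  then show ?thesis by (simp add: ppart_neg tang_iff pfield_def zero_vec_def[symmetric] subspace_0[OF subspace_tangent])
next
  case False
  define j0 where "j0 = nat (\<mu> + int WW)"
  have j0: "int j0 - int WW = \<mu>" using False by (simp add: j0_def)
  show ?thesis unfolding tang_iff
  proof
    fix p assume p: "p \<in> MM"
    show "pfield (ppart X \<mu>) p \<in> tangent_space MM p"
      unfolding tangent_dir[OF p]
    proof
      fix l
      have bl: "bounded_linear (dir (Phi l) p)" using linear_dir by (simp add: linear_conv_bounded_linear)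
      obtain K where K: "K > 0" "\<And>v. norm (dir (Phi l) p v) \<le> norm v * K" using bounded_linear.pos_bounded[OF bl] by blast
      obtain C t0 where C0: "t0 > 0 \<and> C \<ge> 0 \<and> (\<forall>t::real. \<forall>q. 0 < t \<longrightarrow> t < t0 \<longrightarrow> norm q \<le> norm p \<longrightarrow> dil wz (of_real t) q \<in> S \<and>
        norm ((\<chi> a. of_real t ^ (WW - wz a) * X (dil wz (of_real t) q) $ a) - (\<Sum>j\<le>WW + j0. t ^ j *\<^sub>R pfield (ppart X (int j - int WW)) q))
        \<le> C * t ^ Suc (WW + j0))"
        using vec_expansion[OF X S, of "norm p" j0] by (elim exE)
      have "dir (Phi l) p (pfield (ppart X (int j0 - int WW)) p) = 0"
      proof (rule small_polynomial_zero[of t0 "\<lambda>j. dir (Phi l) p (pfield (ppart X (int j - int WW)) p)" "WW + j0" "C * K" j0])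
        show "t0 > 0" using C0 by simp
        fix t :: real assume t0: "0 < t" "t < t0"
        let ?q = "dil wz (of_real t) p"
        let ?v = "\<chi> a. of_real t ^ (WW - wz a) * X ?q $ a"
        let ?s = "\<Sum>j\<le>WW + j0. t ^ j *\<^sub>R pfield (ppart X (int j - int WW)) p"
        have qS: "?q \<in> S" and est: "norm (?v - ?s) \<le> C * t ^ Suc (WW + j0)"
          using C0[THEN conjunct2, THEN conjunct2, rule_format, OF t0 order_refl] by simp_all
        have qM: "?q \<in> MM" by (rule MM_dil[OF t0(1) p])
        have "dil wz (of_real t) ?v = (t ^ WW) *\<^sub>R X ?q"
        proof -
          have "complex_of_real t ^ wz a * of_real t ^ (WW - wz a) = of_real t ^ WW" for a
            using wz_le_WW[of a] by (simp flip: power_add)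
          then show ?thesis
            by (simp add: vec_eq_iff vector_scaleR_component scaleR_conv_of_real[where 'a = complex] flip: mult.assoc)
        qed
        moreover have "(t ^ WW) *\<^sub>R X ?q \<in> tangent_space MM ?q"
          by (rule subspace_scale[OF subspace_tangent[OF qM]], rule t) (use qS qM in simp)
        ultimately have "?v \<in> tangent_space MM p" by (intro tangent_dil[OF t0(1) p]) simp
        then have v0: "dir (Phi l) p ?v = 0" unfolding tangent_dir[OF p] by blast
        have "dir (Phi l) p ?s = (\<Sum>j\<le>WW + j0. of_real t ^ j * dir (Phi l) p (pfield (ppart X (int j - int WW)) p))"
          by (simp add: linear_sum[OF linear_dir] linear_scale[OF linear_dir] scaleR_conv_of_real[where 'a = complex])
        moreover have "norm (dir (Phi l) p ?s) \<le> (C * K) * t ^ Suc (WW + j0)"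
        proof -
          have "norm (dir (Phi l) p ?s) = norm (dir (Phi l) p (?v - ?s))" unfolding linear_diff[OF linear_dir] v0 by simp
          also have "\<dots> \<le> norm (?v - ?s) * K" by (rule K(2))
          also have "\<dots> \<le> (C * t ^ Suc (WW + j0)) * K" using est K(1) by (intro mult_right_mono) auto
          finally show ?thesis by (simp add: mult_ac)
        qed
        ultimately show "norm (\<Sum>j\<le>WW + j0. of_real t ^ j * dir (Phi l) p (pfield (ppart X (int j - int WW)) p)) \<le> (C * K) * t ^ Suc (WW + j0)"
          by simp
      qed simp
      then show "dir (Phi l) p (pfield (ppart X \<mu>) p) = 0" unfolding j0 .
    qed
  qed
qed

text \<open>At dilated points different weights become different powers of \<open>t\<close>.
  Summands with vanishing \<open>a\<close>-th component are removed first, since only nonzero ones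
  have a natural number as degree.\<close>

lemma G_independent:
  assumes N: "finite N" and d: "\<And>\<nu>. \<nu> \<in> N \<Longrightarrow> d \<nu> \<in> GG \<nu>" and s: "(\<Sum>\<nu>\<in>N. d \<nu>) = 0" and \<nu>0: "\<nu>0 \<in> N"
  shows "d \<nu>0 = 0"
proof -
  have "\<forall>\<nu>\<in>N. \<exists>X. d \<nu> = germ (pfield X) \<and> (\<forall>a. rhom (\<nu> * m1 + real (wz a)) (X a)) \<and> tang X"
    using G_rep[OF d] by blast
  then obtain D where D0: "\<forall>\<nu>\<in>N. d \<nu> = germ (pfield (D \<nu>)) \<and> (\<forall>a. rhom (\<nu> * m1 + real (wz a)) (D \<nu> a)) \<and> tang (D \<nu>)"
    by (rule bchoice[THEN exE])
  have "(\<Sum>\<nu>\<in>N. d \<nu>) = (\<Sum>\<nu>\<in>N. germ (pfield (D \<nu>)))" by (rule sum.cong) (use D0 in auto)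
  also have "\<dots> = germ (pfield (\<lambda>a. \<Sum>\<nu>\<in>N. D \<nu> a))"
    unfolding germ_sum[OF N] by (rule arg_cong[where f = germ]) (simp add: fun_eq_iff vec_eq_iff)
  finally have z: "(\<Sum>\<nu>\<in>N. D \<nu> a) = 0" for a using s germ_pfield_0 by metis
  have "D \<nu>0 a = 0" for a
  proof (rule ccontr)
    assume nz: "D \<nu>0 a \<noteq> 0"
    define N' where "N' = {\<nu>\<in>N. D \<nu> a \<noteq> 0}"
    have finN': "finite N'" using N by (simp add: N'_def)
    have "\<forall>\<nu>\<in>N'. \<exists>\<sigma>::nat. real \<sigma> = \<nu> * m1 + real (wz a) \<and> hom wz (int \<sigma>) (D \<nu> a)"
    proof
      fix \<nu> assume "\<nu> \<in> N'"
      then have "\<nu> \<in> N" "D \<nu> a \<noteq> 0" by (simp_all add: N'_def)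
      then show "\<exists>\<sigma>::nat. real \<sigma> = \<nu> * m1 + real (wz a) \<and> hom wz (int \<sigma>) (D \<nu> a)"
        using D0 by (intro rhom_nat) auto
    qed
    then obtain \<sigma> :: "real \<Rightarrow> nat" where \<sigma>: "\<forall>\<nu>\<in>N'. real (\<sigma> \<nu>) = \<nu> * m1 + real (wz a) \<and> hom wz (int (\<sigma> \<nu>)) (D \<nu> a)"
      by (rule bchoice[THEN exE])
    have inj: "\<nu> = \<nu>'" if "\<nu> \<in> N'" "\<nu>' \<in> N'" "\<sigma> \<nu> = \<sigma> \<nu>'" for \<nu> \<nu>'
    proof -
      have "\<nu> * m1 = \<nu>' * m1" using \<sigma> that by (metis add_right_cancel)
      then show ?thesis using m1_pos by simp
    qed
    have \<nu>0': "\<nu>0 \<in> N'" using \<nu>0 nz by (simp add: N'_def)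
    have "ev (D \<nu>0 a) p = 0" for p
    proof -
      define c where "c k = (\<Sum>\<nu>\<in>N'. if \<sigma> \<nu> = k then ev (D \<nu> a) p else 0)" for k
      define n where "n = (\<Sum>\<nu>\<in>N'. \<sigma> \<nu>)"
      have n: "\<sigma> \<nu> \<le> n" if "\<nu> \<in> N'" for \<nu> unfolding n_def using finN' that by (intro member_le_sum) auto
      have "c (\<sigma> \<nu>0) = 0"
      proof (rule small_polynomial_zero[of 1 c n 0])
        fix t :: real assume t: "0 < t" "t < 1"
        have "(\<Sum>k\<le>n. of_real t ^ k * c k) = (\<Sum>\<nu>\<in>N'. \<Sum>k\<le>n. if \<sigma> \<nu> = k then of_real t ^ k * ev (D \<nu> a) p else 0)"
          unfolding c_def sum_distrib_left by (subst sum.swap) (intro sum.cong refl, simp)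
        also have "\<dots> = (\<Sum>\<nu>\<in>N'. of_real t ^ \<sigma> \<nu> * ev (D \<nu> a) p)" using n by (intro sum.cong refl) simp
        also have "\<dots> = (\<Sum>\<nu>\<in>N'. ev (D \<nu> a) (dil wz (of_real t) p))"
          using \<sigma> t by (intro sum.cong refl) (simp add: hom_def)
        also have "\<dots> = (\<Sum>\<nu>\<in>N. ev (D \<nu> a) (dil wz (of_real t) p))"
          by (rule sum.mono_neutral_left) (use N in \<open>auto simp: N'_def\<close>)
        also have "\<dots> = 0" using z[of a] by (metis ev_sum ev_simps(1))
        finally show "norm (\<Sum>k\<le>n. of_real t ^ k * c k) \<le> 0 * t ^ Suc n" by simp
      qed (use n[OF \<nu>0'] in auto)
      moreover have "c (\<sigma> \<nu>0) = (\<Sum>\<nu>\<in>N'. if \<nu> = \<nu>0 then ev (D \<nu>0 a) p else 0)"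
        unfolding c_def by (rule sum.cong) (use inj \<nu>0' in auto)
      ultimately show ?thesis using finN' \<nu>0' by simp
    qed
    then show False using nz pf_eqI[of "D \<nu>0 a" 0] by simp
  qed
  then have "germ (pfield (D \<nu>0)) = 0" unfolding germ_pfield_0 by (rule allI)
  then show ?thesis using D0 \<nu>0 by simp
qed

text \<open>The infinitesimal generator of the dilations; its integral curves
  \<open>dil wz (exp t)\<close> stay in the model.\<close>

lemma euler: "germ (pfield (\<lambda>a. cst (of_nat (wz a)) * var a)) \<in> GG 0 - {0}"
proof -
  let ?E = "\<lambda>a. cst (of_nat (wz a)) * var a :: ('n + 'd) pf"
  have "rhom (0 * m1 + real (wz a)) (?E a)" for a
    unfolding rhom_def by (intro disjI2 exI[of _ "int (wz a)"] conjI hom_cst_mult hom_var) simp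
  moreover have "tang ?E" unfolding tang_iff
  proof
    fix p assume p: "p \<in> MM"
    have "((\<lambda>t::real. dil wz (of_real (exp t)) p) has_vector_derivative pfield ?E p) (at 0)"
      unfolding has_vector_derivative_def
    proof (rule has_derivative_vecI)
      fix a
      have "((\<lambda>t::real. complex_of_real (exp t ^ wz a)) has_vector_derivative of_real (real (wz a))) (at 0)"
        by (rule bounded_linear.has_vector_derivative[OF bounded_linear_of_real])
          (auto intro!: derivative_eq_intros simp flip: has_real_derivative_iff_has_vector_derivative)
      then have "((\<lambda>t::real. complex_of_real (exp t ^ wz a) * p $ a) has_vector_derivative of_real (real (wz a)) * p $ a) (at 0)"
        by (rule bounded_linear.has_vector_derivative[OF bounded_linear_mult_left])
      then show "((\<lambda>t::real. dil wz (of_real (exp t)) p $ a) has_derivative (\<lambda>x. (x *\<^sub>R pfield ?E p) $ a)) (at 0)"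
        by (simp add: has_vector_derivative_def vector_scaleR_component)
    qed
    moreover have "dil wz (of_real (exp 0)) p = p" by (simp add: vec_eq_iff)
    ultimately show "pfield ?E p \<in> tangent_space MM p"
      unfolding tangent_space_def
      by (intro CollectI exI[of _ "\<lambda>t. dil wz (of_real (exp t)) p"]) (simp add: MM_dil[OF _ p, of "exp _"] del: of_real_exp exp_of_real)
  qed
  ultimately have "germ (pfield ?E) \<in> GG 0" by (intro G_intro)
  moreover have "germ (pfield ?E) \<noteq> 0"
  proof
    assume "germ (pfield ?E) = 0"
    then have "?E undefined = 0" unfolding germ_pfield_0 by (rule spec)
    then have "ev (?E undefined) (\<chi> a. 1) = 0" by (simp only: ev_simps)
    then show False using wz_pos[of undefined] by simp
  qed
  ultimately show ?thesis by simp
qed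

theorem grading:
  assumes ft: "finite_type_at_0 MM" and nd: "holomorphically_nondegenerate_at_0 MM"
  shows "\<exists>k. weighted_grading (hol MM) k GG \<and> GG k \<noteq> {0} \<and> (\<forall>\<nu>>k. GG \<nu> = {0})"
proof -
  obtain B where B: "\<And>X a \<sigma>. tang X \<Longrightarrow> hom wz \<sigma> (X a) \<Longrightarrow> X a \<noteq> 0 \<Longrightarrow> \<sigma> \<le> int B"
    using weight_bounded[OF ft nd] by blast
  \<comment> \<open>A nonzero component has degree between 0 and \<open>B\<close>; subtracting its
    coordinate weight, at most \<open>WW\<close>, leaves this range for the weight of the
    field.\<close>
  define I where "I = {- int WW..int B}"
  define T where "T = (\<lambda>\<mu>. real_of_int \<mu> / m1) ` I"
  have finT: "finite T" by (simp add: T_def I_def)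
  have GT: "\<nu> \<in> T" if nz: "GG \<nu> \<noteq> {0}" for \<nu>
  proof -
    have "0 \<in> GG \<nu>" by (rule subspace_0[OF subspace_G])
    then obtain g where g: "g \<in> GG \<nu>" "g \<noteq> 0" using nz by blast
    obtain X where X: "g = germ (pfield X)" "\<And>a. rhom (\<nu> * m1 + real (wz a)) (X a)" "tang X" using G_rep[OF g(1)] by blast
    obtain a where a: "X a \<noteq> 0" using g(2) unfolding X(1) germ_pfield_0 not_all by (elim exE)
    obtain \<sigma> :: nat where s: "real \<sigma> = \<nu> * m1 + real (wz a)" "hom wz (int \<sigma>) (X a)"
      using rhom_nat[OF X(2) a] by blast
    have "int \<sigma> \<le> int B" by (rule B[where a = a, OF X(3) s(2) a])
    then have "int \<sigma> - int (wz a) \<in> I" using wz_le_WW[of a] by (simp add: I_def)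
    moreover have "\<nu> = real_of_int (int \<sigma> - int (wz a)) / m1" using s(1) m1_pos by (simp add: field_simps)
    ultimately show ?thesis unfolding T_def by blast
  qed
  define T' where "T' = {\<nu>\<in>T. GG \<nu> \<noteq> {0}}"
  define k where "k = Max T'"
  have "GG 0 \<noteq> {0}" using euler by blast
  then have "T' \<noteq> {}" using GT[of 0] unfolding T'_def by blast
  moreover have finT': "finite T'" using finT by (simp add: T'_def)
  ultimately have "k \<in> T'" unfolding k_def by (intro Max_in)
  then have k1: "GG k \<noteq> {0}" by (simp add: T'_def)
  have k2: "GG \<nu> = {0}" if "\<nu> > k" for \<nu>
  proof (rule ccontr)
    assume "GG \<nu> \<noteq> {0}"
    then have "\<nu> \<in> T'" using GT by (simp add: T'_def)
    then have "\<nu> \<le> k" unfolding k_def using finT' by simp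
    then show False using that by simp
  qed
  have ex: "\<exists>y. (\<forall>i\<in>{..k}. y i \<in> GG i) \<and> (\<forall>i. i \<notin> {..k} \<longrightarrow> y i = 0) \<and> finite {i. y i \<noteq> 0} \<and> x = (\<Sum>i | y i \<noteq> 0. y i)"
    if x: "x \<in> hol MM" for x
  proof -
    obtain X S where X: "x = germ X" "open S" "0 \<in> S" "holomorphic_map_on X S" "\<And>p. p \<in> S \<inter> MM \<Longrightarrow> X p \<in> tangent_space MM p"
      using x unfolding hol_def by blast
    have tp: "tang (ppart X \<mu>)" for \<mu> by (rule tang_ppart[OF X(4,2,3,5)])
    \<comment> \<open>The bound applies to the Taylor parts of an arbitrary tangent field because
      these are tangent; thus the expansion of the field is finite.\<close>
    have wz0: "wpart wz (\<lambda>p. X p $ a) j q = 0" if "j > B" for j a q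
    proof (rule ccontr)
      assume "wpart wz (\<lambda>p. X p $ a) j q \<noteq> 0"
      moreover have e: "ppart X (int j - int (wz a)) a = wpf wz (\<lambda>p. X p $ a) j" by (simp add: ppart_def)
      ultimately have "ppart X (int j - int (wz a)) a \<noteq> 0" by (metis ev_simps(1) ev_wpf)
      moreover have "hom wz (int j) (ppart X (int j - int (wz a)) a)" unfolding e by (rule hom_wpf)
      ultimately have "int j \<le> int B" by (intro B[where a = a, OF tp])
      then show False using that by simp
    qed
    have "\<exists>e>0. \<forall>p\<in>ball 0 e. X p $ a = (\<Sum>j\<le>B. wpart wz (\<lambda>p. X p $ a) j p)" for a
      by (rule finite_wparts[OF holomorphic_map_cdiff[OF X(4)] X(2,3) wz_pos wz0])
    then have "\<forall>a. \<exists>e>0. \<forall>p\<in>ball 0 e. X p $ a = (\<Sum>j\<le>B. wpart wz (\<lambda>p. X p $ a) j p)" by (intro allI)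
    then obtain e where e: "\<forall>a. e a > 0 \<and> (\<forall>p\<in>ball 0 (e a). X p $ a = (\<Sum>j\<le>B. wpart wz (\<lambda>p. X p $ a) j p))"
      by (rule choice[THEN exE])
    define e0 where "e0 = Min (range e)"
    have e0: "e0 > 0" unfolding e0_def using e by (subst Min_gr_iff) auto
    have e0le: "e0 \<le> e a" for a unfolding e0_def by (rule Min_le) auto
    have sum_eq: "X p = (\<Sum>\<mu>\<in>I. pfield (ppart X \<mu>) p)" if "p \<in> ball 0 e0" for p
    proof (subst vec_eq_iff, intro allI)
      fix a
      have "(\<Sum>\<mu>\<in>I. ev (ppart X \<mu> a) p) = (\<Sum>\<mu>\<in>(\<lambda>j. int j - int (wz a)) ` {..B}. ev (ppart X \<mu> a) p)"
      proof (rule sum.mono_neutral_right)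
        show "finite I" by (simp add: I_def)
        show "(\<lambda>j. int j - int (wz a)) ` {..B} \<subseteq> I" using wz_le_WW[of a] by (auto simp: I_def)
        show "\<forall>\<mu>\<in>I - (\<lambda>j. int j - int (wz a)) ` {..B}. ev (ppart X \<mu> a) p = 0"
        proof
          fix \<mu> assume mu: "\<mu> \<in> I - (\<lambda>j. int j - int (wz a)) ` {..B}"
          show "ev (ppart X \<mu> a) p = 0"
          proof (cases "\<mu> + int (wz a) \<ge> 0")
            case True
            define j where "j = nat (\<mu> + int (wz a))"
            have mj: "\<mu> = int j - int (wz a)" using True by (simp add: j_def)
            then have "j > B" using mu by (metis DiffD2 atMost_iff image_eqI not_le)
            then show ?thesis using True wz0 by (simp add: ppart_def j_def)
          qed (simp add: ppart_def)
        qed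
      qed
      also have "\<dots> = (\<Sum>j\<le>B. wpart wz (\<lambda>p. X p $ a) j p)"
        by (subst sum.reindex) (auto simp: inj_on_def ppart_def)
      also have "\<dots> = X p $ a" using e that e0le[of a] by auto
      finally show "X p $ a = (\<Sum>\<mu>\<in>I. pfield (ppart X \<mu>) p) $ a" by simp
    qed
    have xs: "x = (\<Sum>\<mu>\<in>I. germ (pfield (ppart X \<mu>)))"
      unfolding X(1) germ_sum[of I, unfolded I_def, OF finite_atLeastAtMost_int, folded I_def] germ_eq_iff
      using e0 sum_eq by (intro eventually_nhds_in_open[of "ball 0 e0", THEN eventually_mono]) auto
    \<comment> \<open>Passes from integral indices to normalized real weights; at most one index
      contributes to each \<open>\<nu>\<close>.\<close>
    define y where "y \<nu> = (\<Sum>\<mu>\<in>I. if \<nu> = real_of_int \<mu> / m1 then germ (pfield (ppart X \<mu>)) else 0)" for \<nu>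
    have ymu: "y (real_of_int \<mu> / m1) = germ (pfield (ppart X \<mu>))" if "\<mu> \<in> I" for \<mu>
    proof -
      have "y (real_of_int \<mu> / m1) = (\<Sum>\<mu>'\<in>I. if \<mu>' = \<mu> then germ (pfield (ppart X \<mu>)) else 0)"
        unfolding y_def by (rule sum.cong) (use m1_pos in auto)
      then show ?thesis using that by (simp add: I_def)
    qed
    have yG: "y \<nu> \<in> GG \<nu>" for \<nu>
    proof -
      have "(if \<nu> = real_of_int \<mu> / m1 then germ (pfield (ppart X \<mu>)) else 0) \<in> GG \<nu>" for \<mu>
      proof (cases "\<nu> = real_of_int \<mu> / m1")
        case True
        have "germ (pfield (ppart X \<mu>)) \<in> GG \<nu>"
          by (rule G_intro[OF _ tp]) (use True m1_pos rhom_ppart[of \<mu>] in simp)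
        then show ?thesis using True by simp
      qed (simp add: subspace_0[OF subspace_G])
      then show ?thesis unfolding y_def by (intro subspace_sum subspace_G)
    qed
    have y0: "y \<nu> = 0" if "\<nu> \<notin> T" for \<nu>
      unfolding y_def by (rule sum.neutral) (use that in \<open>auto simp: T_def\<close>)
    have fin: "finite {i. y i \<noteq> 0}" by (rule finite_subset[OF _ finT]) (use y0 in blast)
    have "(\<Sum>i | y i \<noteq> 0. y i) = (\<Sum>i\<in>T. y i)"
      by (rule sum.mono_neutral_left) (use finT y0 in blast)+
    also have "\<dots> = (\<Sum>\<mu>\<in>I. y (real_of_int \<mu> / m1))"
      unfolding T_def by (subst sum.reindex) (use m1_pos in \<open>auto simp: inj_on_def\<close>)
    also have "\<dots> = x" unfolding xs by (rule sum.cong) (auto simp: ymu)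
    finally have "x = (\<Sum>i | y i \<noteq> 0. y i)" by simp
    moreover have "y i = 0" if "i \<notin> {..k}" for i using yG[of i] k2[of i] that by simp
    ultimately show ?thesis using yG fin by (intro exI[of _ y]) simp
  qed
  have un: "y = y'"
    if y: "\<forall>i\<in>{..k}. y i \<in> GG i" "\<forall>i. i \<notin> {..k} \<longrightarrow> y i = 0" "finite {i. y i \<noteq> 0}" "x = (\<Sum>i | y i \<noteq> 0. y i)"
      and y': "\<forall>i\<in>{..k}. y' i \<in> GG i" "\<forall>i. i \<notin> {..k} \<longrightarrow> y' i = 0" "finite {i. y' i \<noteq> 0}" "x = (\<Sum>i | y' i \<noteq> 0. y' i)"
    for x y y'
  proof
    fix \<nu>
    define N where "N = insert \<nu> ({i. y i \<noteq> 0} \<union> {i. y' i \<noteq> 0})"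
    have N: "finite N" using y(3) y'(3) by (simp add: N_def)
    have G: "y i - y' i \<in> GG i" for i
      by (cases "i \<in> {..k}") (use y(1,2) y'(1,2) in \<open>auto intro: subspace_diff[OF subspace_G] simp: subspace_0[OF subspace_G]\<close>)
    have "(\<Sum>i\<in>N. y i) = x" unfolding y(4) by (rule sum.mono_neutral_right) (use N in \<open>auto simp: N_def\<close>)
    moreover have "(\<Sum>i\<in>N. y' i) = x" unfolding y'(4) by (rule sum.mono_neutral_right) (use N in \<open>auto simp: N_def\<close>)
    ultimately have "(\<Sum>i\<in>N. y i - y' i) = 0" by (simp add: sum_subtractf)
    then have "y \<nu> - y' \<nu> = 0" by (rule G_independent[OF N G]) (simp add: N_def)
    then show "y \<nu> = y' \<nu>" by simp
  qed
  have "weighted_grading (hol MM) k GG"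
    unfolding weighted_grading_def internal_direct_sum_def
  proof (intro conjI ballI allI)
    show "subspace (hol MM)" by (rule subspace_hol)
    show "subspace (GG i)" for i by (rule subspace_G)
    show "GG i \<subseteq> hol MM" for i by (simp add: G_def)
    show "germ_bracket X Y \<in> GG (\<mu> + \<nu>)" if "X \<in> GG \<mu>" "Y \<in> GG \<nu>" for \<mu> \<nu> X Y by (rule G_bracket[OF that])
    fix x assume "x \<in> hol MM"
    from ex[OF this] obtain y where y: "(\<forall>i\<in>{..k}. y i \<in> GG i) \<and> (\<forall>i. i \<notin> {..k} \<longrightarrow> y i = 0) \<and> finite {i. y i \<noteq> 0} \<and> x = (\<Sum>i | y i \<noteq> 0. y i)"
      by (elim exE)
    show "\<exists>!y. (\<forall>i\<in>{..k}. y i \<in> GG i) \<and> (\<forall>i. i \<notin> {..k} \<longrightarrow> y i = 0) \<and> finite {i. y i \<noteq> 0} \<and> x = (\<Sum>i | y i \<noteq> 0. y i)"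
    proof (rule ex1I[of _ y])
      show "(\<forall>i\<in>{..k}. y i \<in> GG i) \<and> (\<forall>i. i \<notin> {..k} \<longrightarrow> y i = 0) \<and> finite {i. y i \<noteq> 0} \<and> x = (\<Sum>i | y i \<noteq> 0. y i)" by (rule y)
      fix y' assume y': "(\<forall>i\<in>{..k}. y' i \<in> GG i) \<and> (\<forall>i. i \<notin> {..k} \<longrightarrow> y' i = 0) \<and> finite {i. y' i \<noteq> 0} \<and> x = (\<Sum>i | y' i \<noteq> 0. y' i)"
      show "y' = y" by (rule un[of y' x y]) (insert y y', (elim conjE, assumption)+)
    qed
  qed
  then show ?thesis using k1 k2 by blast
qed

end

section \<open>Determination by weighted jets\<close>

lemma local_lipschitz_scalar:
  fixes f :: "complex ^ 'a::finite \<Rightarrow> complex"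
  assumes f: "cdiff f S" and S: "open S" "p0 \<in> S"
  shows "\<exists>r K. r > 0 \<and> K \<ge> 0 \<and> (\<forall>x\<in>ball p0 r. \<forall>y\<in>ball p0 r. norm (f x - f y) \<le> K * norm (x - y))"
proof -
  obtain R where R: "R > 0" "cball p0 R \<subseteq> S" using S open_contains_cball by blast
  have "compact (f ` cball p0 R)"
    by (rule compact_continuous_image[OF continuous_on_subset[OF cdiff_continuous[OF f] R(2)] compact_cball])
  then obtain M where M: "\<And>x. x \<in> cball p0 R \<Longrightarrow> norm (f x) \<le> M"
    using compact_imp_bounded bounded_iff by (metis imageI)
  define r where "r = R / 4"
  have r: "r > 0" using R by (simp add: r_def)
  have fr: "cdiff f (ball p0 (4 * r))" by (rule cdiff_subset[OF f]) (use R(2) in \<open>auto simp: r_def\<close>)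
  have Mr: "norm (f x) \<le> M" if "x \<in> ball p0 (4 * r)" for x by (rule M) (use that in \<open>simp add: r_def\<close>)
  have M0: "M \<ge> 0" using M[of p0] R(1) by (meson centre_in_cball less_imp_le norm_ge_zero order_trans)
  show ?thesis
  proof (rule exI[of _ r], rule exI[of _ "2 * M / r"], intro conjI ballI)
    fix x y assume xy: "x \<in> ball p0 r" "y \<in> ball p0 r"
    have der: "(f has_derivative frechet_derivative f (at z)) (at z within ball p0 r)" if "z \<in> ball p0 r" for z
      by (rule has_derivative_at_withinI, rule cdiff_derivative(1)[OF fr]) (use that r in auto)
    have on: "onorm (frechet_derivative f (at z)) \<le> 2 * M / r" if "z \<in> ball p0 r" for z
      by (rule onorm_le, rule cdiff_cauchy(1)[OF fr r Mr]) (use that r in auto)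
    show "norm (f x - f y) \<le> 2 * M / r * norm (x - y)"
      by (rule differentiable_bound[OF convex_ball der on xy(1,2)])
  qed (use r M0 in auto)
qed

lemma local_lipschitz:
  assumes X: "holomorphic_map_on (X :: complex ^ 'a::finite \<Rightarrow> complex ^ 'b::finite) S" and S: "open S" "p0 \<in> S"
  shows "\<exists>r K. r > 0 \<and> K \<ge> 0 \<and> (\<forall>x\<in>ball p0 r. \<forall>y\<in>ball p0 r. norm (X x - X y) \<le> K * norm (x - y))"
proof -
  have "\<forall>a. \<exists>r K. r > 0 \<and> K \<ge> 0 \<and> (\<forall>x\<in>ball p0 r. \<forall>y\<in>ball p0 r. norm (X x $ a - X y $ a) \<le> K * norm (x - y))"
    by (intro allI local_lipschitz_scalar[OF holomorphic_map_cdiff[OF X] S])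
  then obtain r where "\<forall>a. \<exists>K. r a > 0 \<and> K \<ge> 0 \<and> (\<forall>x\<in>ball p0 (r a). \<forall>y\<in>ball p0 (r a). norm (X x $ a - X y $ a) \<le> K * norm (x - y))"
    by (rule choice[THEN exE])
  then obtain K where K: "\<forall>a. r a > 0 \<and> K a \<ge> 0 \<and> (\<forall>x\<in>ball p0 (r a). \<forall>y\<in>ball p0 (r a). norm (X x $ a - X y $ a) \<le> K a * norm (x - y))"
    by (rule choice[THEN exE])
  define r0 where "r0 = Min (range r)"
  have r0: "r0 > 0" unfolding r0_def using K by (subst Min_gr_iff) auto
  have r0le: "r0 \<le> r a" for a unfolding r0_def by (rule Min_le) auto
  show ?thesis
  proof (rule exI[of _ r0], rule exI[of _ "\<Sum>a\<in>UNIV. K a"], intro conjI ballI)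
    fix x y assume xy: "x \<in> ball p0 r0" "y \<in> ball p0 r0"
    have "norm ((X x - X y) $ a) \<le> K a * norm (x - y)" for a
    proof -
      have "x \<in> ball p0 (r a)" "y \<in> ball p0 (r a)" using xy r0le[of a] by auto
      then show ?thesis using K by simp
    qed
    then show "norm (X x - X y) \<le> (\<Sum>a\<in>UNIV. K a) * norm (x - y)"
      unfolding sum_distrib_right by (intro order_trans[OF norm_vec_le_sum sum_mono])
  qed (use r0 K in \<open>auto intro: sum_nonneg\<close>)
qed

lemma Ck_on_continuous: "Ck_on k f S \<Longrightarrow> continuous_on S f"
  by (cases k) (auto intro!: continuous_at_imp_continuous_on differentiable_imp_continuous_within)

lemma Ck_on_le: "Ck_on k f S \<Longrightarrow> j \<le> k \<Longrightarrow> Ck_on j f S"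
proof (induction k)
  case (Suc k)
  show ?case
  proof (cases "j = Suc k")
    case False
    then show ?thesis using Suc.IH[OF Ck_on_Suc_D[OF Suc.prems(1)]] Suc.prems(2) by linarith
  qed (use Suc.prems(1) in simp)
qed simp

lemma norm_fst_le': "norm (fst x) \<le> norm x" and norm_snd_le': "norm (snd x) \<le> norm x"
  using norm_fst_le[of "fst x" "snd x"] norm_snd_le[of "snd x" "fst x"] by simp_all

lemma Ck_on_cr_derivative:
  assumes S: "open S" and f: "Ck_on (Suc k) f S"
  shows "Ck_on k (cr_derivative v f) S"
proof -
  have D: "Ck_on k (\<lambda>x. c * frechet_derivative f (at x) w) S" for c w
    by (rule Ck_on_linear[OF bounded_linear_mult_right S], rule f[unfolded Ck_on.simps, THEN conjunct2, THEN spec])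
  have e: "cr_derivative (Z i) f = (\<lambda>x. 1/2 * frechet_derivative f (at x) (axis i 1, 0) + (- \<i>/2) * frechet_derivative f (at x) (axis i \<i>, 0))"
    "cr_derivative (Zbar i) f = (\<lambda>x. 1/2 * frechet_derivative f (at x) (axis i 1, 0) + (\<i>/2) * frechet_derivative f (at x) (axis i \<i>, 0))"
    "cr_derivative (U l) f = (\<lambda>x. 1 * frechet_derivative f (at x) (0, axis l 1))" for i l
    by (auto simp: fun_eq_iff field_simps)
  show ?thesis
    by (cases v) (simp_all only: e, (rule Ck_on_add[OF S D D] D)+)
qed

section \<open>Functions of (z, u) that are small under dilations\<close>

context cr_model
begin

text \<open>The Wirtinger coefficients of a real linear map. \<open>linear_crc\<close> expands a
  differential in them, which links it to the derivatives that are assumed to vanish.\<close>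

definition crc :: "('n, 'd) crvar \<Rightarrow> ((complex ^ 'n) \<times> (real ^ 'd) \<Rightarrow> complex) \<Rightarrow> complex" where
  "crc v L = (case v of Z i \<Rightarrow> (L (axis i 1, 0) - \<i> * L (axis i \<i>, 0)) / 2
     | Zbar i \<Rightarrow> (L (axis i 1, 0) + \<i> * L (axis i \<i>, 0)) / 2 | U l \<Rightarrow> L (0, axis l 1))"

lemma cr_derivative_crc: "cr_derivative v f x = crc v (frechet_derivative f (at x))"
  by (cases v) (simp_all add: crc_def)

lemma sum_crvar: "(\<Sum>v\<in>UNIV. g v) = (\<Sum>i\<in>UNIV. g (Z i)) + (\<Sum>i\<in>UNIV. g (Zbar i)) + (\<Sum>l\<in>UNIV. g (U l))"
  for g :: "('n, 'd) crvar \<Rightarrow> complex"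
proof -
  have u: "(UNIV :: ('n, 'd) crvar set) = Z ` UNIV \<union> (Zbar ` UNIV \<union> U ` UNIV)"
  proof (intro set_eqI iffI UNIV_I)
    fix v :: "('n, 'd) crvar" show "v \<in> Z ` UNIV \<union> (Zbar ` UNIV \<union> U ` UNIV)" by (cases v) auto
  qed
  have "sum g UNIV = sum g (Z ` UNIV) + (sum g (Zbar ` UNIV) + sum g (U ` UNIV))"
    unfolding u by (subst sum.union_disjoint, (auto)[3], subst sum.union_disjoint) auto
  then show ?thesis by (simp add: sum.reindex inj_on_def)
qed

lemma linear_crc:
  assumes L: "linear L"
  shows "L y = (\<Sum>v\<in>UNIV. crc v L * eW y $ v)"
proof -
  have "y = (\<Sum>i\<in>UNIV. Re (fst y $ i) *\<^sub>R (axis i 1, 0) + Im (fst y $ i) *\<^sub>R (axis i \<i>, 0)) + (\<Sum>l\<in>UNIV. (snd y $ l) *\<^sub>R (0, axis l 1))"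
  proof -
    have z: "(\<Sum>i\<in>UNIV. Re (z $ i) *\<^sub>R axis i 1 $ j + Im (z $ i) *\<^sub>R axis i \<i> $ j) = z $ j" for z :: "complex ^ 'n" and j
    proof -
      have "(\<Sum>i\<in>UNIV. Re (z $ i) *\<^sub>R axis i 1 $ j + Im (z $ i) *\<^sub>R axis i \<i> $ j) = (\<Sum>i\<in>UNIV. if j = i then z $ i else 0)"
        by (rule sum.cong[OF refl]) (simp add: axis_def complex_eq_iff)
      then show ?thesis by simp
    qed
    have u: "(\<Sum>l\<in>UNIV. w $ l * axis l 1 $ j) = w $ j" for w :: "real ^ 'd" and j
      by (simp add: axis_def if_distrib cong: if_cong)
    show ?thesis
      unfolding pair_vec_eq fst_add snd_add fst_sum snd_sum fst_scaleR snd_scaleR fst_conv snd_conv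
        vector_add_component sum_component vector_scaleR_component scaleR_zero_right zero_index z
        real_scaleR_def u sum.neutral_const add_0_right add_0_left
      by (intro conjI allI refl)
  qed
  from arg_cong[OF this, of L] have "L y = (\<Sum>i\<in>UNIV. Re (fst y $ i) *\<^sub>R L (axis i 1, 0) + Im (fst y $ i) *\<^sub>R L (axis i \<i>, 0)) + (\<Sum>l\<in>UNIV. (snd y $ l) *\<^sub>R L (0, axis l 1))"
    by (simp only: linear_add[OF L] linear_sum[OF L] linear_scale[OF L])
  also have "(\<Sum>i\<in>UNIV. Re (fst y $ i) *\<^sub>R L (axis i 1, 0) + Im (fst y $ i) *\<^sub>R L (axis i \<i>, 0))
    = (\<Sum>i\<in>UNIV. crc (Z i) L * eW y $ Z i + crc (Zbar i) L * eW y $ Zbar i)"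
  proof (rule sum.cong[OF refl])
    fix i
    obtain a b where ab: "fst y $ i = Complex a b" by (cases "fst y $ i")
    show "Re (fst y $ i) *\<^sub>R L (axis i 1, 0) + Im (fst y $ i) *\<^sub>R L (axis i \<i>, 0) = crc (Z i) L * eW y $ Z i + crc (Zbar i) L * eW y $ Zbar i"
      by (simp add: ab crc_def complex_eq_iff field_simps)
  qed
  finally show ?thesis unfolding sum_crvar
    by (simp add: sum.distrib crc_def scaleR_conv_of_real mult.commute)
qed

definition dl :: "real \<Rightarrow> (complex ^ 'n) \<times> (real ^ 'd) \<Rightarrow> (complex ^ 'n) \<times> (real ^ 'd)" where
  "dl t x = (t *\<^sub>R fst x, \<chi> l. t ^ m l * snd x $ l)"

lemma dl_nth [simp]: "fst (dl t x) $ i = of_real t * fst x $ i" "snd (dl t x) $ l = t ^ m l * snd x $ l"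
  by (simp_all add: dl_def vector_scaleR_component scaleR_conv_of_real[where 'a = complex])

lemma prj_dil: "prj (dil wz (of_real t) p) = dl t (prj p)"
  by (simp add: pair_vec_eq wz_def flip: of_real_power)

lemma eW_dl: "eW (dl t x) $ v = of_real t ^ wt v * eW x $ v"
  by (cases v) auto

lemma norm_dl:
  assumes t: "0 \<le> t" "t \<le> 1"
  shows "norm (dl t x) \<le> t * (2 * norm x)"
proof -
  have "norm (snd (dl t x)) \<le> norm (t *\<^sub>R snd x)"
  proof (rule norm_le_componentwise_cart)
    fix l
    have "t ^ m l \<le> t" using t m2[of l] power_decreasing[of 1 "m l" t] by simp
    then show "norm (snd (dl t x) $ l) \<le> norm ((t *\<^sub>R snd x) $ l)"
      using t by (simp add: abs_mult mult_right_mono)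
  qed
  moreover have "norm (fst (dl t x)) = t * norm (fst x)" using t by (simp add: dl_def)
  ultimately have "norm (dl t x) \<le> t * norm (fst x) + t * norm (snd x)"
    using norm_Pair_le[of "fst (dl t x)" "snd (dl t x)"] t by simp
  also have "\<dots> \<le> t * norm x + t * norm x"
    using t norm_fst_le'[of x] norm_snd_le'[of x] by (intro add_mono mult_left_mono) auto
  finally show ?thesis by simp
qed

lemma dl_near_0:
  assumes W: "open W" "0 \<in> W"
  shows "\<exists>t0>0. t0 \<le> 1 \<and> (\<forall>t x. 0 < t \<longrightarrow> t < t0 \<longrightarrow> norm x \<le> B \<longrightarrow> dl t x \<in> W)"
proof -
  obtain r where r: "r > 0" "ball 0 r \<subseteq> W" using W openE by blast
  define t0 where "t0 = min 1 (r / (2 * \<bar>B\<bar> + 1))"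
  have "t0 > 0" using r by (simp add: t0_def)
  moreover have "dl t x \<in> W" if t: "0 < t" "t < t0" and x: "norm x \<le> B" for t x
  proof -
    have "norm (dl t x) \<le> t * (2 * norm x)" by (rule norm_dl) (use t in \<open>auto simp: t0_def\<close>)
    also have "\<dots> \<le> t * (2 * \<bar>B\<bar> + 1)" using x t by (intro mult_left_mono) auto
    also have "\<dots> < r" using t by (simp add: t0_def pos_less_divide_eq)
    finally show ?thesis using r(2) by auto
  qed
  ultimately show ?thesis by (intro exI[of _ t0]) (auto simp: t0_def)
qed

text \<open>Little-o of \<open>t ^ \<sigma>\<close> under dilation, uniformly on bounded sets. The
  factor \<open>t ^ w\<close> is what the dilation of an increment in a variable of weight
  \<open>w\<close> contributes.\<close>

definition small :: "((complex ^ 'n) \<times> (real ^ 'd) \<Rightarrow> complex) \<Rightarrow> nat \<Rightarrow> nat \<Rightarrow> bool" where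
  "small f w \<sigma> \<longleftrightarrow> (\<forall>B \<epsilon>. \<epsilon> > 0 \<longrightarrow> (\<exists>t0>0. \<forall>t x. 0 < t \<longrightarrow> t < t0 \<longrightarrow> norm x \<le> B \<longrightarrow> norm (f (dl t x)) * t ^ w \<le> \<epsilon> * t ^ \<sigma>))"

text \<open>If the exponents are strictly ordered, boundedness near 0 is enough and the spare factor
  \<open>t\<close> gives the smallness; in the other case it comes from
  \<open>f 0 = 0\<close>.\<close>

lemma small_continuous:
  assumes f: "continuous_on W f" and W: "open W" "0 \<in> W" and c: "f 0 = 0 \<and> \<sigma> \<le> w \<or> \<sigma> < w"
  shows "small f w \<sigma>"
  unfolding small_def
proof (intro allI impI)
  fix B \<epsilon> :: real assume e: "\<epsilon> > 0"
  define c where "c = (if f 0 = 0 then \<epsilon> else norm (f 0) + \<epsilon>)"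
  have ic: "isCont f 0" using f W by (simp add: continuous_on_eq_continuous_at)
  then have "(f \<longlongrightarrow> f 0) (nhds 0)" by (simp add: tendsto_nhds_iff isCont_def)
  then have "\<forall>\<^sub>F y in nhds 0. dist (f y) (f 0) < \<epsilon>" using e tendstoD by blast
  then obtain V where V: "open V" "0 \<in> V" "\<And>y. y \<in> V \<Longrightarrow> dist (f y) (f 0) < \<epsilon>" unfolding eventually_nhds by blast
  obtain t0 where t0: "t0 > 0" "t0 \<le> 1" "\<And>t x. 0 < t \<Longrightarrow> t < t0 \<Longrightarrow> norm x \<le> B \<Longrightarrow> dl t x \<in> V"
    using dl_near_0[OF V(1,2), of B] by blast
  define t1 where "t1 = min t0 (\<epsilon> / (norm (f 0) + \<epsilon>))"
  have t1: "t1 > 0" using t0 e by (simp add: t1_def add_nonneg_pos)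
  have "norm (f (dl t x)) * t ^ w \<le> \<epsilon> * t ^ \<sigma>" if t: "0 < t" "t < t1" and x: "norm x \<le> B" for t x
  proof -
    have t': "t < t0" "t \<le> 1" using t t0(2) by (auto simp: t1_def)
    have d: "norm (f (dl t x) - f 0) \<le> \<epsilon>" using V(3)[OF t0(3)[OF t(1) t'(1) x]] by (simp add: dist_norm)
    show ?thesis
    proof (cases "f 0 = 0 \<and> \<sigma> \<le> w")
      case True
      then have "t ^ w \<le> t ^ \<sigma>" using t' t by (intro power_decreasing) auto
      then show ?thesis using d True e t by (intro mult_mono) auto
    next
      case False
      then have sw: "\<sigma> < w" using c by blast
      have "norm (f (dl t x)) \<le> norm (f 0) + \<epsilon>" using d norm_triangle_ineq2[of "f (dl t x)" "f 0"] by linarith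
      moreover have "t ^ w \<le> t ^ Suc \<sigma>" using t' t sw by (intro power_decreasing) auto
      ultimately have "norm (f (dl t x)) * t ^ w \<le> (norm (f 0) + \<epsilon>) * t ^ Suc \<sigma>" using e t by (intro mult_mono) auto
      also have "\<dots> = ((norm (f 0) + \<epsilon>) * t) * t ^ \<sigma>" by simp
      also have "\<dots> \<le> \<epsilon> * t ^ \<sigma>"
      proof (rule mult_right_mono)
        have "0 < norm (f 0) + \<epsilon>" using e by (simp add: add_nonneg_pos)
        moreover have "t < \<epsilon> / (norm (f 0) + \<epsilon>)" using t by (simp add: t1_def)
        ultimately show "(norm (f 0) + \<epsilon>) * t \<le> \<epsilon>" by (simp add: pos_less_divide_eq mult.commute)
      qed (use t in simp)
      finally show ?thesis .
    qed
  qed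
  then show "\<exists>t0>0. \<forall>t x. 0 < t \<longrightarrow> t < t0 \<longrightarrow> norm x \<le> B \<longrightarrow> norm (f (dl t x)) * t ^ w \<le> \<epsilon> * t ^ \<sigma>"
    using t1 by blast
qed

lemma norm_eW_nth: "norm (eW x $ v) \<le> norm x"
proof (cases v)
  case (U l)
  have "norm (snd x $ l) \<le> norm x" using Finite_Cartesian_Product.norm_nth_le[of "snd x" l] norm_snd_le'[of x] by linarith
  then show ?thesis using U by simp
qed (simp_all, (rule order_trans[OF Finite_Cartesian_Product.norm_nth_le norm_fst_le'])+)

text \<open>Mean value estimate along the segment between the undilated points: each Wirtinger
  derivative meets the factor \<open>t ^ wt v\<close> of the dilated increment.\<close>

lemma small_lipschitz:
  assumes W: "open W" "0 \<in> W" and f: "\<And>y. y \<in> W \<Longrightarrow> f differentiable (at y)"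
    and s: "\<And>v. small (cr_derivative v f) (wt v) \<sigma>" and e: "\<epsilon> > 0"
  shows "\<exists>t0>0. \<forall>t x y. 0 < t \<longrightarrow> t < t0 \<longrightarrow> norm x \<le> B \<longrightarrow> norm y \<le> B \<longrightarrow>
    norm (f (dl t x) - f (dl t y)) \<le> \<epsilon> * t ^ \<sigma> * norm (x - y)"
proof -
  let ?N = "real (card (UNIV :: ('n, 'd) crvar set))"
  have N: "?N > 0" using finite_UNIV_card_ge_0[OF finite] by simp
  have "\<forall>v. \<exists>t0>0. \<forall>t x. 0 < t \<longrightarrow> t < t0 \<longrightarrow> norm x \<le> B \<longrightarrow> norm (cr_derivative v f (dl t x)) * t ^ wt v \<le> \<epsilon> / ?N * t ^ \<sigma>"
  proof
    fix v show "\<exists>t0>0. \<forall>t x. 0 < t \<longrightarrow> t < t0 \<longrightarrow> norm x \<le> B \<longrightarrow> norm (cr_derivative v f (dl t x)) * t ^ wt v \<le> \<epsilon> / ?N * t ^ \<sigma>"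
      by (rule s[unfolded small_def, rule_format]) (use e N in simp)
  qed
  then obtain tv where tv: "\<forall>v. tv v > 0 \<and> (\<forall>t x. 0 < t \<longrightarrow> t < tv v \<longrightarrow> norm x \<le> B \<longrightarrow> norm (cr_derivative v f (dl t x)) * t ^ wt v \<le> \<epsilon> / ?N * t ^ \<sigma>)"
    by (rule choice[THEN exE])
  obtain tW where tW: "tW > 0" "tW \<le> 1" "\<And>t x. 0 < t \<Longrightarrow> t < tW \<Longrightarrow> norm x \<le> B \<Longrightarrow> dl t x \<in> W"
    using dl_near_0[OF W, of B] by blast
  define t0 where "t0 = min tW (Min (range tv))"
  have "t0 > 0" using tW tv unfolding t0_def min_less_iff_conj by (subst Min_gr_iff) auto
  moreover have "norm (f (dl t x) - f (dl t y)) \<le> \<epsilon> * t ^ \<sigma> * norm (x - y)"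
    if t: "0 < t" "t < t0" and x: "norm x \<le> B" and y: "norm y \<le> B" for t x y
  proof -
    have tvv: "t < tv v" for v
    proof -
      have "Min (range tv) \<le> tv v" by (rule Min_le) auto
      then show ?thesis using t unfolding t0_def by linarith
    qed
    have tw: "t < tW" using t unfolding t0_def by linarith
    define F where "F s = f (dl t (y + s *\<^sub>R (x - y)))" for s :: real
    have nb: "norm (y + s *\<^sub>R (x - y)) \<le> B" if "0 \<le> s" "s \<le> 1" for s
    proof -
      have "y + s *\<^sub>R (x - y) = (1 - s) *\<^sub>R y + s *\<^sub>R x" by (simp add: algebra_simps)
      then have "norm (y + s *\<^sub>R (x - y)) \<le> (1 - s) * norm y + s * norm x"
        using norm_triangle_ineq[of "(1 - s) *\<^sub>R y" "s *\<^sub>R x"] that by simp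
      also have "\<dots> \<le> (1 - s) * B + s * B" using that x y by (intro add_mono mult_left_mono) auto
      finally show ?thesis by (simp add: algebra_simps)
    qed
    have der: "(F has_derivative (\<lambda>h. h *\<^sub>R frechet_derivative f (at (dl t (y + s *\<^sub>R (x - y)))) (dl t (x - y)))) (at s within {0..1})"
      if s: "s \<in> {0..1}" for s
    proof -
      let ?p = "dl t (y + s *\<^sub>R (x - y))"
      have "?p \<in> W" using tW(3)[OF t(1) tw nb] s by simp
      then have 1: "(f has_derivative frechet_derivative f (at ?p)) (at ?p)" using f frechet_derivative_works by blast
      have e: "dl t (y + s *\<^sub>R (x - y)) = dl t y + s *\<^sub>R dl t (x - y)" for s
        by (simp add: pair_vec_eq vector_scaleR_component algebra_simps scaleR_conv_of_real[where 'a = complex])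
      have 2: "((\<lambda>s. dl t (y + s *\<^sub>R (x - y))) has_derivative (\<lambda>h. h *\<^sub>R dl t (x - y))) (at s within {0..1})"
        unfolding e by (auto intro!: derivative_eq_intros)
      have "(F has_derivative (\<lambda>h. frechet_derivative f (at ?p) (h *\<^sub>R dl t (x - y)))) (at s within {0..1})"
        unfolding F_def by (rule has_derivative_compose[OF 2 1])
      then show ?thesis by (simp add: linear_scale[OF has_derivative_linear[OF 1]])
    qed
    have bd: "norm (frechet_derivative f (at (dl t (y + s *\<^sub>R (x - y)))) (dl t (x - y))) \<le> \<epsilon> * t ^ \<sigma> * norm (x - y)"
      if s: "s \<in> {0..1}" for s
    proof -
      let ?q = "y + s *\<^sub>R (x - y)"
      have nq: "norm ?q \<le> B" using nb s by simp
      have "f differentiable (at (dl t ?q))" by (rule f[OF tW(3)[OF t(1) tw nq]])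
      then have lin: "linear (frechet_derivative f (at (dl t ?q)))" by (rule linear_frechet_derivative)
      have "norm (frechet_derivative f (at (dl t ?q)) (dl t (x - y))) \<le> (\<Sum>v\<in>(UNIV :: ('n, 'd) crvar set). norm (cr_derivative v f (dl t ?q) * eW (dl t (x - y)) $ v))"
        unfolding linear_crc[OF lin, of "dl t (x - y)"] cr_derivative_crc[symmetric] by (rule norm_sum)
      also have "\<dots> \<le> (\<Sum>v\<in>(UNIV :: ('n, 'd) crvar set). \<epsilon> / ?N * t ^ \<sigma> * norm (x - y))"
      proof (rule sum_mono)
        fix v :: "('n, 'd) crvar"
        have "norm (cr_derivative v f (dl t ?q) * eW (dl t (x - y)) $ v) = (norm (cr_derivative v f (dl t ?q)) * t ^ wt v) * norm (eW (x - y) $ v)"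
          using t by (simp add: eW_dl norm_mult norm_power)
        also have "\<dots> \<le> (\<epsilon> / ?N * t ^ \<sigma>) * norm (x - y)"
        proof (rule mult_mono[OF _ norm_eW_nth])
          show "norm (cr_derivative v f (dl t ?q)) * t ^ wt v \<le> \<epsilon> / ?N * t ^ \<sigma>"
            by (rule tv[rule_format, of v, THEN conjunct2, rule_format, OF t(1) tvv nq])
          show "0 \<le> \<epsilon> / ?N * t ^ \<sigma>" using e N t by (intro mult_nonneg_nonneg) auto
        qed simp
        finally show "norm (cr_derivative v f (dl t ?q) * eW (dl t (x - y)) $ v) \<le> \<epsilon> / ?N * t ^ \<sigma> * norm (x - y)" .
      qed
      also have "\<dots> = \<epsilon> * t ^ \<sigma> * norm (x - y)" using N by simp
      finally show ?thesis .
    qed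
    have on: "onorm (\<lambda>h. h *\<^sub>R frechet_derivative f (at (dl t (y + s *\<^sub>R (x - y)))) (dl t (x - y))) \<le> \<epsilon> * t ^ \<sigma> * norm (x - y)"
      if s: "s \<in> {0..1}" for s
    proof (rule onorm_le)
      fix h :: real
      show "norm (h *\<^sub>R frechet_derivative f (at (dl t (y + s *\<^sub>R (x - y)))) (dl t (x - y))) \<le> \<epsilon> * t ^ \<sigma> * norm (x - y) * norm h"
        using mult_left_mono[OF bd[OF s], of "\<bar>h\<bar>"] by (simp add: mult.commute)
    qed
    have "norm (F 1 - F 0) \<le> \<epsilon> * t ^ \<sigma> * norm (x - y) * norm (1 - 0 :: real)"
      by (rule differentiable_bound[OF convex_real_interval(5) der on]) auto
    then show ?thesis by (simp add: F_def)
  qed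
  ultimately show ?thesis by blast
qed

text \<open>Induction on the smoothness. A derivative in \<open>v\<close> satisfies the hypothesis
  with \<open>\<sigma> - wt v\<close>, or, if \<open>wt v\<close> exceeds \<open>\<sigma>\<close>,
  is small by continuity. Comparison with the value at 0 by \<open>small_lipschitz\<close> then
  leads back to \<open>f\<close>.\<close>

lemma small_vanishing:
  assumes W: "open W" "0 \<in> W" and "Ck_on j f W" "\<sigma> \<le> j"
    and "\<And>vs. sum_list (map wt vs) \<le> \<sigma> \<Longrightarrow> foldr cr_derivative vs f 0 = 0"
  shows "small f 0 \<sigma> \<and> (\<sigma> \<ge> 1 \<longrightarrow> (\<forall>v. small (cr_derivative v f) (wt v) \<sigma>))"
  using assms(3-5)
proof (induction j arbitrary: f \<sigma>)
  case 0
  have "f 0 = 0" using 0(3)[of "[]"] by simp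
  then have "small f 0 0" using 0(1) by (intro small_continuous[OF _ W]) auto
  then show ?case using 0(2) by simp
next
  case (Suc j)
  have f0: "f 0 = 0" using Suc.prems(3)[of "[]"] by simp
  show ?case
  proof (cases "\<sigma> = 0")
    case True
    then show ?thesis using small_continuous[OF Ck_on_continuous[OF Suc.prems(1)] W] f0 by simp
  next
    case False
    have D: "small (cr_derivative v f) (wt v) \<sigma>" for v
    proof (cases "wt v \<le> \<sigma>")
      case True
      have "small (cr_derivative v f) 0 (\<sigma> - wt v)"
      proof (rule Suc.IH[THEN conjunct1])
        show "Ck_on j (cr_derivative v f) W" by (rule Ck_on_cr_derivative[OF W(1) Suc.prems(1)])
        show "\<sigma> - wt v \<le> j" using Suc.prems(2) wt_pos[of v] by linarith
        \<comment> \<open>\<open>foldr\<close> applies the last entry first, so the derivative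
          already taken is appended at the end of the list.\<close>
        show "foldr cr_derivative vs (cr_derivative v f) 0 = 0" if "sum_list (map wt vs) \<le> \<sigma> - wt v" for vs
          using Suc.prems(3)[of "vs @ [v]"] that True by simp
      qed
      moreover have "t ^ wt v * t ^ (\<sigma> - wt v) = t ^ \<sigma>" for t :: real using True by (simp flip: power_add)
      ultimately show ?thesis unfolding small_def
      proof (intro allI impI)
        fix B \<epsilon> :: real assume e: "\<epsilon> > 0" and h: "\<forall>B \<epsilon>. 0 < \<epsilon> \<longrightarrow> (\<exists>t0>0. \<forall>t x. 0 < t \<longrightarrow> t < t0 \<longrightarrow> norm x \<le> B \<longrightarrow>
            norm (cr_derivative v f (dl t x)) * t ^ 0 \<le> \<epsilon> * t ^ (\<sigma> - wt v))" and p: "\<And>t::real. t ^ wt v * t ^ (\<sigma> - wt v) = t ^ \<sigma>"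
        obtain t0 where t0: "t0 > 0" "\<And>t x. 0 < t \<Longrightarrow> t < t0 \<Longrightarrow> norm x \<le> B \<Longrightarrow> norm (cr_derivative v f (dl t x)) * t ^ 0 \<le> \<epsilon> * t ^ (\<sigma> - wt v)"
          using h e by blast
        show "\<exists>t0>0. \<forall>t x. 0 < t \<longrightarrow> t < t0 \<longrightarrow> norm x \<le> B \<longrightarrow> norm (cr_derivative v f (dl t x)) * t ^ wt v \<le> \<epsilon> * t ^ \<sigma>"
        proof (intro exI[of _ t0] conjI allI impI)
          fix t :: real and x :: "(complex ^ 'n) \<times> (real ^ 'd)" assume t: "0 < t" "t < t0" and x: "norm x \<le> B"
          have "norm (cr_derivative v f (dl t x)) * t ^ wt v \<le> (\<epsilon> * t ^ (\<sigma> - wt v)) * t ^ wt v"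
            using t0(2)[OF t x] t by (intro mult_right_mono) auto
          then show "norm (cr_derivative v f (dl t x)) * t ^ wt v \<le> \<epsilon> * t ^ \<sigma>" by (simp add: mult.commute p flip: mult.assoc) (simp add: mult_ac p)
        qed (rule t0(1))
      qed
    next
      case False
      then show ?thesis
        by (intro small_continuous[OF Ck_on_continuous[OF Ck_on_cr_derivative[OF W(1) Suc.prems(1)]] W]) auto
    qed
    have df: "f differentiable (at y)" if "y \<in> W" for y using Suc.prems(1) that by simp
    have "small f 0 \<sigma>"
      unfolding small_def
    proof (intro allI impI)
      fix B \<epsilon> :: real assume e: "\<epsilon> > 0"
      define B' where "B' = \<bar>B\<bar> + 1"
      have e': "\<epsilon> / B' > 0" using e by (simp add: B'_def add_nonneg_pos)
      obtain t0 where t0: "t0 > 0" "\<And>t x y. 0 < t \<Longrightarrow> t < t0 \<Longrightarrow> norm x \<le> B' \<Longrightarrow> norm y \<le> B' \<Longrightarrow>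
          norm (f (dl t x) - f (dl t y)) \<le> \<epsilon> / B' * t ^ \<sigma> * norm (x - y)"
        using small_lipschitz[OF W df D e', of B'] by blast
      have d0: "dl t 0 = 0" for t by (simp add: pair_vec_eq)
      show "\<exists>t0>0. \<forall>t x. 0 < t \<longrightarrow> t < t0 \<longrightarrow> norm x \<le> B \<longrightarrow> norm (f (dl t x)) * t ^ 0 \<le> \<epsilon> * t ^ \<sigma>"
      proof (intro exI[of _ t0] conjI allI impI)
        fix t :: real and x :: "(complex ^ 'n) \<times> (real ^ 'd)" assume t: "0 < t" "t < t0" and x: "norm x \<le> B"
        have nx: "norm x \<le> B'" using x by (simp add: B'_def)
        have "norm (f (dl t x)) \<le> \<epsilon> / B' * t ^ \<sigma> * norm x"
          using t0(2)[OF t nx, of 0] by (simp add: d0 f0 B'_def)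
        also have "\<dots> \<le> \<epsilon> / B' * t ^ \<sigma> * B'"
          by (rule mult_left_mono[OF nx]) (intro mult_nonneg_nonneg less_imp_le[OF e'] zero_le_power less_imp_le[OF t(1)])
        also have "\<dots> = \<epsilon> * t ^ \<sigma>" by (simp add: B'_def)
        finally show "norm (f (dl t x)) * t ^ 0 \<le> \<epsilon> * t ^ \<sigma>" by simp
      qed (rule t0(1))
    qed
    then show ?thesis using D by blast
  qed
qed

end

text \<open>Unlike in a directional derivative, the direction \<open>V t\<close> may vary, as long
  as it converges.\<close>

lemma difference_quotient_limit:
  fixes F :: "'a::real_normed_vector \<Rightarrow> 'b::real_normed_vector"
  assumes F: "(F has_derivative D) (at p)" and V: "(V \<longlongrightarrow> y) net" and h: "(h \<longlongrightarrow> (0::real)) net" "\<forall>\<^sub>F t in net. h t > 0"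
  shows "((\<lambda>t. (1 / h t) *\<^sub>R (F (p + h t *\<^sub>R V t) - F p)) \<longlongrightarrow> D y) net"
proof -
  have bl: "bounded_linear D" using F has_derivative_bounded_linear by blast
  have "((\<lambda>t. (1 / h t) *\<^sub>R (F (p + h t *\<^sub>R V t) - F p) - D (V t)) \<longlongrightarrow> 0) net"
  proof (rule tendstoI)
    fix e :: real assume e: "e > 0"
    define e' where "e' = e / (norm y + 1)"
    have y1: "norm y + 1 > 0" by (simp add: add_nonneg_pos)
    have e': "e' > 0" unfolding e'_def using e y1 by (rule divide_pos_pos)
    obtain d where d: "d > 0" "\<And>z. norm (z - p) < d \<Longrightarrow> norm (F z - F p - D (z - p)) \<le> e' * norm (z - p)"
      using F[unfolded has_derivative_at_alt] e' by blast
    have "((\<lambda>t. h t *\<^sub>R V t) \<longlongrightarrow> 0 *\<^sub>R y) net" by (intro tendsto_scaleR h V)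
    from tendstoD[OF this d(1)] have 1: "\<forall>\<^sub>F t in net. norm (h t *\<^sub>R V t) < d"
      by (simp only: scaleR_zero_left dist_norm diff_0_right)
    have 2: "\<forall>\<^sub>F t in net. norm (V t) < norm y + 1"
      by (rule order_tendstoD(2)[OF tendsto_norm[OF V]]) simp
    show "\<forall>\<^sub>F t in net. dist ((1 / h t) *\<^sub>R (F (p + h t *\<^sub>R V t) - F p) - D (V t)) 0 < e"
      using 1 2 h(2)
    proof eventually_elim
      case (elim t)
      have D: "D (h t *\<^sub>R V t) = h t *\<^sub>R D (V t)" by (rule linear_scale[OF bounded_linear.linear[OF bl]])
      have "norm (F (p + h t *\<^sub>R V t) - F p - D (h t *\<^sub>R V t)) \<le> e' * norm (h t *\<^sub>R V t)"
        using d(2)[of "p + h t *\<^sub>R V t"] elim(1) by simp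
      then have *: "norm (F (p + h t *\<^sub>R V t) - F p - h t *\<^sub>R D (V t)) \<le> h t * (e' * norm (V t))"
        using elim(3) by (simp add: D mult_ac)
      have "(1 / h t) *\<^sub>R (F (p + h t *\<^sub>R V t) - F p) - D (V t) = (1 / h t) *\<^sub>R (F (p + h t *\<^sub>R V t) - F p - h t *\<^sub>R D (V t))"
        using elim(3) by (simp add: scaleR_diff_right)
      then have "norm ((1 / h t) *\<^sub>R (F (p + h t *\<^sub>R V t) - F p) - D (V t)) = (1 / h t) * norm (F (p + h t *\<^sub>R V t) - F p - h t *\<^sub>R D (V t))"
        using elim(3) by simp
      also have "\<dots> \<le> (1 / h t) * (h t * (e' * norm (V t)))" using * elim(3) by (intro mult_left_mono) auto
      also have "\<dots> = e' * norm (V t)" using elim(3) by simp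
      also have "\<dots> < e' * (norm y + 1)" using elim(2) e' by (rule mult_strict_left_mono)
      also have "\<dots> = e" using y1 by (simp add: e'_def)
      finally show ?case by simp
    qed
  qed
  from tendsto_add[OF this bounded_linear.tendsto[OF bl V]] show ?thesis by simp
qed

lemma small_polynomial_zero_eventually:
  assumes "\<forall>\<^sub>F t in at_right (0::real). norm (\<Sum>k\<le>n. of_real t ^ k * a k) \<le> C * t ^ Suc n" "k \<le> n"
  shows "a k = (0 :: complex)"
proof -
  obtain t0 where t0: "t0 > 0" "\<And>t. 0 < t \<Longrightarrow> t < t0 \<Longrightarrow> norm (\<Sum>k\<le>n. of_real t ^ k * a k) \<le> C * t ^ Suc n"
    using assms(1) unfolding eventually_at_right_field by blast
  show ?thesis by (rule small_polynomial_zero[OF t0 assms(2)])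
qed

section \<open>The leading weighted part of a map close to the identity\<close>

context cr_model
begin

lemma wpart_eventually:
  assumes f: "cdiff f S" and S: "open S" "0 \<in> S"
  shows "\<exists>C. \<forall>\<^sub>F t in at_right (0::real). norm (f (dil wz (of_real t) q) - (\<Sum>k\<le>n. of_real t ^ k * wpart wz f k q)) \<le> C * t ^ Suc n"
proof -
  obtain C t0 where C: "t0 > 0 \<and> t0 \<le> 1 \<and> (\<forall>t p. norm t < t0 \<longrightarrow> norm p \<le> norm q \<longrightarrow> dil wz t p \<in> S \<and>
     norm (f (dil wz t p) - (\<Sum>k\<le>n. t ^ k * wpart wz f k p)) \<le> C * norm t ^ Suc n)"
    using wpart_expansion[where w = wz and B = "norm q" and n = n, OF f S wz_pos] by (elim exE)
  have "norm (f (dil wz (of_real t) q) - (\<Sum>k\<le>n. of_real t ^ k * wpart wz f k q)) \<le> C * t ^ Suc n"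
    if t: "0 < t" "t < t0" for t :: real
    using C[THEN conjunct2, THEN conjunct2, rule_format, of "of_real t" q] t by simp
  then show ?thesis using C by (intro exI[of _ C]) (auto simp: eventually_at_right_field intro!: exI[of _ t0])
qed

lemma dil_eventually: "open S \<Longrightarrow> 0 \<in> S \<Longrightarrow> \<forall>\<^sub>F t in at_right (0::real). dil wz (of_real t) q \<in> S"
  using dil_near_0[of S q] unfolding eventually_at_right_field by blast

lemma homogeneous_part_wpart:
  "homogeneous_part (coord_weight m) (real \<sigma> / m1) f p = wpart wz f \<sigma> p"
proof -
  have "sum_list (map (coord_weight m) as) = real (sum_list (map wz as)) / m1" for as :: "('n + 'd) list"
    unfolding coord_weight_wz by (induction as) (simp_all add: add_divide_distrib)
  then show ?thesis using m1_pos by (simp add: homogeneous_part_def wpart_def tcoef_def)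
qed

lemma eP_prj: "eP p = eW (prj p)"
  by (auto simp: vec_eq_crvar)

lemma mem_perturbed: "p \<in> perturbed_model P W R \<longleftrightarrow> prj p \<in> W \<and>
  (\<forall>l. of_real (Im (p $ Inr l)) = ev (PP l) (eP p) + of_real (R (prj p) $ l))"
proof -
  have "(\<chi> v. case v of Z i \<Rightarrow> zpart p $ i | Zbar i \<Rightarrow> vcnj (zpart p) $ i | U l \<Rightarrow> of_real (upart p $ l)) = eP p"
    by (auto simp: vec_eq_crvar zpart_def vcnj_def upart_def)
  then show ?thesis unfolding perturbed_model_def mem_Collect_eq cr_eval_PP prj_def by simp
qed

definition gR :: "((complex ^ 'n) \<times> (real ^ 'd) \<Rightarrow> real ^ 'd) \<Rightarrow> (complex ^ 'n) \<times> (real ^ 'd) \<Rightarrow> complex ^ ('n + 'd)" where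
  "gR R x = gr x + (\<chi> a. case a of Inl i \<Rightarrow> 0 | Inr l \<Rightarrow> \<i> * of_real (R x $ l))"

lemma gR_nth [simp]: "gR R x $ Inl i = fst x $ i" "gR R x $ Inr l = of_real (snd x $ l) + \<i> * (ev (PP l) (eW x) + of_real (R x $ l))"
  by (simp_all add: gR_def algebra_simps)

lemma prj_gR [simp]: "prj (gR R x) = x"
  by (simp add: pair_vec_eq)

lemma gR_mem: "x \<in> W \<Longrightarrow> gR R x \<in> perturbed_model P W R"
  by (simp add: mem_perturbed eP_prj)

lemma gR_prj: "p \<in> perturbed_model P W R \<Longrightarrow> gR R (prj p) = p"
  unfolding mem_perturbed eP_prj vec_eq_Plus by (auto simp: complex_eq_iff)

lemma continuous_gR:
  assumes "continuous_on W R"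
  shows "continuous_on W (gR R)"
proof -
  have "continuous_on W gr"
    by (meson continuous_at_imp_continuous_on gr_has_Dgr has_derivative_continuous)
  moreover have "continuous_on W (\<lambda>x. (\<chi> a. case a of Inl i \<Rightarrow> 0 | Inr l \<Rightarrow> \<i> * of_real (R x $ l)) :: complex ^ ('n + 'd))"
  proof (rule continuous_on_vec_lambda)
    fix a :: "'n + 'd"
    show "continuous_on W (\<lambda>x. case a of Inl i \<Rightarrow> 0 | Inr l \<Rightarrow> \<i> * complex_of_real (R x $ l))"
      by (cases a) (auto intro!: continuous_intros assms)
  qed
  ultimately show ?thesis unfolding gR_def[abs_def] by (rule continuous_on_add)
qed

lemma continuous_prj: "continuous_on A prj"
  using linear_prj linear_continuous_on linear_conv_bounded_linear by blast

text \<open>The inverse of an automorphism also preserves the submanifold near \<open>0\<close>: in the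
  coordinates \<open>(z, u)\<close> the automorphism is injective and continuous, hence open.\<close>

lemma automorphism_inverse:
  assumes W: "open W" "0 \<in> W" and R: "continuous_on W R" "R 0 = 0"
    and g: "0 \<in> S" "open S" "inj_on g S" "continuous_on S g" "g 0 = 0" "g ` (S \<inter> perturbed_model P W R) \<subseteq> perturbed_model P W R"
  shows "\<exists>V. open V \<and> 0 \<in> V \<and> (\<forall>y\<in>perturbed_model P W R. prj y \<in> V \<longrightarrow> inv_into S g y \<in> perturbed_model P W R)"
proof -
  define A where "A = W \<inter> gR R -` S"
  define \<phi> where "\<phi> x = prj (g (gR R x))" for x
  have cR: "continuous_on W (gR R)" by (rule continuous_gR[OF R(1)])
  have A: "open A" unfolding A_def by (rule continuous_open_preimage[OF cR W(1) g(2)])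
  have gA: "g (gR R x) \<in> perturbed_model P W R" if "x \<in> A" for x
    using g(6) gR_mem[of x W R] that by (auto simp: A_def)
  have gRg: "gR R (\<phi> x) = g (gR R x)" if "x \<in> A" for x
    unfolding \<phi>_def by (rule gR_prj[OF gA[OF that]])
  have "inj_on \<phi> A"
  proof (rule inj_onI)
    fix x y assume x: "x \<in> A" and y: "y \<in> A" and e: "\<phi> x = \<phi> y"
    have "g (gR R x) = g (gR R y)" using gRg[OF x] gRg[OF y] e by simp
    then have "gR R x = gR R y" using g(3) x y by (auto simp: A_def dest: inj_onD)
    from arg_cong[OF this, of prj] show "x = y" by simp
  qed
  moreover have "continuous_on A \<phi>"
    unfolding \<phi>_def
    by (rule continuous_on_compose2[OF continuous_prj[of UNIV] continuous_on_compose2[OF g(4) continuous_on_subset[OF cR]]])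
      (auto simp: A_def)
  ultimately have V: "open (\<phi> ` A)" using A by (intro invariance_of_domain)
  have p0: "prj 0 = 0" by (rule linear_0[OF linear_prj])
  have "gR R 0 = 0" using gr_prj[OF zero_MM] p0 R(2) by (simp add: gR_def vec_eq_Plus)
  then have "0 \<in> A" "\<phi> 0 = 0" using W g p0 by (simp_all add: A_def \<phi>_def)
  then have "0 \<in> \<phi> ` A" by (metis imageI)
  moreover have "inv_into S g y \<in> perturbed_model P W R" if y: "y \<in> perturbed_model P W R" "prj y \<in> \<phi> ` A" for y
  proof -
    obtain x where x: "x \<in> A" "prj y = \<phi> x" using y(2) by blast
    have "y = g (gR R x)" using gR_prj[OF y(1)] gRg[OF x(1)] x(2) by simp
    then have "inv_into S g y = gR R x" using x(1) g(3) by (simp add: A_def)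
    then show ?thesis using gR_mem[of x W R] x(1) by (simp add: A_def)
  qed
  ultimately show ?thesis using V by blast
qed

text \<open>The displacement \<open>E\<close> in dilated coordinates divided by
  \<open>t ^ \<mu>\<close>, as \<open>rv_dil\<close> makes explicit. The powers of \<open>t\<close>
  are arranged so that all exponents are natural numbers.\<close>

definition rv :: "(complex ^ ('n + 'd) \<Rightarrow> complex ^ ('n + 'd)) \<Rightarrow> nat \<Rightarrow> real \<Rightarrow> complex ^ ('n + 'd) \<Rightarrow> complex ^ ('n + 'd)" where
  "rv E \<mu> t q = (1 / t ^ (WW + \<mu>)) *\<^sub>R (\<chi> a. of_real t ^ (WW - wz a) * E (dil wz (of_real t) q) $ a)"

lemma rv_dil:
  assumes t: "t > 0"
  shows "E (dil wz (of_real t) q) = dil wz (of_real t) (t ^ \<mu> *\<^sub>R rv E \<mu> t q)"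
proof -
  have "complex_of_real t ^ wz a * (of_real t ^ \<mu> * (inverse (of_real t ^ (WW + \<mu>)) * (of_real t ^ (WW - wz a) * x))) = x" for a x
  proof -
    have "complex_of_real t ^ (WW + \<mu>) = of_real t ^ wz a * of_real t ^ \<mu> * of_real t ^ (WW - wz a)"
      using wz_le_WW[of a] by (simp flip: power_add) (simp add: add.commute add.left_commute)
    then show ?thesis using t by (simp add: field_simps)
  qed
  then show ?thesis
    by (simp add: vec_eq_iff rv_def vector_scaleR_component scaleR_conv_of_real[where 'a = complex] divide_inverse)
qed

lemma rv_expansion:
  assumes E: "holomorphic_map_on E S" and S: "open S" "0 \<in> S" and lead: "\<And>\<nu>. \<nu> < int \<mu> \<Longrightarrow> ppart E \<nu> = (\<lambda>_. 0)"
  shows "\<exists>C t0. t0 > 0 \<and> (\<forall>t q. 0 < t \<longrightarrow> t < t0 \<longrightarrow> norm q \<le> B \<longrightarrow>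
    norm (rv E \<mu> t q - pfield (ppart E (int \<mu>)) q) \<le> C * t)"
proof -
  obtain C t0 where C: "t0 > 0 \<and> C \<ge> 0 \<and> (\<forall>t::real. \<forall>q. 0 < t \<longrightarrow> t < t0 \<longrightarrow> norm q \<le> B \<longrightarrow> dil wz (of_real t) q \<in> S \<and>
    norm ((\<chi> a. of_real t ^ (WW - wz a) * E (dil wz (of_real t) q) $ a) - (\<Sum>j\<le>WW + \<mu>. t ^ j *\<^sub>R pfield (ppart E (int j - int WW)) q))
      \<le> C * t ^ Suc (WW + \<mu>))"
    using vec_expansion[OF E S, of B \<mu>] by (elim exE)
  have "norm (rv E \<mu> t q - pfield (ppart E (int \<mu>)) q) \<le> C * t" if t: "0 < t" "t < t0" and q: "norm q \<le> B" for t q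
  proof -
    let ?v = "\<chi> a. of_real t ^ (WW - wz a) * E (dil wz (of_real t) q) $ a"
    have "(\<Sum>j\<le>WW + \<mu>. t ^ j *\<^sub>R pfield (ppart E (int j - int WW)) q) = (\<Sum>j\<in>{WW + \<mu>}. t ^ j *\<^sub>R pfield (ppart E (int j - int WW)) q)"
    proof (rule sum.mono_neutral_right)
      show "\<forall>j\<in>{..WW + \<mu>} - {WW + \<mu>}. t ^ j *\<^sub>R pfield (ppart E (int j - int WW)) q = 0"
      proof
        fix j assume "j \<in> {..WW + \<mu>} - {WW + \<mu>}"
        then have "ppart E (int j - int WW) = (\<lambda>_. 0)" by (intro lead) auto
        then show "t ^ j *\<^sub>R pfield (ppart E (int j - int WW)) q = 0" by (simp add: pfield_def zero_vec_def[symmetric])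
      qed
    qed auto
    also have "\<dots> = t ^ (WW + \<mu>) *\<^sub>R pfield (ppart E (int \<mu>)) q" by simp
    finally have est: "norm (?v - t ^ (WW + \<mu>) *\<^sub>R pfield (ppart E (int \<mu>)) q) \<le> C * t ^ Suc (WW + \<mu>)"
      using C[THEN conjunct2, THEN conjunct2, rule_format, OF t q] by simp
    have "rv E \<mu> t q - pfield (ppart E (int \<mu>)) q = (1 / t ^ (WW + \<mu>)) *\<^sub>R (?v - t ^ (WW + \<mu>) *\<^sub>R pfield (ppart E (int \<mu>)) q)"
      using t by (simp add: rv_def scaleR_diff_right)
    then have "norm (rv E \<mu> t q - pfield (ppart E (int \<mu>)) q) = (1 / t ^ (WW + \<mu>)) * norm (?v - t ^ (WW + \<mu>) *\<^sub>R pfield (ppart E (int \<mu>)) q)"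
      using t by simp
    also have "\<dots> \<le> (1 / t ^ (WW + \<mu>)) * (C * t ^ Suc (WW + \<mu>))" by (rule mult_left_mono[OF est]) (use t in simp)
    also have "\<dots> = C * t" using t by simp
    finally show ?thesis .
  qed
  then show ?thesis using C by blast
qed

lemma perturbed_dil:
  assumes t: "t > 0" and y: "dil wz (of_real t) y \<in> perturbed_model P W R"
  shows "of_real (t ^ m l * Im (y $ Inr l)) = of_real (t ^ m l) * ev (PP l) (eP y) + of_real (R (dl t (prj y)) $ l)"
proof -
  have "ev (PP l) (dil wt (of_real t) e) = of_real (t ^ m l) * ev (PP l) e" for e
    using hom_PP[of l] t by (simp add: hom_def)
  then show ?thesis using y by (simp add: mem_perturbed prj_dil eP_dil wz_def flip: of_real_power)
qed

text \<open>In dilated coordinates the perturbed model tends to the model, and a point moves by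
  \<open>t ^ \<mu>\<close> times a convergent vector. Subtracting the equations of a point and of
  its image and dividing by \<open>t ^ \<mu>\<close> gives the tangency equation in the limit. The
  perturbation enters only through its difference at two points, so its small Lipschitz constant is
  the relevant quantity.\<close>

lemma tang_leading:
  assumes W: "open W" "0 \<in> W"
    and R: "\<And>l. small (\<lambda>x. of_real (R x $ l)) 0 (m l)"
      "\<And>l v. small (cr_derivative v (\<lambda>x. of_real (R x $ l))) (wt v) (m l)"
      "\<And>l y. y \<in> W \<Longrightarrow> (\<lambda>x. complex_of_real (R x $ l)) differentiable (at y)"
    and E: "holomorphic_map_on E S" and S: "open S" "0 \<in> S"
    and f: "\<And>p. p \<in> S \<inter> perturbed_model P W R \<Longrightarrow> p + E p \<in> perturbed_model P W R"
    and \<mu>: "\<mu> \<ge> 1" and lead: "\<And>\<nu>. \<nu> < int \<mu> \<Longrightarrow> ppart E \<nu> = (\<lambda>_. 0)"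
  shows "tang (ppart E (int \<mu>))"
  unfolding tang_iff
proof
  fix p assume p: "p \<in> MM"
  let ?F = "at_right (0::real)"
  let ?Y = "pfield (ppart E (int \<mu>))"
  define x where "x = prj p"
  \<comment> \<open>The correction of imaginary parts that lifts \<open>p\<close> to the dilated
    perturbed model without changing its (z, u) coordinates.\<close>
  define rr :: "real \<Rightarrow> complex ^ ('n + 'd)" where
    "rr t = (\<chi> a. case a of Inl i \<Rightarrow> 0 | Inr l \<Rightarrow> \<i> * of_real (R (dl t x) $ l / t ^ m l))" for t
  define q where "q t = p + rr t" for t
  define V where "V t = rv E \<mu> t (q t)" for t
  have pos: "\<forall>\<^sub>F t in ?F. t > 0" by (simp add: eventually_at_filter)
  have id0: "((\<lambda>t. t) \<longlongrightarrow> 0) ?F" by (simp add: tendsto_ident_at)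
  have rr: "(rr \<longlongrightarrow> 0) ?F"
  proof (rule vec_tendstoI)
    fix a :: "'n + 'd"
    show "((\<lambda>t. rr t $ a) \<longlongrightarrow> 0 $ a) ?F"
    proof (cases a)
      case (Inr l)
      have "((\<lambda>t. rr t $ a) \<longlongrightarrow> 0) ?F"
      proof (rule tendstoI)
        fix e :: real assume e: "e > 0"
        obtain t0 where t0: "t0 > 0" "\<And>t y. 0 < t \<Longrightarrow> t < t0 \<Longrightarrow> norm y \<le> norm x \<Longrightarrow> norm (complex_of_real (R (dl t y) $ l)) * t ^ 0 \<le> e / 2 * t ^ m l"
          using R(1)[of l, unfolded small_def] e half_gt_zero by blast
        have "dist (rr t $ a) 0 < e" if t: "0 < t" "t < t0" for t
        proof -
          have "norm (complex_of_real (R (dl t x) $ l)) * t ^ 0 \<le> e / 2 * t ^ m l" by (rule t0(2)[OF t order_refl])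
          then have "\<bar>R (dl t x) $ l\<bar> \<le> e / 2 * t ^ m l" by simp
          then have "\<bar>R (dl t x) $ l\<bar> / t ^ m l \<le> e / 2" using t by (simp add: pos_divide_le_eq)
          moreover have "norm (rr t $ a) = \<bar>R (dl t x) $ l\<bar> / t ^ m l" using Inr t by (simp add: rr_def norm_mult norm_divide norm_power)
          ultimately show ?thesis using e by (simp only: dist_norm diff_0_right)
        qed
        then show "\<forall>\<^sub>F t in ?F. dist (rr t $ a) 0 < e" unfolding eventually_at_right_field using t0(1) by blast
      qed
      then show ?thesis by simp
    qed (simp add: rr_def)
  qed
  have q: "(q \<longlongrightarrow> p) ?F" unfolding q_def using tendsto_add[OF tendsto_const[of p] rr] by simp
  have Y: "((\<lambda>t. ?Y (q t)) \<longlongrightarrow> ?Y p) ?F"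
    by (rule isCont_tendsto_compose[OF has_derivative_continuous[OF pfield_has_derivative] q])
  have V: "(V \<longlongrightarrow> ?Y p) ?F"
  proof -
    obtain C t0 where C: "t0 > 0 \<and> (\<forall>t y. 0 < t \<longrightarrow> t < t0 \<longrightarrow> norm y \<le> norm p + 1 \<longrightarrow> norm (rv E \<mu> t y - ?Y y) \<le> C * t)"
    proof -
      have "\<exists>C t0. t0 > 0 \<and> (\<forall>t y. 0 < t \<longrightarrow> t < t0 \<longrightarrow> norm y \<le> norm p + 1 \<longrightarrow> norm (rv E \<mu> t y - ?Y y) \<le> C * t)"
        by (rule rv_expansion[OF E S]) (rule lead)
      then show ?thesis using that by (elim exE)
    qed
    have "\<forall>\<^sub>F t in ?F. norm (q t) < norm p + 1" by (rule order_tendstoD(2)[OF tendsto_norm[OF q]]) simp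
    moreover have "\<forall>\<^sub>F t in ?F. t < t0" by (rule order_tendstoD(2)[OF id0]) (use C in simp)
    ultimately have "\<forall>\<^sub>F t in ?F. norm (V t - ?Y (q t)) \<le> C * t"
      using pos by eventually_elim (use C in \<open>simp add: V_def\<close>)
    moreover have "((\<lambda>t. C * t) \<longlongrightarrow> 0) ?F" using tendsto_mult[OF tendsto_const[of C] id0] by simp
    ultimately have "((\<lambda>t. V t - ?Y (q t)) \<longlongrightarrow> 0) ?F" by (rule Lim_null_comparison)
    from tendsto_add[OF this Y] show ?thesis by simp
  qed
  have pV: "((\<lambda>t. prj (V t)) \<longlongrightarrow> prj (?Y p)) ?F"
    by (rule bounded_linear.tendsto[OF _ V]) (use linear_prj linear_conv_bounded_linear in blast)
  have t\<mu>: "((\<lambda>t. t ^ \<mu>) \<longlongrightarrow> 0) ?F" using tendsto_power[OF id0, of \<mu>] \<mu> by (simp add: power_0_left)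
  obtain tW where tW: "tW > 0" "tW \<le> 1" "\<And>t y. 0 < t \<Longrightarrow> t < tW \<Longrightarrow> norm y \<le> norm x \<Longrightarrow> dl t y \<in> W"
    using dl_near_0[OF W, of "norm x"] by blast
  have inM: "\<forall>\<^sub>F t in ?F. dil wz (of_real t) (q t) \<in> perturbed_model P W R"
  proof -
    have "\<forall>\<^sub>F t in ?F. t < tW" by (rule order_tendstoD(2)[OF id0 tW(1)])
    then show ?thesis using pos
    proof eventually_elim
      case (elim t)
      have "gr (dl t x) = dil wz (of_real t) p"
        unfolding x_def prj_dil[symmetric] by (rule gr_prj[OF MM_dil[OF elim(2) p]])
      then have "gR R (dl t x) = dil wz (of_real t) (q t)"
        using elim(2) by (auto simp: gR_def vec_eq_Plus q_def rr_def wz_def algebra_simps)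
      then show ?case using gR_mem[OF tW(3)[OF elim(2,1) order_refl], of R] by simp
    qed
  qed
  have inS: "\<forall>\<^sub>F t in ?F. dil wz (of_real t) (q t) \<in> S"
  proof -
    have cd: "((\<lambda>t. dil wz (of_real t) (q t)) \<longlongrightarrow> 0) ?F"
    proof (rule vec_tendstoI)
      fix a
      have "((\<lambda>t. complex_of_real t ^ wz a * q t $ a) \<longlongrightarrow> of_real 0 ^ wz a * p $ a) ?F"
        by (intro tendsto_mult tendsto_power tendsto_of_real id0 tendsto_vec_nth q)
      then show "((\<lambda>t. dil wz (of_real t) (q t) $ a) \<longlongrightarrow> 0 $ a) ?F" using wz_pos[of a] by (simp add: power_0_left)
    qed
    show ?thesis by (rule topological_tendstoD[OF cd S])
  qed
  show "?Y p \<in> tangent_space MM p"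
    unfolding tangent_MM[OF p]
  proof
    fix l
    let ?G = "\<lambda>p. ev (PP l) (eP p)"
    \<comment> \<open>The defect of the tangency equation at scale \<open>t\<close>. It converges to
      the defect of the leading part at \<open>p\<close>, and also to 0.\<close>
    let ?A = "\<lambda>t. complex_of_real (Im (V t $ Inr l)) - (1 / t ^ \<mu>) *\<^sub>R (?G (p + t ^ \<mu> *\<^sub>R V t) - ?G p)"
    have "(?A \<longlongrightarrow> of_real (Im (?Y p $ Inr l)) - DP l p (?Y p)) ?F"
      by (intro tendsto_diff tendsto_of_real tendsto_Im tendsto_vec_nth V difference_quotient_limit[OF DP_has_derivative V t\<mu>])
        (use pos in \<open>eventually_elim, simp\<close>)
    moreover have "(?A \<longlongrightarrow> 0) ?F"
    proof (rule tendstoI)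
      fix e :: real assume e: "e > 0"
      define K where "K = norm (prj (?Y p)) + 1"
      have K: "K > 0" by (simp add: K_def add_nonneg_pos)
      have eK: "e / K > 0" using e K by simp
      obtain t0 where t0: "t0 > 0" "\<And>t y z. 0 < t \<Longrightarrow> t < t0 \<Longrightarrow> norm y \<le> norm x + 1 \<Longrightarrow> norm z \<le> norm x + 1 \<Longrightarrow>
          norm (complex_of_real (R (dl t y) $ l) - of_real (R (dl t z) $ l)) \<le> e / K * t ^ m l * norm (y - z)"
      proof -
        have "\<exists>t0>0. \<forall>t y z. 0 < t \<longrightarrow> t < t0 \<longrightarrow> norm y \<le> norm x + 1 \<longrightarrow> norm z \<le> norm x + 1 \<longrightarrow>
          norm (complex_of_real (R (dl t y) $ l) - of_real (R (dl t z) $ l)) \<le> e / K * t ^ m l * norm (y - z)"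
          by (rule small_lipschitz[where f = "\<lambda>x. complex_of_real (R x $ l)", OF W R(3) R(2) eK])
        then show ?thesis using that by blast
      qed
      have 1: "\<forall>\<^sub>F t in ?F. t < t0" by (rule order_tendstoD(2)[OF id0 t0(1)])
      have 2: "\<forall>\<^sub>F t in ?F. norm (prj (V t)) < K" by (rule order_tendstoD(2)[OF tendsto_norm[OF pV]]) (simp add: K_def)
      have "((\<lambda>t. x + t ^ \<mu> *\<^sub>R prj (V t)) \<longlongrightarrow> x + 0 *\<^sub>R prj (?Y p)) ?F" by (intro tendsto_add tendsto_const tendsto_scaleR t\<mu> pV)
      then have 3: "\<forall>\<^sub>F t in ?F. norm (x + t ^ \<mu> *\<^sub>R prj (V t)) < norm x + 1"
        by (intro order_tendstoD(2)[OF tendsto_norm]) auto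
      show "\<forall>\<^sub>F t in ?F. dist (?A t) 0 < e"
        using 1 2 3 pos inM inS
      proof eventually_elim
        case (elim t)
        let ?y = "q t + t ^ \<mu> *\<^sub>R V t"
        have "dil wz (of_real t) (q t) + E (dil wz (of_real t) (q t)) = dil wz (of_real t) ?y"
          unfolding rv_dil[OF elim(4), of E "q t" \<mu>] V_def by (simp add: vec_eq_iff algebra_simps)
        then have yM: "dil wz (of_real t) ?y \<in> perturbed_model P W R" using f[OF IntI[OF elim(6,5)]] by simp
        have prr: "prj (rr t) = 0" by (simp add: pair_vec_eq rr_def)
        have pq: "prj (q t) = x" using prr by (simp add: q_def x_def linear_add[OF linear_prj])
        have py: "prj ?y = x + t ^ \<mu> *\<^sub>R prj (V t)" by (simp only: linear_add[OF linear_prj] linear_scale[OF linear_prj] pq)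
        have eq: "eP (q t) = eP p" unfolding eP_prj pq x_def ..
        have ey: "eP ?y = eP (p + t ^ \<mu> *\<^sub>R V t)"
          unfolding eP_prj by (simp only: linear_add[OF linear_prj] linear_scale[OF linear_prj] pq x_def)
        let ?D = "complex_of_real (R (dl t (x + t ^ \<mu> *\<^sub>R prj (V t))) $ l) - of_real (R (dl t x) $ l)"
        have a1: "of_real (t ^ m l) * complex_of_real (Im (?y $ Inr l)) = of_real (t ^ m l) * ?G (p + t ^ \<mu> *\<^sub>R V t) + of_real (R (dl t (x + t ^ \<mu> *\<^sub>R prj (V t))) $ l)"
          using perturbed_dil[OF elim(4) yM, of l] unfolding py ey of_real_mult .
        have a2: "of_real (t ^ m l) * complex_of_real (Im (q t $ Inr l)) = of_real (t ^ m l) * ?G p + of_real (R (dl t x) $ l)"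
          using perturbed_dil[OF elim(4,5), of l] unfolding pq eq of_real_mult .
        have a3: "complex_of_real (Im (?y $ Inr l)) = of_real (Im (q t $ Inr l)) + of_real (t ^ \<mu>) * of_real (Im (V t $ Inr l))"
          by (simp add: vector_scaleR_component)
        have "of_real (t ^ m l) * (of_real (t ^ \<mu>) * ?A t) = ?D"
        proof -
          have s: "of_real (t ^ \<mu>) * ((1 / t ^ \<mu>) *\<^sub>R z) = z" for z :: complex
            using elim(4) by (simp add: scaleR_conv_of_real)
          have "of_real (t ^ m l) * (of_real (t ^ \<mu>) * ?A t) = of_real (t ^ m l) * (of_real (t ^ \<mu>) * of_real (Im (V t $ Inr l)))
              - of_real (t ^ m l) * (?G (p + t ^ \<mu> *\<^sub>R V t) - ?G p)"
            by (simp only: right_diff_distrib[of _ "complex_of_real (Im (V t $ Inr l))"] s right_diff_distrib[of "complex_of_real (t ^ m l)" "_ * _"])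
          also have "\<dots> = ?D" using a1 a2 unfolding a3 by (simp only: algebra_simps)
          finally show ?thesis .
        qed
        from arg_cong[OF this, of norm] have "t ^ m l * (t ^ \<mu> * norm (?A t)) = norm ?D"
          using elim(4) by (simp only: norm_mult norm_of_real abs_of_pos zero_less_power)
        also have "\<dots> \<le> e / K * t ^ m l * norm (x + t ^ \<mu> *\<^sub>R prj (V t) - x)"
          by (rule t0(2)) (use elim in auto)
        also have "\<dots> = t ^ m l * (t ^ \<mu> * (e / K * norm (prj (V t))))" using elim(4) by simp
        finally have "norm (?A t) \<le> e / K * norm (prj (V t))" using elim(4) by (simp only: mult_le_cancel_left_pos zero_less_power)
        also have "\<dots> < e / K * K" by (rule mult_strict_left_mono[OF elim(2) eK])
        also have "\<dots> = e" using K by simp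
        finally show ?case by simp
      qed
    qed
    ultimately have "of_real (Im (?Y p $ Inr l)) - DP l p (?Y p) = 0"
      using tendsto_unique trivial_limit_at_right_real by blast
    then show "of_real (Im (?Y p $ Inr l)) = DP l p (?Y p)" by simp
  qed
qed

lemma holomorphic_map_compose:
  assumes h: "holomorphic_map_on h S" and g: "holomorphic_map_on g T" and S: "h ` S \<subseteq> T"
  shows "holomorphic_map_on (\<lambda>p. g (h p)) S"
  unfolding holomorphic_map_on_def
proof
  fix p assume p: "p \<in> S"
  then have hp: "h p \<in> T" using S by blast
  obtain L where L: "(h has_derivative L) (at p)" "\<forall>c v. L (c *s v) = c *s L v"
    using h p unfolding holomorphic_map_on_def by blast
  obtain K where K: "(g has_derivative K) (at (h p))" "\<forall>c v. K (c *s v) = c *s K v"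
    using g hp unfolding holomorphic_map_on_def by blast
  show "\<exists>L. ((\<lambda>p. g (h p)) has_derivative L) (at p) \<and> (\<forall>c v. L (c *s v) = c *s L v)"
    by (intro exI[of _ "\<lambda>v. K (L v)"] conjI has_derivative_compose[OF L(1) K(1)]) (simp add: L(2) K(2))
qed

lemma holomorphic_map_continuous: "holomorphic_map_on h S \<Longrightarrow> continuous_on S h"
  by (meson continuous_at_imp_continuous_on holomorphic_map_differentiable differentiable_imp_continuous_within)

lemma holomorphic_minus_id: "holomorphic_map_on h S \<Longrightarrow> holomorphic_map_on (\<lambda>p. h p - p) S"
proof -
  assume h: "holomorphic_map_on h S"
  have "holomorphic_map_on (\<lambda>p. (-1) *\<^sub>R p) S"
    by (rule holomorphic_map_scaleR) (auto simp: holomorphic_map_on_def intro!: exI[of _ "\<lambda>x. x"])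
  from holomorphic_map_add[OF h this] show ?thesis by simp
qed

lemma equal_wparts_close:
  assumes h: "holomorphic_map_on h S" "open S" "0 \<in> S" and g: "holomorphic_map_on g T" "open T" "0 \<in> T"
    and eq: "\<And>a \<sigma> p. \<sigma> \<le> n \<Longrightarrow> wpart wz (\<lambda>p. h p $ a) \<sigma> p = wpart wz (\<lambda>p. g p $ a) \<sigma> p"
  shows "\<exists>C. \<forall>\<^sub>F t in at_right (0::real). norm (h (dil wz (of_real t) q) - g (dil wz (of_real t) q)) \<le> C * t ^ Suc n"
proof -
  have "\<exists>C. \<forall>\<^sub>F t in at_right (0::real). norm ((h (dil wz (of_real t) q) - g (dil wz (of_real t) q)) $ a) \<le> C * t ^ Suc n" for a
  proof -
    obtain C where C: "\<forall>\<^sub>F t in at_right (0::real). norm (h (dil wz (of_real t) q) $ a - (\<Sum>k\<le>n. of_real t ^ k * wpart wz (\<lambda>p. h p $ a) k q)) \<le> C * t ^ Suc n"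
      using wpart_eventually[where f = "\<lambda>p. h p $ a" and q = q and n = n, OF holomorphic_map_cdiff[OF h(1)] h(2,3)] by (elim exE)
    obtain D where D: "\<forall>\<^sub>F t in at_right (0::real). norm (g (dil wz (of_real t) q) $ a - (\<Sum>k\<le>n. of_real t ^ k * wpart wz (\<lambda>p. g p $ a) k q)) \<le> D * t ^ Suc n"
      using wpart_eventually[where f = "\<lambda>p. g p $ a" and q = q and n = n, OF holomorphic_map_cdiff[OF g(1)] g(2,3)] by (elim exE)
    have "\<forall>\<^sub>F t in at_right (0::real). norm ((h (dil wz (of_real t) q) - g (dil wz (of_real t) q)) $ a) \<le> (C + D) * t ^ Suc n"
      using C D
    proof eventually_elim
      case (elim t)
      have "(\<Sum>k\<le>n. of_real t ^ k * wpart wz (\<lambda>p. h p $ a) k q) = (\<Sum>k\<le>n. of_real t ^ k * wpart wz (\<lambda>p. g p $ a) k q)"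
        by (rule sum.cong) (simp_all add: eq)
      then have "norm (h (dil wz (of_real t) q) $ a - g (dil wz (of_real t) q) $ a) \<le> C * t ^ Suc n + D * t ^ Suc n"
        using elim norm_triangle_ineq4[of "h (dil wz (of_real t) q) $ a - (\<Sum>k\<le>n. of_real t ^ k * wpart wz (\<lambda>p. h p $ a) k q)"
            "g (dil wz (of_real t) q) $ a - (\<Sum>k\<le>n. of_real t ^ k * wpart wz (\<lambda>p. g p $ a) k q)"]
        by (simp only: diff_diff_eq2 diff_add_cancel)
      then show ?case by (simp only: vector_minus_component distrib_right)
    qed
    then show ?thesis by (rule exI)
  qed
  then have "\<forall>a. \<exists>C. \<forall>\<^sub>F t in at_right (0::real). norm ((h (dil wz (of_real t) q) - g (dil wz (of_real t) q)) $ a) \<le> C * t ^ Suc n"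
    by (intro allI)
  then obtain C where C: "\<forall>a. \<forall>\<^sub>F t in at_right (0::real). norm ((h (dil wz (of_real t) q) - g (dil wz (of_real t) q)) $ a) \<le> C a * t ^ Suc n"
    by (rule choice[THEN exE])
  have "\<forall>\<^sub>F t in at_right (0::real). \<forall>a. norm ((h (dil wz (of_real t) q) - g (dil wz (of_real t) q)) $ a) \<le> C a * t ^ Suc n"
    by (rule eventually_all_finite) (rule C[THEN spec])
  then have "\<forall>\<^sub>F t in at_right (0::real). norm (h (dil wz (of_real t) q) - g (dil wz (of_real t) q)) \<le> (\<Sum>a\<in>UNIV. C a) * t ^ Suc n"
    by eventually_elim (unfold sum_distrib_right, rule order_trans[OF norm_vec_le_sum sum_mono], blast)
  then show ?thesis by (rule exI)
qed

theorem jet_determination: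
  assumes k: "k \<ge> 0" "\<And>\<nu>. \<nu> > k \<Longrightarrow> GG \<nu> = {0}"
    and W: "open W" "0 \<in> W" and R: "Ck_on (\<Sum>l\<in>UNIV. m l) R W" "vanishing_derivatives m R"
    and h: "h \<in> Aut (perturbed_model P W R)" and g: "g \<in> Aut (perturbed_model P W R)"
    and jets: "weighted_jet (coord_weight m) (k + real WW / m1) h = weighted_jet (coord_weight m) (k + real WW / m1) g"
  shows "h = g"
proof -
  let ?M = "perturbed_model P W R"
  obtain h0 Sh Th where h0: "h = germ h0" "0 \<in> Sh" "biholomorphic_between Sh Th h0" "h0 0 = 0" "h0 ` (Sh \<inter> ?M) \<subseteq> ?M"
    using h unfolding Aut_def by blast
  obtain g0 Sg Tg where g0: "g = germ g0" "0 \<in> Sg" "biholomorphic_between Sg Tg g0" "g0 0 = 0" "g0 ` (Sg \<inter> ?M) \<subseteq> ?M"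
    using g unfolding Aut_def by blast
  define gi where "gi = inv_into Sg g0"
  have hS: "open Sh" "holomorphic_map_on h0 Sh" using h0(3) by (simp_all add: biholomorphic_between_def)
  have gS: "open Sg" "open Tg" "bij_betw g0 Sg Tg" "holomorphic_map_on g0 Sg" "holomorphic_map_on gi Tg"
    using g0(3) by (simp_all add: biholomorphic_between_def gi_def)
  have gT: "g0 ` Sg = Tg" and ginj: "inj_on g0 Sg" using gS(3) by (simp_all add: bij_betw_def)
  have T0: "0 \<in> Tg" using gT g0(2,4) by (metis imageI)
  have gi_g: "gi (g0 p) = p" if "p \<in> Sg" for p unfolding gi_def by (rule inv_into_f_f[OF ginj that])
  have g_gi: "g0 (gi y) = y" if "y \<in> Tg" for y unfolding gi_def by (rule f_inv_into_f) (use that gT in simp)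
  have R0: "R 0 = 0"
  proof (subst vec_eq_iff, intro allI)
    fix l
    have "foldr cr_derivative [] (\<lambda>x. complex_of_real (R x $ l)) 0 = 0"
      by (rule R(2)[unfolded vanishing_derivatives_def, rule_format]) simp
    then show "R 0 $ l = 0 $ l" by simp
  qed
  obtain V where V: "open V" "0 \<in> V" "\<And>y. y \<in> ?M \<Longrightarrow> prj y \<in> V \<Longrightarrow> gi y \<in> ?M"
    using automorphism_inverse[OF W Ck_on_continuous[OF R(1)] R0 g0(2) gS(1) ginj holomorphic_map_continuous[OF gS(4)] g0(4,5)]
    unfolding gi_def by blast
  \<comment> \<open>A neighbourhood on which \<open>gi \<circ> h0\<close> is defined and maps points
    of the perturbed model to such points.\<close>
  define S where "S = Sh \<inter> h0 -` (Tg \<inter> prj -` V)"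
  have "open (UNIV \<inter> prj -` V)" by (rule continuous_open_preimage[OF continuous_prj open_UNIV V(1)])
  then have S: "open S" unfolding S_def
    by (intro continuous_open_preimage[OF holomorphic_map_continuous[OF hS(2)] hS(1)] open_Int gS(2)) simp
  have p0: "prj 0 = 0" by (rule linear_0[OF linear_prj])
  have S0: "0 \<in> S" using h0 T0 V p0 by (simp add: S_def)
  define E where "E p = gi (h0 p) - p" for p
  have fE: "holomorphic_map_on E S"
    unfolding E_def
    by (intro holomorphic_minus_id holomorphic_map_compose[OF holomorphic_map_on_subset[OF hS(2)] gS(5)]) (auto simp: S_def)
  have fM: "p + E p \<in> ?M" if p: "p \<in> S \<inter> ?M" for p
  proof -
    have "h0 p \<in> ?M" using h0(5) p by (auto simp: S_def)
    moreover have "prj (h0 p) \<in> V" using p by (simp add: S_def)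
    ultimately show ?thesis using V(3) by (simp add: E_def)
  qed
  \<comment> \<open>The entries of a field of weight at most \<open>k\<close> have degree at most
    \<open>k * m1\<close> plus a coordinate weight, and \<open>WW\<close> bounds the latter. So
    \<open>n\<close> covers all parts of \<open>E\<close> that belong to weights up to
    \<open>k\<close>.\<close>
  define n where "n = nat \<lfloor>k * m1\<rfloor> + WW"
  have n: "real n \<le> k * m1 + real WW" using k(1) m1_pos by (simp add: n_def)
  have eqw: "wpart wz (\<lambda>p. h0 p $ a) \<sigma> p = wpart wz (\<lambda>p. g0 p $ a) \<sigma> p" if "\<sigma> \<le> n" for a \<sigma> p
  proof -
    have "real \<sigma> \<le> k * m1 + real WW" using that n by linarith
    then have le: "real \<sigma> / m1 \<le> k + real WW / m1" using m1_pos by (simp add: field_simps)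
    have "jet (coord_weight m) (k + real WW / m1) h0 = jet (coord_weight m) (k + real WW / m1) g0"
      using jets unfolding h0(1) g0(1) weighted_jet.abs_eq .
    from fun_cong[OF fun_cong[OF fun_cong[OF this, of "real \<sigma> / m1"], of a], of p] show ?thesis
      using le by (simp add: jet_def homogeneous_part_wpart)
  qed
  have E0: "wpart wz (\<lambda>p. E p $ a) \<sigma> q = 0" if \<sigma>: "\<sigma> \<le> n" for a \<sigma> q
  proof -
    have "\<exists>C. \<forall>\<^sub>F t in at_right (0::real). norm (h0 (dil wz (of_real t) q) - g0 (dil wz (of_real t) q)) \<le> C * t ^ Suc n"
      by (rule equal_wparts_close[OF hS(2,1) h0(2) gS(4,1) g0(2)]) (rule eqw)
    then obtain C where C: "\<forall>\<^sub>F t in at_right (0::real). norm (h0 (dil wz (of_real t) q) - g0 (dil wz (of_real t) q)) \<le> C * t ^ Suc n"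
      by (elim exE)
    obtain D where D: "\<forall>\<^sub>F t in at_right (0::real). norm (E (dil wz (of_real t) q) $ a - (\<Sum>k\<le>n. of_real t ^ k * wpart wz (\<lambda>p. E p $ a) k q)) \<le> D * t ^ Suc n"
      using wpart_eventually[where f = "\<lambda>p. E p $ a" and q = q and n = n, OF holomorphic_map_cdiff[OF fE] S S0] by (elim exE)
    \<comment> \<open>The inverse of \<open>g0\<close> is Lipschitz near 0, so
      \<open>gi (h0 p) - gi (g0 p)\<close> is as small as \<open>h0 p - g0 p\<close>.\<close>
    obtain r K where rK: "r > 0 \<and> K \<ge> 0 \<and> (\<forall>x\<in>ball 0 r. \<forall>y\<in>ball 0 r. norm (gi x - gi y) \<le> K * norm (x - y))"
      using local_lipschitz[OF gS(5,2) T0] by (elim exE)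
    define A where "A = S \<inter> h0 -` ball 0 r"
    define B where "B = Sg \<inter> g0 -` ball 0 r"
    have AB: "open A" "open B" unfolding A_def B_def
      by (intro continuous_open_preimage S gS(1) open_ball holomorphic_map_continuous gS(4) holomorphic_map_on_subset[OF hS(2)]; auto simp: S_def)+
    have AB0: "0 \<in> A" "0 \<in> B" using S0 g0 h0 rK by (simp_all add: A_def B_def)
    have "\<forall>\<^sub>F t in at_right (0::real). norm (\<Sum>k\<le>n. of_real t ^ k * wpart wz (\<lambda>p. E p $ a) k q) \<le> (K * C + D) * t ^ Suc n"
      using C D dil_eventually[OF AB(1) AB0(1), of q] dil_eventually[OF AB(2) AB0(2), of q]
    proof eventually_elim
      case (elim t)
      let ?p = "dil wz (of_real t) q"
      have "E ?p = gi (h0 ?p) - gi (g0 ?p)" using gi_g[of ?p] elim(4) by (simp add: E_def B_def)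
      then have "norm (E ?p) \<le> K * norm (h0 ?p - g0 ?p)" using rK elim(3,4) by (simp add: A_def B_def)
      also have "\<dots> \<le> K * (C * t ^ Suc n)" by (rule mult_left_mono[OF elim(1)]) (use rK in simp)
      finally have "norm (E ?p $ a) \<le> K * (C * t ^ Suc n)"
        by (rule order_trans[OF Finite_Cartesian_Product.norm_nth_le])
      moreover have "norm (\<Sum>k\<le>n. of_real t ^ k * wpart wz (\<lambda>p. E p $ a) k q)
          \<le> norm (E ?p $ a) + norm (E ?p $ a - (\<Sum>k\<le>n. of_real t ^ k * wpart wz (\<lambda>p. E p $ a) k q))"
        unfolding norm_minus_commute[of "E ?p $ a"] by (rule norm_triangle_sub)
      ultimately have "norm (\<Sum>k\<le>n. of_real t ^ k * wpart wz (\<lambda>p. E p $ a) k q) \<le> K * (C * t ^ Suc n) + D * t ^ Suc n"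
        using elim(2) by linarith
      then show ?case by (simp only: distrib_right mult.assoc)
    qed
    then show ?thesis using \<sigma> by (rule small_polynomial_zero_eventually)
  qed
  have sm: "small (\<lambda>x. complex_of_real (R x $ l)) 0 (m l) \<and> (m l \<ge> 1 \<longrightarrow> (\<forall>v. small (cr_derivative v (\<lambda>x. complex_of_real (R x $ l))) (wt v) (m l)))"
    and Rd: "\<And>y. y \<in> W \<Longrightarrow> (\<lambda>x. complex_of_real (R x $ l)) differentiable (at y)" for l
  proof -
    have "bounded_linear (\<lambda>y :: real ^ 'd. complex_of_real (y $ l))"
      by (rule bounded_linear_compose[OF bounded_linear_of_real bounded_linear_vec_nth])
    from Ck_on_linear[OF this W(1) R(1)] have ck: "Ck_on (\<Sum>l\<in>UNIV. m l) (\<lambda>x. complex_of_real (R x $ l)) W" .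
    \<comment> \<open>The order of smoothness is a sum so that it dominates every
      \<open>m l\<close>.\<close>
    have ml: "m l \<le> (\<Sum>l\<in>UNIV. m l)" by (rule member_le_sum) auto
    have w: "crvar_weight m v = real (wt v) / m1" for v :: "('n, 'd) crvar" by (cases v) auto
    have ws: "sum_list (map (crvar_weight m) vs) = real (sum_list (map wt vs)) / m1" for vs :: "('n, 'd) crvar list"
      by (induction vs) (simp_all add: w add_divide_distrib)
    show "small (\<lambda>x. complex_of_real (R x $ l)) 0 (m l) \<and> (m l \<ge> 1 \<longrightarrow> (\<forall>v. small (cr_derivative v (\<lambda>x. complex_of_real (R x $ l))) (wt v) (m l)))"
    proof (rule small_vanishing[OF W ck ml])
      fix vs :: "('n, 'd) crvar list" assume "sum_list (map wt vs) \<le> m l"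
      then have "sum_list (map (crvar_weight m) vs) \<le> real (m l) / real (first_hoermander m)"
        unfolding ws using m1_pos by (intro divide_right_mono) auto
      then show "foldr cr_derivative vs (\<lambda>x. complex_of_real (R x $ l)) 0 = 0"
        by (rule R(2)[unfolded vanishing_derivatives_def, rule_format])
    qed
    have "Suc 0 \<le> (\<Sum>l\<in>UNIV. m l)" using ml m2[of l] by linarith
    then have "Ck_on (Suc 0) (\<lambda>x. complex_of_real (R x $ l)) W" by (rule Ck_on_le[OF ck])
    then show "(\<lambda>x. complex_of_real (R x $ l)) differentiable (at y)" if "y \<in> W" for y using that by simp
  qed
  \<comment> \<open>Shifting by \<open>WW\<close> turns the weights into natural numbers, and the
    strong induction can start at the lowest one. At weights above \<open>k\<close> the induction
    hypothesis says that the part in question is the leading one, as \<open>tang_leading\<close>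
    requires.\<close>
  have lead: "ppart E (int j - int WW) = (\<lambda>_. 0)" for j
  proof (induction j rule: less_induct)
    case (less j)
    let ?\<mu> = "int j - int WW"
    show ?case
    proof (cases "real_of_int ?\<mu> \<le> k * m1")
      case True
      then have fl: "?\<mu> \<le> \<lfloor>k * m1\<rfloor>" by (simp add: le_floor_iff)
      show ?thesis
      proof
        fix a
        have "nat (?\<mu> + int (wz a)) \<le> n" using fl wz_le_WW[of a] unfolding n_def by linarith
        then have "ev (wpf wz (\<lambda>p. E p $ a) (nat (?\<mu> + int (wz a)))) q = ev 0 q" for q by (simp add: E0)
        then have "wpf wz (\<lambda>p. E p $ a) (nat (?\<mu> + int (wz a))) = 0" by (intro pf_eqI)
        then show "ppart E ?\<mu> a = 0" by (simp add: ppart_def)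
      qed
    next
      case False
      have "0 \<le> k * m1" using k(1) by simp
      then have "?\<mu> > 0" using False by linarith
      then obtain \<mu> :: nat where mu: "?\<mu> = int \<mu>" "\<mu> \<ge> 1" using zero_less_imp_eq_int by fastforce
      have before: "ppart E \<nu> = (\<lambda>_. 0)" if \<nu>: "\<nu> < int \<mu>" for \<nu>
      proof (cases "\<nu> < - int WW")
        case False
        then obtain i where i: "\<nu> + int WW = int i" using zero_le_imp_eq_int[of "\<nu> + int WW"] by force
        then have "i < j" using \<nu> mu(1) by linarith
        moreover have "\<nu> = int i - int WW" using i by linarith
        ultimately show ?thesis using less.IH by simp
      qed (rule ppart_neg)
      have tg: "tang (ppart E (int \<mu>))"
      proof (rule tang_leading[OF W _ _ Rd fE S S0 fM mu(2) before])
        show "small (\<lambda>x. complex_of_real (R x $ l)) 0 (m l)" for l using sm[of l] by (rule conjunct1)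
        show "small (cr_derivative v (\<lambda>x. complex_of_real (R x $ l))) (wt v) (m l)" for l v
          using sm[of l] m2[of l] by simp
      qed
      have "germ (pfield (ppart E (int \<mu>))) \<in> GG (real \<mu> / m1)"
        by (rule G_intro[OF _ tg]) (use m1_pos rhom_ppart[of "int \<mu>"] in simp)
      moreover have "real \<mu> / m1 > k" using False mu(1) m1_pos by (simp add: pos_less_divide_eq)
      ultimately have "germ (pfield (ppart E (int \<mu>))) = 0" using k(2) by blast
      then show ?thesis unfolding mu(1) germ_pfield_0 by (simp add: fun_eq_iff)
    qed
  qed
  have all0: "wpart wz (\<lambda>p. E p $ a) \<sigma> q = 0" for a \<sigma> q
  proof -
    have e: "int (\<sigma> + WW - wz a) - int WW = int \<sigma> - int (wz a)" using wz_le_WW[of a] by simp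
    have "ppart E (int \<sigma> - int (wz a)) a = 0" using fun_cong[OF lead[of "\<sigma> + WW - wz a"], of a] unfolding e .
    then have "wpf wz (\<lambda>p. E p $ a) \<sigma> = 0" by (simp add: ppart_def)
    then have "ev (wpf wz (\<lambda>p. E p $ a) \<sigma>) q = ev 0 q" by (rule arg_cong)
    then show ?thesis by simp
  qed
  have "\<forall>\<^sub>F p in nhds 0. E p $ a = 0" for a
  proof -
    obtain e where e: "e > 0 \<and> (\<forall>p\<in>ball 0 e. E p $ a = (\<Sum>k\<le>0. wpart wz (\<lambda>p. E p $ a) k p))"
      using finite_wparts[where f = "\<lambda>p. E p $ a" and n = 0, OF holomorphic_map_cdiff[OF fE] S S0 wz_pos all0] by (elim exE)
    have "\<forall>\<^sub>F p in nhds 0. p \<in> ball (0 :: complex ^ ('n + 'd)) e" by (rule eventually_nhds_in_open) (use e in auto)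
    then show ?thesis by eventually_elim (use e in \<open>simp add: all0\<close>)
  qed
  then have "\<forall>\<^sub>F p in nhds 0. \<forall>a. E p $ a = 0" by (rule eventually_all_finite)
  moreover have "\<forall>\<^sub>F p in nhds 0. p \<in> S" by (rule eventually_nhds_in_open[OF S S0])
  ultimately have "\<forall>\<^sub>F p in nhds 0. h0 p = g0 p"
  proof eventually_elim
    case (elim p)
    then have e: "gi (h0 p) = p" by (simp add: E_def vec_eq_iff)
    have "h0 p \<in> Tg" using elim(2) by (simp add: S_def)
    from g_gi[OF this] show ?case by (simp add: e)
  qed
  then show ?thesis unfolding h0(1) g0(1) germ_eq_iff .
qed

end

theorem theorem1p2:
  fixes m :: "'d::finite \<Rightarrow> nat"
    and P :: "'d \<Rightarrow> ('n::finite, 'd) crvar cpoly"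
  assumes "model_polynomials m P"
    and "finite_type_at_0 (model P)"
    and "hoermander_numbers (model P) m"
    and "holomorphically_nondegenerate_at_0 (model P)"
  shows "\<exists>k::real.
    weighted_grading (hol (model P)) k (G (coord_weight m) (model P)) \<and>
    G (coord_weight m) (model P) k \<noteq> {0} \<and>
    (\<exists>(r::nat) (k\<^sub>0::real). k\<^sub>0 \<ge> 1 \<and>
      (\<forall>W R. open W \<and> 0 \<in> W \<and> Ck_on r R W \<and> vanishing_derivatives m R \<longrightarrow>
        (\<forall>h \<in> Aut (perturbed_model P W R). \<forall>g \<in> Aut (perturbed_model P W R).
           weighted_jet (coord_weight m) (k + k\<^sub>0) h = weighted_jet (coord_weight m) (k + k\<^sub>0) g
             \<longrightarrow> h = g)))"
proof -
  interpret cr_model m P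
    using assms(1,3) by unfold_locales (auto simp: hoermander_numbers_def)
  obtain k where k: "weighted_grading (hol MM) k GG \<and> GG k \<noteq> {0} \<and> (\<forall>\<nu>>k. GG \<nu> = {0})"
    using grading[OF assms(2,4)] by (elim exE)
  have "k \<ge> 0"
  proof (rule ccontr)
    assume "\<not> k \<ge> 0"
    then have "GG 0 = {0}" using k by simp
    then show False using euler by simp
  qed
  moreover have "real WW / m1 \<ge> 1"
  proof -
    \<comment> \<open>\<open>undefined\<close> stands for an arbitrary index; \<open>WW\<close>
      contains its weight, which is at least the first Hoermander number.\<close>
    have "first_hoermander m \<le> m undefined" unfolding first_hoermander_def by (rule Min_le) auto
    also have "\<dots> \<le> WW" using wz_le_WW[of "Inr undefined"] by (simp add: wz_def)
    finally show ?thesis using m1_pos by (simp add: pos_le_divide_eq)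
  qed
  ultimately show ?thesis
  proof (intro exI[of _ k] conjI)
    assume k0: "k \<ge> 0" and w: "real WW / m1 \<ge> 1"
    show "\<exists>(r::nat) (k\<^sub>0::real). k\<^sub>0 \<ge> 1 \<and>
      (\<forall>W R. open W \<and> 0 \<in> W \<and> Ck_on r R W \<and> vanishing_derivatives m R \<longrightarrow>
        (\<forall>h \<in> Aut (perturbed_model P W R). \<forall>g \<in> Aut (perturbed_model P W R).
           weighted_jet (coord_weight m) (k + k\<^sub>0) h = weighted_jet (coord_weight m) (k + k\<^sub>0) g
             \<longrightarrow> h = g))"
    proof (rule exI[of _ "\<Sum>l\<in>UNIV. m l"], rule exI[of _ "real WW / m1"], intro conjI allI impI ballI, rule w, elim conjE)
      fix W R h g
      assume "open W" "0 \<in> W" "Ck_on (\<Sum>l\<in>UNIV. m l) R W" "vanishing_derivatives m R"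
        "h \<in> Aut (perturbed_model P W R)" "g \<in> Aut (perturbed_model P W R)"
        "weighted_jet (coord_weight m) (k + real WW / m1) h = weighted_jet (coord_weight m) (k + real WW / m1) g"
      moreover have "GG \<nu> = {0}" if "\<nu> > k" for \<nu> using k that by simp
      ultimately show "h = g" using k0 by (intro jet_determination[of k W R h g])
    qed
  qed (use k in simp_all)
qed

end
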